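(* Let $n\ge1$ and let $T$ be one of $[a,b]$ ($a<b$ finite), $[a,\infty)$ (put $b=\infty$), or $(-\infty,\infty)$ with $n$ even (put $a=-\infty$, $b=\infty$). Let $\Sigma$ be a positive definite $(n+1)\times(n+1)$ matrix, $K_n^*$ the moment cone on $T$, and $(\mathbb{S}^n)^*=\{x\in\mathbb{R}^{n+1}: x^\top\Sigma x=1\}$. With $\xi=(\theta,\tau)$, $d\xi=\prod d\theta_i\prod d\tau_i$ Lebesgue measure, and $\rho=\rho(\theta)$, $$\mathrm{Vol}^*_n(K_n^*\cap(\mathbb{S}^n)^* )=\int_{\Theta_{[\frac{n+1}{2}]}\times\Delta_{[\frac n2]}}\det\left\{\Bigl(\tfrac{\partial\bar\phi^{(U)}_{n,n}(\rho,\tau)}{\partial\xi}\Bigr)^\top\Sigma\Bigl(\tfrac{\partial\bar\phi^{(U)}_{n,n}(\rho,\tau)}{\partial\xi}\Bigr)\right\}^{\frac12}d\xi$$ $$=\int_{\Theta_{[\frac n2]}\times\Delta_{[\frac{n+1}{2}]}}\det\left\{\Bigl(\tfrac{\partial\bar\phi^{(L)}_{n,n}(\rho,\tau)}{\partial\xi}\Bigr)^\top\Sigma\Bigl(\tfrac{\partial\bar\phi^{(L)}_{n,n}(\rho,\tau)}{\partial\xi}\Bigr)\right\}^{\frac12}d\xi,$$ and, when $n\ge2$, if $T=[a,b]$ or $[a,\infty)$, $$\mathrm{Vol}^*_{n-1}(\partial K_n^*\cap(\mathbb{S}^n)^* )=\int_{\Theta_{[\frac{n-1}{2}]}\times\Delta_{[\frac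 n2]}}\det\left\{\Bigl(\tfrac{\partial\bar\phi^{(L)}_{n,n-1}(\rho,\tau)}{\partial\xi}\Bigr)^\top\Sigma\Bigl(\tfrac{\partial\bar\phi^{(L)}_{n,n-1}(\rho,\tau)}{\partial\xi}\Bigr)\right\}^{\frac12}d\xi$$ $$\qquad+\int_{\Theta_{[\frac n2]}\times\Delta_{[\frac{n-1}{2}]}}\det\left\{\Bigl(\tfrac{\partial\bar\phi^{(U)}_{n,n-1}(\rho,\tau)}{\partial\xi}\Bigr)^\top\Sigma\Bigl(\tfrac{\partial\bar\phi^{(U)}_{n,n-1}(\rho,\tau)}{\partial\xi}\Bigr)\right\}^{\frac12}d\xi,$$ while if $T=(-\infty,\infty)$ the same formula holds with the second integral on the right-hand side omitted.
   Context: $[\cdot]$ denotes integer part. $\mathbb{R}_+=(0,\infty)$. $\psi_n(t)=(1,t,\ldots,t^n)^\top$ for $|t|<\infty$ and $\psi_n(\pm\infty)=(0,\ldots,0,(\pm1)^n)^\top$. The moment cone is $K_n^*=\overline{\{\int_T\psi_n(t)\mu(dt):\mu\text{ a nonnegative measure on }T\}}\subset\mathbb{R}^{n+1}$ and $\partial K_n^*$ is its boundary. $\mathrm{Vol}^*_d$ is the $d$-dimensional volume (Hausdorff measure) induced by the inner product $x^\top\Sigma y$; $\Vert x\Vert_\Sigma=\sqrt{x^\top\Sigma x}$. $\Delta_m=\{\tau=(\tau_1,\ldots,\tau_m)\in(\mathrm{int}\,T)^m:\tau_1<\cdots<\tau_m\}$. For $l\in\{n-1,n\}$ define $$\phi^{(U)}_{n,l}(\rho,\tau)=\begin{cases}\sum_{i=1}^m\rho_i\psi_n(\tau_i)+\rho_{m+1}\psi_n(b)&(l=2m),\\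 \rho_1\psi_n(a)+\sum_{i=1}^m\rho_{i+1}\psi_n(\tau_i)+\rho_{m+2}\psi_n(b)&(l=2m+1),\end{cases}$$ $$\phi^{(L)}_{n,l}(\rho,\tau)=\begin{cases}\rho_1\psi_n(a)+\sum_{i=1}^m\rho_{i+1}\psi_n(\tau_i)&(l=2m),\\ \sum_{i=1}^{m+1}\rho_i\psi_n(\tau_i)&(l=2m+1),\end{cases}$$ and $\bar\phi^{(U)}_{n,l}=\phi^{(U)}_{n,l}/\Vert\phi^{(U)}_{n,l}\Vert_\Sigma$, $\bar\phi^{(L)}_{n,l}=\phi^{(L)}_{n,l}/\Vert\phi^{(L)}_{n,l}\Vert_\Sigma$. $\mathbb{S}_+^m=\{\rho\in\mathbb{R}^{m+1}:\sum\rho_i^2=1,\ \rho_i>0\}$, and $\theta\in\Theta_m\mapsto\rho(\theta)\in\mathbb{S}_+^m$ is a local coordinate system of $\mathbb{S}_+^m$, e.g. polar coordinates on $\Theta_m=(0,\pi/2)^m$: $\rho_1=\cos\theta_1$, $\rho_i=\cos\theta_i\prod_{j=1}^{i-1}\sin\theta_j$ ($2\le i\le m$), $\rho_{m+1}=\prod_{j=1}^m\sin\theta_j$. If $m=0$, the corresponding factor $\Theta_0$ (with $\rho=1$) or $\Delta_0$ is dropped, together with the variable $\theta$ or $\tau$. $\partial/\partial\xi$ denotes the Jacobian matrix with respect to $\xi$. *)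

theory Defs
  imports "HOL-Analysis.Analysis" "Jordan_Normal_Form.Determinant"
begin

text \<open>
  The dimension \<open>n\<close> varies, so points of $\mathbb{R}^{d}$ are functions \<open>nat \<Rightarrow> real\<close> vanishing
  from index \<open>d\<close> on, with the topology \<^const>\<open>Euclidean_space\<close>. All indices are shifted to start
  at 0. Parameters \<open>\<theta>\<close> and \<open>\<tau>\<close>, over which we integrate, are instead extensional functions on
  \<open>{..<m}\<close>, as in \<^const>\<open>PiM\<close>.
\<close>


section \<open>The inner product and Hausdorff measure\<close>

definition pos_def_mat :: "nat \<Rightarrow> real mat \<Rightarrow> bool" where
  "pos_def_mat d A \<longleftrightarrow> A \<in> carrier_mat d d \<and> transpose_mat A = A \<and>
     (\<forall>v\<in>carrier_vec d. v \<noteq> 0\<^sub>v d \<longrightarrow> scalar_prod v (A *\<^sub>v v) > 0)"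

definition mat_inner :: "real mat \<Rightarrow> (nat \<Rightarrow> real) \<Rightarrow> (nat \<Rightarrow> real) \<Rightarrow> real" where
  "mat_inner A x y = scalar_prod (Matrix.vec (dim_row A) x) (A *\<^sub>v Matrix.vec (dim_col A) y)"

definition mat_norm :: "real mat \<Rightarrow> (nat \<Rightarrow> real) \<Rightarrow> real" where
  "mat_norm A x = sqrt (mat_inner A x x)"

definition mat_dist :: "real mat \<Rightarrow> (nat \<Rightarrow> real) \<Rightarrow> (nat \<Rightarrow> real) \<Rightarrow> real" where
  "mat_dist A x y = mat_norm A (\<lambda>i. x i - y i)"

definition mat_normalize :: "real mat \<Rightarrow> (nat \<Rightarrow> real) \<Rightarrow> (nat \<Rightarrow> real)" where
  "mat_normalize A x = (\<lambda>i. x i / mat_norm A x)"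

definition mat_sphere :: "real mat \<Rightarrow> (nat \<Rightarrow> real) set" where
  "mat_sphere A = {x \<in> topspace (Euclidean_space (dim_row A)). mat_inner A x x = 1}"

definition ediam :: "('a \<Rightarrow> 'a \<Rightarrow> real) \<Rightarrow> 'a set \<Rightarrow> ennreal" where
  "ediam ds U = (SUP x\<in>U. SUP y\<in>U. ennreal (ds x y))"

text \<open>
  The factor $\omega_d 2^{-d}$ makes the measure agree with Lebesgue measure on $d$-dimensional
  Euclidean space. Empty covering sets are treated separately only because of \<open>0 ^ 0 = 1\<close>.
\<close>

definition hausdorff_pre_measure ::
    "('a \<Rightarrow> 'a \<Rightarrow> real) \<Rightarrow> nat \<Rightarrow> ennreal \<Rightarrow> 'a set \<Rightarrow> ennreal" where
  "hausdorff_pre_measure ds d \<delta> X =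
     (INF U\<in>{U :: nat \<Rightarrow> 'a set. X \<subseteq> (\<Union>i. U i) \<and> (\<forall>i. ediam ds (U i) \<le> \<delta>)}.
        \<Sum>i. if U i = {} then 0
             else ennreal (unit_ball_vol (real d)) * (ediam ds (U i) / 2) ^ d)"

definition hausdorff_measure :: "('a \<Rightarrow> 'a \<Rightarrow> real) \<Rightarrow> nat \<Rightarrow> 'a set \<Rightarrow> ennreal" where
  "hausdorff_measure ds d X = (SUP \<delta>\<in>{0<..}. hausdorff_pre_measure ds d \<delta> X)"

definition Vol :: "real mat \<Rightarrow> nat \<Rightarrow> (nat \<Rightarrow> real) set \<Rightarrow> ennreal" where
  "Vol A = hausdorff_measure (mat_dist A)"


section \<open>The moment cone\<close>

definition real_segment :: "ereal \<Rightarrow> ereal \<Rightarrow> real set" where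
  "real_segment a b = {t. a \<le> ereal t \<and> ereal t \<le> b}"

definition psi :: "nat \<Rightarrow> ereal \<Rightarrow> (nat \<Rightarrow> real)" where
  "psi n t = (\<lambda>i. if i > n then 0 else
     (case t of ereal r \<Rightarrow> r ^ i
      | PInfty \<Rightarrow> (if i = n then 1 else 0)
      | MInfty \<Rightarrow> (if i = n then (- 1) ^ n else 0)))"

definition moment_cone :: "nat \<Rightarrow> real set \<Rightarrow> (nat \<Rightarrow> real) set" where
  "moment_cone n T = Euclidean_space (n + 1) closure_of
     {(\<lambda>i. \<integral>t. psi n (ereal t) i \<partial>\<mu>) | \<mu>.
        sets \<mu> = sets (restrict_space borel T) \<and>
        (\<forall>i\<le>n. integrable \<mu> (\<lambda>t. psi n (ereal t) i))}"

definition moment_cone_boundary :: "nat \<Rightarrow> real set \<Rightarrow> (nat \<Rightarrow> real) set" where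
  "moment_cone_boundary n T = Euclidean_space (n + 1) frontier_of moment_cone n T"


section \<open>Parametrizations\<close>

definition Delta :: "real set \<Rightarrow> nat \<Rightarrow> (nat \<Rightarrow> real) set" where
  "Delta T m = {\<tau> \<in> {..<m} \<rightarrow>\<^sub>E interior T. strict_mono_on {..<m} \<tau>}"

definition phiU :: "nat \<Rightarrow> nat \<Rightarrow> ereal \<Rightarrow> ereal \<Rightarrow> (nat \<Rightarrow> real) \<Rightarrow> (nat \<Rightarrow> real) \<Rightarrow> (nat \<Rightarrow> real)" where
  "phiU n l a b \<rho> \<tau> = (let m = l div 2 in
     if even l
     then (\<lambda>k. (\<Sum>i<m. \<rho> i * psi n (ereal (\<tau> i)) k) + \<rho> m * psi n b k)
     else (\<lambda>k. \<rho> 0 * psi n a k + (\<Sum>i<m. \<rho> (i + 1) * psi n (ereal (\<tau> i)) k)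
                + \<rho> (m + 1) * psi n b k))"

definition phiL :: "nat \<Rightarrow> nat \<Rightarrow> ereal \<Rightarrow> ereal \<Rightarrow> (nat \<Rightarrow> real) \<Rightarrow> (nat \<Rightarrow> real) \<Rightarrow> (nat \<Rightarrow> real)" where
  "phiL n l a b \<rho> \<tau> = (let m = l div 2 in
     if even l
     then (\<lambda>k. \<rho> 0 * psi n a k + (\<Sum>i<m. \<rho> (i + 1) * psi n (ereal (\<tau> i)) k))
     else (\<lambda>k. \<Sum>i<m + 1. \<rho> i * psi n (ereal (\<tau> i)) k))"

definition pos_sphere :: "nat \<Rightarrow> (nat \<Rightarrow> real) set" where
  "pos_sphere m = {\<rho> \<in> topspace (Euclidean_space (m + 1)).
     (\<Sum>i\<le>m. (\<rho> i)\<^sup>2) = 1 \<and> (\<forall>i\<le>m. \<rho> i > 0)}"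

definition partial_deriv :: "((nat \<Rightarrow> real) \<Rightarrow> real) \<Rightarrow> nat \<Rightarrow> (nat \<Rightarrow> real) \<Rightarrow> real" where
  "partial_deriv f j x = deriv (\<lambda>s. f (x(j := s))) (x j)"

text \<open>
  A regular $C^1$ parametrization of the whole of $\mathbb{S}_+^m$ by an open subset of
  $\mathbb{R}^m$; polar coordinates are an example. For \<open>m = 0\<close> this forces \<open>\<Theta>\<close> to be a
  one-point set and \<open>\<rho> = 1\<close>. As \<^const>\<open>PiM\<close> and \<^const>\<open>Delta\<close> over the empty index set are
  likewise a unit mass and a one-point set, factors with \<open>m = 0\<close> drop out of all integrals.
\<close>

definition sphere_coordinates ::
    "nat \<Rightarrow> (nat \<Rightarrow> real) set \<Rightarrow> ((nat \<Rightarrow> real) \<Rightarrow> (nat \<Rightarrow> real)) \<Rightarrow> bool" where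
  "sphere_coordinates m \<Theta> \<rho> \<longleftrightarrow>
     openin (powertop_real {..<m}) \<Theta> \<and>
     bij_betw \<rho> \<Theta> (pos_sphere m) \<and>
     (\<forall>i\<le>m. \<forall>j<m.
        (\<forall>\<theta>\<in>\<Theta>. (\<lambda>s. \<rho> (\<theta>(j := s)) i) differentiable (at (\<theta> j))) \<and>
        continuous_map (subtopology (powertop_real {..<m}) \<Theta>) euclideanreal
          (partial_deriv (\<lambda>\<theta>. \<rho> \<theta> i) j)) \<and>
     (\<forall>\<theta>\<in>\<Theta>. \<forall>v\<in>carrier_vec m.
        Matrix.mat (m + 1) m (\<lambda>(i, j). partial_deriv (\<lambda>\<theta>. \<rho> \<theta> i) j \<theta>) *\<^sub>v v = 0\<^sub>v (m + 1)
          \<longrightarrow> v = 0\<^sub>v m)"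

definition jacobian ::
    "nat \<Rightarrow> nat \<Rightarrow> nat \<Rightarrow> ((nat \<Rightarrow> real) \<times> (nat \<Rightarrow> real) \<Rightarrow> (nat \<Rightarrow> real)) \<Rightarrow>
      (nat \<Rightarrow> real) \<times> (nat \<Rightarrow> real) \<Rightarrow> real mat" where
  "jacobian d p q F = (\<lambda>(\<theta>, \<tau>). Matrix.mat d (p + q) (\<lambda>(i, j).
     if j < p then partial_deriv (\<lambda>\<theta>'. F (\<theta>', \<tau>) i) j \<theta>
     else partial_deriv (\<lambda>\<tau>'. F (\<theta>, \<tau>') i) (j - p) \<tau>))"

definition gram_density ::
    "real mat \<Rightarrow> nat \<Rightarrow> nat \<Rightarrow> ((nat \<Rightarrow> real) \<times> (nat \<Rightarrow> real) \<Rightarrow> (nat \<Rightarrow> real)) \<Rightarrow>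
      (nat \<Rightarrow> real) \<times> (nat \<Rightarrow> real) \<Rightarrow> real" where
  "gram_density A p q F \<xi> =
     (let J = jacobian (dim_row A) p q F \<xi> in sqrt (Determinant.det (transpose_mat J * A * J)))"

definition param_lebesgue :: "nat \<Rightarrow> nat \<Rightarrow> ((nat \<Rightarrow> real) \<times> (nat \<Rightarrow> real)) measure" where
  "param_lebesgue p q = PiM {..<p} (\<lambda>_. lborel) \<Otimes>\<^sub>M PiM {..<q} (\<lambda>_. lborel)"

text \<open>
  The integrals of the Gram densities of $\bar\phi^{(U)}_{n,l}$ and $\bar\phi^{(L)}_{n,l}$ over
  $\Theta_p \times \Delta_q$.
\<close>

definition integralU ::
    "nat \<Rightarrow> nat \<Rightarrow> ereal \<Rightarrow> ereal \<Rightarrow> real mat \<Rightarrow> (nat \<Rightarrow> (nat \<Rightarrow> real) set) \<Rightarrow>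
      (nat \<Rightarrow> (nat \<Rightarrow> real) \<Rightarrow> (nat \<Rightarrow> real)) \<Rightarrow> nat \<Rightarrow> nat \<Rightarrow> ennreal" where
  "integralU n l a b A \<Theta> \<rho> p q =
     (\<integral>\<^sup>+\<xi>\<in>\<Theta> p \<times> Delta (real_segment a b) q.
        ennreal (gram_density A p q (\<lambda>(\<theta>, \<tau>). mat_normalize A (phiU n l a b (\<rho> p \<theta>) \<tau>)) \<xi>)
        \<partial>param_lebesgue p q)"

definition integralL ::
    "nat \<Rightarrow> nat \<Rightarrow> ereal \<Rightarrow> ereal \<Rightarrow> real mat \<Rightarrow> (nat \<Rightarrow> (nat \<Rightarrow> real) set) \<Rightarrow>
      (nat \<Rightarrow> (nat \<Rightarrow> real) \<Rightarrow> (nat \<Rightarrow> real)) \<Rightarrow> nat \<Rightarrow> nat \<Rightarrow> ennreal" where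
  "integralL n l a b A \<Theta> \<rho> p q =
     (\<integral>\<^sup>+\<xi>\<in>\<Theta> p \<times> Delta (real_segment a b) q.
        ennreal (gram_density A p q (\<lambda>(\<theta>, \<tau>). mat_normalize A (phiL n l a b (\<rho> p \<theta>) \<tau>)) \<xi>)
        \<partial>param_lebesgue p q)"

end

theory Submission
  imports Defs
begin

text \<open>
  The area formula for injective $C^1$ maps identifies each integral with the Hausdorff measure of
  the image of its parametrization; the normalization of Hausdorff measure enters through the
  isodiametric inequality, a consequence of the Prekopa--Leindler inequality. On the side of the
  moment cone, a vector at which every nonzero nonnegative polynomial is positive has exactly one
  upper and exactly one lower principal representation. Every other vector of the cone is
  annihilated by a nonnegative polynomial, whose zeros carry its representing measure, so that it
  has a representation of index at most \<open>n\<close>, interior points counting twice. The vectors whose index is smaller than that of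
  the stratum under consideration are images of fewer parameters and hence form a null set.
\<close>

hide_const (open) Order.top


section \<open>Hausdorff measure\<close>

text \<open>The norm is that of \<Sigma> and the Gram matrix varies from point to point, so the
  isodiametric inequality and the volume of a cube are proved for the metric of every positive
  definite matrix. Near a point of positive density the parametrization is then almost an isometry
  from the metric of the Gram matrix there, and no inverse map is ever differentiated. Hausdorff
  measure is used only as an outer measure: upper bounds come from countable subadditivity, lower
  bounds from compact sets, and the sum of two integrals from compact images at positive distance.
  The null sets rest on a count of parameters. A representation with \<open>k\<close> interior
  points has index \<open>2 * k\<close> plus its endpoints. It needs \<open>k\<close> nodes and one
  weight per atom, of which normalization removes one, so its stratum has index minus one
  parameters. On the whole line both infinite endpoints have the same moment vector because
  \<open>n\<close> is even. By parity a boundary vector of index \<open>n\<close> has no mass there,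
  which is why the second boundary integral disappears.\<close>

definition hcost :: "('a \<Rightarrow> 'a \<Rightarrow> real) \<Rightarrow> nat \<Rightarrow> 'a set \<Rightarrow> ennreal" where
  "hcost ds d U = ennreal (unit_ball_vol (real d)) * (ediam ds U / 2) ^ d"

lemma ennreal_mult_divide_cancel: "k > 0 \<Longrightarrow> ennreal k * (x / ennreal k) = x"
  by (cases x) (auto simp: divide_ennreal ennreal_mult[symmetric] ennreal_top_divide ennreal_mult_top)

lemma ediam_empty [simp]: "ediam ds {} = 0"
  by (simp add: ediam_def bot_ennreal)

lemma hcost_empty [simp]: "d > 0 \<Longrightarrow> hcost ds d {} = 0"
  by (simp add: hcost_def)

lemma ediam_le_iff: "ediam ds U \<le> c \<longleftrightarrow> (\<forall>x\<in>U. \<forall>y\<in>U. ennreal (ds x y) \<le> c)"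
  by (simp add: ediam_def SUP_le_iff)

lemma ediam_upper: "x \<in> U \<Longrightarrow> y \<in> U \<Longrightarrow> ennreal (ds x y) \<le> ediam ds U"
  using ediam_le_iff[of ds U "ediam ds U"] by blast

lemma ediam_mono: "U \<subseteq> V \<Longrightarrow> ediam ds U \<le> ediam ds V"
  by (auto simp: ediam_le_iff intro: ediam_upper)

lemma hcost_mono_ediam: "ediam ds U \<le> ediam ds' V \<Longrightarrow> hcost ds d U \<le> hcost ds' d V"
  unfolding hcost_def by (intro mult_left_mono power_mono divide_right_mono_ennreal) auto

text \<open>The separate treatment of empty covering sets matters only for \<open>d = 0\<close>; for
  \<open>d > 0\<close> their diameter \<open>0\<close> already gives cost \<open>0\<close>.\<close>

lemma hausdorff_pre_measure_hcost:
  assumes "d > 0"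
  shows "hausdorff_pre_measure ds d \<delta> X =
     (INF U\<in>{U :: nat \<Rightarrow> 'a set. X \<subseteq> (\<Union>i. U i) \<and> (\<forall>i. ediam ds (U i) \<le> \<delta>)}. \<Sum>i. hcost ds d (U i))"
proof -
  have "(if U = {} then 0 else ennreal (unit_ball_vol (real d)) * (ediam ds U / 2) ^ d) = hcost ds d U"
    for U :: "'a set"
    using assms by (simp add: hcost_def)
  then show ?thesis
    unfolding hausdorff_pre_measure_def by simp
qed

lemma hausdorff_pre_measure_le:
  assumes "d > 0" "X \<subseteq> (\<Union>i. U i)" "\<And>i. ediam ds (U i) \<le> \<delta>"
  shows "hausdorff_pre_measure ds d \<delta> X \<le> (\<Sum>i::nat. hcost ds d (U i))"
  unfolding hausdorff_pre_measure_hcost[OF assms(1)] using assms by (intro INF_lower) auto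

lemma hausdorff_pre_measure_ge:
  assumes "d > 0"
    and "\<And>U. X \<subseteq> (\<Union>i. U i) \<Longrightarrow> (\<And>i::nat. ediam ds (U i) \<le> \<delta>) \<Longrightarrow> c \<le> (\<Sum>i. hcost ds d (U i))"
  shows "c \<le> hausdorff_pre_measure ds d \<delta> X"
  unfolding hausdorff_pre_measure_hcost[OF assms(1)] using assms(2) by (intro INF_greatest) auto

lemma hausdorff_pre_measure_less:
  assumes "d > 0" "hausdorff_pre_measure ds d \<delta> X < c"
  obtains U where "X \<subseteq> (\<Union>i. U i)" "\<And>i::nat. ediam ds (U i) \<le> \<delta>" "(\<Sum>i. hcost ds d (U i)) < c"
  using assms(2) unfolding hausdorff_pre_measure_hcost[OF assms(1)] INF_less_iff by auto

lemma hausdorff_pre_measure_mono: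
  "d > 0 \<Longrightarrow> X \<subseteq> Y \<Longrightarrow> hausdorff_pre_measure ds d \<delta> X \<le> hausdorff_pre_measure ds d \<delta> Y"
  by (rule hausdorff_pre_measure_ge) (auto intro!: hausdorff_pre_measure_le)

lemma hausdorff_pre_measure_antimono:
  "d > 0 \<Longrightarrow> \<delta> \<le> \<delta>' \<Longrightarrow> hausdorff_pre_measure ds d \<delta>' X \<le> hausdorff_pre_measure ds d \<delta> X"
  by (rule hausdorff_pre_measure_ge) (auto intro!: hausdorff_pre_measure_le intro: order_trans)

lemma hausdorff_pre_measure_single:
  assumes "d > 0" "X \<subseteq> U" "ediam ds U \<le> \<delta>"
  shows "hausdorff_pre_measure ds d \<delta> X \<le> hcost ds d U"
proof -
  have "hausdorff_pre_measure ds d \<delta> X \<le> (\<Sum>i::nat. hcost ds d (if i = 0 then U else {}))"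
    using assms by (intro hausdorff_pre_measure_le) (auto split: if_splits)
  also have "\<dots> = hcost ds d U"
    using assms by (subst suminf_finite[of "{0}"]) auto
  finally show ?thesis .
qed

lemma hausdorff_pre_measure_empty [simp]: "d > 0 \<Longrightarrow> hausdorff_pre_measure ds d \<delta> {} = 0"
  using hausdorff_pre_measure_single[of d "{}" "{}" ds \<delta>] by simp

lemma hausdorff_pre_measure_UN_le:
  assumes d: "d > 0"
  shows "hausdorff_pre_measure ds d \<delta> (\<Union>i. X i) \<le> (\<Sum>i::nat. hausdorff_pre_measure ds d \<delta> (X i))"
    (is "?H (\<Union>i. X i) \<le> ?S")
proof (rule ennreal_le_epsilon)
  fix e :: real assume fin: "?S < top" and e: "0 < e"
  have fin': "?H (X i) < top" for i
    using fin ennreal_suminf_lessD[of "\<lambda>i. ?H (X i)" top i] by simp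
  \<comment> \<open>Near-optimal covers whose errors sum to \<open>e\<close>;
    \<open>prod_decode\<close> then merges them into one sequence.\<close>
  have "\<exists>U. X i \<subseteq> (\<Union>j. U j) \<and> (\<forall>j::nat. ediam ds (U j) \<le> \<delta>) \<and>
      (\<Sum>j. hcost ds d (U j)) \<le> ?H (X i) + ennreal (e * (1/2)^Suc i)" for i
  proof -
    have "?H (X i) < ?H (X i) + ennreal (e * (1/2)^Suc i)"
      using fin'[of i] e by (cases "?H (X i)") (auto simp: ennreal_plus[symmetric] ennreal_less_iff simp del: ennreal_plus)
    from hausdorff_pre_measure_less[OF d this] show ?thesis
      by (metis less_imp_le)
  qed
  then obtain U where U: "\<And>i. X i \<subseteq> (\<Union>j. U i j)" "\<And>i j::nat. ediam ds (U i j) \<le> \<delta>"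
      "\<And>i. (\<Sum>j. hcost ds d (U i j)) \<le> ?H (X i) + ennreal (e * (1/2)^Suc i)"
    by metis
  define V where "V = (\<lambda>k. case prod_decode k of (i, j) \<Rightarrow> U i j)"
  have "x \<in> (\<Union>k. V k)" if "x \<in> X i" for x i
  proof -
    obtain j where "x \<in> U i j" using U(1) \<open>x \<in> X i\<close> by blast
    then have "x \<in> V (prod_encode (i, j))" by (simp add: V_def)
    then show ?thesis by blast
  qed
  then have "?H (\<Union>i. X i) \<le> (\<Sum>k. hcost ds d (V k))"
    using U(2) by (intro hausdorff_pre_measure_le[OF d]) (auto simp: V_def split: prod.splits)
  also have "\<dots> = (\<Sum>i. \<Sum>j. hcost ds d (U i j))"
    using suminf_ennreal_2dimen[of "\<lambda>i. \<Sum>j. hcost ds d (U i j)" "\<lambda>(i,j). hcost ds d (U i j)"]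
    by (simp add: V_def o_def split_def)
  also have "\<dots> \<le> (\<Sum>i. ?H (X i) + ennreal (e * (1/2)^Suc i))"
    by (intro suminf_le U(3)) auto
  also have "\<dots> = ?S + (\<Sum>i. ennreal (e * (1/2)^Suc i))"
    by (intro suminf_add[symmetric]) auto
  also have "(\<Sum>i. ennreal (e * (1/2)^Suc i)) = ennreal e"
    using e sums_mult[OF power_half_series, of e]
    by (intro suminf_ennreal_eq) auto
  finally show "?H (\<Union>i. X i) \<le> ?S + ennreal e" .
qed

lemma hausdorff_pre_measure_sum_le:
  assumes d: "d > 0" and "finite I"
  shows "hausdorff_pre_measure ds d \<delta> (\<Union>i\<in>I. X i) \<le> (\<Sum>i\<in>I. hausdorff_pre_measure ds d \<delta> (X i))"
  using assms(2)
proof (induction rule: finite_induct)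
  case (insert i I)
  let ?HH = "hausdorff_pre_measure ds d \<delta>"
  have "hausdorff_pre_measure ds d \<delta> (X i \<union> Y) \<le> 
     hausdorff_pre_measure ds d \<delta> (X i) + hausdorff_pre_measure ds d \<delta> Y" for Y
  proof -
    let ?Z = "\<lambda>k::nat. if k = 0 then X i else if k = 1 then Y else {}"
    have "X i \<union> Y = (\<Union>k. ?Z k)" by (auto split: if_splits) 
    then have "hausdorff_pre_measure ds d \<delta> (X i \<union> Y) \<le> (\<Sum>k. hausdorff_pre_measure ds d \<delta> (?Z k))"
      using hausdorff_pre_measure_UN_le[OF d, of ds \<delta> ?Z] by simp
    also have "\<dots> = (\<Sum>k\<in>{0,1}. hausdorff_pre_measure ds d \<delta> (?Z k))"
      using d by (intro suminf_finite) auto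
    finally show ?thesis by simp
  qed
  then have "?HH (X i \<union> \<Union> (X ` I)) \<le> ?HH (X i) + ?HH (\<Union> (X ` I))" .
  also have "\<dots> \<le> ?HH (X i) + (\<Sum>i\<in>I. ?HH (X i))"
    by (intro add_left_mono insert.IH)
  finally show ?case using insert by simp
qed (use d in auto)

lemma hausdorff_pre_measure_le_hausdorff_measure:
  "\<delta> > 0 \<Longrightarrow> hausdorff_pre_measure ds d \<delta> X \<le> hausdorff_measure ds d X"
  unfolding hausdorff_measure_def by (intro SUP_upper) auto

lemma hausdorff_measure_le:
  "(\<And>\<delta>. \<delta> > 0 \<Longrightarrow> hausdorff_pre_measure ds d \<delta> X \<le> c) \<Longrightarrow> hausdorff_measure ds d X \<le> c"
  unfolding hausdorff_measure_def by (intro SUP_least) auto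

lemma hausdorff_measure_mono:
  "d > 0 \<Longrightarrow> X \<subseteq> Y \<Longrightarrow> hausdorff_measure ds d X \<le> hausdorff_measure ds d Y"
  by (rule hausdorff_measure_le)
    (meson hausdorff_pre_measure_mono hausdorff_pre_measure_le_hausdorff_measure order_trans)

lemma hausdorff_measure_UN_le:
  assumes "d > 0"
  shows "hausdorff_measure ds d (\<Union>i. X i) \<le> (\<Sum>i::nat. hausdorff_measure ds d (X i))"
proof (rule hausdorff_measure_le)
  fix \<delta> :: ennreal assume "\<delta> > 0"
  have "hausdorff_pre_measure ds d \<delta> (\<Union>i. X i) \<le> (\<Sum>i. hausdorff_pre_measure ds d \<delta> (X i))"
    by (rule hausdorff_pre_measure_UN_le[OF assms])
  also have "\<dots> \<le> (\<Sum>i. hausdorff_measure ds d (X i))"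
    using \<open>\<delta> > 0\<close> by (intro suminf_le hausdorff_pre_measure_le_hausdorff_measure) auto
  finally show "hausdorff_pre_measure ds d \<delta> (\<Union>i. X i) \<le> \<dots>" .
qed

lemma hausdorff_measure_empty [simp]: "d > 0 \<Longrightarrow> hausdorff_measure ds d {} = 0"
  using hausdorff_measure_le[of ds d "{}" 0] by simp

lemma hausdorff_measure_Un_le:
  assumes "d > 0"
  shows "hausdorff_measure ds d (A \<union> B) \<le> hausdorff_measure ds d A + hausdorff_measure ds d B"
proof -
  let ?Z = "\<lambda>k::nat. if k = 0 then A else if k = 1 then B else {}"
  have "A \<union> B = (\<Union>k. ?Z k)" by (auto split: if_splits)
  then have "hausdorff_measure ds d (A \<union> B) \<le> (\<Sum>k. hausdorff_measure ds d (?Z k))"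
    using hausdorff_measure_UN_le[OF assms, of ds ?Z] by simp
  also have "\<dots> = (\<Sum>k\<in>{0,1}. hausdorff_measure ds d (?Z k))"
    using assms by (intro suminf_finite) auto
  finally show ?thesis by simp
qed

lemma hausdorff_measure_UN_null:
  assumes "d > 0" "countable I" "\<And>i. i \<in> I \<Longrightarrow> hausdorff_measure ds d (X i) = 0"
  shows "hausdorff_measure ds d (\<Union>i\<in>I. X i) = 0"
proof (cases "I = {}")
  case False
  have "(\<Union>i\<in>I. X i) = (\<Union>k. X (from_nat_into I k))"
    using range_from_nat_into[OF False assms(2)] by (metis image_image)
  moreover have "hausdorff_measure ds d (\<Union>k. X (from_nat_into I k)) \<le> 0"
    using hausdorff_measure_UN_le[OF assms(1), of ds "\<lambda>k. X (from_nat_into I k)"] 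
      assms(3)[OF from_nat_into[OF False]] by simp
  ultimately show ?thesis by simp
qed (use assms in simp)

lemma ediam_Lipschitz_image:
  assumes "L > 0" "\<And>x y. x \<in> X \<Longrightarrow> y \<in> X \<Longrightarrow> ds2 (f x) (f y) \<le> L * ds1 x y"
  shows "ediam ds2 (f ` (U \<inter> X)) \<le> ennreal L * ediam ds1 U"
  unfolding ediam_le_iff
proof safe
  fix x y assume "x \<in> U" "x \<in> X" "y \<in> U" "y \<in> X"
  then have "ennreal (ds2 (f x) (f y)) \<le> ennreal (L * ds1 x y)"
    using assms by (intro ennreal_leI) auto
  also have "\<dots> = ennreal L * ennreal (ds1 x y)"
    using assms(1) by (simp add: ennreal_mult')
  also have "\<dots> \<le> ennreal L * ediam ds1 U"
    using \<open>x \<in> U\<close> \<open>y \<in> U\<close> by (intro mult_left_mono ediam_upper) auto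
  finally show "ennreal (ds2 (f x) (f y)) \<le> ennreal L * ediam ds1 U" .
qed

text \<open>The scale is tracked explicitly, \<open>\<delta>\<close> becoming
  \<open>L * \<delta>\<close>, because the self-similarity argument for cubes compares premeasures
  at two fixed scales. Covering sets are cut down to \<open>X\<close>, where alone the Lipschitz
  bound holds.\<close>

lemma hausdorff_pre_measure_Lipschitz_image:
  assumes d: "d > 0" and L: "L > 0"
    and lip: "\<And>x y. x \<in> X \<Longrightarrow> y \<in> X \<Longrightarrow> ds2 (f x) (f y) \<le> L * ds1 x y"
  shows "hausdorff_pre_measure ds2 d (ennreal L * \<delta>) (f ` X) \<le> ennreal (L ^ d) * hausdorff_pre_measure ds1 d \<delta> X"
proof -
  have nz: "ennreal (L ^ d) \<noteq> 0" using L by (simp add: ennreal_eq_0_iff not_le)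
  have "hausdorff_pre_measure ds2 d (ennreal L * \<delta>) (f ` X) / ennreal (L ^ d) \<le> hausdorff_pre_measure ds1 d \<delta> X"
  proof (rule hausdorff_pre_measure_ge[OF d])
    fix U assume U: "X \<subseteq> (\<Union>i. U i)" "\<And>i::nat. ediam ds1 (U i) \<le> \<delta>"
    have "hausdorff_pre_measure ds2 d (ennreal L * \<delta>) (f ` X) \<le> (\<Sum>i. hcost ds2 d (f ` (U i \<inter> X)))"
    proof (rule hausdorff_pre_measure_le[OF d])
      show "f ` X \<subseteq> (\<Union>i. f ` (U i \<inter> X))" using U(1) by blast
      show "ediam ds2 (f ` (U i \<inter> X)) \<le> ennreal L * \<delta>" for i
        using ediam_Lipschitz_image[OF L, of X ds2 f ds1 "U i"] lip U(2)[of i]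
        by (meson mult_left_mono order_trans zero_le)
    qed
    also have "\<dots> \<le> (\<Sum>i. ennreal (L ^ d) * hcost ds1 d (U i))"
    proof (intro suminf_le)
      fix i
      have "(ediam ds2 (f ` (U i \<inter> X)) / 2) ^ d \<le> (ennreal L * (ediam ds1 (U i) / 2)) ^ d"
        using ediam_Lipschitz_image[OF L, of X ds2 f ds1 "U i"] lip
        by (intro power_mono) (auto simp: ennreal_times_divide intro!: divide_right_mono_ennreal)
      also have "\<dots> = ennreal (L ^ d) * (ediam ds1 (U i) / 2) ^ d"
        using L by (simp add: power_mult_distrib ennreal_power)
      finally show "hcost ds2 d (f ` (U i \<inter> X)) \<le> ennreal (L ^ d) * hcost ds1 d (U i)"
        unfolding hcost_def by (simp add: mult.left_commute mult_left_mono)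
    qed auto
    also have "\<dots> = ennreal (L ^ d) * (\<Sum>i. hcost ds1 d (U i))"
      by simp
    finally show "hausdorff_pre_measure ds2 d (ennreal L * \<delta>) (f ` X) / ennreal (L ^ d) \<le> (\<Sum>i. hcost ds1 d (U i))"
      using nz by (simp add: divide_le_posI_ennreal mult.commute zero_less_iff_neq_zero)
  qed
  then have "ennreal (L ^ d) * (hausdorff_pre_measure ds2 d (ennreal L * \<delta>) (f ` X) / ennreal (L ^ d))
      \<le> ennreal (L ^ d) * hausdorff_pre_measure ds1 d \<delta> X"
    by (intro mult_left_mono) auto
  then show ?thesis
    using ennreal_mult_divide_cancel[of "L ^ d"] L by simp
qed

lemma hausdorff_measure_Lipschitz_image:
  assumes d: "d > 0" and L: "L > 0"
    and lip: "\<And>x y. x \<in> X \<Longrightarrow> y \<in> X \<Longrightarrow> ds2 (f x) (f y) \<le> L * ds1 x y"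
  shows "hausdorff_measure ds2 d (f ` X) \<le> ennreal (L ^ d) * hausdorff_measure ds1 d X"
proof (rule hausdorff_measure_le)
  fix \<delta> :: ennreal assume \<delta>: "\<delta> > 0"
  have eq: "ennreal L * (\<delta> / ennreal L) = \<delta>"
    by (rule ennreal_mult_divide_cancel[OF L])
  have "\<delta> / ennreal L > 0" using \<delta> by (simp add: ennreal_zero_less_divide)
  then have "ennreal (L ^ d) * hausdorff_pre_measure ds1 d (\<delta> / ennreal L) X \<le> ennreal (L ^ d) * hausdorff_measure ds1 d X"
    by (intro mult_left_mono hausdorff_pre_measure_le_hausdorff_measure) auto
  then show "hausdorff_pre_measure ds2 d \<delta> (f ` X) \<le> ennreal (L ^ d) * hausdorff_measure ds1 d X"
    using hausdorff_pre_measure_Lipschitz_image[OF d L, of X ds2 f ds1 "\<delta> / ennreal L"] lip eq order_trans by metis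
qed

text \<open>At scales below \<open>e\<close> no covering set meets both parts, so every cover splits
  into two. This is Caratheodory's metric criterion in the only form in which additivity is used; it
  takes the place of measurability of the images.\<close>

lemma hausdorff_measure_Un_separated:
  assumes d: "d > 0" and e: "e > 0" and sep: "\<And>x y. x \<in> A \<Longrightarrow> y \<in> B \<Longrightarrow> ds x y \<ge> e"
  shows "hausdorff_measure ds d A + hausdorff_measure ds d B \<le> hausdorff_measure ds d (A \<union> B)"
proof -
  have *: "hausdorff_pre_measure ds d \<delta> A + hausdorff_pre_measure ds d \<delta> B \<le> hausdorff_pre_measure ds d \<delta> (A \<union> B)"
    if \<delta>: "\<delta> < ennreal e" for \<delta>
  proof (rule hausdorff_pre_measure_ge[OF d])
    fix U :: "nat \<Rightarrow> 'a set" assume U: "A \<union> B \<subseteq> (\<Union>i. U i)" "\<And>i. ediam ds (U i) \<le> \<delta>"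
    let ?UA = "\<lambda>i. if U i \<inter> A = {} then {} else U i" and ?UB = "\<lambda>i. if U i \<inter> A = {} then U i else {}"
    have AB: "U i \<inter> A = {} \<or> U i \<inter> B = {}" for i
    proof (rule ccontr)
      assume "\<not> ?thesis"
      then obtain x y where xy: "x \<in> U i" "x \<in> A" "y \<in> U i" "y \<in> B" by blast
      have "ennreal e \<le> ennreal (ds x y)" using sep xy by (intro ennreal_leI) auto
      also have "\<dots> \<le> \<delta>" using ediam_upper[of x "U i" y ds] U(2)[of i] xy by (meson order_trans)
      finally show False using \<delta> by simp
    qed
    have "A \<subseteq> (\<Union>i. ?UA i)"
    proof
      fix x assume "x \<in> A"
      then obtain i where "x \<in> U i" using U(1) by blast
      then show "x \<in> (\<Union>i. ?UA i)" using \<open>x \<in> A\<close> by (intro UN_I[of i]) auto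
    qed
    moreover have "B \<subseteq> (\<Union>i. ?UB i)"
    proof
      fix x assume "x \<in> B"
      then obtain i where "x \<in> U i" using U(1) by blast
      then show "x \<in> (\<Union>i. ?UB i)" using \<open>x \<in> B\<close> AB[of i] by (intro UN_I[of i]) auto
    qed
    ultimately have "hausdorff_pre_measure ds d \<delta> A + hausdorff_pre_measure ds d \<delta> B
        \<le> (\<Sum>i. hcost ds d (?UA i)) + (\<Sum>i. hcost ds d (?UB i))"
      using U(2) by (intro add_mono hausdorff_pre_measure_le[OF d]) auto
    also have "\<dots> = (\<Sum>i. hcost ds d (?UA i) + hcost ds d (?UB i))"
      by (intro suminf_add) auto
    also have "\<dots> = (\<Sum>i. hcost ds d (U i))"
      using d by (intro arg_cong[where f=suminf] ext) auto
    finally show "hausdorff_pre_measure ds d \<delta> A + hausdorff_pre_measure ds d \<delta> B \<le> (\<Sum>i. hcost ds d (U i))" .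
  qed
  let ?f = "\<lambda>X \<delta>. hausdorff_pre_measure ds d \<delta> X"
  have "hausdorff_measure ds d A + hausdorff_measure ds d B = (SUP \<delta>\<in>{0<..}. ?f A \<delta> + ?f B \<delta>)"
    unfolding hausdorff_measure_def
  proof (rule SUP_add_directed_ennreal[symmetric])
    fix i j :: ennreal assume "i \<in> {0<..}" "j \<in> {0<..}"
    then show "\<exists>k\<in>{0<..}. ?f A i + ?f B j \<le> ?f A k + ?f B k"
      by (intro bexI[of _ "min i j"] add_mono hausdorff_pre_measure_antimono[OF d]) auto
  qed
  also have "\<dots> \<le> hausdorff_measure ds d (A \<union> B)"
  proof (rule SUP_least)
    fix \<delta> :: ennreal assume "\<delta> \<in> {0<..}"
    \<comment> \<open>Premeasures grow as the scale shrinks, so passing below \<open>e\<close> loses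
      nothing.\<close>
    define \<delta>' where "\<delta>' = min \<delta> (ennreal (e / 2))"
    have "?f A \<delta> + ?f B \<delta> \<le> ?f A \<delta>' + ?f B \<delta>'"
      unfolding \<delta>'_def by (intro add_mono hausdorff_pre_measure_antimono[OF d]) auto
    also have "\<dots> \<le> ?f (A \<union> B) \<delta>'"
      using e by (intro *) (auto simp: \<delta>'_def min_less_iff_disj ennreal_less_iff)
    also have "\<dots> \<le> hausdorff_measure ds d (A \<union> B)"
      using e \<open>\<delta> \<in> {0<..}\<close> by (intro hausdorff_pre_measure_le_hausdorff_measure) (auto simp: \<delta>'_def)
    finally show "?f A \<delta> + ?f B \<delta> \<le> hausdorff_measure ds d (A \<union> B)" .
  qed
  finally show ?thesis .
qed


section \<open>The Prekopa--Leindler inequality\<close>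

text \<open>The one-dimensional Brunn-Minkowski argument wants a least element of each set. A tail
  cut off at one of its own points has one, and such tails exhaust the set, whether or not its
  infimum is attained or finite.\<close>

lemma emeasure_add_le_of_tails:
  fixes A :: "real set"
  assumes A: "A \<in> sets borel" "A \<noteq> {}"
    and le: "\<And>a. a \<in> A \<Longrightarrow> emeasure lborel (A \<inter> {a..}) + y \<le> c"
  shows "emeasure lborel A + y \<le> c"
proof -
  have "\<exists>t. decseq t \<and> (\<forall>k::nat. \<exists>a\<in>A. a \<le> t k) \<and> (\<forall>x\<in>A. \<exists>k. t k \<le> x)"
  proof (cases "bdd_below A")
    case False
    then have "\<exists>a\<in>A. a \<le> - real k" for k
      unfolding bdd_below_def by (meson linear)
    moreover have "\<exists>k. - real k \<le> x" for x
      by (metis minus_le_iff real_arch_simple)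
    ultimately show ?thesis
      by (intro exI[of _ "\<lambda>k. - real k"]) (auto simp: decseq_def)
  next
    case True
    show ?thesis
    proof (cases "Inf A \<in> A")
      case True
      then show ?thesis
        by (intro exI[of _ "\<lambda>k. Inf A"]) (auto simp: decseq_def intro: cInf_lower \<open>bdd_below A\<close>)
    next
      case nin: False
      have "\<exists>a\<in>A. a \<le> Inf A + 1 / Suc k" for k
        using cInf_less_iff[OF A(2) True, of "Inf A + 1 / Suc k"] by (auto intro: less_imp_le)
      moreover have "\<exists>k. Inf A + 1 / Suc k \<le> x" if "x \<in> A" for x
      proof -
        have "Inf A < x" using that nin cInf_lower[OF that True] by (cases "Inf A = x") auto
        then obtain k where "inverse (real (Suc k)) < x - Inf A"
          using reals_Archimedean[of "x - Inf A"] by auto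
        then show ?thesis by (intro exI[of _ k]) (simp add: field_simps)
      qed
      ultimately show ?thesis
        by (intro exI[of _ "\<lambda>k. Inf A + 1 / Suc k"]) (auto simp: decseq_def frac_le)
    qed
  qed
  then obtain t where t: "decseq t" "\<And>k::nat. \<exists>a\<in>A. a \<le> t k" "\<And>x. x \<in> A \<Longrightarrow> \<exists>k. t k \<le> x"
    by blast
  have "incseq (\<lambda>k. A \<inter> {t k..})"
    using t(1) by (auto simp: incseq_def decseq_def intro: order_trans)
  then have "(SUP k. emeasure lborel (A \<inter> {t k..})) = emeasure lborel (\<Union>k. A \<inter> {t k..})"
    using A by (intro SUP_emeasure_incseq) auto
  also have "(\<Union>k. A \<inter> {t k..}) = A" using t(3) by auto
  finally have eq: "emeasure lborel A + y = (SUP k. emeasure lborel (A \<inter> {t k..}) + y)"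
    by (simp add: ennreal_SUP_add_left)
  show ?thesis unfolding eq
  proof (rule SUP_least)
    fix k
    obtain a where a: "a \<in> A" "a \<le> t k" using t(2) by blast
    have "emeasure lborel (A \<inter> {t k..}) \<le> emeasure lborel (A \<inter> {a..})"
      using a A by (intro emeasure_mono) auto
    then show "emeasure lborel (A \<inter> {t k..}) + y \<le> c"
      using le[OF a(1)] by (meson add_right_mono order_trans)
  qed
qed

lemma emeasure_lborel_affine:
  assumes "C \<in> sets borel" "c \<noteq> 0"
  shows "emeasure lborel C = ennreal \<bar>c\<bar> * emeasure lborel ((\<lambda>x. t + c * x) -` C)"
proof -
  have [measurable]: "(\<lambda>x. t + c * x) -` C \<in> sets borel"
    using assms(1) by (intro measurable_sets_borel[where M=borel]) auto
  have "emeasure lborel C = (\<integral>\<^sup>+x. indicator C x \<partial>lborel)"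
    using assms by simp
  also have "\<dots> = ennreal \<bar>c\<bar> * (\<integral>\<^sup>+x. indicator C (t + c * x) \<partial>lborel)"
    using assms by (intro nn_integral_real_affine) auto
  also have "(\<integral>\<^sup>+x. indicator C (t + c * x) \<partial>lborel) = (\<integral>\<^sup>+x. indicator ((\<lambda>x. t + c * x) -` C) x \<partial>lborel)"
    by (simp add: indicator_def)
  finally show ?thesis by simp
qed

text \<open>Brunn-Minkowski on the line, for differences instead of sums, since differences of a set
  with itself are what its diameter controls.\<close>

lemma emeasure_half_difference_ge:
  fixes A B C :: "real set"
  assumes A: "A \<in> sets borel" "A \<noteq> {}" and B: "B \<in> sets borel" "B \<noteq> {}" and C: "C \<in> sets borel"
    and sub: "\<And>a b. a \<in> A \<Longrightarrow> b \<in> B \<Longrightarrow> (a - b) / 2 \<in> C"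
  shows "emeasure lborel A + emeasure lborel B \<le> 2 * emeasure lborel C"
proof -
  have "emeasure lborel (A \<inter> {a..}) + emeasure lborel (B \<inter> {b..}) \<le> 2 * emeasure lborel C"
    if a: "a \<in> A" and b: "b \<in> B" for a b
  proof -
    \<comment> \<open>With minima \<open>a\<close> and \<open>b\<close>, the copies
      \<open>A - b\<close> and \<open>a - B\<close> lie to the right and to the left of
      \<open>a - b\<close>. They overlap only in that point, and both are contained in twice
      \<open>C\<close>.\<close>
    define A1 where "A1 = (\<lambda>x. b + 1 * x) -` (A \<inter> {a..})"
    define B1 where "B1 = (\<lambda>x. a + (-1) * x) -` (B \<inter> {b..})"
    define C2 where "C2 = (\<lambda>x. 0 + (1/2) * x) -` C"
    have s: "A1 \<in> sets borel" "B1 \<in> sets borel" "C2 \<in> sets borel"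
      unfolding A1_def B1_def C2_def using A B C by (intro measurable_sets_borel[where M=borel]; simp)+
    have "emeasure lborel C = ennreal (1/2) * emeasure lborel C2"
      using emeasure_lborel_affine[OF C, of "1/2" 0] by (simp add: C2_def)
    then have "2 * emeasure lborel C = ennreal 2 * ennreal (1/2) * emeasure lborel C2"
      by (simp only: mult.assoc ennreal_numeral)
    also have "ennreal 2 * ennreal (1/2) = 1"
      by (subst ennreal_mult[symmetric]) auto
    finally have C2: "2 * emeasure lborel C = emeasure lborel C2" by simp
    have "emeasure lborel (A \<inter> {a..}) = emeasure lborel A1"
      using emeasure_lborel_affine[of "A \<inter> {a..}" 1 b] A by (simp add: A1_def)
    moreover have "emeasure lborel (B \<inter> {b..}) = emeasure lborel B1"
      using emeasure_lborel_affine[of "B \<inter> {b..}" "-1" a] B by (simp add: B1_def)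
    moreover have "emeasure lborel B1 = emeasure lborel (B1 - {a - b})"
      using s by (intro emeasure_Diff_null_set[symmetric]) (auto intro: finite_imp_null_set_lborel)
    moreover have "emeasure lborel A1 + emeasure lborel (B1 - {a - b}) = emeasure lborel (A1 \<union> (B1 - {a - b}))"
      using s by (intro plus_emeasure) (auto simp: A1_def B1_def)
    moreover have "\<dots> \<le> emeasure lborel C2"
    proof (intro emeasure_mono)
      show "A1 \<union> (B1 - {a - b}) \<subseteq> C2"
      proof
        fix x assume "x \<in> A1 \<union> (B1 - {a - b})"
        then show "x \<in> C2"
          using sub[OF _ b, of "b + x"] sub[OF a, of "a - x"] by (auto simp: A1_def B1_def C2_def)
      qed
    qed (use s in simp)
    ultimately show ?thesis by (simp add: C2)
  qed
  then have "emeasure lborel A + emeasure lborel (B \<inter> {b..}) \<le> 2 * emeasure lborel C" if "b \<in> B" for b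
    using that by (intro emeasure_add_le_of_tails[OF A]) auto
  then have "emeasure lborel B + emeasure lborel A \<le> 2 * emeasure lborel C"
    by (intro emeasure_add_le_of_tails[OF B]) (auto simp: add.commute)
  then show ?thesis by (simp add: add.commute)
qed

text \<open>Layer-cake formula with levels rescaled to the unit interval; cutting at level
  \<open>c\<close> produces the minimum. Scaling each function by its own bound lets the level sets
  of different functions be compared at the same \<open>l\<close>.\<close>

lemma layer_cake_min:
  fixes f :: "real \<Rightarrow> ennreal"
  assumes [measurable]: "f \<in> borel_measurable borel" and c: "c > 0"
  shows "ennreal c * (\<integral>\<^sup>+l\<in>{0<..<1}. emeasure lborel {x. ennreal (c * l) < f x} \<partial>lborel) =
    (\<integral>\<^sup>+x. min (f x) (ennreal c) \<partial>lborel)"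
proof -
  let ?P = "\<lambda>l x. l \<in> {0<..<1} \<and> ennreal (c * l) < f x"
  have "(\<integral>\<^sup>+l\<in>{0<..<1}. emeasure lborel {x. ennreal (c * l) < f x} \<partial>lborel) =
     (\<integral>\<^sup>+l. (\<integral>\<^sup>+x. indicator {x. ?P l x} x \<partial>lborel) \<partial>lborel)"
  proof (intro nn_integral_cong)
    fix l
    have "{x. ?P l x} = (if l \<in> {0<..<1} then {x. ennreal (c * l) < f x} else {})" by auto
    moreover have "{x. ennreal (c * l) < f x} \<in> sets borel" by measurable
    moreover from this have "(\<integral>\<^sup>+x. indicator {x. ?P l x} x \<partial>lborel) = emeasure lborel {x. ?P l x}"
      by (intro nn_integral_indicator) auto
    ultimately show "emeasure lborel {x. ennreal (c * l) < f x} * indicator {0<..<1} l =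
      (\<integral>\<^sup>+x. indicator {x. ?P l x} x \<partial>lborel)"
      by auto
  qed
  also have "\<dots> = (\<integral>\<^sup>+l. (\<integral>\<^sup>+x. indicator {z \<in> space (lborel \<Otimes>\<^sub>M lborel). ?P (fst z) (snd z)} (l, x) \<partial>lborel) \<partial>lborel)"
    by (simp add: indicator_def space_pair_measure)
  also have "\<dots> = (\<integral>\<^sup>+x. (\<integral>\<^sup>+l. indicator {z \<in> space (lborel \<Otimes>\<^sub>M lborel). ?P (fst z) (snd z)} (l, x) \<partial>lborel) \<partial>lborel)"
    by (intro lborel_pair.Fubini'[symmetric]) (simp add: split_def)
  also have "\<dots> = (\<integral>\<^sup>+x. (\<integral>\<^sup>+l. indicator {l. ?P l x} l \<partial>lborel) \<partial>lborel)"
    by (simp add: indicator_def space_pair_measure)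
  finally have "ennreal c * (\<integral>\<^sup>+l\<in>{0<..<1}. emeasure lborel {x. ennreal (c * l) < f x} \<partial>lborel) =
     (\<integral>\<^sup>+x. ennreal c * (\<integral>\<^sup>+l. indicator {l. ?P l x} l \<partial>lborel) \<partial>lborel)"
    by (simp add: nn_integral_cmult)
  also have "\<dots> = (\<integral>\<^sup>+x. min (f x) (ennreal c) \<partial>lborel)"
  proof (intro nn_integral_cong)
    fix x
    show "ennreal c * (\<integral>\<^sup>+l. indicator {l. ?P l x} l \<partial>lborel) = min (f x) (ennreal c)"
    proof (cases "f x")
      case (real r)
      have "{l. ?P l x} = {0<..<min 1 (r / c)}"
        using c real by (auto simp: ennreal_less_iff field_simps)
      then show ?thesis using real c
        by (auto simp: ennreal_mult[symmetric] min_def field_simps)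
    next
      case top
      then have "{l. ?P l x} = {0<..<1}" by auto
      then show ?thesis using top by simp
    qed
  qed
  finally show ?thesis .
qed

lemma ennreal_power2_strict_mono:
  fixes a b :: ennreal
  assumes "a < b"
  shows "a\<^sup>2 < b\<^sup>2"
proof (cases a)
  case (real r)
  then have "a\<^sup>2 = ennreal (r\<^sup>2)" by (simp add: ennreal_power)
  moreover have "ennreal (r\<^sup>2) < b\<^sup>2"
  proof (cases b)
    case (real t)
    then show ?thesis using assms \<open>a = ennreal r\<close> \<open>0 \<le> r\<close>
      by (auto simp: ennreal_power ennreal_less_iff intro: power_strict_mono)
  next
    case top
    then have "b\<^sup>2 = top" by (simp only: power2_eq_square ennreal_top_mult) simp
    then show ?thesis by simp
  qed
  ultimately show ?thesis by simp
qed (use assms in simp)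

lemma ennreal_am_gm:
  fixes a b c :: ennreal
  assumes "a + b \<le> 2 * c"
  shows "a * b \<le> c ^ 2"
proof (cases c)
  case (real r)
  then have "2 * c < top" by (simp add: ennreal_mult_less_top)
  then have "a + b < top" using assms by (rule le_less_trans[rotated])
  then obtain s t where st: "a = ennreal s" "s \<ge> 0" "b = ennreal t" "t \<ge> 0"
    by (cases a; cases b) auto
  have "ennreal (s + t) \<le> ennreal (2 * r)"
    using assms st real by (simp add: ennreal_mult)
  then have "s + t \<le> 2 * r" using real by (subst (asm) ennreal_le_iff) auto
  then have "(s + t)\<^sup>2 \<le> (2 * r)\<^sup>2" using st by (intro power_mono) auto
  then have "s * t \<le> r\<^sup>2" using zero_le_power2[of "s - t"] by (simp add: power2_eq_square algebra_simps)
  then show ?thesis using st real by (simp add: ennreal_mult[symmetric] ennreal_power ennreal_leI)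
qed (simp add: power2_eq_square ennreal_top_mult)

lemma prekopa_leindler_real_bounded:
  fixes f g h :: "real \<Rightarrow> ennreal"
  assumes [measurable]: "f \<in> borel_measurable borel" "g \<in> borel_measurable borel" "h \<in> borel_measurable borel"
    and le: "\<And>x y. f x * g y \<le> (h ((x - y) / 2))\<^sup>2"
    and bd: "\<And>x. f x \<le> ennreal N" "\<And>x. g x \<le> ennreal N"
  shows "(\<integral>\<^sup>+x. f x \<partial>lborel) * (\<integral>\<^sup>+x. g x \<partial>lborel) \<le> (\<integral>\<^sup>+x. h x \<partial>lborel)\<^sup>2"
proof -
  have "(SUP x. f x) \<le> ennreal N" "(SUP x. g x) \<le> ennreal N" using bd by (auto intro: SUP_least)
  then obtain F G where F: "(SUP x. f x) = ennreal F" "F \<ge> 0" and G: "(SUP x. g x) = ennreal G" "G \<ge> 0"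
    by (metis ennreal_cases ennreal_neq_top top.extremum_uniqueI)
  have fF: "f x \<le> ennreal F" and gG: "g x \<le> ennreal G" for x
    unfolding F(1)[symmetric] G(1)[symmetric] by (auto intro: SUP_upper)
  show ?thesis
  proof (cases "F = 0 \<or> G = 0")
    case True
    then have "(\<forall>x. f x = 0) \<or> (\<forall>x. g x = 0)" using fF gG by auto
    then show ?thesis by auto
  next
    case False
    then have F0: "F > 0" and G0: "G > 0" using F G by auto
    \<comment> \<open>Dividing \<open>f\<close>, \<open>g\<close>, \<open>h\<close> by
      \<open>F\<close>, \<open>G\<close>, \<open>s\<close> preserves the hypothesis and makes both
      suprema \<open>1\<close>. Hence for every level in the open unit interval the level sets of
      \<open>f\<close> and \<open>g\<close> are nonempty, as Brunn-Minkowski requires.\<close>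
    define s where "s = sqrt (F * G)"
    have s0: "s > 0" and s2: "s * s = F * G" using F0 G0 by (auto simp: s_def)
    let ?A = "\<lambda>l. emeasure lborel {x. ennreal (F * l) < f x}"
    let ?B = "\<lambda>l. emeasure lborel {x. ennreal (G * l) < g x}"
    let ?C = "\<lambda>l. emeasure lborel {x. ennreal (s * l) < h x}"
    let ?I = "\<lambda>A. (\<integral>\<^sup>+l\<in>{0<..<1}. A l \<partial>lborel)"
    have meas: "(\<lambda>l. emeasure lborel {x. ennreal (c * l) < u x}) \<in> borel_measurable borel"
      if [measurable]: "u \<in> borel_measurable borel" for c and u :: "real \<Rightarrow> ennreal"
    proof -
      have "(\<lambda>l. emeasure lborel (Pair l -` {z \<in> space (lborel \<Otimes>\<^sub>M lborel). ennreal (c * fst z) < u (snd z)})) \<in> borel_measurable lborel"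
        by (intro lborel.measurable_emeasure_Pair) measurable
      then show ?thesis by (simp add: space_pair_measure vimage_def)
    qed
    have "?A l + ?B l \<le> 2 * ?C l" if l: "l \<in> {0<..<1}" for l
    proof (rule emeasure_half_difference_ge)
      have "ennreal (F * l) < (SUP x. f x)" "ennreal (G * l) < (SUP x. g x)"
        using l F0 G0 F G by (auto simp: ennreal_less_iff)
      then show "{x. ennreal (F * l) < f x} \<noteq> {}" "{x. ennreal (G * l) < g x} \<noteq> {}"
        by (auto simp: less_SUP_iff)
    next
      fix a b assume a: "a \<in> {x. ennreal (F * l) < f x}" and b: "b \<in> {x. ennreal (G * l) < g x}"
      obtain u v where uv: "f a = ennreal u" "u \<ge> 0" "g b = ennreal v" "v \<ge> 0"
        using fF[of a] gG[of b] by (cases "f a"; cases "g b") (auto simp: top_unique)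
      have "F * l < u" "G * l < v" using a b uv l F0 G0 by (auto simp: ennreal_less_iff)
      moreover have "0 < F * l" "0 < G * l" using l F0 G0 by auto
      ultimately have "(F * l) * (G * l) < u * v" by (intro mult_strict_mono) linarith+
      then have "ennreal ((s * l)\<^sup>2) < f a * g b"
        using uv s2 l F0 G0 by (simp add: ennreal_mult[symmetric] ennreal_less_iff power2_eq_square algebra_simps)
      then have *: "(ennreal (s * l))\<^sup>2 < (h ((a - b) / 2))\<^sup>2"
        using le[of a b] s0 l by (simp add: ennreal_power)
      show "(a - b) / 2 \<in> {x. ennreal (s * l) < h x}"
      proof (rule ccontr)
        assume "\<not> ?thesis"
        then have "(h ((a - b) / 2))\<^sup>2 \<le> (ennreal (s * l))\<^sup>2" by (intro power_mono) auto
        with * show False by simp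
      qed
    qed measurable
    then have "?I (\<lambda>l. ?A l + ?B l) \<le> ?I (\<lambda>l. 2 * ?C l)"
      by (intro nn_integral_mono) (auto simp: indicator_def)
    then have le': "?I ?A + ?I ?B \<le> 2 * ?I ?C"
      using meas by (simp add: nn_integral_add nn_integral_cmult distrib_right mult.assoc)
    have "ennreal F * ?I ?A = (\<integral>\<^sup>+x. f x \<partial>lborel)" "ennreal G * ?I ?B = (\<integral>\<^sup>+x. g x \<partial>lborel)"
      using layer_cake_min[of f F] layer_cake_min[of g G] F0 G0 fF gG by (simp_all add: min_absorb1)
    moreover have "ennreal s * ?I ?C \<le> (\<integral>\<^sup>+x. h x \<partial>lborel)"
      using layer_cake_min[of h s] s0 by (auto intro!: nn_integral_mono)
    \<comment> \<open>The additive inequality becomes the product form by the inequality of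
      arithmetic and geometric means.\<close>
    moreover have "(ennreal F * ?I ?A) * (ennreal G * ?I ?B) \<le> (ennreal s * ?I ?C)\<^sup>2"
    proof -
      have "(ennreal F * ?I ?A) * (ennreal G * ?I ?B) = ennreal (F * G) * (?I ?A * ?I ?B)"
        using F G by (simp add: ennreal_mult mult_ac)
      also have "\<dots> \<le> ennreal (F * G) * (?I ?C)\<^sup>2"
        using ennreal_am_gm[OF le'] by (intro mult_left_mono) auto
      also have "\<dots> = (ennreal s * ?I ?C)\<^sup>2"
        using s0 by (simp add: s2[symmetric] ennreal_mult power2_eq_square mult_ac)
      finally show ?thesis .
    qed
    ultimately show ?thesis using power_mono[of "ennreal s * ?I ?C" "\<integral>\<^sup>+x. h x \<partial>lborel" 2]
      by simp
  qed
qed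

text \<open>Both functions are truncated at independent heights, so monotone convergence can be
  applied to each factor of the product separately.\<close>

lemma prekopa_leindler_real:
  fixes f g h :: "real \<Rightarrow> ennreal"
  assumes [measurable]: "f \<in> borel_measurable borel" "g \<in> borel_measurable borel" "h \<in> borel_measurable borel"
    and le: "\<And>x y. f x * g y \<le> (h ((x - y) / 2))\<^sup>2"
  shows "(\<integral>\<^sup>+x. f x \<partial>lborel) * (\<integral>\<^sup>+x. g x \<partial>lborel) \<le> (\<integral>\<^sup>+x. h x \<partial>lborel)\<^sup>2"
proof -
  let ?t = "\<lambda>u (N::nat) x. min (u x) (of_nat N :: ennreal)"
  have conv: "(\<integral>\<^sup>+x. u x \<partial>lborel) = (SUP N. \<integral>\<^sup>+x. ?t u N x \<partial>lborel)"
    if [measurable]: "u \<in> borel_measurable borel" for u :: "real \<Rightarrow> ennreal"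
  proof -
    have "u x = (SUP N. ?t u N x)" for x
    proof (cases "u x")
      case (real r)
      obtain N where "r \<le> real N" using real_arch_simple by blast
      then have "?t u N x = u x" using real by (simp add: min_absorb1 ennreal_of_nat_eq_real_of_nat ennreal_leI)
      then show ?thesis by (intro antisym SUP_upper2[of N] SUP_least) auto
    next
      case top
      show ?thesis
        by (simp only: top min_absorb2[OF top_greatest] ennreal_SUP_of_nat_eq_top)
    qed
    then have "(\<integral>\<^sup>+x. u x \<partial>lborel) = (\<integral>\<^sup>+x. (SUP N. ?t u N x) \<partial>lborel)" by simp
    also have "\<dots> = (SUP N. \<integral>\<^sup>+x. ?t u N x \<partial>lborel)"
      by (intro nn_integral_monotone_convergence_SUP)
         (auto simp: incseq_def le_fun_def min_le_iff_disj intro: min.coboundedI2 of_nat_mono)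
    finally show ?thesis .
  qed
  have "(\<integral>\<^sup>+x. ?t f N x \<partial>lborel) * (\<integral>\<^sup>+x. ?t g M x \<partial>lborel) \<le> (\<integral>\<^sup>+x. h x \<partial>lborel)\<^sup>2" for N M
  proof (rule prekopa_leindler_real_bounded[where N="real (max N M)"])
    show "?t f N x * ?t g M y \<le> (h ((x - y) / 2))\<^sup>2" for x y
      by (rule order_trans[OF mult_mono[OF min.cobounded1 min.cobounded1 zero_le zero_le] le])
    show "?t f N x \<le> ennreal (real (max N M))" "?t g M x \<le> ennreal (real (max N M))" for x
      by (rule order_trans[OF min.cobounded2], simp add: ennreal_of_nat_eq_real_of_nat ennreal_leI)+
  qed measurable
  then show ?thesis
    unfolding conv[OF assms(1)] conv[OF assms(2)]
    by (simp add: SUP_mult_left_ennreal SUP_mult_right_ennreal SUP_le_iff)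
qed

section \<open>Lebesgue measure in finitely many coordinates\<close>

abbreviation lebesgue_fun :: "nat \<Rightarrow> (nat \<Rightarrow> real) measure" where
  "lebesgue_fun d \<equiv> PiM {..<d} (\<lambda>_. lborel)"

interpretation lborel_fun: product_sigma_finite "\<lambda>_::nat. lborel :: real measure"
  by standard

lemma nn_integral_lebesgue_fun_Suc:
  assumes "f \<in> borel_measurable (lebesgue_fun (Suc d))"
  shows "(\<integral>\<^sup>+x. f x \<partial>lebesgue_fun (Suc d)) = (\<integral>\<^sup>+x. (\<integral>\<^sup>+s. f (x(d := s)) \<partial>lborel) \<partial>lebesgue_fun d)"
  using lborel_fun.product_nn_integral_insert[of "{..<d}" d f] assms by (simp add: lessThan_Suc)

lemma nn_integral_lebesgue_fun_Suc_rev: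
  assumes "f \<in> borel_measurable (lebesgue_fun (Suc d))"
  shows "(\<integral>\<^sup>+x. f x \<partial>lebesgue_fun (Suc d)) = (\<integral>\<^sup>+s. (\<integral>\<^sup>+x. f (x(d := s)) \<partial>lebesgue_fun d) \<partial>lborel)"
  using lborel_fun.product_nn_integral_insert_rev[of "{..<d}" d f] assms by (simp add: lessThan_Suc)

lemma measurable_lebesgue_fun_upd [measurable]:
  "(\<lambda>(x, s). x(d := s)) \<in> measurable (lebesgue_fun d \<Otimes>\<^sub>M lborel) (lebesgue_fun (Suc d))"
  using measurable_add_dim[of d "{..<d}" "\<lambda>_. lborel"] by (simp add: lessThan_Suc)

lemma measurable_lebesgue_fun_section:
  assumes "f \<in> measurable (lebesgue_fun (Suc d)) N" "x \<in> space (lebesgue_fun d)"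
  shows "(\<lambda>s. f (x(d := s))) \<in> measurable lborel N"
proof -
  have "(\<lambda>s. f ((\<lambda>(x, s). x(d := s)) (x, s))) \<in> measurable lborel N"
    by (rule measurable_compose[OF measurable_compose[OF measurable_Pair1'[OF assms(2)] measurable_lebesgue_fun_upd] assms(1)])
  then show ?thesis by simp
qed

lemma measurable_lebesgue_fun_integral:
  assumes "f \<in> borel_measurable (lebesgue_fun (Suc d))"
  shows "(\<lambda>x. \<integral>\<^sup>+s. f (x(d := s)) \<partial>lborel) \<in> borel_measurable (lebesgue_fun d)"
proof -
  have "(\<lambda>z. f ((\<lambda>(x, s). x(d := s)) z)) \<in> borel_measurable (lebesgue_fun d \<Otimes>\<^sub>M lborel)"
    by (rule measurable_compose[OF measurable_lebesgue_fun_upd assms])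
  then show ?thesis
    by (intro lborel.borel_measurable_nn_integral) (simp add: split_def)
qed

definition half_diff :: "nat \<Rightarrow> (nat \<Rightarrow> real) \<Rightarrow> (nat \<Rightarrow> real) \<Rightarrow> (nat \<Rightarrow> real)" where
  "half_diff d x y = (\<lambda>i\<in>{..<d}. (x i - y i) / 2)"

text \<open>Induction on the dimension: integrating out the last coordinate preserves the
  hypothesis, by the inequality on the line applied to sections.\<close>

lemma prekopa_leindler:
  assumes "f \<in> borel_measurable (lebesgue_fun d)" "g \<in> borel_measurable (lebesgue_fun d)"
    "h \<in> borel_measurable (lebesgue_fun d)"
    and "\<And>x y. x \<in> space (lebesgue_fun d) \<Longrightarrow> y \<in> space (lebesgue_fun d) \<Longrightarrow> f x * g y \<le> (h (half_diff d x y))\<^sup>2"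
  shows "(\<integral>\<^sup>+x. f x \<partial>lebesgue_fun d) * (\<integral>\<^sup>+x. g x \<partial>lebesgue_fun d) \<le> (\<integral>\<^sup>+x. h x \<partial>lebesgue_fun d)\<^sup>2"
  using assms
proof (induction d arbitrary: f g h)
  case 0
  show ?case using "0.prems"(4)[of "\<lambda>_. undefined" "\<lambda>_. undefined"]
    by (simp add: half_diff_def lborel_fun.nn_integral_empty space_PiM)
next
  case (Suc d)
  let ?int = "\<lambda>u x. \<integral>\<^sup>+s. u (x(d := s)) \<partial>lborel"
  have upd: "x(d := s) \<in> space (lebesgue_fun (Suc d))" if "x \<in> space (lebesgue_fun d)" for x s
    using that by (auto simp: space_PiM PiE_def extensional_def Pi_def)
  have "(\<integral>\<^sup>+x. ?int f x \<partial>lebesgue_fun d) * (\<integral>\<^sup>+x. ?int g x \<partial>lebesgue_fun d) \<le> (\<integral>\<^sup>+x. ?int h x \<partial>lebesgue_fun d)\<^sup>2"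
  proof (rule Suc.IH)
    fix x y assume x: "x \<in> space (lebesgue_fun d)" and y: "y \<in> space (lebesgue_fun d)"
    have xy: "half_diff d x y \<in> space (lebesgue_fun d)" by (auto simp: half_diff_def space_PiM)
    show "?int f x * ?int g y \<le> (?int h (half_diff d x y))\<^sup>2"
    proof (rule prekopa_leindler_real)
      fix s t
      have "half_diff (Suc d) (x(d := s)) (y(d := t)) = (half_diff d x y)(d := (s - t) / 2)"
        by (auto simp: half_diff_def fun_eq_iff)
      then show "f (x(d := s)) * g (y(d := t)) \<le> (h ((half_diff d x y)(d := (s - t) / 2)))\<^sup>2"
        using Suc.prems(4)[OF upd[OF x] upd[OF y]] by metis
    qed (use measurable_lebesgue_fun_section Suc.prems x y xy in \<open>auto simp: measurable_lborel1\<close>)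
  qed (intro measurable_lebesgue_fun_integral Suc.prems)+
  then show ?case using Suc.prems by (simp add: nn_integral_lebesgue_fun_Suc)
qed

lemma emeasure_le_half_differences:
  assumes E: "E \<in> sets (lebesgue_fun d)" and B: "B \<in> sets (lebesgue_fun d)"
    and sub: "\<And>x y. x \<in> E \<Longrightarrow> y \<in> E \<Longrightarrow> half_diff d x y \<in> B"
  shows "emeasure (lebesgue_fun d) E \<le> emeasure (lebesgue_fun d) B"
proof -
  have "(\<integral>\<^sup>+x. indicator E x \<partial>lebesgue_fun d) * (\<integral>\<^sup>+x. indicator E x \<partial>lebesgue_fun d)
      \<le> (\<integral>\<^sup>+x. indicator B x \<partial>lebesgue_fun d)\<^sup>2"
    using E B sub by (intro prekopa_leindler) (auto simp: indicator_def)
  then have *: "(emeasure (lebesgue_fun d) E)\<^sup>2 \<le> (emeasure (lebesgue_fun d) B)\<^sup>2"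
    using E B by (simp add: power2_eq_square)
  show ?thesis
  proof (rule ccontr)
    assume "\<not> ?thesis"
    then have "emeasure (lebesgue_fun d) B < emeasure (lebesgue_fun d) E" by simp
    then have "(emeasure (lebesgue_fun d) B)\<^sup>2 < (emeasure (lebesgue_fun d) E)\<^sup>2"
      by (rule ennreal_power2_strict_mono)
    with * show False by simp
  qed
qed


section \<open>Positive definite matrices and volumes of ellipsoids\<close>

lemma mat_inner_eq_sum:
  assumes "A \<in> carrier_mat d d"
  shows "mat_inner A x y = (\<Sum>i<d. \<Sum>j<d. A $$ (i, j) * x i * y j)"
  using assms by (auto simp: mat_inner_def scalar_prod_def atLeast0LessThan sum_distrib_left mult_ac intro!: sum.cong)

lemma mat_inner_cong:
  assumes "A \<in> carrier_mat d d" "\<And>i. i < d \<Longrightarrow> x i = x' i" "\<And>i. i < d \<Longrightarrow> y i = y' i"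
  shows "mat_inner A x y = mat_inner A x' y'"
  unfolding mat_inner_eq_sum[OF assms(1)] using assms(2,3) by (intro sum.cong refl) auto

lemma pos_def_mat_carrier: "pos_def_mat d A \<Longrightarrow> A \<in> carrier_mat d d"
  by (simp add: pos_def_mat_def)

lemma pos_def_mat_sym:
  assumes "pos_def_mat d A" "i < d" "j < d"
  shows "A $$ (i, j) = A $$ (j, i)"
  using assms by (metis carrier_matD index_transpose_mat(1) pos_def_mat_def)

lemma pos_def_mat_inner_pos:
  assumes "pos_def_mat d A" "i < d" "x i \<noteq> 0"
  shows "mat_inner A x x > 0"
proof -
  have "Matrix.vec d x \<noteq> 0\<^sub>v d" using assms(2,3) by (metis index_vec index_zero_vec(1))
  then show ?thesis
    using assms(1) unfolding pos_def_mat_def mat_inner_def by auto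
qed

lemma pos_def_matI:
  assumes A: "A \<in> carrier_mat d d" and "\<And>i j. i < d \<Longrightarrow> j < d \<Longrightarrow> A $$ (i, j) = A $$ (j, i)"
    and pos: "\<And>x i. i < d \<Longrightarrow> x i \<noteq> 0 \<Longrightarrow> mat_inner A x x > 0"
  shows "pos_def_mat d A"
  unfolding pos_def_mat_def
proof (intro conjI ballI impI A)
  show "transpose_mat A = A" using assms by (intro eq_matI) auto
  fix v :: "real Matrix.vec" assume v: "v \<in> carrier_vec d" "v \<noteq> 0\<^sub>v d"
  then obtain i where i: "i < d" "v $ i \<noteq> 0"
    by (metis carrier_vecD eq_vecI index_zero_vec)
  have "Matrix.vec d (\<lambda>i. v $ i) = v" using v by auto
  then show "scalar_prod v (A *\<^sub>v v) > 0"
    using pos[of i "\<lambda>i. v $ i"] i A by (simp add: mat_inner_def)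
qed

lemma mat_inner_nonneg: "pos_def_mat d A \<Longrightarrow> mat_inner A x x \<ge> 0"
proof -
  assume A: "pos_def_mat d A"
  show ?thesis
  proof (cases "\<exists>i<d. x i \<noteq> 0")
    case True
    then show ?thesis using pos_def_mat_inner_pos[OF A] by (meson less_imp_le)
  next
    case False
    then show ?thesis by (simp add: mat_inner_eq_sum[OF pos_def_mat_carrier[OF A]])
  qed
qed

text \<open>Completing the square in the last variable; \<open>schur\<close> is the Schur complement of the last
  diagonal entry.\<close>

definition schur :: "nat \<Rightarrow> real mat \<Rightarrow> real mat" where
  "schur d G = Matrix.mat d d (\<lambda>(i, j). G $$ (i, j) - G $$ (i, d) * G $$ (d, j) / G $$ (d, d))"

lemma pos_def_mat_diag_pos:
  assumes "pos_def_mat d G" "k < d"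
  shows "G $$ (k, k) > 0"
proof -
  let ?e = "\<lambda>i::nat. if i = k then 1 else 0 :: real"
  have "mat_inner G ?e ?e = (\<Sum>i<d. \<Sum>j<d. if j = k then (if i = k then G $$ (i, k) else 0) else 0)"
    unfolding mat_inner_eq_sum[OF pos_def_mat_carrier[OF assms(1)]] by (intro sum.cong refl) auto
  also have "\<dots> = G $$ (k, k)" using assms(2) by (simp add: sum.delta)
  finally show ?thesis using pos_def_mat_inner_pos[OF assms, of ?e] by simp
qed

lemma mat_inner_schur:
  assumes G: "pos_def_mat (Suc d) G"
  shows "mat_inner G x x =
    G $$ (d, d) * (x d + (\<Sum>i<d. G $$ (i, d) * x i) / G $$ (d, d))\<^sup>2 + mat_inner (schur d G) x x"
proof -
  define g where "g = G $$ (d, d)"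
  define c where "c = (\<Sum>i<d. G $$ (i, d) * x i)"
  have g: "g > 0" using pos_def_mat_diag_pos[OF G] by (simp add: g_def)
  have cc: "c\<^sup>2 / g = (\<Sum>i<d. \<Sum>j<d. (G $$ (i, d) * G $$ (d, j) / g) * x i * x j)"
  proof -
    have "c\<^sup>2 = (\<Sum>i<d. \<Sum>j<d. (G $$ (i, d) * x i) * (G $$ (d, j) * x j))"
      unfolding c_def power2_eq_square sum_product
      using pos_def_mat_sym[OF G] by (intro sum.cong refl) auto
    then show ?thesis by (simp add: sum_divide_distrib mult_ac)
  qed
  have S: "schur d G \<in> carrier_mat d d" by (simp add: schur_def)
  have "mat_inner (schur d G) x x = (\<Sum>i<d. \<Sum>j<d. G $$ (i, j) * x i * x j) - c\<^sup>2 / g"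
    unfolding mat_inner_eq_sum[OF S] cc sum_subtractf[symmetric]
    by (intro sum.cong refl) (simp add: schur_def g_def algebra_simps)
  moreover have "mat_inner G x x = (\<Sum>i<d. \<Sum>j<d. G $$ (i, j) * x i * x j) + 2 * c * x d + g * (x d)\<^sup>2"
  proof -
    have "(\<Sum>j<d. G $$ (d, j) * x d * x j) = c * x d"
      unfolding c_def sum_distrib_right using pos_def_mat_sym[OF G] by (intro sum.cong refl) auto
    moreover have "(\<Sum>i<d. G $$ (i, d) * x i * x d) = c * x d"
      unfolding c_def sum_distrib_right by simp
    ultimately show ?thesis
      unfolding mat_inner_eq_sum[OF pos_def_mat_carrier[OF G]]
      by (simp add: sum.distrib g_def power2_eq_square)
  qed
  moreover have "g * (x d + c / g)\<^sup>2 = g * (x d)\<^sup>2 + 2 * c * x d + c\<^sup>2 / g"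
    using g by (simp add: power2_eq_square field_simps)
  ultimately show ?thesis by (simp add: g_def c_def)
qed

lemma pos_def_mat_schur:
  assumes G: "pos_def_mat (Suc d) G"
  shows "pos_def_mat d (schur d G)"
proof (rule pos_def_matI)
  fix x :: "nat \<Rightarrow> real" and i assume i: "i < d" "x i \<noteq> 0"
  let ?c = "(\<Sum>i<d. G $$ (i, d) * x i) / G $$ (d, d)"
  \<comment> \<open>This last coordinate makes the square in \<open>mat_inner_schur\<close> vanish,
    so the form of the Schur complement is a value of the form of \<open>G\<close>.\<close>
  let ?x = "x(d := - ?c)"
  have "mat_inner (schur d G) x x = mat_inner (schur d G) ?x ?x"
    by (rule mat_inner_cong[where d=d]) (auto simp: schur_def)
  also have "\<dots> = mat_inner G ?x ?x"
    using mat_inner_schur[OF G, of ?x] by simp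
  also have "\<dots> > 0"
    using i by (intro pos_def_mat_inner_pos[OF G, of i]) auto
  finally show "mat_inner (schur d G) x x > 0" .
qed (use pos_def_mat_sym[OF G] in \<open>auto simp: schur_def\<close>)

lemma det_schur:
  assumes G: "pos_def_mat (Suc d) G"
  shows "Determinant.det G = G $$ (d, d) * Determinant.det (schur d G)"
proof -
  define g where "g = G $$ (d, d)"
  have g: "g > 0" using pos_def_mat_diag_pos[OF G] by (simp add: g_def)
  \<comment> \<open>Block elimination \<open>G = U * V\<close>: \<open>U\<close> is unipotent,
    \<open>V\<close> is block triangular with diagonal blocks \<open>schur d G\<close> and
    \<open>g\<close>.\<close>
  define U where "U = four_block_mat (1\<^sub>m d) (Matrix.mat d 1 (\<lambda>(i, j). G $$ (i, d) / g)) (0\<^sub>m 1 d) (1\<^sub>m 1)"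
  define V where "V = four_block_mat (schur d G) (0\<^sub>m d 1) (Matrix.mat 1 d (\<lambda>(i, j). G $$ (d, j))) (Matrix.mat 1 1 (\<lambda>_. g))"
  have S: "schur d G \<in> carrier_mat d d" by (simp add: schur_def)
  have U: "U \<in> carrier_mat (Suc d) (Suc d)" and V: "V \<in> carrier_mat (Suc d) (Suc d)"
    using S by (auto simp: U_def V_def)
  have Ue: "U $$ (i, k) = (if i = k then 1 else if k = d then G $$ (i, d) / g else 0)"
    if "i < Suc d" "k < Suc d" for i k
    using that by (auto simp: U_def less_Suc_eq)
  have Ve: "V $$ (k, j) = (if k < d then (if j < d then schur d G $$ (k, j) else 0) else G $$ (d, j))"
    if "k < Suc d" "j < Suc d" for k j
    using that S by (auto simp: V_def g_def less_Suc_eq)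
  have "U * V = G"
  proof (rule eq_matI)
    fix i j assume "i < dim_row G" "j < dim_col G"
    then have ij: "i < Suc d" "j < Suc d" using pos_def_mat_carrier[OF G] by auto
    have "(U * V) $$ (i, j) = (\<Sum>k<Suc d. U $$ (i, k) * V $$ (k, j))"
      using U V ij by (simp add: scalar_prod_def atLeast0LessThan)
    also have "\<dots> = (\<Sum>k<d. (if i = k then 1 else 0) * V $$ (k, j)) + U $$ (i, d) * V $$ (d, j)"
      using ij by (subst sum.lessThan_Suc) (intro arg_cong2[where f="(+)"] sum.cong refl, auto simp: Ue)
    also have "(\<Sum>k<d. (if i = k then 1 else 0) * V $$ (k, j)) = (\<Sum>k<d. if i = k then V $$ (k, j) else 0)"
      by (intro sum.cong) auto
    also have "\<dots> + U $$ (i, d) * V $$ (d, j) = G $$ (i, j)"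
      using ij g by (auto simp: Ue Ve less_Suc_eq schur_def g_def)
    finally show "(U * V) $$ (i, j) = G $$ (i, j)" .
  qed (use U V pos_def_mat_carrier[OF G] in auto)
  then have "Determinant.det G = Determinant.det U * Determinant.det V"
    using det_mult[OF U V] by simp
  also have "Determinant.det U = 1"
    unfolding U_def by (subst det_four_block_mat_lower_left_zero[where n=d and m=1]) auto
  also have "Determinant.det V = Determinant.det (schur d G) * g"
    unfolding V_def using S
    by (subst det_four_block_mat_upper_right_zero_col[where n=d]) (auto simp: det_single)
  finally show ?thesis by (simp add: g_def)
qed

lemma det_pos_def_mat:
  "pos_def_mat d G \<Longrightarrow> Determinant.det G > 0"
proof (induction d arbitrary: G)
  case 0
  then show ?case by (simp add: pos_def_mat_def)
next
  case (Suc d)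
  then show ?case
    using det_schur[OF Suc.prems] pos_def_mat_diag_pos[OF Suc.prems, of d] pos_def_mat_schur[OF Suc.prems] by simp
qed

lemma pos_def_mat_coercive:
  "pos_def_mat d G \<Longrightarrow> \<exists>k>0. \<forall>x. k * (\<Sum>i<d. (x i)\<^sup>2) \<le> mat_inner G x x"
proof (induction d arbitrary: G)
  case 0
  then show ?case using mat_inner_nonneg[OF 0] by (auto intro!: exI[of _ 1])
next
  case (Suc d)
  define g where "g = G $$ (d, d)"
  have g: "g > 0" using pos_def_mat_diag_pos[OF Suc.prems] by (simp add: g_def)
  obtain k where k: "k > 0" "\<And>x. k * (\<Sum>i<d. (x i)\<^sup>2) \<le> mat_inner (schur d G) x x"
    using Suc.IH[OF pos_def_mat_schur[OF Suc.prems]] by blast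
  define C where "C = (\<Sum>i<d. (G $$ (i, d) / g)\<^sup>2)"
  have C: "C \<ge> 0" by (simp add: C_def sum_nonneg)
  \<comment> \<open>Origin of the two summands: the sum of all squares is at most
    \<open>1 + 2 * C\<close> times the first \<open>d\<close> squares plus twice the completed
    square, and the form of \<open>G\<close> dominates \<open>k\<close> times the former and
    \<open>g\<close> times the latter.\<close>
  define M where "M = (1 + 2 * C) / k + 2 / g"
  have "(1 + 2 * C) / k > 0" "2 / g > 0" using C k g by (simp_all add: add_pos_nonneg)
  then have M: "M > 0" unfolding M_def by (rule add_pos_pos)
  have "(\<Sum>i<Suc d. (x i)\<^sup>2) \<le> M * mat_inner G x x" for x
  proof -
    define c where "c = (\<Sum>i<d. G $$ (i, d) * x i) / g"
    define y where "y = (\<Sum>i<d. (x i)\<^sup>2)"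
    have y: "y \<ge> 0" by (simp add: y_def sum_nonneg)
    have "c = (\<Sum>i<d. (G $$ (i, d) / g) * x i)" by (simp add: c_def sum_divide_distrib)
    then have "c\<^sup>2 \<le> C * y"
      using Cauchy_Schwarz_ineq_sum[of "\<lambda>i. G $$ (i, d) / g" x "{..<d}"] by (simp add: C_def y_def)
    moreover have "(x d)\<^sup>2 \<le> 2 * (x d + c)\<^sup>2 + 2 * c\<^sup>2"
      using zero_le_power2[of "x d + 2 * c"] by (simp add: power2_eq_square algebra_simps)
    ultimately have "y + (x d)\<^sup>2 \<le> (1 + 2 * C) * y + 2 * (x d + c)\<^sup>2"
      by (simp add: algebra_simps)
    also have "\<dots> = ((1 + 2 * C) / k) * (k * y) + (2 / g) * (g * (x d + c)\<^sup>2)"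
      using k g by simp
    also have "\<dots> \<le> ((1 + 2 * C) / k) * mat_inner G x x + (2 / g) * mat_inner G x x"
    proof (intro add_mono mult_left_mono)
      have *: "mat_inner G x x = g * (x d + c)\<^sup>2 + mat_inner (schur d G) x x"
        using mat_inner_schur[OF Suc.prems, of x] by (simp add: g_def c_def)
      have "0 \<le> k * y" "0 \<le> g * (x d + c)\<^sup>2" using k y g by auto
      then show "k * y \<le> mat_inner G x x" "g * (x d + c)\<^sup>2 \<le> mat_inner G x x"
        using k(2)[of x] unfolding * y_def by linarith+
    qed (use k g C in auto)
    finally show ?thesis by (simp add: y_def M_def algebra_simps)
  qed
  then show ?case
    using M by (intro exI[of _ "1 / M"]) (auto simp: field_simps)
qed

section \<open>Integrals of functions of a quadratic form\<close>

lemma mat_inner_measurable [measurable]: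
  assumes "G \<in> carrier_mat d d"
  shows "(\<lambda>x. mat_inner G x x) \<in> borel_measurable (lebesgue_fun d)"
proof -
  have "(\<lambda>x. \<Sum>i<d. \<Sum>j<d. G $$ (i, j) * x i * x j) \<in> borel_measurable (lebesgue_fun d)"
    by measurable
  then show ?thesis by (simp add: mat_inner_eq_sum[OF assms])
qed

text \<open>Change of variables without a linear map: after completing the square, a shift and a
  scaling reduce the last variable to its plain square, the order of integration is exchanged, and
  induction treats the remaining form. The outer function \<open>f\<close> must be arbitrary because
  the induction applies to \<open>f\<close> shifted by the square of the last variable.\<close>

lemma nn_integral_mat_inner:
  assumes "pos_def_mat d G" "f \<in> borel_measurable borel"
  shows "(\<integral>\<^sup>+x. f (mat_inner G x x) \<partial>lebesgue_fun d) =
    ennreal (1 / sqrt (Determinant.det G)) * (\<integral>\<^sup>+x. f (\<Sum>i<d. (x i)\<^sup>2) \<partial>lebesgue_fun d)"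
  using assms
proof (induction d arbitrary: G f)
  case 0
  then show ?case by (simp add: mat_inner_eq_sum[OF pos_def_mat_carrier[OF 0(1)]] pos_def_mat_def)
next
  case (Suc d)
  note G = Suc.prems(1) and [measurable] = Suc.prems(2)
  define g where "g = G $$ (d, d)"
  have g: "g > 0" using pos_def_mat_diag_pos[OF G] by (simp add: g_def)
  note S = pos_def_mat_schur[OF G]
  let ?q = "\<lambda>x. mat_inner (schur d G) x x"
  have q_upd: "?q (x(d := s)) = ?q x" for x s
    by (rule mat_inner_cong[OF pos_def_mat_carrier[OF S]]) auto
  have [measurable]: "(\<lambda>x. mat_inner G x x) \<in> borel_measurable (lebesgue_fun (Suc d))"
    by (rule mat_inner_measurable[OF pos_def_mat_carrier[OF G]])
  have [measurable]: "?q \<in> borel_measurable (lebesgue_fun (Suc d))"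
    unfolding mat_inner_eq_sum[OF pos_def_mat_carrier[OF S]] by measurable
  have shift: "(\<integral>\<^sup>+s. f (mat_inner G (x(d := s)) (x(d := s))) \<partial>lborel)
     = ennreal (1 / sqrt g) * (\<integral>\<^sup>+s. f (s\<^sup>2 + ?q x) \<partial>lborel)" for x
  proof -
    define c where "c = (\<Sum>i<d. G $$ (i, d) * x i) / g"
    have "mat_inner G (x(d := s)) (x(d := s)) = g * (s + c)\<^sup>2 + ?q x" for s
      using mat_inner_schur[OF G, of "x(d := s)"] by (simp add: g_def c_def q_upd)
    then have "(\<integral>\<^sup>+s. f (mat_inner G (x(d := s)) (x(d := s))) \<partial>lborel)
        = (\<integral>\<^sup>+s. f (g * (s + c)\<^sup>2 + ?q x) \<partial>lborel)" by simp
    also have "\<dots> = ennreal \<bar>1 / sqrt g\<bar> * (\<integral>\<^sup>+s. f (g * ((- c + (1 / sqrt g) * s) + c)\<^sup>2 + ?q x) \<partial>lborel)"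
      using g by (intro nn_integral_real_affine) auto
    also have "\<dots> = ennreal (1 / sqrt g) * (\<integral>\<^sup>+s. f (s\<^sup>2 + ?q x) \<partial>lborel)"
      using g by (simp add: power_divide)
    finally show ?thesis .
  qed
  have "(\<integral>\<^sup>+x. f (mat_inner G x x) \<partial>lebesgue_fun (Suc d)) =
      (\<integral>\<^sup>+x. ennreal (1 / sqrt g) * (\<integral>\<^sup>+s. f (s\<^sup>2 + ?q x) \<partial>lborel) \<partial>lebesgue_fun d)"
    by (subst nn_integral_lebesgue_fun_Suc) (auto simp: shift)
  also have "\<dots> = ennreal (1 / sqrt g) * (\<integral>\<^sup>+x. (\<integral>\<^sup>+s. f (s\<^sup>2 + ?q x) \<partial>lborel) \<partial>lebesgue_fun d)"
  proof (rule nn_integral_cmult)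
    have "(\<lambda>x. f ((x d)\<^sup>2 + ?q x)) \<in> borel_measurable (lebesgue_fun (Suc d))" by measurable
    from measurable_lebesgue_fun_integral[OF this]
    show "(\<lambda>x. \<integral>\<^sup>+s. f (s\<^sup>2 + ?q x) \<partial>lborel) \<in> borel_measurable (lebesgue_fun d)"
      by (simp add: q_upd)
  qed
  also have "(\<integral>\<^sup>+x. (\<integral>\<^sup>+s. f (s\<^sup>2 + ?q x) \<partial>lborel) \<partial>lebesgue_fun d) =
      (\<integral>\<^sup>+x. f ((x d)\<^sup>2 + ?q x) \<partial>lebesgue_fun (Suc d))"
    by (subst nn_integral_lebesgue_fun_Suc) (auto simp: q_upd)
  also have "\<dots> = (\<integral>\<^sup>+s. (\<integral>\<^sup>+x. f (s\<^sup>2 + ?q x) \<partial>lebesgue_fun d) \<partial>lborel)"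
    by (subst nn_integral_lebesgue_fun_Suc_rev) (auto simp: q_upd)
  also have "\<dots> = (\<integral>\<^sup>+s. ennreal (1 / sqrt (Determinant.det (schur d G))) *
      (\<integral>\<^sup>+x. f (s\<^sup>2 + (\<Sum>i<d. (x i)\<^sup>2)) \<partial>lebesgue_fun d) \<partial>lborel)"
    by (intro nn_integral_cong Suc.IH[OF S]) simp
  also have "\<dots> = ennreal (1 / sqrt (Determinant.det (schur d G))) *
      (\<integral>\<^sup>+s. (\<integral>\<^sup>+x. f (s\<^sup>2 + (\<Sum>i<d. (x i)\<^sup>2)) \<partial>lebesgue_fun d) \<partial>lborel)"
  proof (rule nn_integral_cmult)
    interpret LF: sigma_finite_measure "lebesgue_fun d"
      by (intro lborel_fun.sigma_finite) auto
    show "(\<lambda>s. \<integral>\<^sup>+x. f (s\<^sup>2 + (\<Sum>i<d. (x i)\<^sup>2)) \<partial>lebesgue_fun d) \<in> borel_measurable lborel"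
      by (intro LF.borel_measurable_nn_integral) (simp add: split_def)
  qed
  also have "(\<integral>\<^sup>+s. (\<integral>\<^sup>+x. f (s\<^sup>2 + (\<Sum>i<d. (x i)\<^sup>2)) \<partial>lebesgue_fun d) \<partial>lborel) =
      (\<integral>\<^sup>+x. f (\<Sum>i<Suc d. (x i)\<^sup>2) \<partial>lebesgue_fun (Suc d))"
    by (subst nn_integral_lebesgue_fun_Suc_rev) (auto simp: add.commute)
  finally show ?case
    using g det_pos_def_mat[OF S] by (simp add: det_schur[OF G] g_def real_sqrt_mult ennreal_mult'[symmetric] mult.assoc[symmetric])
qed

lemma emeasure_sublevel_eq_nn_integral:
  fixes h :: "'a \<Rightarrow> real"
  assumes [measurable]: "h \<in> borel_measurable M"
  shows "emeasure M {x \<in> space M. h x \<le> c} = (\<integral>\<^sup>+x. indicator {..c} (h x) \<partial>M)"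
proof -
  have "(\<integral>\<^sup>+x. indicator {..c} (h x) \<partial>M) = (\<integral>\<^sup>+x. indicator {x \<in> space M. h x \<le> c} x \<partial>M)"
    by (intro nn_integral_cong) (simp add: indicator_def)
  also have "\<dots> = emeasure M {x \<in> space M. h x \<le> c}"
    by (rule nn_integral_indicator) measurable
  finally show ?thesis by simp
qed

lemma emeasure_ellipsoid:
  assumes G: "pos_def_mat d G" and d: "d > 0" and r: "r \<ge> 0"
  shows "emeasure (lebesgue_fun d) {x \<in> space (lebesgue_fun d). mat_inner G x x \<le> r\<^sup>2} =
    ennreal (unit_ball_vol (real d) * r ^ d / sqrt (Determinant.det G))"
proof -
  have ball: "emeasure (lebesgue_fun d) {x \<in> space (lebesgue_fun d). (\<Sum>i<d. (x i)\<^sup>2) \<le> r\<^sup>2} =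
    ennreal (unit_ball_vol (real d) * r ^ d)" if r: "r > 0" for r :: real
  proof -
    have "{f. sqrt (\<Sum>i<d. (f i)\<^sup>2) \<le> r} \<inter> space (lebesgue_fun d) =
        {x \<in> space (lebesgue_fun d). (\<Sum>i<d. (x i)\<^sup>2) \<le> r\<^sup>2}"
      using r by (auto simp: sum_nonneg intro: real_le_lsqrt sqrt_le_D)
    then show ?thesis using emeasure_cball_aux[of "{..<d}" r] r by simp
  qed
  have ball': "emeasure (lebesgue_fun d) {x \<in> space (lebesgue_fun d). (\<Sum>i<d. (x i)\<^sup>2) \<le> r\<^sup>2} =
    ennreal (unit_ball_vol (real d) * r ^ d)"
  proof (cases "r = 0")
    case True
    let ?B = "\<lambda>r. {x \<in> space (lebesgue_fun d). (\<Sum>i<d. (x i)\<^sup>2) \<le> r\<^sup>2}"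
    have "emeasure (lebesgue_fun d) (?B 0) \<le> ennreal (unit_ball_vol (real d) * s)" if "s > 0" for s :: real
    proof -
      \<comment> \<open>Radius zero is squeezed into balls whose volume is proportional to an
        arbitrary \<open>s > 0\<close>.\<close>
      have "?B 0 \<subseteq> ?B (root d s)"
        using zero_le_power2 by (auto intro: order_trans)
      then have "emeasure (lebesgue_fun d) (?B 0) \<le> emeasure (lebesgue_fun d) (?B (root d s))"
        by (intro emeasure_mono) auto
      also have "\<dots> = ennreal (unit_ball_vol (real d) * s)"
        using ball[of "root d s"] d that by simp
      finally show ?thesis .
    qed
    from this[of "e / unit_ball_vol (real d)" for e] 
    have small: "emeasure (lebesgue_fun d) (?B 0) \<le> 0 + ennreal e" if "e > 0" for e
      using that by (simp add: unit_ball_vol_pos less_imp_neq[symmetric] del: power_zero_numeral)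
    have "emeasure (lebesgue_fun d) (?B 0) \<le> 0"
      by (rule ennreal_le_epsilon) (rule small)
    then show ?thesis using True d by (simp add: zero_power)
  qed (use ball[of r] r in auto)
  have "emeasure (lebesgue_fun d) {x \<in> space (lebesgue_fun d). mat_inner G x x \<le> r\<^sup>2} =
      (\<integral>\<^sup>+x. indicator {..r\<^sup>2} (mat_inner G x x) \<partial>lebesgue_fun d)"
    by (rule emeasure_sublevel_eq_nn_integral[OF mat_inner_measurable[OF pos_def_mat_carrier[OF G]]])
  also have "\<dots> = ennreal (1 / sqrt (Determinant.det G)) * (\<integral>\<^sup>+x. indicator {..r\<^sup>2} (\<Sum>i<d. (x i)\<^sup>2) \<partial>lebesgue_fun d)"
    by (rule nn_integral_mat_inner[OF G]) simp
  also have "(\<integral>\<^sup>+x. indicator {..r\<^sup>2} (\<Sum>i<d. (x i)\<^sup>2) \<partial>lebesgue_fun d) =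
      emeasure (lebesgue_fun d) {x \<in> space (lebesgue_fun d). (\<Sum>i<d. (x i)\<^sup>2) \<le> r\<^sup>2}"
    by (rule emeasure_sublevel_eq_nn_integral[symmetric]) measurable
  finally show ?thesis
    using det_pos_def_mat[OF G] r by (simp add: ball' ennreal_mult'[symmetric] mult.commute)
qed


section \<open>The isodiametric inequality and volumes of cubes\<close>

lemma mat_inner_combination:
  assumes "pos_def_mat d A"
  shows "mat_inner A (\<lambda>i. s * u i + t * v i) (\<lambda>i. s * u i + t * v i) =
    s\<^sup>2 * mat_inner A u u + 2 * s * t * mat_inner A u v + t\<^sup>2 * mat_inner A v v"
proof -
  note A = pos_def_mat_carrier[OF assms]
  have sym: "mat_inner A v u = mat_inner A u v"
    unfolding mat_inner_eq_sum[OF A] using pos_def_mat_sym[OF assms]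
    by (subst sum.swap) (auto intro!: sum.cong)
  have "mat_inner A (\<lambda>i. s * u i + t * v i) (\<lambda>i. s * u i + t * v i) =
    s\<^sup>2 * mat_inner A u u + s * t * mat_inner A u v + s * t * mat_inner A v u + t\<^sup>2 * mat_inner A v v"
    unfolding mat_inner_eq_sum[OF A] sum_distrib_left sum.distrib[symmetric]
    by (intro sum.cong refl) (simp add: power2_eq_square algebra_simps)
  then show ?thesis by (simp add: sym)
qed

text \<open>Young's inequality, read off from the nonnegativity of the form at
  \<open>sqrt e * u - v / sqrt e\<close>. With small \<open>e\<close>, a much smaller perturbation
  \<open>v\<close> costs only a factor close to \<open>1\<close> on \<open>u\<close>.\<close>

lemma mat_inner_add_le:
  assumes "pos_def_mat d A" "e > 0"
  shows "mat_inner A (\<lambda>i. u i + v i) (\<lambda>i. u i + v i) \<le> (1 + e) * mat_inner A u u + (1 + 1 / e) * mat_inner A v v"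
proof -
  have "0 \<le> (sqrt e)\<^sup>2 * mat_inner A u u + 2 * sqrt e * (- 1 / sqrt e) * mat_inner A u v + (- 1 / sqrt e)\<^sup>2 * mat_inner A v v"
    using mat_inner_nonneg[OF assms(1)] unfolding mat_inner_combination[OF assms(1), symmetric] .
  also have "\<dots> = e * mat_inner A u u - 2 * mat_inner A u v + (1 / e) * mat_inner A v v"
    using assms(2) by (simp add: power_divide)
  finally show ?thesis
    using mat_inner_combination[OF assms(1), of 1 u 1 v] by (simp add: algebra_simps)
qed

lemma mat_inner_scale:
  assumes "A \<in> carrier_mat d d"
  shows "mat_inner A (\<lambda>i. s * u i) (\<lambda>i. s * u i) = s\<^sup>2 * mat_inner A u u"
  unfolding mat_inner_eq_sum[OF assms] sum_distrib_left
  by (intro sum.cong refl) (simp add: power2_eq_square algebra_simps)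

lemma mat_inner_le_sum_squares:
  assumes "A \<in> carrier_mat d d"
  shows "\<exists>C>0. \<forall>x. mat_inner A x x \<le> C * (\<Sum>i<d. (x i)\<^sup>2)"
proof -
  define C where "C = (\<Sum>i<d. \<Sum>j<d. \<bar>A $$ (i, j)\<bar>)"
  have C: "C \<ge> 0" by (auto simp: C_def intro!: sum_nonneg)
  have "mat_inner A x x \<le> (C + 1) * (\<Sum>i<d. (x i)\<^sup>2)" for x
  proof -
    let ?N = "\<Sum>i<d. (x i)\<^sup>2"
    have N: "(x i)\<^sup>2 \<le> ?N" if "i < d" for i
      using that by (intro member_le_sum) auto
    have "mat_inner A x x \<le> (\<Sum>i<d. \<Sum>j<d. \<bar>A $$ (i, j)\<bar> * ?N)"
      unfolding mat_inner_eq_sum[OF assms]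
    proof (intro sum_mono)
      fix i j assume ij: "i \<in> {..<d}" "j \<in> {..<d}"
      have "\<bar>x i * x j\<bar> \<le> ((x i)\<^sup>2 + (x j)\<^sup>2) / 2"
        using zero_le_power2[of "\<bar>x i\<bar> - \<bar>x j\<bar>"] by (simp add: power2_eq_square abs_mult algebra_simps)
      also have "\<dots> \<le> ?N" using N[of i] N[of j] ij by simp
      finally have "\<bar>A $$ (i, j)\<bar> * \<bar>x i * x j\<bar> \<le> \<bar>A $$ (i, j)\<bar> * ?N"
        by (intro mult_left_mono) auto
      moreover have "A $$ (i, j) * x i * x j \<le> \<bar>A $$ (i, j)\<bar> * \<bar>x i * x j\<bar>"
        unfolding abs_mult[symmetric] mult.assoc by (rule abs_ge_self)
      ultimately show "A $$ (i, j) * x i * x j \<le> \<bar>A $$ (i, j)\<bar> * ?N" by linarith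
    qed
    also have "\<dots> = C * ?N" by (simp add: C_def sum_distrib_right)
    also have "\<dots> \<le> (C + 1) * ?N" by (intro mult_right_mono sum_nonneg) auto
    finally show ?thesis .
  qed
  then show ?thesis using C by (intro exI[of _ "C + 1"]) auto
qed

lemma mat_dist_le_iff:
  assumes "r \<ge> 0"
  shows "mat_dist A x y \<le> r \<longleftrightarrow> mat_inner A (\<lambda>i. x i - y i) (\<lambda>i. x i - y i) \<le> r\<^sup>2"
  unfolding mat_dist_def mat_norm_def using assms real_sqrt_le_iff[of _ "r\<^sup>2"] by simp

text \<open>Half differences of points of \<open>E\<close> have norm at most half the diameter, so
  they lie in an ellipsoid of known volume, and \<open>emeasure_le_half_differences\<close> applies.
  The factor \<open>sqrt (Determinant.det G)\<close> converts Lebesgue measure into the volume of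
  the metric of \<open>G\<close>.\<close>

lemma hcost_isodiametric:
  assumes G: "pos_def_mat d G" and d: "d > 0" and E: "E \<in> sets (lebesgue_fun d)"
  shows "ennreal (sqrt (Determinant.det G)) * emeasure (lebesgue_fun d) E \<le> hcost (mat_dist G) d E"
proof (cases "ediam (mat_dist G) E")
  case top
  then have "hcost (mat_dist G) d E = top"
    using d unit_ball_vol_pos[of "real d"]
    by (auto simp: hcost_def ennreal_top_divide ennreal_mult_top ennreal_eq_0_iff not_le power_eq_top_ennreal)
  then show ?thesis by simp
next
  case (real D)
  define r where "r = D / 2"
  have r: "r \<ge> 0" using real by (simp add: r_def)
  have "emeasure (lebesgue_fun d) E \<le> emeasure (lebesgue_fun d) {x \<in> space (lebesgue_fun d). mat_inner G x x \<le> r\<^sup>2}"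
  proof (rule emeasure_le_half_differences[OF E])
    show "{x \<in> space (lebesgue_fun d). mat_inner G x x \<le> r\<^sup>2} \<in> sets (lebesgue_fun d)"
      using mat_inner_measurable[OF pos_def_mat_carrier[OF G]] by measurable
    fix x y assume "x \<in> E" "y \<in> E"
    then have "ennreal (mat_dist G x y) \<le> ennreal D" using ediam_upper[of x E y "mat_dist G"] real by simp
    then have "mat_dist G x y \<le> D" using real by (simp add: ennreal_le_iff)
    then have "mat_inner G (\<lambda>i. x i - y i) (\<lambda>i. x i - y i) \<le> D\<^sup>2"
      using real by (simp add: mat_dist_le_iff)
    moreover have "mat_inner G (half_diff d x y) (half_diff d x y) = (1/2)\<^sup>2 * mat_inner G (\<lambda>i. x i - y i) (\<lambda>i. x i - y i)"
      unfolding mat_inner_scale[OF pos_def_mat_carrier[OF G], symmetric]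
      by (rule mat_inner_cong[OF pos_def_mat_carrier[OF G]]) (auto simp: half_diff_def)
    ultimately show "half_diff d x y \<in> {x \<in> space (lebesgue_fun d). mat_inner G x x \<le> r\<^sup>2}"
      by (auto simp: r_def power_divide half_diff_def space_PiM)
  qed
  also have "\<dots> = ennreal (unit_ball_vol (real d) * r ^ d / sqrt (Determinant.det G))"
    by (rule emeasure_ellipsoid[OF G d r])
  finally have "ennreal (sqrt (Determinant.det G)) * emeasure (lebesgue_fun d) E \<le>
     ennreal (sqrt (Determinant.det G)) * ennreal (unit_ball_vol (real d) * r ^ d / sqrt (Determinant.det G))"
    by (intro mult_left_mono) auto
  also have "\<dots> = ennreal (unit_ball_vol (real d) * r ^ d)"
    using det_pos_def_mat[OF G] r by (subst ennreal_mult[symmetric]) auto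
  also have "\<dots> = hcost (mat_dist G) d E"
    using r real by (simp add: hcost_def r_def ennreal_mult ennreal_power ennreal_divide_numeral)
  finally show ?thesis .
qed

text \<open>Half-open dyadic cubes of side \<open>1 / 2 ^ k\<close>, encoded by floors so that each
  point determines its cube at every level and a finer index determines the coarser one.\<close>

definition dcube :: "nat \<Rightarrow> nat \<Rightarrow> (nat \<Rightarrow> int) \<Rightarrow> (nat \<Rightarrow> real) set" where
  "dcube d k z = {y \<in> {..<d} \<rightarrow>\<^sub>E UNIV. \<forall>i<d. \<lfloor>2 ^ k * y i\<rfloor> = z i}"

lemma dcube_eq_PiE:
  "dcube d k z = (\<Pi>\<^sub>E i\<in>{..<d}. {real_of_int (z i) / 2 ^ k ..< (real_of_int (z i) + 1) / 2 ^ k})"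
  unfolding dcube_def by (auto simp: PiE_def Pi_def floor_eq_iff field_simps)

lemma sets_dcube [measurable]: "dcube d k z \<in> sets (lebesgue_fun d)"
  unfolding dcube_eq_PiE by (intro sets_PiM_I_finite) auto

lemma emeasure_dcube: "emeasure (lebesgue_fun d) (dcube d k z) = ennreal ((1 / 2 ^ k) ^ d)"
  unfolding dcube_eq_PiE
  by (subst lborel_fun.emeasure_PiM) (auto simp: field_simps ennreal_power diff_divide_distrib[symmetric])

definition grid_index :: "nat \<Rightarrow> nat \<Rightarrow> (nat \<Rightarrow> real) \<Rightarrow> (nat \<Rightarrow> int)" where
  "grid_index d k x = (\<lambda>i\<in>{..<d}. \<lfloor>2 ^ k * x i\<rfloor>)"

lemma mem_dcube_grid_index: "x \<in> {..<d} \<rightarrow>\<^sub>E UNIV \<Longrightarrow> x \<in> dcube d k (grid_index d k x)"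
  by (simp add: dcube_def grid_index_def)

lemma dcube_coord_close:
  assumes "x \<in> dcube d k z" "y \<in> dcube d k z" "i < d"
  shows "\<bar>x i - y i\<bar> < 1 / 2 ^ k"
proof -
  have "\<lfloor>2 ^ k * x i\<rfloor> = \<lfloor>2 ^ k * y i\<rfloor>" using assms by (simp add: dcube_def)
  then have "\<bar>2 ^ k * x i - 2 ^ k * y i\<bar> < 1" by linarith
  then have "2 ^ k * \<bar>x i - y i\<bar> < 1" by (simp add: right_diff_distrib[symmetric] abs_mult)
  then show ?thesis by (simp add: field_simps)
qed

text \<open>The reference cube is centred at the origin so that it contains the ellipsoids of
  \<open>emeasure_ellipsoid\<close> without translation.\<close>

definition ref_cube :: "nat \<Rightarrow> (nat \<Rightarrow> real) set" where
  "ref_cube d = {..<d} \<rightarrow>\<^sub>E {-1..<1}"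

definition ref_grid :: "nat \<Rightarrow> nat \<Rightarrow> (nat \<Rightarrow> int) set" where
  "ref_grid d k = {..<d} \<rightarrow>\<^sub>E {- (2 ^ k)..<2 ^ k}"

lemma finite_ref_grid [simp]: "finite (ref_grid d k)"
  by (simp add: ref_grid_def finite_PiE)

lemma card_ref_grid: "card (ref_grid d k) = (2 ^ Suc k) ^ d"
  unfolding ref_grid_def by (subst card_PiE) (auto simp: nat_add_distrib nat_power_eq nat_mult_distrib)

lemma grid_index_ref_cube:
  assumes "x \<in> ref_cube d"
  shows "grid_index d k x \<in> ref_grid d k"
proof -
  have "\<lfloor>2 ^ k * x i\<rfloor> \<in> {- (2 ^ k)..<2 ^ k}" if "i < d" for i
  proof -
    have "-1 \<le> x i" "x i < 1" using assms that by (auto simp: ref_cube_def PiE_def Pi_def)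
    then have "- (2 ^ k) \<le> 2 ^ k * x i" "2 ^ k * x i < 2 ^ k"
      using mult_left_mono[of "-1" "x i" "2 ^ k"] mult_strict_left_mono[of "x i" 1 "2 ^ k"] by auto
    then show ?thesis by (simp add: le_floor_iff floor_less_iff)
  qed
  then show ?thesis by (simp add: grid_index_def ref_grid_def PiE_def Pi_def)
qed

lemma ref_cube_subset_UN: "ref_cube d \<subseteq> (\<Union>z\<in>ref_grid d k. dcube d k z)"
proof
  fix x assume x: "x \<in> ref_cube d"
  then have "x \<in> {..<d} \<rightarrow>\<^sub>E UNIV" by (auto simp: ref_cube_def PiE_def)
  then show "x \<in> (\<Union>z\<in>ref_grid d k. dcube d k z)"
    by (intro UN_I[OF grid_index_ref_cube[OF x]] mem_dcube_grid_index)
qed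

text \<open>The cube is a translate of the reference cube scaled by \<open>1 / 2 ^ Suc k\<close>;
  the exponent is \<open>Suc k\<close> because the reference cube has side \<open>2\<close>.\<close>

lemma hausdorff_pre_measure_dcube:
  assumes G: "pos_def_mat d G" and d: "d > 0"
  shows "hausdorff_pre_measure (mat_dist G) d (ennreal (1 / 2 ^ Suc k) * \<delta>) (dcube d k z) \<le>
    ennreal ((1 / 2 ^ Suc k) ^ d) * hausdorff_pre_measure (mat_dist G) d \<delta> (ref_cube d)"
proof -
  let ?f = "\<lambda>x. \<lambda>i\<in>{..<d}. (real_of_int (z i) + (x i + 1) / 2) / 2 ^ k"
  have "y \<in> ?f ` ref_cube d" if y: "y \<in> dcube d k z" for y
  proof
    let ?x = "\<lambda>i\<in>{..<d}. 2 * (2 ^ k * y i - z i) - 1"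
    show "y = ?f ?x"
      using y by (auto simp: dcube_def fun_eq_iff PiE_def extensional_def field_simps)
    have "real_of_int (z i) \<le> 2 ^ k * y i \<and> 2 * (2 ^ k * y i) - 2 * real_of_int (z i) < 2" if "i < d" for i
    proof -
      have "\<lfloor>2 ^ k * y i\<rfloor> = z i" using y that by (simp add: dcube_def)
      then show ?thesis by linarith
    qed
    then show "?x \<in> ref_cube d" by (auto simp: ref_cube_def)
  qed
  then have "dcube d k z \<subseteq> ?f ` ref_cube d" by blast
  then have "hausdorff_pre_measure (mat_dist G) d (ennreal (1 / 2 ^ Suc k) * \<delta>) (dcube d k z) \<le>
      hausdorff_pre_measure (mat_dist G) d (ennreal (1 / 2 ^ Suc k) * \<delta>) (?f ` ref_cube d)"
    by (rule hausdorff_pre_measure_mono[OF d])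
  also have "\<dots> \<le> ennreal ((1 / 2 ^ Suc k) ^ d) * hausdorff_pre_measure (mat_dist G) d \<delta> (ref_cube d)"
  proof (rule hausdorff_pre_measure_Lipschitz_image[OF d])
    fix x y
    have "mat_inner G (\<lambda>i. ?f x i - ?f y i) (\<lambda>i. ?f x i - ?f y i) =
        (1 / 2 ^ Suc k)\<^sup>2 * mat_inner G (\<lambda>i. x i - y i) (\<lambda>i. x i - y i)"
      unfolding mat_inner_scale[OF pos_def_mat_carrier[OF G], symmetric]
      by (rule mat_inner_cong[OF pos_def_mat_carrier[OF G]]) (simp_all add: field_simps)
    then show "mat_dist G (?f x) (?f y) \<le> 1 / 2 ^ Suc k * mat_dist G x y"
      unfolding mat_dist_def mat_norm_def by (simp add: real_sqrt_mult real_sqrt_divide)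
  qed simp
  finally show ?thesis .
qed

lemma ediam_ref_cube:
  assumes G: "pos_def_mat d G"
  shows "\<exists>R>0. ediam (mat_dist G) (ref_cube d) \<le> ennreal R"
proof -
  obtain C where C: "C > 0" "\<And>x. mat_inner G x x \<le> C * (\<Sum>i<d. (x i)\<^sup>2)"
    using mat_inner_le_sum_squares[OF pos_def_mat_carrier[OF G]] by blast
  define R where "R = sqrt (C * (4 * d) + 1)"
  have R: "R > 0" using C by (simp add: R_def add_nonneg_pos)
  have "mat_dist G x y \<le> R" if xy: "x \<in> ref_cube d" "y \<in> ref_cube d" for x y
  proof -
    have "(x i - y i)\<^sup>2 \<le> 2\<^sup>2" if "i < d" for i
    proof -
      have "\<bar>x i\<bar> \<le> 1" "\<bar>y i\<bar> \<le> 1" using xy that by (force simp: ref_cube_def PiE_def Pi_def abs_le_iff)+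
      then show ?thesis by (intro power2_le_iff_abs_le[THEN iffD2]) auto
    qed
    then have "(\<Sum>i<d. (x i - y i)\<^sup>2) \<le> 4 * d"
      using sum_bounded_above[of "{..<d}" "\<lambda>i. (x i - y i)\<^sup>2" 4] by simp
    then have "C * (\<Sum>i<d. (x i - y i)\<^sup>2) \<le> C * (4 * d)" using C by (intro mult_left_mono) auto
    then have "mat_inner G (\<lambda>i. x i - y i) (\<lambda>i. x i - y i) \<le> C * (4 * d)"
      using C(2)[of "\<lambda>i. x i - y i"] by linarith
    also have "\<dots> \<le> R\<^sup>2" using C by (simp add: R_def)
    finally show ?thesis using R by (simp add: mat_dist_le_iff)
  qed
  then show ?thesis using R by (intro exI[of _ R]) (auto simp: ediam_le_iff ennreal_leI)
qed

text \<open>Self-similarity: \<open>ref_cube\<close> is covered by \<open>(2 ^ Suc k) ^ d\<close>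
  copies of itself scaled by \<open>1 / 2 ^ Suc k\<close>. The number of copies cancels the scaling
  of costs, so refining the scale cannot increase the premeasure.\<close>

lemma Vol_ref_cube_le_pre_measure:
  assumes G: "pos_def_mat d G" and d: "d > 0" and R: "R > 0"
  shows "Vol G d (ref_cube d) \<le> hausdorff_pre_measure (mat_dist G) d (ennreal R) (ref_cube d)"
  unfolding Vol_def
proof (rule hausdorff_measure_le)
  fix \<delta> :: ennreal assume \<delta>: "\<delta> > 0"
  let ?h = "hausdorff_pre_measure (mat_dist G) d"
  obtain k where k: "ennreal (1 / 2 ^ Suc k) * ennreal R \<le> \<delta>"
  proof (cases \<delta>)
    case (real r)
    then have "r / R > 0" using \<delta> R by auto
    then obtain k where "(1/2) ^ k < r / R" using real_arch_pow_inv[of "r / R" "1/2"] by auto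
    moreover have "(1/2 :: real) ^ Suc k \<le> (1/2) ^ k" by simp
    ultimately have "(1/2) ^ Suc k < r / R" by linarith
    then have "(1/2) ^ Suc k * R < r" using R by (simp only: pos_less_divide_eq)
    then have "1 / 2 ^ Suc k * R \<le> r" by (simp only: power_one_over)
    then have "ennreal (1 / 2 ^ Suc k) * ennreal R \<le> \<delta>"
      using real R by (subst ennreal_mult[symmetric]) (auto intro: ennreal_leI)
    then show ?thesis using that by blast
  qed (use that in auto)
  have "?h \<delta> (ref_cube d) \<le> ?h (ennreal (1 / 2 ^ Suc k) * ennreal R) (ref_cube d)"
    by (rule hausdorff_pre_measure_antimono[OF d k])
  also have "\<dots> \<le> ?h (ennreal (1 / 2 ^ Suc k) * ennreal R) (\<Union>z\<in>ref_grid d k. dcube d k z)"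
    by (rule hausdorff_pre_measure_mono[OF d ref_cube_subset_UN])
  also have "\<dots> \<le> (\<Sum>z\<in>ref_grid d k. ?h (ennreal (1 / 2 ^ Suc k) * ennreal R) (dcube d k z))"
    by (rule hausdorff_pre_measure_sum_le[OF d]) simp
  also have "\<dots> \<le> (\<Sum>z\<in>ref_grid d k. ennreal ((1 / 2 ^ Suc k) ^ d) * ?h (ennreal R) (ref_cube d))"
    by (intro sum_mono hausdorff_pre_measure_dcube[OF G d])
  also have "\<dots> = (of_nat (card (ref_grid d k)) * ennreal ((1 / 2 ^ Suc k) ^ d)) * ?h (ennreal R) (ref_cube d)"
    by (simp add: mult.assoc)
  also have "of_nat (card (ref_grid d k)) * ennreal ((1 / 2 ^ Suc k) ^ d) = 1"
    unfolding card_ref_grid ennreal_of_nat_eq_real_of_nat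
    by (subst ennreal_mult[symmetric]) (auto simp: power_one_over)
  finally show "?h \<delta> (ref_cube d) \<le> ?h (ennreal R) (ref_cube d)" by simp
qed

lemma hausdorff_pre_measure_Un_le:
  assumes "d > 0"
  shows "hausdorff_pre_measure ds d \<delta> (A \<union> B) \<le>
    hausdorff_pre_measure ds d \<delta> A + hausdorff_pre_measure ds d \<delta> B"
proof -
  have "A \<union> B = (\<Union>b\<in>{True, False}. if b then A else B)" by auto
  then show ?thesis
    using hausdorff_pre_measure_sum_le[OF assms, of "{True, False}" ds \<delta> "\<lambda>b. if b then A else B"] by simp
qed

text \<open>A sharp bound without a Vitali covering: the cube is covered by one ellipsoid
  \<open>B r\<close> of known cost and by the grid cubes not contained in it, each costing its share
  of the unknown volume \<open>c\<close>. Since \<open>c\<close> is finite, subtraction leaves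
  \<open>c\<close> times the fraction of grid cubes inside the ellipsoid, bounded by the cost of the
  ellipsoid. Comparing Lebesgue volumes then gives the constant.\<close>

lemma Vol_ref_cube_le:
  assumes G: "pos_def_mat d G" and d: "d > 0"
  shows "Vol G d (ref_cube d) \<le> ennreal (2 ^ d * sqrt (Determinant.det G))"
proof -
  let ?h = "hausdorff_pre_measure (mat_dist G) d" and ?q = "\<lambda>x. mat_inner G x x"
  obtain R where R: "R > 0" "ediam (mat_dist G) (ref_cube d) \<le> ennreal R"
    using ediam_ref_cube[OF G] by blast
  have "Vol G d (ref_cube d) \<le> hcost (mat_dist G) d (ref_cube d)"
    using Vol_ref_cube_le_pre_measure[OF G d R(1)] hausdorff_pre_measure_single[OF d order_refl R(2)] by (rule order_trans)
  also have "\<dots> \<le> ennreal (unit_ball_vol d) * (ennreal R / 2) ^ d"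
    unfolding hcost_def by (intro mult_left_mono power_mono divide_right_mono_ennreal R) auto
  also have "\<dots> < top"
    using R(1) by (simp add: ennreal_divide_numeral ennreal_power ennreal_mult_less_top)
  finally obtain c where c: "Vol G d (ref_cube d) = ennreal c" "c \<ge> 0"
    by (cases "Vol G d (ref_cube d)") auto
  obtain \<kappa> where \<kappa>: "\<kappa> > 0" "\<And>x. \<kappa> * (\<Sum>i<d. (x i)\<^sup>2) \<le> ?q x"
    using pos_def_mat_coercive[OF G] by blast
  obtain C where C: "C > 0" "\<And>x. ?q x \<le> C * (\<Sum>i<d. (x i)\<^sup>2)"
    using mat_inner_le_sum_squares[OF pos_def_mat_carrier[OF G]] by blast
  \<comment> \<open>Coercivity confines the ellipsoid of this radius to coordinates at most
    \<open>1 / 2\<close> in absolute value, hence to the reference cube.\<close>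
  define r where "r = sqrt \<kappa> / 2"
  have r: "r > 0" using \<kappa> by (simp add: r_def)
  define B where "B = (\<lambda>r. {x \<in> space (lebesgue_fun d). ?q x \<le> r\<^sup>2})"
  have B_sub: "B r \<subseteq> ref_cube d"
  proof
    fix x assume x: "x \<in> B r"
    have "x i \<in> {-1..<1}" if "i < d" for i
    proof -
      have "(x i)\<^sup>2 \<le> (\<Sum>i<d. (x i)\<^sup>2)" using that by (intro member_le_sum) auto
      then have "\<kappa> * (x i)\<^sup>2 \<le> \<kappa> * (\<Sum>i<d. (x i)\<^sup>2)" using \<kappa> by (intro mult_left_mono) auto
      also have "\<dots> \<le> r\<^sup>2" using \<kappa>(2)[of x] x by (auto simp: B_def)
      also have "\<dots> = \<kappa> * (1/2)\<^sup>2" using \<kappa> by (simp add: r_def power_divide)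
      finally have "(x i)\<^sup>2 \<le> (1/2)\<^sup>2" using \<kappa> by (subst (asm) mult_le_cancel_left_pos) auto
      then have "\<bar>x i\<bar> \<le> 1/2" by (subst (asm) power2_le_iff_abs_le) auto
      then show ?thesis by auto
    qed
    then show "x \<in> ref_cube d" using x by (auto simp: B_def ref_cube_def space_PiM PiE_def Pi_def)
  qed
  have hB: "hcost (mat_dist G) d (B r) \<le> ennreal (unit_ball_vol d * r ^ d)"
  proof -
    have "ediam (mat_dist G) (B r) \<le> ennreal (2 * r)"
      unfolding ediam_le_iff
    proof (intro ballI ennreal_leI)
      fix x y assume "x \<in> B r" "y \<in> B r"
      then have q: "?q x \<le> r\<^sup>2" "?q y \<le> r\<^sup>2" by (auto simp: B_def)
      have "mat_inner G (\<lambda>i. x i - y i) (\<lambda>i. x i - y i) \<le> 2 * ?q x + 2 * ?q y"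
        using mat_inner_add_le[OF G, of 1 x "\<lambda>i. (-1) * y i"] mat_inner_scale[OF pos_def_mat_carrier[OF G], of "-1" y] by simp
      also have "\<dots> \<le> (2 * r)\<^sup>2" using q by (simp add: power2_eq_square)
      finally show "mat_dist G x y \<le> 2 * r" using r by (simp add: mat_dist_le_iff)
    qed
    then have "hcost (mat_dist G) d (B r) \<le> ennreal (unit_ball_vol d) * (ennreal (2 * r) / 2) ^ d"
      unfolding hcost_def by (intro mult_left_mono power_mono divide_right_mono_ennreal) auto
    also have "ennreal (2 * r) / 2 = ennreal r"
      using r by (subst ennreal_divide_numeral) auto
    finally show ?thesis using r by (simp add: ennreal_power ennreal_mult)
  qed
  \<comment> \<open>The slightly smaller ellipsoid \<open>B (t * r)\<close> is covered by the grid
    cubes lying inside \<open>B r\<close>, which bounds their number from below; \<open>t\<close>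
    tends to \<open>1\<close> at the end.\<close>
  have main: "c * t ^ d \<le> 2 ^ d * sqrt (Determinant.det G)" if t: "0 < t" "t < 1" for t
  proof -
    define e where "e = (1 / t\<^sup>2 - 1) / 2"
    have t2: "t\<^sup>2 < 1" "t\<^sup>2 > 0" using t by (auto simp: power_less_one_iff)
    have *: "(1 / u - 1) / 2 > 0 \<and> (1 + (1 / u - 1) / 2) * u < 1" if "u < 1" "u > 0" for u :: real
      using that by (simp add: field_simps)
    have e: "e > 0" and et: "(1 + e) * t\<^sup>2 < 1" using *[OF t2] by (simp_all only: e_def)
    \<comment> \<open>Chosen so that the second term of \<open>mat_inner_add_le\<close> uses up
      exactly the gap between \<open>(1 + e) * (t * r)\<^sup>2\<close> and
      \<open>r\<^sup>2\<close>.\<close>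
    define \<eta> where "\<eta> = (1 - (1 + e) * t\<^sup>2) * r\<^sup>2 / ((1 + 1 / e) * C * d)"
    have \<eta>: "\<eta> > 0" unfolding \<eta>_def using et e C d r
      by (intro divide_pos_pos mult_pos_pos) (auto intro!: add_pos_pos)
    obtain M where M: "(1/2) ^ M < \<eta>" "(1/2::real) ^ M \<le> 1"
      using real_arch_pow_inv[OF \<eta>, of "1/2"] by (auto simp: power_le_one)
    have near: "?q y \<le> r\<^sup>2" if x: "x \<in> B (t * r)" and xy: "x \<in> dcube d M z" "y \<in> dcube d M z" for x y z
    proof -
      have "(y i - x i)\<^sup>2 \<le> \<eta>" if "i < d" for i
      proof -
        have "\<bar>y i - x i\<bar> \<le> (1/2) ^ M" using dcube_coord_close[OF xy(2,1) that] by (simp add: power_one_over)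
        then have "\<bar>y i - x i\<bar>\<^sup>2 \<le> ((1/2) ^ M)\<^sup>2" by (intro power_mono) auto
        also have "\<dots> \<le> (1/2) ^ M * 1" unfolding power2_eq_square by (intro mult_left_mono M) auto
        finally show ?thesis using M by simp
      qed
      then have "(\<Sum>i<d. (y i - x i)\<^sup>2) \<le> d * \<eta>"
        using sum_bounded_above[of "{..<d}" "\<lambda>i. (y i - x i)\<^sup>2" \<eta>] by simp
      then have "C * (\<Sum>i<d. (y i - x i)\<^sup>2) \<le> C * (d * \<eta>)" using C by (intro mult_left_mono) auto
      then have q2: "mat_inner G (\<lambda>i. y i - x i) (\<lambda>i. y i - x i) \<le> C * (d * \<eta>)"
        using C(2)[of "\<lambda>i. y i - x i"] by linarith
      have "?q y \<le> (1 + e) * ?q x + (1 + 1 / e) * mat_inner G (\<lambda>i. y i - x i) (\<lambda>i. y i - x i)"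
        using mat_inner_add_le[OF G e, of x "\<lambda>i. y i - x i"] by simp
      also have "\<dots> \<le> (1 + e) * (t * r)\<^sup>2 + (1 + 1 / e) * (C * (d * \<eta>))"
        using x e q2 by (intro add_mono mult_left_mono) (auto simp: B_def)
      also have "(1 + 1 / e) * (C * (d * \<eta>)) = (1 - (1 + e) * t\<^sup>2) * r\<^sup>2"
      proof -
        have "1 + 1 / e > 0" using e by (simp add: add_pos_pos)
        then show ?thesis using C d by (simp add: \<eta>_def)
      qed
      also have "(1 + e) * (t * r)\<^sup>2 + (1 - (1 + e) * t\<^sup>2) * r\<^sup>2 = r\<^sup>2"
        by (simp add: power_mult_distrib algebra_simps)
      finally show ?thesis .
    qed
    define I where "I = {z \<in> ref_grid d M. dcube d M z \<subseteq> B r}"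
    have I: "I \<subseteq> ref_grid d M" "finite I" by (auto simp: I_def)
    \<comment> \<open>The reciprocal of the number of grid cubes, which is also the factor by which
      costs scale.\<close>
    define s where "s = (1 / 2 ^ Suc M :: real) ^ d"
    have s: "s > 0" by (simp add: s_def)
    have card_s: "real (card (ref_grid d M)) * s = 1"
      unfolding card_ref_grid s_def by (simp add: power_one_over)
    have "?h (ennreal R) (ref_cube d) \<le> ?h (ennreal R) (B r \<union> (\<Union>z\<in>ref_grid d M - I. dcube d M z))"
    proof (rule hausdorff_pre_measure_mono[OF d])
      show "ref_cube d \<subseteq> B r \<union> (\<Union>z\<in>ref_grid d M - I. dcube d M z)"
        using ref_cube_subset_UN[of d M] unfolding I_def by blast
    qed
    also have "\<dots> \<le> ?h (ennreal R) (B r) + ?h (ennreal R) (\<Union>z\<in>ref_grid d M - I. dcube d M z)"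
      by (rule hausdorff_pre_measure_Un_le[OF d])
    also have "\<dots> \<le> hcost (mat_dist G) d (B r) + (\<Sum>z\<in>ref_grid d M - I. ?h (ennreal R) (dcube d M z))"
      using ediam_mono[OF B_sub] R(2)
      by (intro add_mono hausdorff_pre_measure_single[OF d] hausdorff_pre_measure_sum_le[OF d]) (auto intro: order_trans)
    also have "\<dots> \<le> ennreal (unit_ball_vol d * r ^ d) + (\<Sum>z\<in>ref_grid d M - I. ennreal s * ennreal c)"
    proof (intro add_mono hB sum_mono)
      fix z
      have "?h (ennreal R) (dcube d M z) \<le> ?h (ennreal (1 / 2 ^ Suc M) * ennreal R) (dcube d M z)"
      proof (rule hausdorff_pre_measure_antimono[OF d])
        have "(1 / 2 :: real) ^ Suc M \<le> 1" by (intro power_le_one) auto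
        then have "1 / 2 ^ Suc M * R \<le> 1 * R"
          using R(1) by (intro mult_right_mono) (simp_all only: power_one_over less_imp_le)
        then show "ennreal (1 / 2 ^ Suc M) * ennreal R \<le> ennreal R"
          by (subst ennreal_mult'[symmetric]) (auto intro: ennreal_leI)
      qed
      also have "\<dots> \<le> ennreal s * ?h (ennreal R) (ref_cube d)"
        unfolding s_def by (rule hausdorff_pre_measure_dcube[OF G d])
      also have "\<dots> \<le> ennreal s * ennreal c"
        unfolding c(1)[symmetric] Vol_def using R(1)
        by (intro mult_left_mono hausdorff_pre_measure_le_hausdorff_measure) auto
      finally show "?h (ennreal R) (dcube d M z) \<le> ennreal s * ennreal c" .
    qed
    also have "\<dots> = ennreal (unit_ball_vol d * r ^ d + real (card (ref_grid d M - I)) * (s * c))"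
      using c s r by (simp add: ennreal_mult ennreal_of_nat_eq_real_of_nat ennreal_plus)
    finally have "ennreal c \<le> \<dots>"
      using Vol_ref_cube_le_pre_measure[OF G d R(1)] c(1) by (metis order_trans)
    then have "c \<le> unit_ball_vol d * r ^ d + real (card (ref_grid d M - I)) * (s * c)"
      using c s r by (subst (asm) ennreal_le_iff) auto
    also have "real (card (ref_grid d M - I)) = real (card (ref_grid d M)) - real (card I)"
      using I by (simp add: card_Diff_subset card_mono of_nat_diff)
    finally have cI: "c * (real (card I) * s) \<le> unit_ball_vol d * r ^ d"
      using card_s by (simp add: algebra_simps)
    have "B (t * r) \<subseteq> (\<Union>z\<in>I. dcube d M z)"
    proof
      fix x assume x: "x \<in> B (t * r)"
      have sp: "x \<in> {..<d} \<rightarrow>\<^sub>E UNIV" using x by (simp add: B_def space_PiM)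
      have "(t * r)\<^sup>2 \<le> r\<^sup>2" using t r by (intro power_mono) auto
      then have "x \<in> B r" using x by (auto simp: B_def)
      then have "grid_index d M x \<in> ref_grid d M" using B_sub grid_index_ref_cube by blast
      moreover have "dcube d M (grid_index d M x) \<subseteq> B r"
        using near[OF x mem_dcube_grid_index[OF sp]] by (auto simp: B_def space_PiM dcube_def)
      ultimately show "x \<in> (\<Union>z\<in>I. dcube d M z)"
        using mem_dcube_grid_index[OF sp, of M] by (auto simp: I_def)
    qed
    then have "emeasure (lebesgue_fun d) (B (t * r)) \<le> emeasure (lebesgue_fun d) (\<Union>z\<in>I. dcube d M z)"
      using I by (intro emeasure_mono) auto
    also have "\<dots> \<le> (\<Sum>z\<in>I. emeasure (lebesgue_fun d) (dcube d M z))"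
      using I by (intro emeasure_subadditive_finite) auto
    also have "\<dots> = ennreal (real (card I) * (2 ^ d * s))"
    proof -
      have "2 ^ d * s = (1 / 2 ^ M) ^ d" by (simp add: s_def power_mult_distrib[symmetric])
      then show ?thesis by (simp only: emeasure_dcube sum_constant ennreal_of_nat_eq_real_of_nat) (simp add: ennreal_mult)
    qed
    also have "emeasure (lebesgue_fun d) (B (t * r)) = ennreal (unit_ball_vol d * (t * r) ^ d / sqrt (Determinant.det G))"
      unfolding B_def using t r by (intro emeasure_ellipsoid[OF G d]) auto
    finally have "unit_ball_vol d * (t * r) ^ d / sqrt (Determinant.det G) \<le> real (card I) * (2 ^ d * s)"
      using s by (subst (asm) ennreal_le_iff) auto
    then have "c * (unit_ball_vol d * (t * r) ^ d / sqrt (Determinant.det G)) \<le> c * (real (card I) * (2 ^ d * s))"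
      using c by (intro mult_left_mono) auto
    also have "\<dots> = 2 ^ d * (c * (real (card I) * s))" by simp
    also have "\<dots> \<le> 2 ^ d * (unit_ball_vol d * r ^ d)" using cI by (intro mult_left_mono) auto
    finally have "(unit_ball_vol d * r ^ d) * (c * t ^ d / sqrt (Determinant.det G)) \<le> (unit_ball_vol d * r ^ d) * 2 ^ d"
      by (simp add: power_mult_distrib mult_ac)
    then have "c * t ^ d / sqrt (Determinant.det G) \<le> 2 ^ d"
      using r unit_ball_vol_pos[of "real d"] by (subst (asm) mult_le_cancel_left_pos) auto
    then show ?thesis using det_pos_def_mat[OF G] by (simp add: field_simps)
  qed
  have "((\<lambda>t. c * t ^ d) \<longlongrightarrow> c * 1 ^ d) (at_left (1::real))"
    by (intro tendsto_intros)
  moreover have "eventually (\<lambda>t. c * t ^ d \<le> 2 ^ d * sqrt (Determinant.det G)) (at_left (1::real))"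
    using eventually_at_left_real[of 0 "1::real"] main by (auto elim!: eventually_mono)
  ultimately have "c * 1 ^ d \<le> 2 ^ d * sqrt (Determinant.det G)"
    by (rule tendsto_upperbound) simp
  then show ?thesis using c by (simp add: ennreal_leI)
qed

lemma Vol_dcube_le:
  assumes G: "pos_def_mat d G" and d: "d > 0"
  shows "Vol G d (dcube d k z) \<le> ennreal (sqrt (Determinant.det G)) * emeasure (lebesgue_fun d) (dcube d k z)"
proof -
  have "Vol G d (dcube d k z) \<le> ennreal ((1 / 2 ^ Suc k) ^ d) * Vol G d (ref_cube d)"
    unfolding Vol_def
  proof (rule hausdorff_measure_le)
    fix \<delta> :: ennreal assume \<delta>: "\<delta> > 0"
    let ?\<delta> = "\<delta> / ennreal (1 / 2 ^ Suc k)"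
    have "ennreal (1 / 2 ^ Suc k) * ?\<delta> = \<delta>" by (intro ennreal_mult_divide_cancel) simp
    moreover have "?\<delta> > 0" using \<delta> by (simp add: ennreal_zero_less_divide)
    then have "hausdorff_pre_measure (mat_dist G) d ?\<delta> (ref_cube d) \<le> hausdorff_measure (mat_dist G) d (ref_cube d)"
      by (rule hausdorff_pre_measure_le_hausdorff_measure)
    then have "ennreal ((1 / 2 ^ Suc k) ^ d) * hausdorff_pre_measure (mat_dist G) d ?\<delta> (ref_cube d) \<le>
        ennreal ((1 / 2 ^ Suc k) ^ d) * hausdorff_measure (mat_dist G) d (ref_cube d)"
      by (intro mult_left_mono) auto
    ultimately show "hausdorff_pre_measure (mat_dist G) d \<delta> (dcube d k z) \<le>
        ennreal ((1 / 2 ^ Suc k) ^ d) * hausdorff_measure (mat_dist G) d (ref_cube d)"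
      using hausdorff_pre_measure_dcube[OF G d, of k ?\<delta> z] by (simp only:)
  qed
  also have "\<dots> \<le> ennreal ((1 / 2 ^ Suc k) ^ d) * ennreal (2 ^ d * sqrt (Determinant.det G))"
    by (intro mult_left_mono Vol_ref_cube_le[OF G d]) auto
  also have "\<dots> = ennreal (sqrt (Determinant.det G) * (1 / 2 ^ k) ^ d)"
    using det_pos_def_mat[OF G]
    by (subst ennreal_mult[symmetric]) (auto simp: power_mult_distrib power_one_over field_simps)
  finally show ?thesis
    using det_pos_def_mat[OF G] by (simp add: emeasure_dcube ennreal_mult)
qed


section \<open>Continuously differentiable functions of finitely many coordinates\<close>

text \<open>Parameters are extensional functions as in \<open>PiM\<close>, so that the topology
  inherited from \<open>nat \<Rightarrow> real\<close> and Lebesgue measure share one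
  carrier.\<close>

abbreviation ext_space :: "nat \<Rightarrow> (nat \<Rightarrow> real) set" where
  "ext_space d \<equiv> {..<d} \<rightarrow>\<^sub>E UNIV"

abbreviation ext_open :: "nat \<Rightarrow> (nat \<Rightarrow> real) set \<Rightarrow> bool" where
  "ext_open d \<Omega> \<equiv> openin (top_of_set (ext_space d)) \<Omega>"

definition near_box :: "nat \<Rightarrow> real \<Rightarrow> (nat \<Rightarrow> real) \<Rightarrow> (nat \<Rightarrow> real) set" where
  "near_box d r x = {y \<in> ext_space d. \<forall>j<d. \<bar>y j - x j\<bar> < r}"

lemma near_box_mono: "r \<le> s \<Longrightarrow> near_box d r x \<subseteq> near_box d s x"
  by (fastforce simp: near_box_def)

lemma ext_open_near_box:
  assumes \<Omega>: "ext_open d \<Omega>" and x: "x \<in> \<Omega>"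
  shows "\<exists>r>0. near_box d r x \<subseteq> \<Omega>"
proof -
  obtain O' where O': "open O'" "\<Omega> = ext_space d \<inter> O'" using \<Omega> by (auto simp: openin_open)
  have "openin (product_topology (\<lambda>_::nat. euclidean :: real topology) UNIV) O'"
    using O'(1) by (simp add: open_fun_def)
  from product_topology_open_contains_basis[OF this, of x]
  obtain X where X: "x \<in> (\<Pi>\<^sub>E i\<in>UNIV. X i)" "\<And>i. open (X i)" "(\<Pi>\<^sub>E i\<in>UNIV. X i) \<subseteq> O'"
    using x O' by auto
  have "\<exists>e>0. \<forall>s. \<bar>s - x i\<bar> < e \<longrightarrow> s \<in> X i" for i
    using X(1,2) open_dist[of "X i"] by (auto simp: dist_real_def PiE_def Pi_def)
  then obtain e where e: "\<And>i. e i > 0" "\<And>i s. \<bar>s - x i\<bar> < e i \<Longrightarrow> s \<in> X i" by metis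
  define r where "r = Min (insert 1 (e ` {..<d}))"
  have r: "r > 0" "\<And>i. i < d \<Longrightarrow> r \<le> e i" using e(1) by (auto simp: r_def)
  have "y \<in> \<Omega>" if y: "y \<in> near_box d r x" for y
  proof -
    have "y i \<in> X i" for i
    proof (cases "i < d")
      case True
      then have "\<bar>y i - x i\<bar> < e i" using y r(2)[OF True] by (force simp: near_box_def)
      then show ?thesis by (rule e(2))
    next
      case False
      then have "y i = x i" using y x O' by (auto simp: near_box_def PiE_def extensional_def)
      then show ?thesis using X(1) by (auto simp: PiE_def Pi_def)
    qed
    then show ?thesis using X(3) y O' by (auto simp: near_box_def)
  qed
  then show ?thesis using r(1) by blast
qed

lemma continuous_on_near_box:
  fixes g :: "(nat \<Rightarrow> real) \<Rightarrow> real"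
  assumes \<Omega>: "ext_open d \<Omega>" and x: "x \<in> \<Omega>" and g: "continuous_on \<Omega> g" and e: "e > 0"
  shows "\<exists>r>0. near_box d r x \<subseteq> {y \<in> \<Omega>. \<bar>g y - g x\<bar> < e}"
proof (rule ext_open_near_box)
  have "openin (top_of_set \<Omega>) (\<Omega> \<inter> g -` ball (g x) e)"
    by (intro continuous_openin_preimage_gen g) simp
  then have "ext_open d (\<Omega> \<inter> g -` ball (g x) e)" using \<Omega> by (rule openin_trans)
  moreover have "\<Omega> \<inter> g -` ball (g x) e = {y \<in> \<Omega>. \<bar>g y - g x\<bar> < e}"
    by (auto simp: dist_real_def abs_minus_commute)
  ultimately show "ext_open d {y \<in> \<Omega>. \<bar>g y - g x\<bar> < e}" by simp
qed (use x e in simp)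

lemma common_radius:
  fixes P :: "nat \<Rightarrow> real \<Rightarrow> bool"
  assumes "\<And>i. i < n \<Longrightarrow> \<exists>r>0. P i r" "\<And>i r s. i < n \<Longrightarrow> P i r \<Longrightarrow> s \<le> r \<Longrightarrow> P i s"
  shows "\<exists>r>0. \<forall>i<n. P i r"
proof -
  obtain e where e: "\<And>i. i < n \<Longrightarrow> e i > 0 \<and> P i (e i)" using assms(1) by metis
  define r where "r = Min (insert 1 (e ` {..<n}))"
  have "r > 0" "\<And>i. i < n \<Longrightarrow> r \<le> e i" using e by (auto simp: r_def)
  then show ?thesis using e assms(2) by blast
qed

text \<open>The product topology of \<open>nat \<Rightarrow> real\<close> comes from no norm, so
  differentiability is imposed one coordinate at a time, in the form in which
  \<open>partial_deriv\<close> computes it. Total differentiability is recovered in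
  \<open>C1_with_strict\<close>.\<close>

definition C1_with :: "nat \<Rightarrow> (nat \<Rightarrow> real) set \<Rightarrow> ((nat \<Rightarrow> real) \<Rightarrow> real) \<Rightarrow> (nat \<Rightarrow> (nat \<Rightarrow> real) \<Rightarrow> real) \<Rightarrow> bool" where
  "C1_with d \<Omega> f f' \<longleftrightarrow> (\<forall>j<d. continuous_on \<Omega> (f' j) \<and>
     (\<forall>x\<in>\<Omega>. ((\<lambda>s. f (x(j := s))) has_real_derivative f' j x) (at (x j))))"

definition C1 :: "nat \<Rightarrow> (nat \<Rightarrow> real) set \<Rightarrow> ((nat \<Rightarrow> real) \<Rightarrow> real) \<Rightarrow> bool" where
  "C1 d \<Omega> f \<longleftrightarrow> (\<exists>f'. C1_with d \<Omega> f f')"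

text \<open>Moving from \<open>y\<close> to \<open>x\<close> one coordinate at a time stays inside
  the box, and the mean value theorem on each step bounds the error by the oscillation of the
  partial derivatives. Both points vary, which is what estimates of distances between image points
  require.\<close>

lemma C1_with_strict:
  assumes \<Omega>: "ext_open d \<Omega>" and f: "C1_with d \<Omega> f f'" and x0: "x0 \<in> \<Omega>" and e: "e > 0"
  shows "\<exists>r>0. near_box d r x0 \<subseteq> \<Omega> \<and> (\<forall>x\<in>near_box d r x0. \<forall>y\<in>near_box d r x0.
    \<bar>f x - f y - (\<Sum>j<d. f' j x0 * (x j - y j))\<bar> \<le> e * (\<Sum>j<d. \<bar>x j - y j\<bar>))"
proof -
  have "\<exists>r>0. \<forall>j<d. near_box d r x0 \<subseteq> {z \<in> \<Omega>. \<bar>f' j z - f' j x0\<bar> < e}"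
  proof (rule common_radius)
    fix j assume "j < d"
    then show "\<exists>r>0. near_box d r x0 \<subseteq> {z \<in> \<Omega>. \<bar>f' j z - f' j x0\<bar> < e}"
      using f e by (intro continuous_on_near_box[OF \<Omega> x0]) (auto simp: C1_with_def)
  qed (use near_box_mono in blast)
  then obtain r1 where r1: "r1 > 0" "\<And>j. j < d \<Longrightarrow> near_box d r1 x0 \<subseteq> {z \<in> \<Omega>. \<bar>f' j z - f' j x0\<bar> < e}" by blast
  obtain r2 where r2: "r2 > 0" "near_box d r2 x0 \<subseteq> \<Omega>" using ext_open_near_box[OF \<Omega> x0] by blast
  define r where "r = min r1 r2"
  have r: "r > 0" "near_box d r x0 \<subseteq> \<Omega>" "\<And>j z. j < d \<Longrightarrow> z \<in> near_box d r x0 \<Longrightarrow> \<bar>f' j z - f' j x0\<bar> < e"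
  proof -
    show "r > 0" using r1 r2 by (simp add: r_def)
    show "near_box d r x0 \<subseteq> \<Omega>" using r2(2) near_box_mono[of r r2 d x0] by (auto simp: r_def)
    show "\<bar>f' j z - f' j x0\<bar> < e" if "j < d" "z \<in> near_box d r x0" for j z
      using r1(2)[OF that(1)] near_box_mono[of r r1 d x0] that(2) by (auto simp: r_def)
  qed
  have "\<bar>f x - f y - (\<Sum>j<d. f' j x0 * (x j - y j))\<bar> \<le> e * (\<Sum>j<d. \<bar>x j - y j\<bar>)"
    if x: "x \<in> near_box d r x0" and y: "y \<in> near_box d r x0" for x y
  proof -
    define z where "z = (\<lambda>k j. if j < k then x j else y j)"
    have z: "z k \<in> near_box d r x0" if "k \<le> d" for k
      using x y that by (auto simp: near_box_def z_def PiE_def extensional_def)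
    have z0: "z 0 = y" by (simp add: z_def)
    have zd: "z d = x"
      using x y by (auto simp: z_def fun_eq_iff near_box_def PiE_def extensional_def)
    have step: "\<bar>f (z (Suc k)) - f (z k) - f' k x0 * (x k - y k)\<bar> \<le> e * \<bar>x k - y k\<bar>" if k: "k < d" for k
    proof -
      let ?\<phi> = "\<lambda>s. f ((z k)(k := s)) - f' k x0 * s"
      let ?B = "ball (x0 k) r"
      have inb: "(z k)(k := s) \<in> near_box d r x0" if "s \<in> ?B" for s
        using z[of k] k that by (auto simp: near_box_def dist_real_def abs_minus_commute PiE_def extensional_def)
      have "norm (?\<phi> (x k) - ?\<phi> (y k)) \<le> e * norm (x k - y k)"
      proof (rule field_differentiable_bound[where S="?B"])
        fix s assume s: "s \<in> ?B"
        note b = inb[OF s]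
        have "\<forall>x\<in>\<Omega>. ((\<lambda>t. f (x(k := t))) has_real_derivative f' k x) (at (x k))"
          using f k by (simp add: C1_with_def)
        from bspec[OF this, of "(z k)(k := s)"] b r(2)
        have "((\<lambda>t. f ((z k)(k := t))) has_real_derivative f' k ((z k)(k := s))) (at s)" by auto
        then have "(?\<phi> has_real_derivative f' k ((z k)(k := s)) - f' k x0) (at s)"
          by (auto intro!: derivative_eq_intros)
        then show "(?\<phi> has_real_derivative f' k ((z k)(k := s)) - f' k x0) (at s within ?B)"
          by (rule has_field_derivative_at_within)
        show "norm (f' k ((z k)(k := s)) - f' k x0) \<le> e"
          using r(3)[OF k b] by simp
      qed (use x y k in \<open>auto simp: near_box_def dist_real_def abs_minus_commute\<close>)
      moreover have "(z k)(k := x k) = z (Suc k)" "(z k)(k := y k) = z k"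
        by (auto simp: z_def fun_eq_iff less_Suc_eq)
      ultimately show ?thesis by (simp add: algebra_simps)
    qed
    have "f x - f y = (\<Sum>k<d. f (z (Suc k)) - f (z k))"
      using sum_lessThan_telescope[of "\<lambda>k. f (z k)" d] z0 zd by simp
    then have "f x - f y - (\<Sum>j<d. f' j x0 * (x j - y j)) = (\<Sum>k<d. f (z (Suc k)) - f (z k) - f' k x0 * (x k - y k))"
      by (simp add: sum_subtractf)
    also have "\<bar>\<dots>\<bar> \<le> (\<Sum>k<d. \<bar>f (z (Suc k)) - f (z k) - f' k x0 * (x k - y k)\<bar>)" by (rule sum_abs)
    also have "\<dots> \<le> (\<Sum>k<d. e * \<bar>x k - y k\<bar>)" by (intro sum_mono step) auto
    finally show ?thesis by (simp add: sum_distrib_left)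
  qed
  then show ?thesis using r by blast
qed

lemma open_coords_near:
  fixes d :: nat
  shows "open {y. \<forall>j<d. \<bar>y j - x j\<bar> < (r::real)}"
proof -
  have "{y. \<forall>j<d. \<bar>y j - x j\<bar> < r} = (\<Inter>j\<in>{..<d}. {y. \<bar>y j - x j\<bar> < r})" by auto
  also have "open \<dots>"
    by (intro open_INT ballI open_Collect_less continuous_intros continuous_on_product_coordinates) auto
  finally show ?thesis .
qed

lemma C1_with_continuous:
  assumes \<Omega>: "ext_open d \<Omega>" and f: "C1_with d \<Omega> f f'"
  shows "continuous_on \<Omega> f"
  unfolding continuous_on_def
proof
  fix x0 assume x0: "x0 \<in> \<Omega>"
  obtain r where r: "r > 0" "near_box d r x0 \<subseteq> \<Omega>" "\<And>x y. x \<in> near_box d r x0 \<Longrightarrow> y \<in> near_box d r x0 \<Longrightarrow>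
    \<bar>f x - f y - (\<Sum>j<d. f' j x0 * (x j - y j))\<bar> \<le> 1 * (\<Sum>j<d. \<bar>x j - y j\<bar>)"
    using C1_with_strict[OF \<Omega> f x0, of 1] by auto
  have sub: "\<Omega> \<subseteq> ext_space d" using \<Omega> by (auto dest: openin_imp_subset)
  let ?g = "\<lambda>x. (\<Sum>j<d. f' j x0 * (x j - x0 j))"
  have "((\<lambda>x. f x - f x0 - ?g x) \<longlongrightarrow> 0) (at x0 within \<Omega>)"
  proof (rule Lim_null_comparison)
    have "eventually (\<lambda>x. x \<in> {y. \<forall>j<d. \<bar>y j - x0 j\<bar> < r}) (at x0 within \<Omega>)"
      by (rule topological_tendstoD[OF tendsto_ident_at open_coords_near]) (use r in simp)
    moreover have "eventually (\<lambda>x. x \<in> \<Omega>) (at x0 within \<Omega>)" by (simp add: eventually_at_filter)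
    ultimately show "eventually (\<lambda>x. norm (f x - f x0 - ?g x) \<le> (\<Sum>j<d. \<bar>x j - x0 j\<bar>)) (at x0 within \<Omega>)"
    proof eventually_elim
      case (elim x)
      then show ?case using r(1) r(3)[of x x0] sub x0 by (auto simp: near_box_def)
    qed
    have "((\<lambda>x. \<Sum>j<d. \<bar>x j - x0 j\<bar>) \<longlongrightarrow> (\<Sum>j<d. \<bar>x0 j - x0 j\<bar>)) (at x0 within \<Omega>)"
      by (intro tendsto_intros continuous_on_product_coordinates[unfolded continuous_on_def, rule_format]
         tendsto_within_subset[OF continuous_on_product_coordinates[unfolded continuous_on_def, rule_format]]) auto
    then show "((\<lambda>x. \<Sum>j<d. \<bar>x j - x0 j\<bar>) \<longlongrightarrow> 0) (at x0 within \<Omega>)" by simp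
  qed
  moreover have "(?g \<longlongrightarrow> (\<Sum>j<d. f' j x0 * (x0 j - x0 j))) (at x0 within \<Omega>)"
    by (intro tendsto_intros tendsto_within_subset[OF continuous_on_product_coordinates[unfolded continuous_on_def, rule_format]]) auto
  ultimately have "((\<lambda>x. (f x - f x0 - ?g x) + ?g x + f x0) \<longlongrightarrow> 0 + (\<Sum>j<d. f' j x0 * (x0 j - x0 j)) + f x0) (at x0 within \<Omega>)"
    by (intro tendsto_add tendsto_const)
  then show "(f \<longlongrightarrow> f x0) (at x0 within \<Omega>)" by simp
qed

lemma C1_continuous: "ext_open d \<Omega> \<Longrightarrow> C1 d \<Omega> f \<Longrightarrow> continuous_on \<Omega> f"
  using C1_with_continuous by (auto simp: C1_def)

lemma C1_with_partial_deriv: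
  "C1_with d \<Omega> f f' \<Longrightarrow> j < d \<Longrightarrow> x \<in> \<Omega> \<Longrightarrow> partial_deriv f j x = f' j x"
  unfolding partial_deriv_def C1_with_def by (blast intro: DERIV_imp_deriv)

lemma C1_imp_with_partial_deriv:
  assumes "C1 d \<Omega> f"
  shows "C1_with d \<Omega> f (partial_deriv f)"
proof -
  obtain f' where f': "C1_with d \<Omega> f f'" using assms by (auto simp: C1_def)
  have "continuous_on \<Omega> (partial_deriv f j) \<longleftrightarrow> continuous_on \<Omega> (f' j)" if "j < d" for j
    by (rule continuous_on_cong) (auto simp: C1_with_partial_deriv[OF f' that])
  then show ?thesis
    using f' C1_with_partial_deriv[OF f'] by (simp add: C1_with_def)
qed

section \<open>Closure properties of continuously differentiable functions\<close>

lemma C1_const: "C1 d \<Omega> (\<lambda>_. c)"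
  unfolding C1_def C1_with_def by (intro exI[of _ "\<lambda>_ _. 0"]) (auto intro!: derivative_eq_intros)

lemma C1_coord: "C1 d \<Omega> (\<lambda>x. x i)"
  unfolding C1_def C1_with_def
proof (intro exI[of _ "\<lambda>j _. if i = j then 1 else 0"] allI impI conjI ballI)
  fix j x assume "j < d" "x \<in> \<Omega>"
  show "((\<lambda>s. (x(j := s)) i) has_real_derivative (if i = j then 1 else 0)) (at (x j))"
    by (cases "i = j") auto
qed auto

lemma C1_add:
  assumes "C1 d \<Omega> f" "C1 d \<Omega> g"
  shows "C1 d \<Omega> (\<lambda>x. f x + g x)"
proof -
  obtain f' g' where "C1_with d \<Omega> f f'" "C1_with d \<Omega> g g'" using assms by (auto simp: C1_def)
  then have "C1_with d \<Omega> (\<lambda>x. f x + g x) (\<lambda>j x. f' j x + g' j x)"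
    by (auto simp: C1_with_def intro!: continuous_intros derivative_intros)
  then show ?thesis by (auto simp: C1_def)
qed

lemma C1_mult:
  assumes \<Omega>: "ext_open d \<Omega>" and "C1 d \<Omega> f" "C1 d \<Omega> g"
  shows "C1 d \<Omega> (\<lambda>x. f x * g x)"
proof -
  obtain f' g' where fg: "C1_with d \<Omega> f f'" "C1_with d \<Omega> g g'" using assms by (auto simp: C1_def)
  have c: "continuous_on \<Omega> f" "continuous_on \<Omega> g" using C1_continuous assms by auto
  have "C1_with d \<Omega> (\<lambda>x. f x * g x) (\<lambda>j x. f' j x * g x + g' j x * f x)"
    unfolding C1_with_def
  proof (intro allI impI conjI ballI)
    fix j assume j: "j < d"
    then show "continuous_on \<Omega> (\<lambda>x. f' j x * g x + g' j x * f x)"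
      using fg c by (auto simp: C1_with_def intro!: continuous_intros)
    fix x assume "x \<in> \<Omega>"
    then have "((\<lambda>s. f (x(j := s))) has_real_derivative f' j x) (at (x j))"
        "((\<lambda>s. g (x(j := s))) has_real_derivative g' j x) (at (x j))"
      using fg j by (auto simp: C1_with_def)
    from DERIV_mult[OF this] show "((\<lambda>s. f (x(j := s)) * g (x(j := s))) has_real_derivative f' j x * g x + g' j x * f x) (at (x j))"
      by simp
  qed
  then show ?thesis by (auto simp: C1_def)
qed

lemma C1_sum:
  assumes "finite I" "\<And>i. i \<in> I \<Longrightarrow> C1 d \<Omega> (f i)"
  shows "C1 d \<Omega> (\<lambda>x. \<Sum>i\<in>I. f i x)"
  using assms by (induction rule: finite_induct) (auto intro: C1_const C1_add)

lemma C1_power: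
  assumes "ext_open d \<Omega>" "C1 d \<Omega> f"
  shows "C1 d \<Omega> (\<lambda>x. f x ^ n)"
  using assms by (induction n) (auto intro: C1_const C1_mult)

lemma C1_compose:
  assumes \<Omega>: "ext_open d \<Omega>" and f: "C1 d \<Omega> f"
    and g: "\<And>x. x \<in> \<Omega> \<Longrightarrow> (g has_real_derivative g' (f x)) (at (f x))" and g': "continuous_on (f ` \<Omega>) g'"
  shows "C1 d \<Omega> (\<lambda>x. g (f x))"
proof -
  obtain f' where f': "C1_with d \<Omega> f f'" using f by (auto simp: C1_def)
  have c: "continuous_on \<Omega> f" using C1_continuous assms by auto
  have "C1_with d \<Omega> (\<lambda>x. g (f x)) (\<lambda>j x. g' (f x) * f' j x)"
    unfolding C1_with_def
  proof (intro allI impI conjI ballI)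
    fix j assume j: "j < d"
    then show "continuous_on \<Omega> (\<lambda>x. g' (f x) * f' j x)"
      using f' c by (auto simp: C1_with_def intro!: continuous_intros continuous_on_compose2[OF g'])
    fix x assume x: "x \<in> \<Omega>"
    then have "((\<lambda>s. f (x(j := s))) has_real_derivative f' j x) (at (x j))"
      using f' j by (auto simp: C1_with_def)
    then show "((\<lambda>s. g (f (x(j := s)))) has_real_derivative g' (f x) * f' j x) (at (x j))"
      using g[OF x] by (intro DERIV_chain2[where g="\<lambda>s. f (x(j := s))"]) auto
  qed
  then show ?thesis by (auto simp: C1_def)
qed

lemma continuous_on_det:
  fixes M :: "'a::topological_space \<Rightarrow> real mat"
  assumes M: "\<And>x. x \<in> S \<Longrightarrow> M x \<in> carrier_mat n n"
    and c: "\<And>i j. i < n \<Longrightarrow> j < n \<Longrightarrow> continuous_on S (\<lambda>x. M x $$ (i, j))"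
  shows "continuous_on S (\<lambda>x. Determinant.det (M x))"
proof -
  have "continuous_on S (\<lambda>x. \<Sum>p\<in>{p. p permutes {0..<n}}. signof p * (\<Prod>i = 0..<n. M x $$ (i, p i)))"
    by (intro continuous_on_sum continuous_on_mult continuous_on_const continuous_on_prod c)
      (auto simp: permutes_in_image)
  moreover have "(\<Sum>p\<in>{p. p permutes {0..<n}}. signof p * (\<Prod>i = 0..<n. M x $$ (i, p i))) = Determinant.det (M x)"
    if "x \<in> S" for x
    using det_def'[OF M[OF that]] by simp
  ultimately show ?thesis by (simp cong: continuous_on_cong)
qed

section \<open>Borel sets of the parameter spaces\<close>

lemma ext_space_closed: "closed (ext_space d)"
proof -
  have "ext_space d = (\<Inter>i\<in>{d..}. {x. x i = undefined})"
    by (auto simp: PiE_def extensional_def not_less)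
  then show ?thesis by (auto intro!: closed_INT closed_Collect_eq continuous_intros)
qed

text \<open>Links the Borel sets of the function topology with the product sigma-algebra:
  coordinates from \<open>d\<close> on are constantly \<open>undefined\<close>, hence measurable as
  well.\<close>

lemma measurable_id_lebesgue_fun: "(\<lambda>x. x) \<in> borel_measurable (lebesgue_fun d)"
proof (rule measurable_coordinatewise_then_product)
  fix i
  show "(\<lambda>x. x i) \<in> borel_measurable (lebesgue_fun d)"
  proof (cases "i < d")
    case False
    then have "x i = undefined" if "x \<in> space (lebesgue_fun d)" for x
      using that by (auto simp: space_PiM PiE_def extensional_def)
    then show ?thesis by (subst measurable_cong[where g="\<lambda>_. undefined"]) auto
  qed measurable
qed

lemma borel_Int_ext_space:
  assumes "B \<in> sets borel"
  shows "B \<inter> ext_space d \<in> sets (lebesgue_fun d)"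
  using measurable_sets[OF measurable_id_lebesgue_fun assms, of d] by (simp add: space_PiM)

lemma ext_open_borel: "ext_open d \<Omega> \<Longrightarrow> \<Omega> \<in> sets borel"
  using ext_space_closed by (auto simp: openin_open)

lemma ext_open_sets: "ext_open d \<Omega> \<Longrightarrow> \<Omega> \<in> sets (lebesgue_fun d)"
  using borel_Int_ext_space by (auto simp: openin_open Int_commute)

lemma borel_measurable_indicator_continuous_on:
  fixes g :: "(nat \<Rightarrow> real) \<Rightarrow> real"
  assumes "ext_open d \<Omega>" "continuous_on \<Omega> g"
  shows "(\<lambda>x. ennreal (g x) * indicator \<Omega> x) \<in> borel_measurable (lebesgue_fun d)"
proof -
  have "(\<lambda>x. indicator \<Omega> x *\<^sub>R g x) \<in> borel_measurable borel"
    using assms by (intro borel_measurable_continuous_on_indicator ext_open_borel)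
  from measurable_compose[OF measurable_id_lebesgue_fun this]
  have "(\<lambda>x. ennreal (indicator \<Omega> x *\<^sub>R g x)) \<in> borel_measurable (lebesgue_fun d)" by measurable
  moreover have "ennreal (indicator \<Omega> x *\<^sub>R g x) = ennreal (g x) * indicator \<Omega> x" for x
    by (auto simp: indicator_def)
  ultimately show ?thesis by simp
qed


section \<open>The area formula\<close>

text \<open>The coarser floor is the finer one divided by a power of two, so cubes of different
  levels are nested or disjoint.\<close>

lemma dcube_nested:
  assumes "k \<le> k'" "y \<in> dcube d k' (grid_index d k' x)"
  shows "y \<in> dcube d k (grid_index d k x)"
proof -
  have "\<lfloor>2 ^ k * y i\<rfloor> = \<lfloor>2 ^ k * x i\<rfloor>" if i: "i < d" for i
  proof -
    have *: "\<lfloor>2 ^ k * t\<rfloor> = \<lfloor>2 ^ k' * t\<rfloor> div 2 ^ (k' - k)" for t :: real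
    proof -
      obtain m where "k' = k + m" using assms(1) by (auto simp: le_iff_add)
      then have "2 ^ k * t = 2 ^ k' * t / real_of_int (2 ^ (k' - k))"
        by (simp add: power_add)
      then show ?thesis using floor_divide_real_eq_div[of "2 ^ (k' - k)" "2 ^ k' * t"] by simp
    qed
    have "\<lfloor>2 ^ k' * y i\<rfloor> = \<lfloor>2 ^ k' * x i\<rfloor>" using assms(2) i by (simp add: dcube_def grid_index_def)
    then show ?thesis by (simp add: *)
  qed
  then show ?thesis using assms(2) by (simp add: dcube_def grid_index_def)
qed

lemma grid_index_eq:
  assumes "y \<in> dcube d k z" "z \<in> {..<d} \<rightarrow>\<^sub>E UNIV"
  shows "grid_index d k y = z"
  using assms by (auto simp: dcube_def grid_index_def fun_eq_iff PiE_def extensional_def)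

lemma grid_index_PiE: "grid_index d k x \<in> {..<d} \<rightarrow>\<^sub>E UNIV"
  by (simp add: grid_index_def)

text \<open>Stopping-time decomposition: take for each point the first good dyadic cube containing it.\<close>

lemma dyadic_stopping_cubes:
  assumes \<Omega>: "\<Omega> \<subseteq> ext_space d"
    and ex: "\<And>x. x \<in> \<Omega> \<Longrightarrow> \<exists>k. P k (grid_index d k x)"
    and sub: "\<And>k z. P k z \<Longrightarrow> dcube d k z \<subseteq> \<Omega>"
  shows "\<exists>X :: nat \<Rightarrow> (nat \<Rightarrow> real) set. disjoint_family X \<and> (\<Union>n. X n) = \<Omega> \<and>
    (\<forall>n. X n = {} \<or> (\<exists>k z. X n = dcube d k z \<and> P k z))"
proof -
  define \<kappa> where "\<kappa> = (\<lambda>x. LEAST k. P k (grid_index d k x))"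
  define s where "s = (\<lambda>x. (\<kappa> x, grid_index d (\<kappa> x) x))"
  define S where "S = s ` \<Omega>"
  define Q where "Q = (\<lambda>p :: nat \<times> (nat \<Rightarrow> int). dcube d (fst p) (snd p))"
  have P\<kappa>: "P (\<kappa> x) (grid_index d (\<kappa> x) x)" if "x \<in> \<Omega>" for x
    unfolding \<kappa>_def using ex[OF that] by (rule LeastI_ex)
  have "S \<subseteq> UNIV \<times> ({..<d} \<rightarrow>\<^sub>E UNIV)"
    using grid_index_PiE by (auto simp: S_def s_def)
  moreover have "countable ((UNIV :: nat set) \<times> ({..<d} \<rightarrow>\<^sub>E (UNIV :: int set)))"
    by (intro countable_SIGMA countable_PiE) auto
  ultimately have S: "countable S" by (rule countable_subset)
  \<comment> \<open>Of two selected cubes that meet, the finer lies in the coarser. The coarser is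
    good and contains the point that selected the finer one, so minimality of the level chosen for
    that point makes the levels equal.\<close>
  have same: "p = q" if p: "p \<in> S" and q: "q \<in> S" and y: "y \<in> Q p" "y \<in> Q q" and le: "fst p \<le> fst q" for p q y
  proof -
    obtain x x' where x: "x \<in> \<Omega>" "p = s x" and x': "x' \<in> \<Omega>" "q = s x'" using p q by (auto simp: S_def)
    have y1: "grid_index d (\<kappa> x) y = grid_index d (\<kappa> x) x"
      using grid_index_eq[OF _ grid_index_PiE] y x by (auto simp: Q_def s_def)
    have y2: "y \<in> dcube d (\<kappa> x') (grid_index d (\<kappa> x') x')" using y x' by (simp add: Q_def s_def)
    have le': "\<kappa> x \<le> \<kappa> x'" using le x x' by (simp add: s_def)
    have y3: "grid_index d (\<kappa> x) y = grid_index d (\<kappa> x) x'"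
      by (rule grid_index_eq[OF dcube_nested[OF le' y2] grid_index_PiE])
    then have "P (\<kappa> x) (grid_index d (\<kappa> x) x')" using P\<kappa>[OF x(1)] y1 by simp
    then have "\<kappa> x' \<le> \<kappa> x" unfolding \<kappa>_def[of] by (rule Least_le)
    then show ?thesis using le' y1 y3 x x' by (simp add: s_def)
  qed
  then have same': "p = q" if "p \<in> S" "q \<in> S" "y \<in> Q p" "y \<in> Q q" for p q y
    using that by (metis linear)
  \<comment> \<open>Indices that enumerate no selected cube give the empty set, which the conclusion
    allows.\<close>
  define X where "X = (\<lambda>n. \<Union>p\<in>{p \<in> S. to_nat_on S p = n}. Q p)"
  have X_eq: "X (to_nat_on S p) = Q p" if "p \<in> S" for p
    using that inj_on_to_nat_on[OF S] by (auto simp: X_def dest: inj_onD)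
  have X_cases: "X n = {} \<or> (\<exists>p\<in>S. n = to_nat_on S p)" for n
    by (auto simp: X_def)
  show ?thesis
  proof (intro exI[of _ X] conjI allI)
    show "disjoint_family X"
      unfolding disjoint_family_on_def
    proof (intro ballI impI)
      fix m n :: nat assume "m \<noteq> n"
      then show "X m \<inter> X n = {}"
        using same' by (fastforce simp: X_def)
    qed
    have "\<Omega> \<subseteq> (\<Union>n. X n)"
    proof
      fix x assume x: "x \<in> \<Omega>"
      then have "x \<in> Q (s x)" using \<Omega> mem_dcube_grid_index by (auto simp: Q_def s_def)
      then show "x \<in> (\<Union>n. X n)" using X_eq[of "s x"] x by (auto simp: S_def)
    qed
    moreover have "X n \<subseteq> \<Omega>" for n
    proof (cases "X n = {}")
      case False
      then obtain x where x: "x \<in> \<Omega>" "n = to_nat_on S (s x)" using X_cases[of n] by (auto simp: S_def)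
      then have "X n = dcube d (\<kappa> x) (grid_index d (\<kappa> x) x)" using X_eq[of "s x"] by (simp add: S_def Q_def s_def)
      then show ?thesis using sub[OF P\<kappa>[OF x(1)]] by simp
    qed simp
    ultimately show "(\<Union>n. X n) = \<Omega>" by blast
    show "X n = {} \<or> (\<exists>k z. X n = dcube d k z \<and> P k z)" for n
    proof (cases "X n = {}")
      case False
      then obtain x where x: "x \<in> \<Omega>" "n = to_nat_on S (s x)" using X_cases[of n] by (auto simp: S_def)
      then have "X n = dcube d (\<kappa> x) (grid_index d (\<kappa> x) x)" using X_eq[of "s x"] by (simp add: S_def Q_def s_def)
      then show ?thesis using P\<kappa>[OF x(1)] by blast
    qed simp
  qed
qed

lemma ext_open_compact_exhaustion:
  assumes "ext_open d \<Omega>"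
  obtains K :: "nat \<Rightarrow> (nat \<Rightarrow> real) set" where "incseq K" "\<And>n. compact (K n)" "(\<Union>n. K n) = \<Omega>"
proof -
  obtain O' where O': "open O'" "\<Omega> = ext_space d \<inter> O'" using assms by (auto simp: openin_open)
  define B where "B = (\<lambda>n::nat. {..<d} \<rightarrow>\<^sub>E {- real n .. real n})"
  define C where "C = (\<lambda>n::nat. \<Inter>y\<in>-O'. {x. 1 / (real n + 1) \<le> dist x y})"
  have B: "compact (B n)" for n
  proof -
    have "B n = (\<Pi>\<^sub>E i\<in>UNIV. if i < d then {- real n .. real n} else {undefined})"
      by (auto simp: B_def PiE_def Pi_def extensional_def split: if_splits)
    moreover have "compactin (product_topology (\<lambda>_::nat. euclidean :: real topology) UNIV)
        (\<Pi>\<^sub>E i\<in>UNIV. if i < d then {- real n .. real n} else {undefined})"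
      by (subst compactin_PiE) auto
    ultimately show ?thesis by (simp add: euclidean_product_topology)
  qed
  have C: "closed (C n)" for n
    unfolding C_def by (intro closed_INT ballI closed_Collect_le continuous_intros)
  show thesis
  proof
    show "compact (B n \<inter> C n)" for n by (rule compact_Int_closed[OF B C])
    show "incseq (\<lambda>n. B n \<inter> C n)"
    proof (rule incseq_SucI)
      fix n
      have "1 / (real (Suc n) + 1) \<le> 1 / (real n + 1)" by (simp add: frac_le)
      then have "C n \<subseteq> C (Suc n)" unfolding C_def by (blast intro: order_trans)
      moreover have "B n \<subseteq> B (Suc n)" unfolding B_def by (intro PiE_mono) auto
      ultimately show "B n \<inter> C n \<subseteq> B (Suc n) \<inter> C (Suc n)" by blast
    qed
    have "C n \<subseteq> O'" for n
    proof
      fix x assume x: "x \<in> C n"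
      show "x \<in> O'"
      proof (rule ccontr)
        assume "x \<notin> O'"
        then have "1 / (real n + 1) \<le> dist x x" using x unfolding C_def by blast
        then show False by (simp add: field_simps)
      qed
    qed
    then have "(\<Union>n. B n \<inter> C n) \<subseteq> \<Omega>" using O' by (auto simp: B_def PiE_def)
    moreover have "x \<in> (\<Union>n. B n \<inter> C n)" if x: "x \<in> \<Omega>" for x
    proof -
      obtain e where e: "e > 0" "\<And>y. dist y x < e \<Longrightarrow> y \<in> O'" using O' x unfolding open_dist by blast
      obtain N where N: "1 / e \<le> real N" using real_arch_simple by blast
      obtain M where M: "(\<Sum>i<d. \<bar>x i\<bar>) \<le> real M" using real_arch_simple by blast
      let ?n = "max N M"
      have "x \<in> B ?n"
      proof -
        have "\<bar>x i\<bar> \<le> real ?n" if "i < d" for i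
        proof -
          have "\<bar>x i\<bar> \<le> (\<Sum>i<d. \<bar>x i\<bar>)" using that by (intro member_le_sum) auto
          also have "\<dots> \<le> real ?n" using M by simp
          finally show ?thesis .
        qed
        then show ?thesis using x O' by (force simp: B_def PiE_def Pi_def abs_le_iff)
      qed
      moreover have "x \<in> C ?n"
      proof -
        have "1 / e < real ?n + 1" using N by simp
        then have "1 / (real ?n + 1) < e" using e(1) by (simp add: field_simps)
        then show ?thesis unfolding C_def using e(2) by (auto simp: dist_commute not_less[symmetric])
      qed
      ultimately show ?thesis by blast
    qed
    ultimately show "(\<Union>n. B n \<inter> C n) = \<Omega>" by blast
  qed
qed

locale C1_param =
  fixes d D :: nat and \<Omega> :: "(nat \<Rightarrow> real) set" and F :: "(nat \<Rightarrow> real) \<Rightarrow> (nat \<Rightarrow> real)" and A :: "real mat"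
  assumes d: "d > 0" and \<Omega>: "ext_open d \<Omega>" and F: "\<And>i. i < D \<Longrightarrow> C1 d \<Omega> (\<lambda>x. F x i)"
    and A: "pos_def_mat D A"
begin

definition J :: "(nat \<Rightarrow> real) \<Rightarrow> real mat" where
  "J x = Matrix.mat D d (\<lambda>(i, j). partial_deriv (\<lambda>y. F y i) j x)"

definition G :: "(nat \<Rightarrow> real) \<Rightarrow> real mat" where
  "G x = transpose_mat (J x) * A * J x"

definition dens :: "(nat \<Rightarrow> real) \<Rightarrow> real" where
  "dens x = sqrt (Determinant.det (G x))"

definition dF :: "(nat \<Rightarrow> real) \<Rightarrow> (nat \<Rightarrow> real) \<Rightarrow> nat \<Rightarrow> real" where
  "dF x v i = (\<Sum>j<d. partial_deriv (\<lambda>y. F y i) j x * v j)"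

section \<open>The Gram matrix and distances between image points\<close>

lemma A_carrier: "A \<in> carrier_mat D D"
  by (rule pos_def_mat_carrier[OF A])

lemma J_carrier [simp]: "J x \<in> carrier_mat D d"
  by (simp add: J_def)

lemma A_dim [simp]: "dim_row A = D" "dim_col A = D"
  using A_carrier by auto

lemma J_dim [simp]: "dim_row (J x) = D" "dim_col (J x) = d"
  by (simp_all add: J_def)

lemma G_dim [simp]: "dim_row (G x) = d" "dim_col (G x) = d"
  by (simp_all add: G_def)

lemma G_carrier [simp]: "G x \<in> carrier_mat d d"
  by (intro carrier_matI) auto

lemma \<Omega>_sub: "\<Omega> \<subseteq> ext_space d"
  using \<Omega> by (auto dest: openin_imp_subset)

lemma G_inner: "mat_inner (G x) v v = mat_inner A (dF x v) (dF x v)"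
proof -
  let ?v = "Matrix.vec d v"
  have Jv: "J x *\<^sub>v ?v = Matrix.vec D (dF x v)"
    by (intro eq_vecI) (auto simp: J_def dF_def scalar_prod_def atLeast0LessThan intro!: sum.cong)
  have c: "A *\<^sub>v (J x *\<^sub>v ?v) \<in> carrier_vec D" using A_carrier Jv by simp
  have "mat_inner (G x) v v = scalar_prod ?v (G x *\<^sub>v ?v)"
    by (simp add: mat_inner_def)
  also have "G x *\<^sub>v ?v = transpose_mat (J x) *\<^sub>v (A *\<^sub>v (J x *\<^sub>v ?v))"
  proof -
    have "G x *\<^sub>v ?v = (transpose_mat (J x) * A) *\<^sub>v (J x *\<^sub>v ?v)"
      unfolding G_def by (rule assoc_mult_mat_vec[of _ d D _ d]) (auto intro: carrier_matI)
    also have "\<dots> = transpose_mat (J x) *\<^sub>v (A *\<^sub>v (J x *\<^sub>v ?v))"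
      by (rule assoc_mult_mat_vec[of _ d D _ D]) (auto simp: Jv intro: carrier_matI)
    finally show ?thesis .
  qed
  also have "scalar_prod ?v \<dots> = scalar_prod (transpose_mat (J x) *\<^sub>v (A *\<^sub>v (J x *\<^sub>v ?v))) ?v"
    by (intro comm_scalar_prod[of _ d] mult_mat_vec_carrier[of _ d D] c) auto
  also have "\<dots> = scalar_prod (A *\<^sub>v (J x *\<^sub>v ?v)) (J x *\<^sub>v ?v)"
    by (rule transpose_vec_mult_scalar[OF J_carrier _ c]) simp
  also have "\<dots> = scalar_prod (J x *\<^sub>v ?v) (A *\<^sub>v (J x *\<^sub>v ?v))"
    using c Jv by (intro comm_scalar_prod[of _ D]) auto
  also have "\<dots> = mat_inner A (dF x v) (dF x v)"
    using A_carrier unfolding Jv by (simp add: mat_inner_def)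
  finally show ?thesis .
qed

lemma G_entry:
  assumes "k < d" "l < d"
  shows "G x $$ (k, l) = (\<Sum>m<D. (\<Sum>i<D. J x $$ (i, k) * A $$ (i, m)) * J x $$ (m, l))"
  using assms by (simp add: G_def scalar_prod_def atLeast0LessThan)

lemma G_sym:
  assumes "k < d" "l < d"
  shows "G x $$ (k, l) = G x $$ (l, k)"
proof -
  have *: "G x $$ (k, l) = (\<Sum>m<D. \<Sum>i<D. J x $$ (i, k) * A $$ (i, m) * J x $$ (m, l))"
    if "k < d" "l < d" for k l
    unfolding G_entry[OF that] by (simp add: sum_distrib_right)
  show ?thesis
    unfolding *[OF assms] *[OF assms(2,1)] using pos_def_mat_sym[OF A]
    by (subst sum.swap) (auto intro!: sum.cong)
qed

lemma G_entry_continuous: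
  assumes "k < d" "l < d"
  shows "continuous_on \<Omega> (\<lambda>x. G x $$ (k, l))"
proof -
  have "continuous_on \<Omega> (partial_deriv (\<lambda>y. F y i) j)" if "i < D" "j < d" for i j
    using C1_imp_with_partial_deriv[OF F[OF that(1)]] that(2) by (simp add: C1_with_def)
  then have "continuous_on \<Omega> (\<lambda>x. J x $$ (i, j))" if "i < D" "j < d" for i j
    using that by (simp add: J_def)
  then show ?thesis
    unfolding G_entry[OF assms] using assms by (intro continuous_intros) auto
qed

lemma dens_continuous: "continuous_on \<Omega> dens"
  unfolding dens_def
  by (intro continuous_on_real_sqrt continuous_on_det[of \<Omega> G d] G_entry_continuous) auto

text \<open>The perturbation by a multiple of the identity makes the Gram matrix definite where the
  Jacobian degenerates.\<close>

definition P :: "real \<Rightarrow> (nat \<Rightarrow> real) \<Rightarrow> real mat" where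
  "P e x = Matrix.mat d d (\<lambda>(i, j). (1 + e) * G x $$ (i, j) + (if i = j then e else 0))"

lemma P_inner: "mat_inner (P e x) v v = (1 + e) * mat_inner (G x) v v + e * (\<Sum>i<d. (v i)\<^sup>2)"
proof -
  have "mat_inner (P e x) v v = (\<Sum>i<d. \<Sum>j<d. P e x $$ (i, j) * v i * v j)"
    by (rule mat_inner_eq_sum) (simp add: P_def)
  also have "\<dots> = (\<Sum>i<d. \<Sum>j<d. (1 + e) * (G x $$ (i, j) * v i * v j) + (if i = j then e * (v i)\<^sup>2 else 0))"
    by (intro sum.cong refl) (auto simp: P_def algebra_simps power2_eq_square)
  also have "\<dots> = (1 + e) * (\<Sum>i<d. \<Sum>j<d. G x $$ (i, j) * v i * v j) + (\<Sum>i<d. e * (v i)\<^sup>2)"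
    by (simp add: sum.distrib sum_distrib_left sum.delta)
  finally show ?thesis by (simp add: mat_inner_eq_sum[OF G_carrier] sum_distrib_left)
qed

lemma P_pos_def:
  assumes e: "e > 0"
  shows "pos_def_mat d (P e x)"
proof (rule pos_def_matI)
  fix v :: "nat \<Rightarrow> real" and i assume i: "i < d" "v i \<noteq> 0"
  have "0 < (v i)\<^sup>2" using i by simp
  also have "\<dots> \<le> (\<Sum>i<d. (v i)\<^sup>2)" using i by (intro member_le_sum) auto
  finally have "0 < e * (\<Sum>i<d. (v i)\<^sup>2)" using e by simp
  moreover have "0 \<le> (1 + e) * mat_inner (G x) v v"
    using e mat_inner_nonneg[OF A] by (simp add: G_inner)
  ultimately show "mat_inner (P e x) v v > 0" by (simp add: P_inner)
qed (auto simp: P_def G_sym)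

lemma P_det_tendsto: "((\<lambda>e. sqrt (Determinant.det (P e x))) \<longlongrightarrow> dens x) (at_right 0)"
proof -
  have "continuous_on UNIV (\<lambda>e. Determinant.det (P e x))"
  proof (rule continuous_on_det[where n=d])
    fix i j assume ij: "i < d" "j < d"
    have "continuous_on UNIV (\<lambda>e. (1 + e) * G x $$ (i, j) + (if i = j then e else 0))"
      by (cases "i = j") (auto intro!: continuous_intros)
    then show "continuous_on UNIV (\<lambda>e. P e x $$ (i, j))" using ij by (simp add: P_def)
  qed (simp add: P_def)
  then have "((\<lambda>e. Determinant.det (P e x)) \<longlongrightarrow> Determinant.det (P 0 x)) (at 0)"
    by (simp add: continuous_on_def)
  then have "((\<lambda>e. Determinant.det (P e x)) \<longlongrightarrow> Determinant.det (P 0 x)) (at_right 0)"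
    by (rule tendsto_within_subset) simp
  moreover have "P 0 x = G x"
    by (intro eq_matI) (auto simp: P_def)
  ultimately show ?thesis unfolding dens_def by (auto intro: tendsto_real_sqrt)
qed

text \<open>In general \<open>G x\<close> is only semidefinite; its determinant is the limit of
  those of the definite matrices \<open>P e x\<close>.\<close>

lemma det_G_nonneg: "Determinant.det (G x) \<ge> 0"
proof -
  have "eventually (\<lambda>e. sqrt (Determinant.det (P e x)) \<ge> 0) (at_right 0)"
    using det_pos_def_mat[OF P_pos_def]
    by (auto simp: eventually_at_right_field less_imp_le intro!: exI[of _ 1])
  then have "dens x \<ge> 0" by (intro tendsto_lowerbound[OF P_det_tendsto]) auto
  then show ?thesis by (simp add: dens_def)
qed

lemma dens_nonneg: "dens x \<ge> 0"
  using det_G_nonneg by (simp add: dens_def)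

lemma G_pos_def:
  assumes "dens x > 0"
  shows "pos_def_mat d (G x)"
proof (rule pos_def_matI)
  fix v :: "nat \<Rightarrow> real" and i assume i: "i < d" "v i \<noteq> 0"
  let ?v = "Matrix.vec d v"
  have v: "?v \<in> carrier_vec d" "?v \<noteq> 0\<^sub>v d" using i by (auto dest: arg_cong[where f="\<lambda>w. w $ i"])
  have nz: "\<exists>k<D. dF x v k \<noteq> 0"
  proof (rule ccontr)
    assume "\<not> ?thesis"
    then have Jv: "J x *\<^sub>v ?v = 0\<^sub>v D"
      by (intro eq_vecI) (auto simp: J_def dF_def scalar_prod_def atLeast0LessThan)
    have "G x *\<^sub>v ?v = (transpose_mat (J x) * A) *\<^sub>v (J x *\<^sub>v ?v)"
      unfolding G_def by (rule assoc_mult_mat_vec[of _ d D _ d]) (auto intro: carrier_matI)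
    also have "\<dots> = 0\<^sub>v d"
      unfolding Jv by (intro eq_vecI) (auto simp: scalar_prod_def)
    finally have "Determinant.det (G x) = 0"
      using det_0_iff_vec_prod_zero[OF G_carrier[of x]] v by blast
    then show False using assms by (simp add: dens_def)
  qed
  then show "mat_inner (G x) v v > 0"
    using pos_def_mat_inner_pos[OF A] by (auto simp: G_inner)
qed (auto simp: G_sym)

text \<open>Strict differentiability replaces the increment of \<open>F\<close> by that of its
  derivative up to a small linear error, and \<open>mat_inner_add_le\<close> used in both directions
  turns this into a comparison of squared distances. The remaining \<open>e\<close> times the
  Euclidean square is absorbed later, by \<open>P\<close> in the upper bound and by coercivity in
  the lower one.\<close>

lemma dist_estimates:
  assumes x0: "x0 \<in> \<Omega>" and e: "e > 0"
  shows "\<exists>r>0. near_box d r x0 \<subseteq> \<Omega> \<and> (\<forall>x\<in>near_box d r x0. \<forall>y\<in>near_box d r x0.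
     mat_inner A (\<lambda>i. F x i - F y i) (\<lambda>i. F x i - F y i) \<le>
       (1 + e) * mat_inner (G x0) (\<lambda>j. x j - y j) (\<lambda>j. x j - y j) + e * (\<Sum>j<d. (x j - y j)\<^sup>2) \<and>
     mat_inner (G x0) (\<lambda>j. x j - y j) (\<lambda>j. x j - y j) \<le>
       (1 + e) * mat_inner A (\<lambda>i. F x i - F y i) (\<lambda>i. F x i - F y i) + e * (\<Sum>j<d. (x j - y j)\<^sup>2))"
proof -
  obtain C where C: "C > 0" "\<And>x. mat_inner A x x \<le> C * (\<Sum>i<D. (x i)\<^sup>2)"
    using mat_inner_le_sum_squares[OF A_carrier] by blast
  \<comment> \<open>\<open>K - 1\<close> is the factor with which \<open>\<eta>\<^sup>2\<close>
    enters the error after Young and Cauchy-Schwarz; the added \<open>1\<close> keeps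
    \<open>K\<close> positive.\<close>
  define K where "K = (1 + 1 / e) * C * D * d + 1"
  have K: "K > 0" using e C by (auto simp: K_def intro!: add_nonneg_pos mult_nonneg_nonneg)
  define \<eta> where "\<eta> = sqrt (e / K)"
  have \<eta>: "\<eta> > 0" using e K by (simp add: \<eta>_def)
  have "\<exists>r>0. \<forall>i<D. near_box d r x0 \<subseteq> \<Omega> \<and> (\<forall>x\<in>near_box d r x0. \<forall>y\<in>near_box d r x0.
    \<bar>F x i - F y i - dF x0 (\<lambda>j. x j - y j) i\<bar> \<le> \<eta> * (\<Sum>j<d. \<bar>x j - y j\<bar>))"
  proof (rule common_radius)
    fix i assume "i < D"
    then show "\<exists>r>0. near_box d r x0 \<subseteq> \<Omega> \<and> (\<forall>x\<in>near_box d r x0. \<forall>y\<in>near_box d r x0.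
      \<bar>F x i - F y i - dF x0 (\<lambda>j. x j - y j) i\<bar> \<le> \<eta> * (\<Sum>j<d. \<bar>x j - y j\<bar>))"
      unfolding dF_def using C1_with_strict[OF \<Omega> C1_imp_with_partial_deriv[OF F] x0 \<eta>] by blast
  next
    fix i r s assume "s \<le> (r :: real)"
    then show "near_box d r x0 \<subseteq> \<Omega> \<and> (\<forall>x\<in>near_box d r x0. \<forall>y\<in>near_box d r x0.
        \<bar>F x i - F y i - dF x0 (\<lambda>j. x j - y j) i\<bar> \<le> \<eta> * (\<Sum>j<d. \<bar>x j - y j\<bar>)) \<Longrightarrow>
      near_box d s x0 \<subseteq> \<Omega> \<and> (\<forall>x\<in>near_box d s x0. \<forall>y\<in>near_box d s x0.
        \<bar>F x i - F y i - dF x0 (\<lambda>j. x j - y j) i\<bar> \<le> \<eta> * (\<Sum>j<d. \<bar>x j - y j\<bar>))"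
      using near_box_mono[of s r d x0] by blast
  qed
  then obtain r1 where r1: "r1 > 0" "\<And>i x y. i < D \<Longrightarrow> x \<in> near_box d r1 x0 \<Longrightarrow> y \<in> near_box d r1 x0 \<Longrightarrow>
    \<bar>F x i - F y i - dF x0 (\<lambda>j. x j - y j) i\<bar> \<le> \<eta> * (\<Sum>j<d. \<bar>x j - y j\<bar>)" by blast
  obtain r2 where r2: "r2 > 0" "near_box d r2 x0 \<subseteq> \<Omega>" using ext_open_near_box[OF \<Omega> x0] by blast
  define r where "r = min r1 r2"
  have r: "r > 0" "near_box d r x0 \<subseteq> \<Omega>" "near_box d r x0 \<subseteq> near_box d r1 x0"
    using r1 r2 near_box_mono[of r r1 d x0] near_box_mono[of r r2 d x0] by (auto simp: r_def)
  show ?thesis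
  proof (intro exI[of _ r] conjI ballI r(1,2))
    fix x y assume "x \<in> near_box d r x0" "y \<in> near_box d r x0"
    then have x: "x \<in> near_box d r1 x0" and y: "y \<in> near_box d r1 x0" using r(3) by auto
    let ?w = "\<lambda>j. x j - y j" and ?f = "\<lambda>i. F x i - F y i"
    let ?S = "\<Sum>j<d. (?w j)\<^sup>2"
    define err where "err = (\<lambda>i. ?f i - dF x0 ?w i)"
    have "(\<Sum>j<d. \<bar>?w j\<bar> * 1)\<^sup>2 \<le> (\<Sum>j<d. \<bar>?w j\<bar>\<^sup>2) * (\<Sum>j<d. 1\<^sup>2)"
      by (rule Cauchy_Schwarz_ineq_sum)
    then have cs: "(\<Sum>j<d. \<bar>?w j\<bar>)\<^sup>2 \<le> ?S * d" by simp
    have "(err i)\<^sup>2 \<le> \<eta>\<^sup>2 * (?S * d)" if "i < D" for i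
    proof -
      have "\<bar>err i\<bar> \<le> \<eta> * (\<Sum>j<d. \<bar>?w j\<bar>)" using r1(2)[OF that x y] by (simp add: err_def)
      then have "\<bar>err i\<bar>\<^sup>2 \<le> (\<eta> * (\<Sum>j<d. \<bar>?w j\<bar>))\<^sup>2" by (intro power_mono) auto
      also have "\<dots> \<le> \<eta>\<^sup>2 * (?S * d)"
        unfolding power_mult_distrib using cs by (intro mult_left_mono) auto
      finally show ?thesis by simp
    qed
    then have "(\<Sum>i<D. (err i)\<^sup>2) \<le> D * (\<eta>\<^sup>2 * (?S * d))"
      using sum_bounded_above[of "{..<D}" "\<lambda>i. (err i)\<^sup>2" "\<eta>\<^sup>2 * (?S * d)"] by simp
    then have "C * (\<Sum>i<D. (err i)\<^sup>2) \<le> C * (D * (\<eta>\<^sup>2 * (?S * d)))" using C by (intro mult_left_mono) auto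
    then have "mat_inner A err err \<le> C * (D * (\<eta>\<^sup>2 * (?S * d)))" using C(2)[of err] by linarith
    then have "(1 + 1 / e) * mat_inner A err err \<le> (1 + 1 / e) * (C * (D * (\<eta>\<^sup>2 * (?S * d))))"
      using e by (intro mult_left_mono) auto
    also have "\<dots> = ((K - 1) * \<eta>\<^sup>2) * ?S" by (simp add: K_def mult_ac)
    also have "\<dots> \<le> e * ?S"
    proof (intro mult_right_mono sum_nonneg)
      have "(K - 1) * \<eta>\<^sup>2 \<le> K * \<eta>\<^sup>2" by (intro mult_right_mono) auto
      also have "\<dots> = e" using e K by (simp add: \<eta>_def)
      finally show "(K - 1) * \<eta>\<^sup>2 \<le> e" .
    qed auto
    finally have err: "(1 + 1 / e) * mat_inner A err err \<le> e * ?S" .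
    have "mat_inner A ?f ?f \<le> (1 + e) * mat_inner A (dF x0 ?w) (dF x0 ?w) + (1 + 1 / e) * mat_inner A err err"
      using mat_inner_add_le[OF A e, of "dF x0 ?w" err] by (simp add: err_def)
    then show "mat_inner A ?f ?f \<le> (1 + e) * mat_inner (G x0) ?w ?w + e * ?S"
      using err by (simp add: G_inner)
    have "mat_inner A (\<lambda>i. (-1) * err i) (\<lambda>i. (-1) * err i) = mat_inner A err err"
      using mat_inner_scale[OF A_carrier, of "-1" err] by simp
    then have "mat_inner A (dF x0 ?w) (dF x0 ?w) \<le> (1 + e) * mat_inner A ?f ?f + (1 + 1 / e) * mat_inner A err err"
      using mat_inner_add_le[OF A e, of ?f "\<lambda>i. (-1) * err i"] by (simp add: err_def)
    then show "mat_inner (G x0) ?w ?w \<le> (1 + e) * mat_inner A ?f ?f + e * ?S"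
      using err by (simp add: G_inner)
  qed
qed

end

lemma ennreal_le_of_scaled:
  fixes x y :: ennreal
  assumes "\<And>l :: real. l > 1 \<Longrightarrow> x \<le> ennreal l * y"
  shows "x \<le> y"
proof (cases y)
  case (real r)
  have "x \<le> ennreal 2 * y" using assms[of 2] by simp
  also have "\<dots> < top" using real by (simp add: ennreal_mult[symmetric] del: ennreal_numeral)
  finally obtain t where t: "x = ennreal t" "t \<ge> 0" by (cases x) auto
  have "t \<le> l * r" if "l > 1" for l
    using assms[OF that] t real that by (simp add: ennreal_mult[symmetric] ennreal_le_iff)
  moreover have "((\<lambda>l. l * r) \<longlongrightarrow> 1 * r) (at_right (1::real))" by (intro tendsto_intros)
  ultimately have "t \<le> 1 * r"
    by (intro tendsto_lowerbound[of "\<lambda>l. l * r" _ "at_right (1::real)"])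
       (auto simp: eventually_at_right_field intro!: exI[of _ 2])
  then show ?thesis using t real by (simp add: ennreal_leI)
qed simp

lemma near_box_contains_dcube:
  assumes x: "x \<in> ext_space d" and r: "r > 0"
  shows "\<exists>k. dcube d k (grid_index d k x) \<subseteq> near_box d r x"
proof -
  obtain k where k: "(1/2) ^ k < r" using real_arch_pow_inv[OF r, of "1/2"] by auto
  have "y \<in> near_box d r x" if y: "y \<in> dcube d k (grid_index d k x)" for y
  proof -
    have "\<bar>y i - x i\<bar> < r" if "i < d" for i
      using dcube_coord_close[OF y mem_dcube_grid_index[OF x] that] k by (simp add: power_one_over)
    then show ?thesis using y by (simp add: near_box_def dcube_def)
  qed
  then show ?thesis by blast
qed

lemma hausdorff_measure_disjoint_cover_le:
  assumes d: "d > 0" and M: "sets M = sets (lebesgue_fun m)"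
    and X: "disjoint_family X" "\<And>n. X n \<in> sets (lebesgue_fun m)"
    and le: "\<And>n. hausdorff_measure ds d (F ` X n) \<le> emeasure M (X n)"
  shows "hausdorff_measure ds d (F ` (\<Union>n::nat. X n)) \<le> emeasure M (\<Union>n. X n)"
proof -
  have "hausdorff_measure ds d (F ` (\<Union>n. X n)) \<le> (\<Sum>n. hausdorff_measure ds d (F ` X n))"
    unfolding image_UN by (rule hausdorff_measure_UN_le[OF d])
  also have "\<dots> \<le> (\<Sum>n. emeasure M (X n))" by (intro suminf_le le) auto
  also have "\<dots> = emeasure M (\<Union>n. X n)" using X M by (intro suminf_emeasure) auto
  finally show ?thesis .
qed

lemma mat_dist_pos:
  assumes "pos_def_mat D A" "i < D" "u i \<noteq> v i"
  shows "mat_dist A u v > 0"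
  unfolding mat_dist_def mat_norm_def
  using pos_def_mat_inner_pos[OF assms(1,2), of "\<lambda>i. u i - v i"] assms(3) by simp

lemma continuous_on_mat_dist:
  assumes A: "A \<in> carrier_mat D D"
    and "\<And>i. i < D \<Longrightarrow> continuous_on S (\<lambda>p. f p i)" "\<And>i. i < D \<Longrightarrow> continuous_on S (\<lambda>p. g p i)"
  shows "continuous_on S (\<lambda>p. mat_dist A (f p) (g p))"
  unfolding mat_dist_def mat_norm_def mat_inner_eq_sum[OF A]
  using assms(2,3) by (intro continuous_intros) auto

context C1_param
begin

section \<open>The area formula: upper bound\<close>

lemma F_continuous: "i < D \<Longrightarrow> continuous_on \<Omega> (\<lambda>x. F x i)"
  using C1_continuous[OF \<Omega> F] by blast

text \<open>The summand \<open>e\<close> leaves room for strict estimates where the density vanishes.\<close>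

definition gmeas :: "real \<Rightarrow> (nat \<Rightarrow> real) measure" where
  "gmeas e = density (lebesgue_fun d) (\<lambda>x. ennreal (dens x + e) * indicator \<Omega> x)"

lemma sets_gmeas [simp]: "sets (gmeas e) = sets (lebesgue_fun d)"
  by (simp add: gmeas_def)

lemma gmeas_measurable [measurable]:
  "(\<lambda>x. ennreal (dens x + e) * indicator \<Omega> x) \<in> borel_measurable (lebesgue_fun d)"
  by (intro borel_measurable_indicator_continuous_on \<Omega> continuous_intros dens_continuous)

lemma emeasure_gmeas:
  assumes "X \<in> sets (lebesgue_fun d)" "X \<subseteq> \<Omega>"
  shows "emeasure (gmeas e) X = (\<integral>\<^sup>+x. ennreal (dens x + e) * indicator X x \<partial>lebesgue_fun d)"
proof -
  have "emeasure (gmeas e) X = (\<integral>\<^sup>+x. (ennreal (dens x + e) * indicator \<Omega> x) * indicator X x \<partial>lebesgue_fun d)"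
    unfolding gmeas_def by (intro emeasure_density gmeas_measurable assms)
  also have "\<dots> = (\<integral>\<^sup>+x. ennreal (dens x + e) * indicator X x \<partial>lebesgue_fun d)"
    using assms(2) by (intro nn_integral_cong) (auto simp: indicator_def)
  finally show ?thesis .
qed

lemma emeasure_gmeas_le:
  assumes "X \<in> sets (lebesgue_fun d)" "X \<subseteq> \<Omega>" "\<And>x. x \<in> X \<Longrightarrow> dens x + e \<le> c"
  shows "emeasure (gmeas e) X \<le> ennreal c * emeasure (lebesgue_fun d) X"
proof -
  have "emeasure (gmeas e) X \<le> (\<integral>\<^sup>+x. ennreal c * indicator X x \<partial>lebesgue_fun d)"
    unfolding emeasure_gmeas[OF assms(1,2)] using assms(3)
    by (intro nn_integral_mono) (auto simp: indicator_def intro: ennreal_leI)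
  then show ?thesis using assms(1) by (simp add: nn_integral_cmult_indicator)
qed

lemma emeasure_gmeas_ge:
  assumes "X \<in> sets (lebesgue_fun d)" "X \<subseteq> \<Omega>" "\<And>x. x \<in> X \<Longrightarrow> c \<le> dens x + e"
  shows "ennreal c * emeasure (lebesgue_fun d) X \<le> emeasure (gmeas e) X"
proof -
  have "(\<integral>\<^sup>+x. ennreal c * indicator X x \<partial>lebesgue_fun d) \<le> emeasure (gmeas e) X"
    unfolding emeasure_gmeas[OF assms(1,2)] using assms(3)
    by (intro nn_integral_mono) (auto simp: indicator_def intro: ennreal_leI)
  then show ?thesis using assms(1) by (simp add: nn_integral_cmult_indicator)
qed

text \<open>Near \<open>x0\<close> the map does not increase distances measured by the definite
  matrix \<open>P t x0\<close>, so the volume of a cube in that metric bounds that of its image.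
  Half of \<open>e\<close> pays for replacing the determinant by its limit, half for the variation
  of the density.\<close>

lemma Vol_image_dcube_le:
  assumes x0: "x0 \<in> \<Omega>" and e: "e > 0"
  shows "\<exists>r>0. near_box d r x0 \<subseteq> \<Omega> \<and>
    (\<forall>k z. dcube d k z \<subseteq> near_box d r x0 \<longrightarrow> Vol A d (F ` dcube d k z) \<le> emeasure (gmeas e) (dcube d k z))"
proof -
  have "eventually (\<lambda>t. sqrt (Determinant.det (P t x0)) < dens x0 + e / 2) (at_right 0)"
    using e by (intro order_tendstoD(2)[OF P_det_tendsto]) auto
  then obtain b where b: "b > 0" "\<And>t. t > 0 \<Longrightarrow> t < b \<Longrightarrow> sqrt (Determinant.det (P t x0)) < dens x0 + e / 2"
    by (auto simp: eventually_at_right_field)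
  define t where "t = b / 2"
  have t: "t > 0" "sqrt (Determinant.det (P t x0)) < dens x0 + e / 2"
    using b(1) b(2)[of "b / 2"] by (auto simp: t_def)
  obtain r1 where r1: "r1 > 0" "near_box d r1 x0 \<subseteq> \<Omega>"
    "\<And>x y. x \<in> near_box d r1 x0 \<Longrightarrow> y \<in> near_box d r1 x0 \<Longrightarrow>
      mat_inner A (\<lambda>i. F x i - F y i) (\<lambda>i. F x i - F y i) \<le>
       (1 + t) * mat_inner (G x0) (\<lambda>j. x j - y j) (\<lambda>j. x j - y j) + t * (\<Sum>j<d. (x j - y j)\<^sup>2)"
    using dist_estimates[OF x0 t(1)] by blast
  obtain r2 where r2: "r2 > 0" "near_box d r2 x0 \<subseteq> {y \<in> \<Omega>. \<bar>dens y - dens x0\<bar> < e / 2}"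
    using continuous_on_near_box[OF \<Omega> x0 dens_continuous, of "e / 2"] e by auto
  define r where "r = min r1 r2"
  have sub: "near_box d r x0 \<subseteq> near_box d r1 x0" "near_box d r x0 \<subseteq> near_box d r2 x0"
    by (simp_all add: near_box_mono r_def)
  show ?thesis
  proof (intro exI[of _ r] conjI allI impI)
    show "r > 0" using r1 r2 by (simp add: r_def)
    show "near_box d r x0 \<subseteq> \<Omega>" using sub r1 by blast
    fix k z assume Q: "dcube d k z \<subseteq> near_box d r x0"
    have "Vol A d (F ` dcube d k z) \<le> ennreal (1 ^ d) * Vol (P t x0) d (dcube d k z)"
      unfolding Vol_def
    proof (rule hausdorff_measure_Lipschitz_image[OF d])
      fix x y assume "x \<in> dcube d k z" "y \<in> dcube d k z"
      then have "mat_inner A (\<lambda>i. F x i - F y i) (\<lambda>i. F x i - F y i) \<le>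
          mat_inner (P t x0) (\<lambda>j. x j - y j) (\<lambda>j. x j - y j)"
        unfolding P_inner using Q sub by (intro r1(3)) auto
      then show "mat_dist A (F x) (F y) \<le> 1 * mat_dist (P t x0) x y"
        by (simp add: mat_dist_def mat_norm_def)
    qed simp
    also have "\<dots> = Vol (P t x0) d (dcube d k z)" by simp
    also have "\<dots> \<le> ennreal (sqrt (Determinant.det (P t x0))) * emeasure (lebesgue_fun d) (dcube d k z)"
      by (rule Vol_dcube_le[OF P_pos_def[OF t(1)] d])
    also have "\<dots> \<le> emeasure (gmeas e) (dcube d k z)"
    proof (rule emeasure_gmeas_ge)
      fix x assume "x \<in> dcube d k z"
      then have "\<bar>dens x - dens x0\<bar> < e / 2" using Q sub r2 by blast
      then show "sqrt (Determinant.det (P t x0)) \<le> dens x + e" using t(2) by linarith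
    qed (use Q sub r1 in auto)
    finally show "Vol A d (F ` dcube d k z) \<le> emeasure (gmeas e) (dcube d k z)" .
  qed
qed

text \<open>Inside a unit cube Lebesgue measure is at most \<open>1\<close>, so the surplus
  \<open>e\<close> in the density adds at most \<open>e\<close> to the bound and can be sent to
  \<open>0\<close>.\<close>

lemma Vol_image_unit_cube_le:
  "Vol A d (F ` (\<Omega> \<inter> dcube d 0 z0)) \<le> emeasure (gmeas 0) (\<Omega> \<inter> dcube d 0 z0)"
proof (rule ennreal_le_epsilon)
  fix e :: real assume e: "e > 0"
  let ?\<Omega>0 = "\<Omega> \<inter> dcube d 0 z0"
  have s: "?\<Omega>0 \<in> sets (lebesgue_fun d)" by (intro sets.Int ext_open_sets \<Omega> sets_dcube)
  let ?P = "\<lambda>k z. dcube d k z \<subseteq> ?\<Omega>0 \<and> Vol A d (F ` dcube d k z) \<le> emeasure (gmeas e) (dcube d k z)"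
  have sub: "?\<Omega>0 \<subseteq> ext_space d" using \<Omega>_sub by blast
  have ex: "\<exists>k. ?P k (grid_index d k x)" if x: "x \<in> ?\<Omega>0" for x
  proof -
    have xe: "x \<in> ext_space d" using x \<Omega>_sub by blast
    obtain r where r: "r > 0" "near_box d r x \<subseteq> \<Omega>"
      "\<And>k z. dcube d k z \<subseteq> near_box d r x \<Longrightarrow> Vol A d (F ` dcube d k z) \<le> emeasure (gmeas e) (dcube d k z)"
      using Vol_image_dcube_le[OF _ e, of x] x by blast
    obtain k where k: "dcube d k (grid_index d k x) \<subseteq> near_box d r x"
      using near_box_contains_dcube[OF xe r(1)] by blast
    have "dcube d k (grid_index d k x) \<subseteq> dcube d 0 z0"
    proof
      fix y assume "y \<in> dcube d k (grid_index d k x)"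
      then have "y \<in> dcube d 0 (grid_index d 0 x)" by (rule dcube_nested[OF le0])
      then show "y \<in> dcube d 0 z0" using x by (simp add: dcube_def grid_index_def)
    qed
    then show ?thesis using k r by (intro exI[of _ k]) blast
  qed
  have sub': "\<And>k z. ?P k z \<Longrightarrow> dcube d k z \<subseteq> ?\<Omega>0" by blast
  have "\<exists>X :: nat \<Rightarrow> (nat \<Rightarrow> real) set. disjoint_family X \<and> (\<Union>n. X n) = ?\<Omega>0 \<and>
      (\<forall>n. X n = {} \<or> (\<exists>k z. X n = dcube d k z \<and> ?P k z))"
    by (rule dyadic_stopping_cubes[of ?\<Omega>0 d ?P, OF sub ex sub'])
  then obtain X where X12: "disjoint_family X" "(\<Union>n::nat. X n) = ?\<Omega>0"
    and X3: "\<forall>n. X n = {} \<or> (\<exists>k z. X n = dcube d k z \<and> ?P k z)"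
    by (elim exE conjE) (rule that)
  note X = X12 X3[rule_format]
  have "hausdorff_measure (mat_dist A) d (F ` (\<Union>n. X n)) \<le> emeasure (gmeas e) (\<Union>n. X n)"
  proof (rule hausdorff_measure_disjoint_cover_le[where m=d, OF d _ X(1)])
    fix n
    show "X n \<in> sets (lebesgue_fun d)" using X(3)[of n] by auto
    show "hausdorff_measure (mat_dist A) d (F ` X n) \<le> emeasure (gmeas e) (X n)"
      using X(3)[of n] d by (auto simp: Vol_def)
  qed simp
  then have "Vol A d (F ` ?\<Omega>0) \<le> emeasure (gmeas e) ?\<Omega>0" by (simp add: Vol_def X(2))
  also have "\<dots> = (\<integral>\<^sup>+x. (ennreal (dens x + 0) * indicator \<Omega> x) * indicator ?\<Omega>0 x + ennreal e * indicator ?\<Omega>0 x \<partial>lebesgue_fun d)"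
    unfolding emeasure_gmeas[OF s Int_lower1] using e dens_nonneg
    by (intro nn_integral_cong) (auto simp: indicator_def ennreal_plus)
  also have "\<dots> = emeasure (gmeas 0) ?\<Omega>0 + ennreal e * emeasure (lebesgue_fun d) ?\<Omega>0"
    using s gmeas_measurable[of 0]
    by (subst nn_integral_add) (auto simp: gmeas_def emeasure_density nn_integral_cmult_indicator simp del: add_0_right)
  also have "\<dots> \<le> emeasure (gmeas 0) ?\<Omega>0 + ennreal e * 1"
  proof (intro add_left_mono mult_left_mono)
    have "emeasure (lebesgue_fun d) ?\<Omega>0 \<le> emeasure (lebesgue_fun d) (dcube d 0 z0)"
      by (intro emeasure_mono) auto
    then show "emeasure (lebesgue_fun d) ?\<Omega>0 \<le> 1" by (simp add: emeasure_dcube)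
  qed auto
  finally show "Vol A d (F ` ?\<Omega>0) \<le> emeasure (gmeas 0) ?\<Omega>0 + ennreal e" by simp
qed

theorem Vol_image_le: "Vol A d (F ` \<Omega>) \<le> emeasure (gmeas 0) \<Omega>"
proof -
  have sub: "\<And>k z. k = 0 \<Longrightarrow> dcube d k z \<subseteq> ext_space d" by (auto simp: dcube_def)
  have ex: "\<exists>k::nat. k = 0" by simp
  \<comment> \<open>With the predicate \<open>k = 0\<close> the decomposition merely enumerates the
    unit cubes.\<close>
  have "\<exists>X :: nat \<Rightarrow> (nat \<Rightarrow> real) set. disjoint_family X \<and> (\<Union>n. X n) = ext_space d \<and>
      (\<forall>n. X n = {} \<or> (\<exists>k z. X n = dcube d k z \<and> k = 0))"
    by (rule dyadic_stopping_cubes[of "ext_space d" d "\<lambda>k z. k = 0", OF order_refl ex sub])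
  then obtain X where X0: "disjoint_family X \<and> (\<Union>n::nat. X n) = ext_space d \<and>
      (\<forall>n. X n = {} \<or> (\<exists>k z. X n = dcube d k z \<and> k = 0))" by (rule exE)
  have X: "disjoint_family X" "(\<Union>n. X n) = ext_space d" "X n = {} \<or> (\<exists>z. X n = dcube d 0 z)" for n
    using conjunct1[OF X0] conjunct1[OF conjunct2[OF X0]] spec[OF conjunct2[OF conjunct2[OF X0]], of n] by (simp_all only:) blast
  have "(\<Union>n. \<Omega> \<inter> X n) = \<Omega> \<inter> (\<Union>n. X n)" by (simp only: Int_UN_distrib)
  then have \<Omega>X: "(\<Union>n. \<Omega> \<inter> X n) = \<Omega>" using Int_absorb2[OF \<Omega>_sub] by (simp only: X(2))
  have "hausdorff_measure (mat_dist A) d (F ` (\<Union>n. \<Omega> \<inter> X n)) \<le> emeasure (gmeas 0) (\<Union>n. \<Omega> \<inter> X n)"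
  proof (rule hausdorff_measure_disjoint_cover_le[where m=d, OF d])
    show "disjoint_family (\<lambda>n. \<Omega> \<inter> X n)" using X(1) by (auto simp: disjoint_family_on_def)
    fix n
    show "\<Omega> \<inter> X n \<in> sets (lebesgue_fun d)"
      using X(3)[of n] ext_open_sets[OF \<Omega>] by auto
    show "hausdorff_measure (mat_dist A) d (F ` (\<Omega> \<inter> X n)) \<le> emeasure (gmeas 0) (\<Omega> \<inter> X n)"
      using X(3)[of n] d Vol_image_unit_cube_le by (auto simp: Vol_def)
  qed simp
  then show ?thesis unfolding \<Omega>X Vol_def .
qed

text \<open>Where the density is positive the Gram matrix is definite, so locally the inverse of
  \<open>F\<close> is Lipschitz from the metric of \<open>A\<close> to that of \<open>G x0\<close>
  with constant close to \<open>1\<close>. The isodiametric inequality for \<open>G x0\<close> then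
  bounds measure by cost.\<close>

lemma gmeas_le_hcost_image:
  assumes x0: "x0 \<in> \<Omega>" and dens: "dens x0 > 0" and l: "l > 1"
  shows "\<exists>r>0. near_box d r x0 \<subseteq> \<Omega> \<and> (\<forall>E\<in>sets (lebesgue_fun d). E \<subseteq> near_box d r x0 \<longrightarrow>
    emeasure (gmeas 0) E \<le> ennreal l * hcost (mat_dist A) d (F ` E))"
proof -
  note G = G_pos_def[OF dens]
  obtain \<kappa> where \<kappa>: "\<kappa> > 0" "\<And>x. \<kappa> * (\<Sum>i<d. (x i)\<^sup>2) \<le> mat_inner (G x0) x x"
    using pos_def_mat_coercive[OF G] by blast
  \<comment> \<open>Lipschitz constant of the inverse: coercivity bounds the error \<open>e\<close>
    times the Euclidean square by \<open>e / \<kappa>\<close> times the form of \<open>G x0\<close>,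
    which moves to the left-hand side. The extra factor \<open>1 + e\<close> below covers the
    variation of the density.\<close>
  let ?s = "\<lambda>e. sqrt ((1 + e) / (1 - e / \<kappa>))"
  have "((\<lambda>e. (1 + e) * ?s e ^ d) \<longlongrightarrow> (1 + 0) * ?s 0 ^ d) (at_right 0)"
    using \<kappa>(1) by (intro tendsto_intros) auto
  then have "eventually (\<lambda>e. (1 + e) * ?s e ^ d < l) (at_right 0)"
    using l by (intro order_tendstoD(2)) auto
  then obtain b where b: "b > 0" "\<And>e. e > 0 \<Longrightarrow> e < b \<Longrightarrow> (1 + e) * ?s e ^ d < l"
    by (auto simp: eventually_at_right_field)
  define e where "e = min b \<kappa> / 2"
  have e: "e > 0" "e < \<kappa>" "(1 + e) * ?s e ^ d < l" using b(1) \<kappa>(1) b(2)[of e] by (auto simp: e_def)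
  have ek: "1 - e / \<kappa> > 0" using e \<kappa> by (simp add: field_simps)
  have s: "?s e > 0" using e ek by simp
  obtain r1 where r1: "r1 > 0" "near_box d r1 x0 \<subseteq> \<Omega>"
    "\<And>x y. x \<in> near_box d r1 x0 \<Longrightarrow> y \<in> near_box d r1 x0 \<Longrightarrow>
      mat_inner (G x0) (\<lambda>j. x j - y j) (\<lambda>j. x j - y j) \<le>
       (1 + e) * mat_inner A (\<lambda>i. F x i - F y i) (\<lambda>i. F x i - F y i) + e * (\<Sum>j<d. (x j - y j)\<^sup>2)"
    using dist_estimates[OF x0 e(1)] by blast
  obtain r2 where r2: "r2 > 0" "near_box d r2 x0 \<subseteq> {y \<in> \<Omega>. \<bar>dens y - dens x0\<bar> < e * dens x0}"
    using continuous_on_near_box[OF \<Omega> x0 dens_continuous, of "e * dens x0"] e dens by auto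
  define r where "r = min r1 r2"
  have sub: "near_box d r x0 \<subseteq> near_box d r1 x0" "near_box d r x0 \<subseteq> near_box d r2 x0"
    by (simp_all add: near_box_mono r_def)
  show ?thesis
  proof (intro exI[of _ r] conjI ballI impI)
    show "r > 0" using r1 r2 by (simp add: r_def)
    show "near_box d r x0 \<subseteq> \<Omega>" using sub r1 by blast
    fix E assume Es: "E \<in> sets (lebesgue_fun d)" and E: "E \<subseteq> near_box d r x0"
    have lip: "mat_dist (G x0) x y \<le> ?s e * mat_dist A (F x) (F y)" if "x \<in> E" "y \<in> E" for x y
    proof -
      let ?w = "\<lambda>j. x j - y j" and ?f = "\<lambda>i. F x i - F y i"
      have "mat_inner (G x0) ?w ?w \<le> (1 + e) * mat_inner A ?f ?f + e * (\<Sum>j<d. (?w j)\<^sup>2)"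
        using that E sub by (intro r1(3)) auto
      moreover have "(e / \<kappa>) * (\<kappa> * (\<Sum>j<d. (?w j)\<^sup>2)) \<le> (e / \<kappa>) * mat_inner (G x0) ?w ?w"
        using \<kappa> e by (intro mult_left_mono) auto
      ultimately have "(1 - e / \<kappa>) * mat_inner (G x0) ?w ?w \<le> (1 + e) * mat_inner A ?f ?f"
        using \<kappa> by (simp add: algebra_simps)
      then have "mat_inner (G x0) ?w ?w \<le> (1 + e) / (1 - e / \<kappa>) * mat_inner A ?f ?f"
        using ek by (simp add: pos_le_divide_eq mult.commute)
      then show ?thesis
        unfolding mat_dist_def mat_norm_def real_sqrt_mult[symmetric] by (rule real_sqrt_le_mono)
    qed
    have "ediam (mat_dist (G x0)) E \<le> ennreal (?s e) * ediam (mat_dist A) (F ` E)"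
      unfolding ediam_le_iff
    proof (intro ballI)
      fix x y assume xy: "x \<in> E" "y \<in> E"
      have "ennreal (mat_dist (G x0) x y) \<le> ennreal (?s e * mat_dist A (F x) (F y))"
        by (rule ennreal_leI[OF lip[OF xy]])
      also have "\<dots> = ennreal (?s e) * ennreal (mat_dist A (F x) (F y))"
        using s by (intro ennreal_mult') simp
      also have "\<dots> \<le> ennreal (?s e) * ediam (mat_dist A) (F ` E)"
        using xy by (intro mult_left_mono ediam_upper) auto
      finally show "ennreal (mat_dist (G x0) x y) \<le> ennreal (?s e) * ediam (mat_dist A) (F ` E)" .
    qed
    then have "(ediam (mat_dist (G x0)) E / 2) ^ d \<le> (ennreal (?s e) * (ediam (mat_dist A) (F ` E) / 2)) ^ d"
      unfolding ennreal_times_divide by (intro power_mono divide_right_mono_ennreal) auto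
    also have "\<dots> = ennreal (?s e ^ d) * (ediam (mat_dist A) (F ` E) / 2) ^ d"
      using s by (simp add: power_mult_distrib ennreal_power)
    finally have hc: "hcost (mat_dist (G x0)) d E \<le> ennreal (?s e ^ d) * hcost (mat_dist A) d (F ` E)"
      unfolding hcost_def by (metis mult.left_commute mult_left_mono zero_le)
    have "emeasure (gmeas 0) E \<le> ennreal ((1 + e) * dens x0) * emeasure (lebesgue_fun d) E"
    proof (rule emeasure_gmeas_le[OF Es])
      fix x assume "x \<in> E"
      then have "\<bar>dens x - dens x0\<bar> < e * dens x0" using E sub r2 by blast
      then show "dens x + 0 \<le> (1 + e) * dens x0" by (simp add: algebra_simps)
    qed (use E sub r1 in auto)
    also have "\<dots> = ennreal (1 + e) * (ennreal (sqrt (Determinant.det (G x0))) * emeasure (lebesgue_fun d) E)"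
      using e dens by (simp add: ennreal_mult mult.assoc dens_def)
    also have "\<dots> \<le> ennreal (1 + e) * (ennreal (?s e ^ d) * hcost (mat_dist A) d (F ` E))"
      by (intro mult_left_mono order_trans[OF hcost_isodiametric[OF G d Es] hc]) auto
    also have "\<dots> = ennreal ((1 + e) * ?s e ^ d) * hcost (mat_dist A) d (F ` E)"
    proof -
      have "0 \<le> ?s e ^ d" using s by (intro zero_le_power) simp
      then show ?thesis using e(1) by (simp only: ennreal_mult[of "1 + e" "?s e ^ d"] mult.assoc)
    qed
    also have "\<dots> \<le> ennreal l * hcost (mat_dist A) d (F ` E)"
      using e by (intro mult_right_mono ennreal_leI) auto
    finally show "emeasure (gmeas 0) E \<le> ennreal l * hcost (mat_dist A) d (F ` E)" .
  qed
qed

text \<open>Uniform continuity of the inverse on a compact set: the image distance attains a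
  positive minimum over the pairs of points at distance at least \<open>e\<close>.\<close>

lemma compact_separation:
  assumes K: "compact K" "K \<subseteq> \<Omega>" and inj: "\<And>x y. x \<in> K \<Longrightarrow> y \<in> K \<Longrightarrow> (\<And>i. i < D \<Longrightarrow> F x i = F y i) \<Longrightarrow> x = y"
    and e: "e > 0"
  shows "\<exists>\<delta>>0. \<forall>x\<in>K. \<forall>y\<in>K. mat_dist A (F x) (F y) \<le> \<delta> \<longrightarrow> dist x y < e"
proof -
  let ?C = "(K \<times> K) \<inter> {p. e \<le> dist (fst p) (snd p)}"
  show ?thesis
  proof (cases "?C = {}")
    case True
    then show ?thesis by (intro exI[of _ 1]) (auto simp: not_le)
  next
    case False
    have "compact ?C"
      by (intro compact_Int_closed compact_Times K closed_Collect_le continuous_intros)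
    moreover have "continuous_on ?C (\<lambda>p. mat_dist A (F (fst p)) (F (snd p)))"
      using K(2) by (intro continuous_on_mat_dist[OF A_carrier] continuous_on_compose2[OF F_continuous] continuous_intros) auto
    ultimately obtain p where p: "p \<in> ?C" "\<And>q. q \<in> ?C \<Longrightarrow> mat_dist A (F (fst p)) (F (snd p)) \<le> mat_dist A (F (fst q)) (F (snd q))"
      using continuous_attains_inf[OF _ False] by blast
    define m where "m = mat_dist A (F (fst p)) (F (snd p))"
    have "fst p \<noteq> snd p" using p(1) e by auto
    then have "\<not> (\<forall>i<D. F (fst p) i = F (snd p) i)"
      using inj[of "fst p" "snd p"] p(1) by (auto simp: mem_Times_iff)
    then obtain i where "i < D" "F (fst p) i \<noteq> F (snd p) i" by blast
    then have m: "m > 0" unfolding m_def by (rule mat_dist_pos[OF A])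
    show ?thesis
    proof (intro exI[of _ "m / 2"] conjI ballI impI)
      fix x y assume xy: "x \<in> K" "y \<in> K" "mat_dist A (F x) (F y) \<le> m / 2"
      show "dist x y < e"
      proof (rule ccontr)
        assume "\<not> ?thesis"
        then have "m \<le> mat_dist A (F x) (F y)" using p(2)[of "(x, y)"] xy by (simp add: m_def)
        then show False using xy m by simp
      qed
    qed (use m in simp)
  qed
qed

text \<open>A sufficiently fine cover of the image pulls back to small sets, to each of which
  \<open>gmeas_le_hcost_image\<close> applies; injectivity is what makes the pulled back sets
  small.\<close>

lemma gmeas_compact_le:
  assumes K: "compact K" "K \<subseteq> \<Omega>" and dens: "\<And>x. x \<in> K \<Longrightarrow> dens x > 0"
    and inj: "\<And>x y. x \<in> K \<Longrightarrow> y \<in> K \<Longrightarrow> (\<And>i. i < D \<Longrightarrow> F x i = F y i) \<Longrightarrow> x = y"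
  shows "emeasure (gmeas 0) K \<le> Vol A d (F ` K)"
proof (rule ennreal_le_of_scaled)
  fix l :: real assume l: "l > 1"
  have Ks: "S \<in> sets (lebesgue_fun d)" if "closed S" "S \<subseteq> K" for S
  proof -
    have "S \<inter> ext_space d \<in> sets (lebesgue_fun d)" using that(1) by (intro borel_Int_ext_space) auto
    moreover have "S \<inter> ext_space d = S" using that(2) K \<Omega>_sub by blast
    ultimately show ?thesis by simp
  qed
  have "\<exists>r>0. near_box d r x \<subseteq> \<Omega> \<and> (\<forall>E\<in>sets (lebesgue_fun d). E \<subseteq> near_box d r x \<longrightarrow>
      emeasure (gmeas 0) E \<le> ennreal l * hcost (mat_dist A) d (F ` E))" if "x \<in> K" for x
    using gmeas_le_hcost_image[OF _ dens l] that K by blast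
  then obtain r where r: "\<And>x. x \<in> K \<Longrightarrow> r x > 0" "\<And>x E. x \<in> K \<Longrightarrow> E \<in> sets (lebesgue_fun d) \<Longrightarrow> E \<subseteq> near_box d (r x) x \<Longrightarrow>
      emeasure (gmeas 0) E \<le> ennreal l * hcost (mat_dist A) d (F ` E)"
    by metis
  let ?O = "\<lambda>x. {y. \<forall>j<d. \<bar>y j - x j\<bar> < r x}"
  have c1: "K \<subseteq> \<Union> (?O ` K)" using r(1) by fastforce
  have c2: "\<And>B. B \<in> ?O ` K \<Longrightarrow> open B" using open_coords_near by blast
  \<comment> \<open>A Lebesgue number of the cover by good boxes: below the scale
    \<open>\<delta>\<close>, each pulled back covering set lies in one of them.\<close>
  obtain e where e: "e > 0" "\<And>x. x \<in> K \<Longrightarrow> \<exists>B\<in>?O ` K. ball x e \<subseteq> B"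
    by (rule Heine_Borel_lemma[OF K(1) c1 c2]) (assumption | blast | erule (1) that)+
  obtain \<delta> where \<delta>: "\<delta> > 0" "\<And>x y. x \<in> K \<Longrightarrow> y \<in> K \<Longrightarrow> mat_dist A (F x) (F y) \<le> \<delta> \<Longrightarrow> dist x y < e"
    using compact_separation[OF K inj e(1)] by blast
  have "emeasure (gmeas 0) K / ennreal l \<le> hausdorff_pre_measure (mat_dist A) d (ennreal \<delta>) (F ` K)"
  proof (rule hausdorff_pre_measure_ge[OF d])
    fix U assume U: "F ` K \<subseteq> (\<Union>i. U i)" "\<And>i::nat. ediam (mat_dist A) (U i) \<le> ennreal \<delta>"
    \<comment> \<open>Covering sets need not be measurable. Closures of their preimages are, and by
      continuity the images of these closures have no larger diameter.\<close>
    define E where "E = (\<lambda>i. closure {x \<in> K. F x \<in> U i})"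
    have EK: "E i \<subseteq> K" for i
      unfolding E_def using K(1) by (intro closure_minimal compact_imp_closed) auto
    have Es: "E i \<in> sets (lebesgue_fun d)" for i
      using EK[of i] by (intro Ks) (auto simp: E_def)
    have diam: "ennreal (mat_dist A (F x) (F y)) \<le> ediam (mat_dist A) (U i)" if xy: "x \<in> E i" "y \<in> E i" for x y i
    proof -
      obtain t where t: "ediam (mat_dist A) (U i) = ennreal t" "t \<ge> 0"
        using U(2)[of i] by (cases "ediam (mat_dist A) (U i)") (auto simp: top_unique)
      let ?S = "{x \<in> K. F x \<in> U i}"
      let ?T = "(K \<times> K) \<inter> (\<lambda>p. mat_dist A (F (fst p)) (F (snd p))) -` {..t}"
      have cont: "continuous_on (K \<times> K) (\<lambda>p. mat_dist A (F (fst p)) (F (snd p)))"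
        using K(2) by (intro continuous_on_mat_dist[OF A_carrier] continuous_on_compose2[OF F_continuous] continuous_intros) auto
      have "closed ?T"
        by (rule continuous_closed_preimage[OF cont]) (simp_all add: closed_Times compact_imp_closed K(1))
      moreover have "?S \<times> ?S \<subseteq> ?T"
      proof
        fix p assume p: "p \<in> ?S \<times> ?S"
        then have "ennreal (mat_dist A (F (fst p)) (F (snd p))) \<le> ennreal t"
          unfolding t(1)[symmetric] by (intro ediam_upper) auto
        then show "p \<in> ?T" using p t(2) by (auto simp: ennreal_le_iff)
      qed
      ultimately have "closure (?S \<times> ?S) \<subseteq> ?T" by (intro closure_minimal)
      then have "(x, y) \<in> ?T" using xy by (auto simp: E_def closure_Times)
      then show ?thesis using t by (auto intro: ennreal_leI)
    qed
    have "emeasure (gmeas 0) (E i) \<le> ennreal l * hcost (mat_dist A) d (U i)" for i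
    proof (cases "E i = {}")
      case False
      then obtain x where x: "x \<in> E i" by blast
      obtain c where c: "c \<in> K" "ball x e \<subseteq> ?O c" using e(2)[of x] x EK by blast
      have "E i \<subseteq> near_box d (r c) c"
      proof
        fix y assume y: "y \<in> E i"
        have "ennreal (mat_dist A (F x) (F y)) \<le> ennreal \<delta>" using diam[OF x y] U(2)[of i] by (rule order_trans)
        then have "dist x y < e" using x y EK \<delta> by (intro \<delta>(2)) (auto simp: ennreal_le_iff)
        then have "y \<in> ?O c" using c by auto
        then show "y \<in> near_box d (r c) c" using EK[of i] y K(2) \<Omega>_sub unfolding near_box_def by blast
      qed
      then have "emeasure (gmeas 0) (E i) \<le> ennreal l * hcost (mat_dist A) d (F ` E i)"
        by (rule r(2)[OF c(1) Es])
      also have "\<dots> \<le> ennreal l * hcost (mat_dist A) d (U i)"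
        using diam by (intro mult_left_mono hcost_mono_ediam) (auto simp: ediam_le_iff)
      finally show ?thesis .
    qed simp
    then have "(\<Sum>i. emeasure (gmeas 0) (E i)) \<le> (\<Sum>i. ennreal l * hcost (mat_dist A) d (U i))"
      by (intro suminf_le) auto
    moreover have "emeasure (gmeas 0) K \<le> emeasure (gmeas 0) (\<Union>i. E i)"
    proof (rule emeasure_mono)
      show "K \<subseteq> (\<Union>i. E i)"
      proof
        fix x assume x: "x \<in> K"
        then obtain i where "F x \<in> U i" using U(1) by blast
        then have "x \<in> E i" using x closure_subset[of "{x \<in> K. F x \<in> U i}"] by (auto simp: E_def)
        then show "x \<in> (\<Union>i. E i)" by blast
      qed
      show "(\<Union>i. E i) \<in> sets (gmeas 0)" using Es by auto
    qed
    moreover have "\<dots> \<le> (\<Sum>i. emeasure (gmeas 0) (E i))"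
      using Es by (intro emeasure_subadditive_countably) auto
    ultimately have "emeasure (gmeas 0) K \<le> (\<Sum>i. hcost (mat_dist A) d (U i)) * ennreal l"
      by (simp add: mult.commute)
    then show "emeasure (gmeas 0) K / ennreal l \<le> (\<Sum>i. hcost (mat_dist A) d (U i))"
      using l by (intro divide_le_posI_ennreal) (auto simp: mult.commute)
  qed
  also have "\<dots> \<le> Vol A d (F ` K)"
    unfolding Vol_def using \<delta> by (intro hausdorff_pre_measure_le_hausdorff_measure) simp
  finally have "ennreal l * (emeasure (gmeas 0) K / ennreal l) \<le> ennreal l * Vol A d (F ` K)"
    by (intro mult_left_mono) auto
  then show "emeasure (gmeas 0) K \<le> ennreal l * Vol A d (F ` K)"
    using l by (simp add: ennreal_mult_divide_cancel)
qed

text \<open>Points of zero density carry no \<open>gmeas 0\<close>. The remaining set is open, hence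
  an increasing union of compact sets on which the density is positive.\<close>

lemma gmeas_exhaustion:
  "\<exists>K :: nat \<Rightarrow> (nat \<Rightarrow> real) set. (\<forall>n. compact (K n) \<and> K n \<subseteq> \<Omega> \<and> (\<forall>x\<in>K n. dens x > 0)) \<and>
    incseq (\<lambda>n. emeasure (gmeas 0) (K n)) \<and> (SUP n. emeasure (gmeas 0) (K n)) = emeasure (gmeas 0) \<Omega>"
proof -
  let ?Op = "\<Omega> \<inter> dens -` {0<..}"
  have Op: "ext_open d ?Op"
    by (rule openin_trans[OF continuous_openin_preimage_gen[OF dens_continuous open_greaterThan] \<Omega>])
  obtain K where K: "incseq K" "\<And>n. compact (K n)" "(\<Union>n. K n) = ?Op"
    using ext_open_compact_exhaustion[OF Op] by blast
  have Ks: "K n \<in> sets (lebesgue_fun d)" for n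
  proof -
    have "K n \<inter> ext_space d \<in> sets (lebesgue_fun d)" using K(2)[of n] by (intro borel_Int_ext_space) (auto simp: compact_imp_closed)
    moreover have "K n \<inter> ext_space d = K n" using K(3) \<Omega>_sub by blast
    ultimately show ?thesis by simp
  qed
  have "emeasure (gmeas 0) \<Omega> = emeasure (gmeas 0) ?Op"
  proof -
    have "ennreal (dens x) * indicator \<Omega> x = ennreal (dens x) * indicator ?Op x" for x
      using dens_nonneg[of x] by (auto simp: indicator_def)
    then show ?thesis
      using emeasure_gmeas[OF ext_open_sets[OF \<Omega>], of 0] emeasure_gmeas[OF ext_open_sets[OF Op], of 0] by simp
  qed
  also have "\<dots> = (SUP n. emeasure (gmeas 0) (K n))"
    unfolding K(3)[symmetric] using K(1) Ks by (intro SUP_emeasure_incseq[symmetric]) auto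
  finally have "(SUP n. emeasure (gmeas 0) (K n)) = emeasure (gmeas 0) \<Omega>" by simp
  moreover have "incseq (\<lambda>n. emeasure (gmeas 0) (K n))"
    using K(1) Ks by (auto simp: incseq_def intro!: emeasure_mono)
  moreover have "K n \<subseteq> ?Op" for n using K(3) by blast
  ultimately show ?thesis using K(2) by (intro exI[of _ K]) auto
qed

theorem Vol_image_ge:
  assumes inj: "\<And>x y. x \<in> \<Omega> \<Longrightarrow> y \<in> \<Omega> \<Longrightarrow> (\<And>i. i < D \<Longrightarrow> F x i = F y i) \<Longrightarrow> x = y"
  shows "emeasure (gmeas 0) \<Omega> \<le> Vol A d (F ` \<Omega>)"
proof -
  obtain K where K0: "\<forall>n::nat. compact (K n) \<and> K n \<subseteq> \<Omega> \<and> (\<forall>x\<in>K n. dens x > 0)"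
    and K4: "incseq (\<lambda>n. emeasure (gmeas 0) (K n))"
    and K5: "(SUP n. emeasure (gmeas 0) (K n)) = emeasure (gmeas 0) \<Omega>"
    using gmeas_exhaustion by blast
  have K: "\<And>n. compact (K n)" "\<And>n. K n \<subseteq> \<Omega>" "\<And>n x. x \<in> K n \<Longrightarrow> dens x > 0"
    using K0 by blast+
  have "emeasure (gmeas 0) (K n) \<le> Vol A d (F ` \<Omega>)" for n
  proof -
    have "emeasure (gmeas 0) (K n) \<le> Vol A d (F ` K n)"
    proof (rule gmeas_compact_le[OF K(1-3)])
      fix x y assume "x \<in> K n" "y \<in> K n" "\<And>i. i < D \<Longrightarrow> F x i = F y i"
      then show "x = y" using K(2)[of n] by (intro inj) auto
    qed
    also have "\<dots> \<le> Vol A d (F ` \<Omega>)"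
      unfolding Vol_def using K(2) by (intro hausdorff_measure_mono d image_mono)
    finally show ?thesis .
  qed
  then show ?thesis unfolding K5[symmetric] by (intro SUP_least)
qed

end

text \<open>Additivity for two images that may touch in the limit: compact pieces with disjoint
  images have positive distance, so \<open>hausdorff_measure_Un_separated\<close> applies to them
  before passing to the supremum.\<close>

theorem Vol_disjoint_images_ge:
  assumes P1: "C1_param d D \<Omega>1 F1 A" and P2: "C1_param d D \<Omega>2 F2 A"
    and inj1: "\<And>x y. x \<in> \<Omega>1 \<Longrightarrow> y \<in> \<Omega>1 \<Longrightarrow> (\<And>i. i < D \<Longrightarrow> F1 x i = F1 y i) \<Longrightarrow> x = y"
    and inj2: "\<And>x y. x \<in> \<Omega>2 \<Longrightarrow> y \<in> \<Omega>2 \<Longrightarrow> (\<And>i. i < D \<Longrightarrow> F2 x i = F2 y i) \<Longrightarrow> x = y"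
    and disj: "\<And>x y. x \<in> \<Omega>1 \<Longrightarrow> y \<in> \<Omega>2 \<Longrightarrow> \<exists>i<D. F1 x i \<noteq> F2 y i"
  shows "emeasure (C1_param.gmeas d D \<Omega>1 F1 A 0) \<Omega>1 + emeasure (C1_param.gmeas d D \<Omega>2 F2 A 0) \<Omega>2
    \<le> Vol A d (F1 ` \<Omega>1 \<union> F2 ` \<Omega>2)"
proof -
  interpret P1: C1_param d D \<Omega>1 F1 A by (rule P1)
  interpret P2: C1_param d D \<Omega>2 F2 A by (rule P2)
  obtain K1 where K10: "\<forall>n::nat. compact (K1 n) \<and> K1 n \<subseteq> \<Omega>1 \<and> (\<forall>x\<in>K1 n. P1.dens x > 0)"
    and K14: "incseq (\<lambda>n. emeasure (P1.gmeas 0) (K1 n))"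
    and K15: "(SUP n. emeasure (P1.gmeas 0) (K1 n)) = emeasure (P1.gmeas 0) \<Omega>1"
    using P1.gmeas_exhaustion by blast
  have K1: "\<And>n. compact (K1 n)" "\<And>n. K1 n \<subseteq> \<Omega>1" "\<And>n x. x \<in> K1 n \<Longrightarrow> P1.dens x > 0"
    using K10 by blast+
  obtain K2 where K20: "\<forall>n::nat. compact (K2 n) \<and> K2 n \<subseteq> \<Omega>2 \<and> (\<forall>x\<in>K2 n. P2.dens x > 0)"
    and K24: "incseq (\<lambda>n. emeasure (P2.gmeas 0) (K2 n))"
    and K25: "(SUP n. emeasure (P2.gmeas 0) (K2 n)) = emeasure (P2.gmeas 0) \<Omega>2"
    using P2.gmeas_exhaustion by blast
  have K2: "\<And>n. compact (K2 n)" "\<And>n. K2 n \<subseteq> \<Omega>2" "\<And>n x. x \<in> K2 n \<Longrightarrow> P2.dens x > 0"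
    using K20 by blast+
  have "emeasure (P1.gmeas 0) (K1 n) + emeasure (P2.gmeas 0) (K2 n) \<le> Vol A d (F1 ` \<Omega>1 \<union> F2 ` \<Omega>2)" for n
  proof -
    have "\<exists>e>0. \<forall>x\<in>K1 n. \<forall>y\<in>K2 n. e \<le> mat_dist A (F1 x) (F2 y)"
    proof (cases "K1 n \<times> K2 n = {}")
      case False
      have "continuous_on (K1 n \<times> K2 n) (\<lambda>p. mat_dist A (F1 (fst p)) (F2 (snd p)))"
        using K1(2) K2(2) by (intro continuous_on_mat_dist[OF P1.A_carrier] continuous_on_compose2[OF P1.F_continuous]
           continuous_on_compose2[OF P2.F_continuous] continuous_intros) auto
      then obtain p where p: "p \<in> K1 n \<times> K2 n" "\<And>q. q \<in> K1 n \<times> K2 n \<Longrightarrow>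
          mat_dist A (F1 (fst p)) (F2 (snd p)) \<le> mat_dist A (F1 (fst q)) (F2 (snd q))"
        using continuous_attains_inf[OF compact_Times[OF K1(1) K2(1)] False] by blast
      have "fst p \<in> \<Omega>1" "snd p \<in> \<Omega>2" using p(1) K1(2)[of n] K2(2)[of n] by (auto simp: mem_Times_iff)
      then obtain i where "i < D" "F1 (fst p) i \<noteq> F2 (snd p) i" using disj by blast
      then have "mat_dist A (F1 (fst p)) (F2 (snd p)) > 0" by (rule mat_dist_pos[OF P1.A])
      then show ?thesis using p(2) by (intro exI[of _ "mat_dist A (F1 (fst p)) (F2 (snd p))"]) auto
    qed (auto intro: exI[of _ 1])
    then obtain e where e: "e > 0" "\<And>x y. x \<in> K1 n \<Longrightarrow> y \<in> K2 n \<Longrightarrow> e \<le> mat_dist A (F1 x) (F2 y)" by blast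
    have "emeasure (P1.gmeas 0) (K1 n) \<le> Vol A d (F1 ` K1 n)"
    proof (rule P1.gmeas_compact_le[OF K1(1-3)])
      fix x y assume "x \<in> K1 n" "y \<in> K1 n" "\<And>i. i < D \<Longrightarrow> F1 x i = F1 y i"
      then show "x = y" using K1(2)[of n] by (intro inj1) auto
    qed
    moreover have "emeasure (P2.gmeas 0) (K2 n) \<le> Vol A d (F2 ` K2 n)"
    proof (rule P2.gmeas_compact_le[OF K2(1-3)])
      fix x y assume "x \<in> K2 n" "y \<in> K2 n" "\<And>i. i < D \<Longrightarrow> F2 x i = F2 y i"
      then show "x = y" using K2(2)[of n] by (intro inj2) auto
    qed
    moreover have "Vol A d (F1 ` K1 n) + Vol A d (F2 ` K2 n) \<le> Vol A d (F1 ` K1 n \<union> F2 ` K2 n)"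
      unfolding Vol_def using e by (intro hausdorff_measure_Un_separated[OF P1.d e(1)]) auto
    moreover have "\<dots> \<le> Vol A d (F1 ` \<Omega>1 \<union> F2 ` \<Omega>2)"
      unfolding Vol_def using K1(2) K2(2) by (intro hausdorff_measure_mono P1.d Un_mono image_mono)
    ultimately show ?thesis by (meson add_mono order_trans)
  qed
  then show ?thesis
    unfolding K15[symmetric] K25[symmetric] ennreal_SUP_add[OF K14 K24, symmetric] by (intro SUP_least)
qed


section \<open>Polynomials nonnegative on an interval and their dual cone\<close>

text \<open>The Riesz functional of \<open>x\<close>: for moments of a measure it integrates the
  polynomial.\<close>

definition pairing :: "nat \<Rightarrow> (nat \<Rightarrow> real) \<Rightarrow> real poly \<Rightarrow> real" where
  "pairing n x p = (\<Sum>i\<le>n. x i * coeff p i)"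

lemma pairing_add_right: "pairing n x (p + q) = pairing n x p + pairing n x q"
  by (simp add: pairing_def sum.distrib algebra_simps)

lemma pairing_smult_right: "pairing n x (Polynomial.smult c p) = c * pairing n x p"
  by (simp add: pairing_def sum_distrib_left algebra_simps)

lemma pairing_diff_right: "pairing n x (p - q) = pairing n x p - pairing n x q"
  by (simp add: pairing_def sum_subtractf algebra_simps)

lemma pairing_minus_right: "pairing n x (- p) = - pairing n x p"
  by (simp add: pairing_def sum_negf)

lemma pairing_zero_right [simp]: "pairing n x 0 = 0"
  by (simp add: pairing_def)

lemma pairing_sum_right: "finite I \<Longrightarrow> pairing n x (\<Sum>i\<in>I. f i) = (\<Sum>i\<in>I. pairing n x (f i))"
  by (induction I rule: finite_induct) (simp_all add: pairing_add_right)

lemma pairing_combination_left: "pairing n (\<lambda>i. s * x i + t * y i) p = s * pairing n x p + t * pairing n y p"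
  by (simp add: pairing_def sum.distrib sum_distrib_left algebra_simps)

lemma pairing_cong: "(\<And>i. i \<le> n \<Longrightarrow> x i = y i) \<Longrightarrow> pairing n x p = pairing n y p"
  by (simp add: pairing_def)

lemma poly_eq_sum_le: "degree p \<le> n \<Longrightarrow> poly p t = (\<Sum>i\<le>n. coeff p i * t ^ i)" for t :: real
  by (simp add: poly_altdef) (auto intro!: sum.mono_neutral_left le_degree simp: coeff_eq_0)

lemma pairing_powers: "degree p \<le> n \<Longrightarrow> pairing n (\<lambda>i. z ^ i) p = poly p z"
  by (simp add: pairing_def poly_eq_sum_le mult.commute)

lemma pairing_unit: "pairing n (\<lambda>i. if i = n then c else 0) p = c * coeff p n"
proof -
  have "pairing n (\<lambda>i. if i = n then c else 0) p = (\<Sum>i\<le>n. if i = n then c * coeff p n else 0)"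
    unfolding pairing_def by (intro sum.cong) auto
  then show ?thesis by simp
qed

lemma pairing_monom: "i \<le> n \<Longrightarrow> pairing n x (monom 1 i) = x i"
proof -
  assume i: "i \<le> n"
  have "pairing n x (monom 1 i) = (\<Sum>j\<le>n. if j = i then x i else 0)"
    unfolding pairing_def by (intro sum.cong) auto
  then show ?thesis using i by simp
qed

lemma poly_eventually_nonneg_top:
  fixes r :: "real poly"
  assumes "degree r \<le> n" "coeff r n > 0"
  shows "\<exists>R. \<forall>t\<ge>R. poly r t \<ge> 0"
proof -
  have "degree r = n" using assms by (intro antisym le_degree) auto
  then have "lead_coeff r > 0" using assms by simp
  from poly_pinfty_gt_lc[OF this] obtain R where "\<And>t. t \<ge> R \<Longrightarrow> poly r t \<ge> lead_coeff r" by blast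
  then show ?thesis using \<open>lead_coeff r > 0\<close> by (intro exI[of _ R]) (meson less_imp_le order_trans)
qed

lemma poly_eventually_nonneg_bot:
  fixes r :: "real poly"
  assumes "degree r \<le> n" "coeff r n > 0" "even n"
  shows "\<exists>R. \<forall>t\<le>R. poly r t \<ge> 0"
proof -
  let ?s = "pcompose r [:0, -1:]"
  have "degree ?s \<le> n" using assms(1) by (simp add: degree_pcompose)
  moreover have "coeff ?s n = coeff r n" using assms(3) by (simp add: coeff_pcompose_linear)
  ultimately obtain R where R: "\<And>t. t \<ge> R \<Longrightarrow> poly ?s t \<ge> 0" using poly_eventually_nonneg_top[of ?s n] assms by auto
  show ?thesis using R[of "- t" for t] by (intro exI[of _ "- R"]) (auto simp: poly_pcompose)
qed

lemma coeff_nonneg_of_nonneg_top: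
  fixes p :: "real poly"
  assumes "degree p \<le> n" "\<And>t. t \<ge> R \<Longrightarrow> poly p t \<ge> 0"
  shows "coeff p n \<ge> 0"
proof (rule ccontr)
  assume neg: "\<not> ?thesis"
  then have "degree (- p) = n" using assms(1) by (simp add: antisym le_degree)
  then have "lead_coeff (- p) > 0" using neg by simp
  from poly_pinfty_gt_lc[OF this] obtain S where S: "\<And>t. t \<ge> S \<Longrightarrow> poly (- p) t \<ge> lead_coeff (- p)" by blast
  show False using S[of "max R S"] assms(2)[of "max R S"] \<open>lead_coeff (- p) > 0\<close> by simp
qed

section \<open>Multiplicities of zeros and interpolation\<close>

lemma roots_prod_factor:
  fixes p :: "real poly"
  assumes "finite I" "p \<noteq> 0" "\<And>z. z \<in> I \<Longrightarrow> k z \<le> order z p"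
  shows "\<exists>r. p = (\<Prod>z\<in>I. [:- z, 1:] ^ k z) * r"
  using assms
proof (induction I rule: finite_induct)
  case (insert z I)
  then obtain r where r: "p = (\<Prod>z\<in>I. [:- z, 1:] ^ k z) * r" by auto
  let ?Q = "\<Prod>z\<in>I. [:- z, 1:] ^ k z"
  have "poly ?Q z \<noteq> 0" using insert.hyps by (auto simp: poly_prod)
  then have "order z ?Q = 0" by (simp add: order_0I)
  moreover have "order z p = order z ?Q + order z r" using r insert.prems(1) by (simp add: order_mult)
  ultimately have "k z \<le> order z r" using insert.prems(2)[of z] by simp
  then have "[:- z, 1:] ^ k z dvd r" by (simp add: order_divides)
  then obtain s where "r = [:- z, 1:] ^ k z * s" by (elim dvdE)
  then have "p = (\<Prod>z\<in>insert z I. [:- z, 1:] ^ k z) * s" using r insert.hyps by (simp add: mult_ac)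
  then show ?case by blast
qed auto

lemma sum_orders_le_degree:
  fixes p :: "real poly"
  assumes "finite I" "p \<noteq> 0" "\<And>z. z \<in> I \<Longrightarrow> k z \<le> order z p"
  shows "(\<Sum>z\<in>I. k z) \<le> degree p"
proof -
  obtain r where r: "p = (\<Prod>z\<in>I. [:- z, 1:] ^ k z) * r" using roots_prod_factor[of I p k] assms by blast
  have "degree (\<Prod>z\<in>I. [:- z, 1:] ^ k z) = (\<Sum>z\<in>I. k z)"
    by (subst degree_prod_sum_eq) (auto simp: degree_power_eq)
  moreover have "degree p = degree (\<Prod>z\<in>I. [:- z, 1:] ^ k z) + degree r"
    using r assms(2) by (metis degree_mult_eq mult_eq_0_iff)
  ultimately show ?thesis by simp
qed

text \<open>An interior zero is a local minimum, so the derivative vanishes there too.\<close>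

lemma order_ge_2_of_interior_zero:
  fixes p :: "real poly"
  assumes "p \<noteq> 0" "z \<in> interior S" "\<And>t. t \<in> S \<Longrightarrow> poly p t \<ge> 0" "poly p z = 0"
  shows "2 \<le> order z p"
proof -
  obtain e where e: "e > 0" "ball z e \<subseteq> S" using assms(2) by (auto simp: mem_interior)
  have "poly (pderiv p) z = 0"
    by (rule DERIV_local_min[OF poly_DERIV e(1)])
       (use e(2) assms(3,4) in \<open>auto simp: dist_real_def abs_minus_commute subset_iff\<close>)
  moreover obtain q where q: "p = [:- z, 1:] * q" using assms(4) by (auto simp: poly_eq_0_iff_dvd)
  moreover have "pderiv p = [:- z, 1:] * pderiv q + q * pderiv [:- z, 1:]"
    unfolding q by (rule pderiv_mult)
  ultimately have "poly q z = 0" by (simp add: pderiv_pCons)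
  then obtain s where "q = [:- z, 1:] * s" by (auto simp: poly_eq_0_iff_dvd)
  then have "p = [:- z, 1:] ^ 2 * s" by (simp only: q power2_eq_square mult.assoc)
  then have "[:- z, 1:] ^ 2 dvd p" by (rule dvdI)
  then show ?thesis using assms(1) by (simp only: order_divides) simp
qed

definition lagrange_poly :: "real set \<Rightarrow> real \<Rightarrow> real poly" where
  "lagrange_poly Z z = Polynomial.smult (1 / (\<Prod>y\<in>Z - {z}. z - y)) (\<Prod>y\<in>Z - {z}. [:- y, 1:])"

lemma poly_lagrange_poly:
  assumes "finite Z" "z \<in> Z" "y \<in> Z"
  shows "poly (lagrange_poly Z z) y = (if y = z then 1 else 0)"
proof (cases "y = z")
  case True
  have "(\<Prod>y\<in>Z - {z}. z - y) \<noteq> 0" using assms(1) by (simp add: prod_zero_iff)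
  then show ?thesis using True by (simp add: lagrange_poly_def poly_prod)
next
  case False
  then have "(\<Prod>x\<in>Z - {z}. y - x) = 0" using assms by (intro prod_zero) auto
  then show ?thesis using False by (simp add: lagrange_poly_def poly_prod)
qed

lemma degree_lagrange_poly:
  assumes "finite Z" "z \<in> Z"
  shows "degree (lagrange_poly Z z) < card Z"
proof -
  have "degree (lagrange_poly Z z) \<le> degree (\<Prod>y\<in>Z - {z}. [:- y, 1:])"
    unfolding lagrange_poly_def by (rule degree_smult_le)
  also have "\<dots> = card (Z - {z})" by (subst degree_prod_sum_eq) auto
  finally show ?thesis using assms by (simp add: card_Diff_singleton card_gt_0_iff) (metis Suc_pred assms card_gt_0_iff empty_iff le_imp_less_Suc)
qed

text \<open>Vandermonde, extended by a point at infinity of weight \<open>c\<close> whose moment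
  vector is the last unit vector. Testing with Lagrange polynomials isolates each node; if
  \<open>c\<close> is present, one node fewer keeps their degree below \<open>n\<close>, so that
  infinity is not seen.\<close>

lemma moments_independent:
  fixes w :: "real \<Rightarrow> real"
  assumes Z: "finite Z" "card Z \<le> n + 1" "c \<noteq> 0 \<Longrightarrow> card Z \<le> n"
    and eq: "\<And>i. i \<le> n \<Longrightarrow> (\<Sum>z\<in>Z. w z * z ^ i) + (if i = n then c else 0) = 0"
  shows "(\<forall>z\<in>Z. w z = 0) \<and> c = 0"
proof -
  have lin: "(\<Sum>z\<in>Z. w z * poly q z) + c * coeff q n = 0" if q: "degree q \<le> n" for q
  proof -
    have "(\<Sum>i\<le>n. coeff q i * ((\<Sum>z\<in>Z. w z * z ^ i) + (if i = n then c else 0))) = 0"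
      using eq by (intro sum.neutral) auto
    moreover have "(\<Sum>i\<le>n. coeff q i * ((\<Sum>z\<in>Z. w z * z ^ i) + (if i = n then c else 0))) =
        (\<Sum>i\<le>n. \<Sum>z\<in>Z. w z * (coeff q i * z ^ i)) + (\<Sum>i\<le>n. if i = n then c * coeff q n else 0)"
      unfolding sum.distrib[symmetric] by (intro sum.cong refl) (auto simp: distrib_left sum_distrib_left mult_ac)
    moreover have "(\<Sum>i\<le>n. \<Sum>z\<in>Z. w z * (coeff q i * z ^ i)) = (\<Sum>z\<in>Z. w z * poly q z)"
      by (subst sum.swap) (simp add: poly_eq_sum_le[OF q] sum_distrib_left)
    ultimately show ?thesis by simp
  qed
  have w: "w z = 0" if z: "z \<in> Z" for z
  proof -
    note deg = degree_lagrange_poly[OF Z(1) z]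
    have "c * coeff (lagrange_poly Z z) n = 0"
    proof (cases "c = 0")
      case False
      then have "degree (lagrange_poly Z z) < n" using deg Z(3) by simp
      then show ?thesis by (simp add: coeff_eq_0)
    qed simp
    moreover have "(\<Sum>y\<in>Z. w y * poly (lagrange_poly Z z) y) = (\<Sum>y\<in>Z. if y = z then w z else 0)"
      using Z(1) z by (intro sum.cong) (auto simp: poly_lagrange_poly)
    ultimately show ?thesis using lin[of "lagrange_poly Z z"] deg Z z by auto
  qed
  moreover have "c = 0" using eq[of n] w by simp
  ultimately show ?thesis by blast
qed

section \<open>The dual cone and zeros at infinity\<close>

locale moment_interval =
  fixes n :: nat and a b :: ereal
  assumes n: "n \<ge> 1"
    and ab: "(\<bar>a\<bar> \<noteq> \<infinity> \<and> \<bar>b\<bar> \<noteq> \<infinity> \<and> a < b) \<or> (\<bar>a\<bar> \<noteq> \<infinity> \<and> b = \<infinity>) \<or> (a = -\<infinity> \<and> b = \<infinity> \<and> even n)"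
begin

abbreviation T :: "real set" where "T \<equiv> real_segment a b"

definition nonnegT :: "real poly \<Rightarrow> bool" where
  "nonnegT p \<longleftrightarrow> degree p \<le> n \<and> (\<forall>t\<in>T. poly p t \<ge> 0)"

definition dual :: "(nat \<Rightarrow> real) \<Rightarrow> bool" where
  "dual x \<longleftrightarrow> (\<forall>p. nonnegT p \<longrightarrow> pairing n x p \<ge> 0)"

text \<open>The interior of the dual cone, expressed without topology;
  \<open>moment_cone_boundary_iff\<close> proves the agreement.\<close>

definition strict :: "(nat \<Rightarrow> real) \<Rightarrow> bool" where
  "strict x \<longleftrightarrow> (\<forall>p. nonnegT p \<and> p \<noteq> 0 \<longrightarrow> pairing n x p > 0)"

lemma pairing_psi_real: "degree p \<le> n \<Longrightarrow> pairing n (psi n (ereal z)) p = poly p z"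
  by (subst pairing_cong[where y="\<lambda>i. z ^ i"]) (auto simp: psi_def pairing_powers)

lemma pairing_psi_infinity: "pairing n (psi n \<infinity>) p = coeff p n"
proof -
  have "psi n \<infinity> = (\<lambda>i. if i = n then 1 else 0)" by (auto simp: psi_def fun_eq_iff)
  then show ?thesis by (simp add: pairing_unit)
qed

lemma closed_T: "closed T"
proof -
  have "T = {t. a \<le> ereal t} \<inter> {t. ereal t \<le> b}" by (auto simp: real_segment_def)
  then show ?thesis by (auto intro!: closed_Int closed_Collect_le continuous_on_ereal)
qed

lemma interior_T: "interior T = {t. a < ereal t \<and> ereal t < b}"
proof -
  consider (fin) \<alpha> \<beta> where "a = ereal \<alpha>" "b = ereal \<beta>" "\<alpha> < \<beta>" | (half) \<alpha> where "a = ereal \<alpha>" "b = \<infinity>" | (line) "a = -\<infinity>" "b = \<infinity>"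
    using ab by (cases a; cases b) auto
  then show ?thesis
  proof cases
    case fin
    then have "T = {\<alpha>..\<beta>}" by (auto simp: real_segment_def)
    then show ?thesis using fin by (auto simp: interior_atLeastAtMost_real)
  next
    case half
    then have "T = {\<alpha>..}" by (auto simp: real_segment_def)
    then show ?thesis using half by (auto simp: interior_real_atLeast)
  next
    case line
    then have "T = UNIV" by (auto simp: real_segment_def)
    then show ?thesis using line by auto
  qed
qed

lemma infinite_interior_T: "infinite (interior T)"
proof -
  consider (fin) \<alpha> \<beta> where "a = ereal \<alpha>" "b = ereal \<beta>" "\<alpha> < \<beta>" | (half) \<alpha> where "a = ereal \<alpha>" "b = \<infinity>" | (line) "a = -\<infinity>" "b = \<infinity>"
    using ab by (cases a; cases b) auto
  then obtain s t :: real where "s < t" "{s<..<t} \<subseteq> interior T"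
  proof cases
    case fin
    then have "{\<alpha><..<\<beta>} \<subseteq> interior T" unfolding interior_T by auto
    then show ?thesis using that fin(3) by blast
  next
    case half
    then have "{\<alpha><..<\<alpha> + 1} \<subseteq> interior T" unfolding interior_T by auto
    then show ?thesis using that[of \<alpha> "\<alpha> + 1"] by simp
  next
    case line
    then have "{0<..<1} \<subseteq> interior T" unfolding interior_T by auto
    then show ?thesis using that[of 0 1] by simp
  qed
  then show ?thesis using infinite_Ioo infinite_super by blast
qed

lemma T_cases:
  assumes "t \<in> T"
  shows "t \<in> interior T \<or> a = ereal t \<or> b = ereal t"
  using assms unfolding interior_T by (auto simp: real_segment_def)

text \<open>For \<open>a = -\<infinity>\<close> the junk value \<open>real_of_ereal a = 0\<close> gives $1 + t^n$ with \<open>n\<close> even.\<close>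

definition gpos :: "real poly" where
  "gpos = 1 + [:- real_of_ereal a, 1:] ^ n"

lemma gpos_degree: "degree gpos \<le> n"
  unfolding gpos_def by (intro degree_add_le) (auto simp: degree_power_eq)

lemma gpos_coeff: "coeff gpos n = 1"
proof -
  have "coeff ([:- real_of_ereal a, 1:] ^ n) n = 1"
    using lead_coeff_power[of "[:- real_of_ereal a, 1:]" n] by (simp add: degree_power_eq)
  then show ?thesis using n by (simp add: gpos_def)
qed

lemma gpos_ge: "t \<in> T \<Longrightarrow> poly gpos t \<ge> 1"
proof -
  assume t: "t \<in> T"
  have "(t - real_of_ereal a) ^ n \<ge> 0"
  proof (cases "a = -\<infinity>")
    case True
    then show ?thesis using ab by (intro zero_le_even_power) auto
  next
    case False
    then have "t \<ge> real_of_ereal a" using t ab by (cases a) (auto simp: real_segment_def)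
    then show ?thesis by (intro zero_le_power) simp
  qed
  then show ?thesis by (simp add: gpos_def)
qed

lemma gpos_nonnegT: "nonnegT gpos"
  using gpos_ge gpos_degree by (force simp: nonnegT_def)

lemma nonnegT_coeff:
  assumes "nonnegT p" "b = \<infinity>"
  shows "coeff p n \<ge> 0"
proof (rule coeff_nonneg_of_nonneg_top)
  show "degree p \<le> n" using assms(1) unfolding nonnegT_def by blast
  fix t assume "t \<ge> real_of_ereal a"
  then have "t \<in> T" using assms(2) ab by (cases a) (auto simp: real_segment_def)
  then show "poly p t \<ge> 0" using assms(1) unfolding nonnegT_def by blast
qed

text \<open>On a compact set \<open>p\<close> has a positive minimum where \<open>q\<close> is not
  positive, so a large multiple of \<open>p\<close> outweighs \<open>q\<close> there. For
  \<open>b = \<infinity>\<close> a vanishing coefficient of order \<open>n\<close> is a zero at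
  infinity, and positivity of this coefficient in the combination takes care of large
  arguments.\<close>

lemma nonneg_near_zeros:
  assumes p: "nonnegT p" and q: "degree q \<le> n"
    and zero: "\<And>z. z \<in> T \<Longrightarrow> poly p z = 0 \<Longrightarrow> poly q z > 0"
    and inf: "b = \<infinity> \<Longrightarrow> coeff p n = 0 \<Longrightarrow> coeff q n > 0"
  shows "\<exists>C\<ge>0. nonnegT (q + Polynomial.smult C p)"
proof -
  have compact_part: "\<exists>C0\<ge>0. \<forall>C\<ge>C0. \<forall>t\<in>S. poly q t + C * poly p t \<ge> 0" if S: "compact S" "S \<subseteq> T" for S
  proof -
    let ?S = "S \<inter> {t. poly q t \<le> 0}"
    have cS: "compact ?S" by (intro compact_Int_closed S closed_Collect_le continuous_intros)
    show ?thesis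
    proof (cases "?S = {}")
      case True
      have "poly q t + C * poly p t \<ge> 0" if "C \<ge> 0" "t \<in> S" for C t
        using True that S p by (intro add_nonneg_nonneg mult_nonneg_nonneg) (auto simp: nonnegT_def)
      then show ?thesis by (intro exI[of _ 0]) auto
    next
      case False
      obtain t0 where t0: "t0 \<in> ?S" "\<And>t. t \<in> ?S \<Longrightarrow> poly p t0 \<le> poly p t"
        using continuous_attains_inf[OF cS False continuous_on_poly[OF continuous_on_id, of _ p]] by blast
      obtain t1 where t1: "t1 \<in> ?S" "\<And>t. t \<in> ?S \<Longrightarrow> poly q t1 \<le> poly q t"
        using continuous_attains_inf[OF cS False continuous_on_poly[OF continuous_on_id, of _ q]] by blast
      have "poly p t0 \<noteq> 0" using zero[of t0] t0(1) S by auto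
      then have m: "poly p t0 > 0" using t0(1) S p by (force simp: nonnegT_def)
      have nn: "- poly q t1 / poly p t0 \<ge> 0" using t1(1) m by (intro divide_nonneg_pos) auto
      have "poly q t + C * poly p t \<ge> 0" if C: "C \<ge> - poly q t1 / poly p t0" and t: "t \<in> S" for C t
      proof (cases "t \<in> ?S")
        case True
        have C0: "C \<ge> 0" using C nn by (rule order_trans[rotated])
        have "- poly q t1 \<le> C * poly p t0" using C m by (simp only: pos_divide_le_eq)
        also have "\<dots> \<le> C * poly p t" using t0(2)[OF True] C0 by (intro mult_left_mono)
        finally show ?thesis using t1(2)[OF True] by simp
      next
        case False
        have "C \<ge> 0" using C nn by (rule order_trans[rotated])
        moreover have "poly p t \<ge> 0" using t S p by (auto simp: nonnegT_def)
        ultimately have "C * poly p t \<ge> 0" by simp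
        then show ?thesis using False t by simp
      qed
      then show ?thesis using nn by blast
    qed
  qed
  have deg: "degree (q + Polynomial.smult C p) \<le> n" for C
    using p q by (intro degree_add_le) (auto simp: nonnegT_def intro: order_trans[OF degree_smult_le])
  show ?thesis
  proof (cases "b = \<infinity>")
    case False
    then obtain \<alpha> \<beta> where "a = ereal \<alpha>" "b = ereal \<beta>" using ab by (cases a; cases b) auto
    then have "T = {\<alpha>..\<beta>}" by (auto simp: real_segment_def)
    then have "compact T" by simp
    then obtain C where "C \<ge> 0" "\<forall>t\<in>T. poly q t + C * poly p t \<ge> 0" using compact_part[of T] by blast
    then show ?thesis using deg by (intro exI[of _ C]) (auto simp: nonnegT_def)
  next
    case True
    have pn: "coeff p n \<ge> 0" by (rule nonnegT_coeff[OF p True])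
    obtain C1 where C1: "C1 \<ge> 0" "coeff (q + Polynomial.smult C1 p) n > 0"
    proof (cases "coeff p n = 0")
      case True
      then show ?thesis using inf[OF \<open>b = \<infinity>\<close>] that[of 0] by simp
    next
      case False
      let ?C = "(\<bar>coeff q n\<bar> + 1) / coeff p n"
      have "?C \<ge> 0" using pn by simp
      moreover have "coeff (q + Polynomial.smult ?C p) n > 0" using False by simp
      ultimately show ?thesis by (rule that)
    qed
    obtain R1 where R1: "\<And>t. t \<ge> R1 \<Longrightarrow> poly (q + Polynomial.smult C1 p) t \<ge> 0"
      using poly_eventually_nonneg_top[OF deg C1(2)] by blast
    \<comment> \<open>For a finite left endpoint any bound below it will do; on the line, evenness
      of \<open>n\<close> gives nonnegativity on the far left as well.\<close>
    obtain R2 where R2: "\<And>t. t \<in> T \<Longrightarrow> t \<le> R2 \<Longrightarrow> poly (q + Polynomial.smult C1 p) t \<ge> 0"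
    proof (cases "a = -\<infinity>")
      case True
      then have "even n" using ab by auto
      then show ?thesis using poly_eventually_nonneg_bot[OF deg C1(2)] that by blast
    next
      case False
      then obtain \<alpha> where "a = ereal \<alpha>" using ab by (cases a) auto
      then show ?thesis using that[of "\<alpha> - 1"] by (auto simp: real_segment_def)
    qed
    let ?S = "T \<inter> {R2..R1}"
    have "compact ?S" by (intro closed_Int_compact closed_T compact_Icc)
    then obtain C0 where C0: "C0 \<ge> 0" "\<And>C t. C \<ge> C0 \<Longrightarrow> t \<in> ?S \<Longrightarrow> poly q t + C * poly p t \<ge> 0"
      using compact_part[of ?S] by blast
    define C where "C = max C0 C1"
    have "poly (q + Polynomial.smult C p) t \<ge> 0" if t: "t \<in> T" for t
    proof (cases "t \<in> ?S")
      case True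
      then show ?thesis using C0(2)[of C t] by (simp add: C_def)
    next
      case False
      then have "poly (q + Polynomial.smult C1 p) t \<ge> 0" using t R1[of t] R2[of t] by force
      moreover have "C1 * poly p t \<le> C * poly p t" using t p by (intro mult_right_mono) (auto simp: C_def nonnegT_def)
      ultimately show ?thesis by simp
    qed
    then show ?thesis using deg C0(1) by (intro exI[of _ C]) (auto simp: nonnegT_def C_def)
  qed
qed

text \<open>Adding a small multiple of \<open>gpos\<close> makes \<open>q\<close> strictly positive
  at the zeros of \<open>p\<close>, and the multiple of \<open>p\<close> that
  \<open>nonneg_near_zeros\<close> adds is invisible to \<open>x\<close>.\<close>

lemma dual_nonneg_of_zeros:
  assumes x: "dual x" and p: "nonnegT p" "pairing n x p = 0" and q: "degree q \<le> n"
    and zero: "\<And>z. z \<in> T \<Longrightarrow> poly p z = 0 \<Longrightarrow> poly q z \<ge> 0"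
    and inf: "b = \<infinity> \<Longrightarrow> coeff p n = 0 \<Longrightarrow> coeff q n \<ge> 0"
  shows "pairing n x q \<ge> 0"
proof (rule field_le_epsilon)
  fix e :: real assume e: "e > 0"
  have g0: "pairing n x gpos \<ge> 0" using x gpos_nonnegT by (simp add: dual_def)
  define d where "d = e / (pairing n x gpos + 1)"
  have d: "d > 0" using e g0 by (simp add: d_def)
  have "\<exists>C\<ge>0. nonnegT ((q + Polynomial.smult d gpos) + Polynomial.smult C p)"
  proof (rule nonneg_near_zeros[OF p(1)])
    show "degree (q + Polynomial.smult d gpos) \<le> n"
      using q gpos_degree by (intro degree_add_le) (auto intro: order_trans[OF degree_smult_le])
    show "poly (q + Polynomial.smult d gpos) z > 0" if "z \<in> T" "poly p z = 0" for z
      using zero[OF that] gpos_ge[OF that(1)] d by (simp add: add_nonneg_pos)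
    show "coeff (q + Polynomial.smult d gpos) n > 0" if "b = \<infinity>" "coeff p n = 0"
      using inf[OF that] d by (simp add: gpos_coeff)
  qed
  then obtain C where C: "nonnegT ((q + Polynomial.smult d gpos) + Polynomial.smult C p)" by blast
  have "0 \<le> pairing n x ((q + Polynomial.smult d gpos) + Polynomial.smult C p)" using x C by (simp add: dual_def)
  also have "\<dots> = pairing n x q + d * pairing n x gpos" by (simp add: pairing_add_right pairing_smult_right p(2))
  also have "d * pairing n x gpos \<le> e" using e g0 by (simp add: d_def field_simps)
  finally show "0 \<le> pairing n x q + e" by simp
qed

text \<open>By \<open>dual_nonneg_of_zeros\<close>, applied to a polynomial and its negative, the
  pairing with \<open>x\<close> depends only on the values at the zeros of \<open>p\<close>,
  infinity included. Lagrange interpolation there gives the representing weights directly, and they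
  are nonnegative because the Lagrange polynomials are nonnegative at the zeros.\<close>

lemma dual_supported_on_zeros:
  assumes x: "dual x" and p: "nonnegT p" "p \<noteq> 0" "pairing n x p = 0"
  shows "\<exists>w c. (\<forall>z. w z \<ge> 0) \<and> c \<ge> 0 \<and> (c \<noteq> 0 \<longrightarrow> b = \<infinity> \<and> coeff p n = 0) \<and>
    (\<forall>i\<le>n. x i = (\<Sum>z\<in>{z \<in> T. poly p z = 0}. w z * z ^ i) + (if i = n then c else 0))"
proof -
  define Z where "Z = {z \<in> T. poly p z = 0}"
  have finZ: "finite Z" using poly_roots_finite[OF p(2)] by (rule finite_subset[rotated]) (auto simp: Z_def)
  have degp: "degree p \<le> n" using p(1) by (simp add: nonnegT_def)
  have "card Z \<le> card {z. poly p z = 0}" using poly_roots_finite[OF p(2)] by (intro card_mono) (auto simp: Z_def)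
  also have "\<dots> \<le> degree p" by (rule card_poly_roots_bound[OF p(2)])
  finally have cardZ: "card Z \<le> degree p" .
  let ?l = "lagrange_poly Z"
  have degl: "degree (?l z) < n" if "z \<in> Z" for z
    using degree_lagrange_poly[OF finZ that] cardZ degp by simp
  define flag where "flag \<longleftrightarrow> b = \<infinity> \<and> coeff p n = 0"
  \<comment> \<open>The Lagrange polynomial of the point at infinity: zero on \<open>Z\<close>, with
    coefficient \<open>1\<close> at order \<open>n\<close>.\<close>
  define linf where "linf = monom 1 (n - card Z) * (\<Prod>y\<in>Z. [:- y, 1:])"
  have deglinf: "degree linf \<le> n" "coeff linf n = 1"
  proof -
    have "degree (\<Prod>y\<in>Z. [:- y, 1:]) = card Z" by (subst degree_prod_sum_eq) auto
    moreover have "lead_coeff (\<Prod>y\<in>Z. [:- y, 1:]) = 1" by (simp add: lead_coeff_prod)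
    moreover have "(\<Prod>y\<in>Z. [:- y, 1:]) \<noteq> 0" using finZ by (simp add: prod_zero_iff)
    ultimately show "degree linf \<le> n" "coeff linf n = 1"
      using cardZ degp by (auto simp: linf_def degree_mult_eq degree_monom_eq coeff_monom_mult)
  qed
  have linfZ: "poly linf z = 0" if "z \<in> Z" for z
    using that finZ by (auto simp: linf_def poly_prod intro!: prod_zero)
  define w where "w = (\<lambda>z. if z \<in> Z then pairing n x (?l z) else 0)"
  define c where "c = (if flag then pairing n x linf else 0)"
  have w: "w z \<ge> 0" for z
  proof (cases "z \<in> Z")
    case True
    have "pairing n x (?l z) \<ge> 0"
    proof (rule dual_nonneg_of_zeros[OF x p(1,3)])
      show "poly (?l z) y \<ge> 0" if "y \<in> T" "poly p y = 0" for y
        using poly_lagrange_poly[OF finZ True, of y] that by (simp add: Z_def)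
      show "coeff (?l z) n \<ge> 0" using degl[OF True] by (simp add: coeff_eq_0)
    qed (use degl[OF True] in simp)
    then show ?thesis by (simp add: w_def True)
  qed (simp add: w_def)
  moreover have "c \<ge> 0"
  proof (cases flag)
    case True
    have "pairing n x linf \<ge> 0"
      by (rule dual_nonneg_of_zeros[OF x p(1,3)]) (use deglinf linfZ in \<open>auto simp: Z_def\<close>)
    then show ?thesis by (simp add: c_def True)
  qed (simp add: c_def)
  moreover have "x i = (\<Sum>z\<in>Z. w z * z ^ i) + (if i = n then c else 0)" if i: "i \<le> n" for i
  proof -
    let ?m = "monom 1 i :: real poly"
    \<comment> \<open>The interpolation remainder of the monomial: it vanishes at all zeros of
      \<open>p\<close>, and at infinity if that is one of them.\<close>
    define r where "r = ?m - (\<Sum>z\<in>Z. Polynomial.smult (z ^ i) (?l z)) - (if flag then Polynomial.smult (coeff ?m n) linf else 0)"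
    have degs: "degree (\<Sum>z\<in>Z. Polynomial.smult (z ^ i) (?l z)) \<le> n"
      using finZ degl by (intro degree_sum_le) (auto intro: order_trans[OF degree_smult_le] less_imp_le)
    have degr: "degree r \<le> n"
      unfolding r_def using degs deglinf i
      by (intro degree_diff_le) (auto simp: degree_monom_eq intro: order_trans[OF degree_smult_le])
    have r0: "poly r z = 0" if z: "z \<in> Z" for z
    proof -
      have "(\<Sum>y\<in>Z. y ^ i * poly (?l y) z) = (\<Sum>y\<in>Z. if y = z then z ^ i else 0)"
        using finZ z by (intro sum.cong) (auto simp: poly_lagrange_poly)
      then show ?thesis using finZ z linfZ[OF z] by (simp add: r_def poly_sum poly_monom)
    qed
    have rn: "coeff r n = 0" if flag
      using that deglinf degl by (simp add: r_def coeff_sum coeff_eq_0)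
    have "pairing n x r \<ge> 0"
      by (rule dual_nonneg_of_zeros[OF x p(1,3) degr]) (use r0 rn in \<open>auto simp: Z_def flag_def\<close>)
    moreover have "pairing n x (- r) \<ge> 0"
      by (rule dual_nonneg_of_zeros[OF x p(1,3)]) (use degr r0 rn in \<open>auto simp: Z_def flag_def\<close>)
    ultimately have "pairing n x r = 0" by (simp add: pairing_minus_right)
    then have "x i = (\<Sum>z\<in>Z. z ^ i * pairing n x (?l z)) + (if flag then coeff ?m n * pairing n x linf else 0)"
      using finZ i by (cases flag) (simp_all add: r_def pairing_diff_right pairing_sum_right pairing_smult_right pairing_monom cong: if_cong)
    then show ?thesis by (auto simp: w_def c_def mult.commute)
  qed
  ultimately show ?thesis
    unfolding Z_def[symmetric] by (intro exI[of _ w] exI[of _ c]) (auto simp: c_def flag_def)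
qed

end


section \<open>Representing measures of minimal index\<close>

definition poly_of :: "nat \<Rightarrow> (nat \<Rightarrow> real) \<Rightarrow> real poly" where
  "poly_of n c = (\<Sum>i\<le>n. monom (c i) i)"

lemma coeff_poly_of: "coeff (poly_of n c) i = (if i \<le> n then c i else 0)"
  by (simp add: poly_of_def coeff_sum if_distrib cong: if_cong)

lemma degree_poly_of: "degree (poly_of n c) \<le> n"
  by (intro degree_le) (simp add: coeff_poly_of)

lemma poly_poly_of: "poly (poly_of n c) t = (\<Sum>i\<le>n. c i * t ^ i)"
  by (simp add: poly_eq_sum_le[OF degree_poly_of] coeff_poly_of)

lemma pairing_poly_of: "pairing n x (poly_of n c) = (\<Sum>i\<le>n. x i * c i)"
  by (simp add: pairing_def coeff_poly_of)

context moment_interval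
begin

text \<open>A compact base of the cone of nonnegative polynomials, which turns strictness into
  positivity of a continuous function on a compact set.\<close>

definition unit_nonneg :: "(nat \<Rightarrow> real) set" where
  "unit_nonneg = {c. (\<forall>i>n. c i = 0) \<and> (\<Sum>i\<le>n. (c i)\<^sup>2) = 1 \<and> (\<forall>t\<in>T. (\<Sum>i\<le>n. c i * t ^ i) \<ge> 0)}"

lemma continuous_on_coord [continuous_intros]: "continuous_on S (\<lambda>c. (c :: nat \<Rightarrow> real) i)"
  by (rule continuous_on_subset[OF continuous_on_product_coordinates]) simp

lemma unit_nonneg_bound: "c \<in> unit_nonneg \<Longrightarrow> \<bar>c i\<bar> \<le> 1"
proof -
  assume c: "c \<in> unit_nonneg"
  show ?thesis
  proof (cases "i \<le> n")
    case True
    have "(c i)\<^sup>2 \<le> (\<Sum>i\<le>n. (c i)\<^sup>2)" using True by (intro member_le_sum) auto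
    then have "(c i)\<^sup>2 \<le> 1" using c by (simp add: unit_nonneg_def)
    then show ?thesis by (simp add: abs_square_le_1)
  qed (use c in \<open>simp add: unit_nonneg_def\<close>)
qed

lemma compact_unit_nonneg: "compact unit_nonneg"
proof -
  let ?B = "\<Pi>\<^sub>E i\<in>UNIV. if i \<le> n then {- 1 .. 1 :: real} else {0}"
  have "compactin (product_topology (\<lambda>_::nat. euclidean :: real topology) UNIV) ?B"
    by (subst compactin_PiE) auto
  then have "compact ?B" by (simp add: euclidean_product_topology)
  moreover have "closed ({c. (\<Sum>i\<le>n. (c i)\<^sup>2) = (1 :: real)} \<inter> (\<Inter>t\<in>T. {c. (\<Sum>i\<le>n. c i * t ^ i) \<ge> 0}))"
    by (intro closed_Int closed_INT ballI closed_Collect_eq closed_Collect_le continuous_intros)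
  ultimately have "compact (?B \<inter> ({c. (\<Sum>i\<le>n. (c i)\<^sup>2) = (1 :: real)} \<inter> (\<Inter>t\<in>T. {c. (\<Sum>i\<le>n. c i * t ^ i) \<ge> 0})))"
    by (rule compact_Int_closed)
  also have "?B \<inter> ({c. (\<Sum>i\<le>n. (c i)\<^sup>2) = (1 :: real)} \<inter> (\<Inter>t\<in>T. {c. (\<Sum>i\<le>n. c i * t ^ i) \<ge> 0})) = unit_nonneg"
  proof (intro equalityI subsetI)
    fix c assume "c \<in> unit_nonneg"
    then show "c \<in> ?B \<inter> ({c. (\<Sum>i\<le>n. (c i)\<^sup>2) = (1 :: real)} \<inter> (\<Inter>t\<in>T. {c. (\<Sum>i\<le>n. c i * t ^ i) \<ge> 0}))"
      using unit_nonneg_bound[of c] by (auto simp: unit_nonneg_def PiE_def Pi_def abs_le_iff minus_le_iff)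
  next
    fix c assume "c \<in> ?B \<inter> ({c. (\<Sum>i\<le>n. (c i)\<^sup>2) = (1 :: real)} \<inter> (\<Inter>t\<in>T. {c. (\<Sum>i\<le>n. c i * t ^ i) \<ge> 0}))"
    then show "c \<in> unit_nonneg"
      by (auto simp: unit_nonneg_def PiE_def Pi_def split: if_splits) (metis not_le singletonD)
  qed
  finally show ?thesis .
qed

lemma unit_nonneg_poly_of:
  assumes "c \<in> unit_nonneg"
  shows "nonnegT (poly_of n c)" "poly_of n c \<noteq> 0"
proof -
  show "nonnegT (poly_of n c)" using assms degree_poly_of
    by (auto simp: nonnegT_def unit_nonneg_def poly_poly_of)
  show "poly_of n c \<noteq> 0"
  proof
    assume "poly_of n c = 0"
    then have "c i = 0" if "i \<le> n" for i using coeff_poly_of[of n c i] that by simp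
    then show False using assms by (simp add: unit_nonneg_def)
  qed
qed

lemma nonnegT_normalize:
  assumes p: "nonnegT p" "p \<noteq> 0"
  shows "\<exists>c s. c \<in> unit_nonneg \<and> s > 0 \<and> p = Polynomial.smult s (poly_of n c)"
proof -
  define s where "s = sqrt (\<Sum>i\<le>n. (coeff p i)\<^sup>2)"
  define c where "c = (\<lambda>i. coeff p i / s)"
  have deg: "degree p \<le> n" using p by (simp add: nonnegT_def)
  have "0 < (lead_coeff p)\<^sup>2" using p by simp
  also have "\<dots> \<le> (\<Sum>i\<le>n. (coeff p i)\<^sup>2)" using deg by (intro member_le_sum) auto
  finally have pos: "(\<Sum>i\<le>n. (coeff p i)\<^sup>2) > 0" .
  then have s: "s > 0" by (simp add: s_def)
  have s2: "s\<^sup>2 = (\<Sum>i\<le>n. (coeff p i)\<^sup>2)" using pos by (simp add: s_def)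
  have "c \<in> unit_nonneg"
    unfolding unit_nonneg_def
  proof (intro CollectI conjI ballI allI impI)
    show "c i = 0" if "i > n" for i using that deg by (simp add: c_def coeff_eq_0)
    have "(\<Sum>i\<le>n. (c i)\<^sup>2) = (\<Sum>i\<le>n. (coeff p i)\<^sup>2) / s\<^sup>2"
      by (simp add: c_def power_divide sum_divide_distrib)
    then show "(\<Sum>i\<le>n. (c i)\<^sup>2) = 1" using s unfolding s2[symmetric] by simp
    fix t assume "t \<in> T"
    then have "poly p t \<ge> 0" using p by (simp add: nonnegT_def)
    moreover have "(\<Sum>i\<le>n. c i * t ^ i) = poly p t / s"
      by (simp add: c_def poly_eq_sum_le[OF deg] sum_divide_distrib)
    ultimately show "(\<Sum>i\<le>n. c i * t ^ i) \<ge> 0" using s by simp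
  qed
  moreover have "p = Polynomial.smult s (poly_of n c)"
    using s deg by (intro poly_eqI) (auto simp: coeff_poly_of c_def coeff_eq_0)
  ultimately show ?thesis using s by blast
qed

lemma strict_iff_unit: "strict x \<longleftrightarrow> (\<forall>c\<in>unit_nonneg. (\<Sum>i\<le>n. x i * c i) > 0)"
proof
  assume "strict x"
  then show "\<forall>c\<in>unit_nonneg. (\<Sum>i\<le>n. x i * c i) > 0"
    using unit_nonneg_poly_of by (auto simp: strict_def pairing_poly_of[symmetric])
next
  assume pos: "\<forall>c\<in>unit_nonneg. (\<Sum>i\<le>n. x i * c i) > 0"
  show "strict x"
    unfolding strict_def
  proof (intro allI impI)
    fix p assume "nonnegT p \<and> p \<noteq> 0"
    then obtain c s where "c \<in> unit_nonneg" "s > 0" "p = Polynomial.smult s (poly_of n c)" using nonnegT_normalize by blast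
    then show "pairing n x p > 0" using pos by (simp add: pairing_smult_right pairing_poly_of)
  qed
qed

lemma strict_stable:
  assumes "strict x"
  shows "\<exists>e>0. \<forall>y. (\<forall>i\<le>n. \<bar>y i - x i\<bar> < e) \<longrightarrow> strict y"
proof (cases "unit_nonneg = {}")
  case True
  then show ?thesis by (intro exI[of _ 1]) (simp add: strict_iff_unit)
next
  case False
  have cont: "continuous_on unit_nonneg (\<lambda>c. \<Sum>i\<le>n. x i * c i)" by (intro continuous_intros)
  obtain c0 where c0: "c0 \<in> unit_nonneg" "\<forall>c\<in>unit_nonneg. (\<Sum>i\<le>n. x i * c0 i) \<le> (\<Sum>i\<le>n. x i * c i)"
    using continuous_attains_inf[OF compact_unit_nonneg False cont] by blast
  define m where "m = (\<Sum>i\<le>n. x i * c0 i)"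
  have m: "m > 0" using assms c0(1) by (simp add: m_def strict_iff_unit)
  \<comment> \<open>Coefficients on the base are at most \<open>1\<close> in absolute value, so
    \<open>n + 1\<close> perturbations below \<open>e\<close> change the pairing by at most half of
    the minimum \<open>m\<close>.\<close>
  define e where "e = m / (2 * (real n + 1))"
  have e: "e > 0" using m by (simp add: e_def)
  have "strict y" if y: "\<forall>i\<le>n. \<bar>y i - x i\<bar> < e" for y
    unfolding strict_iff_unit
  proof
    fix c assume c: "c \<in> unit_nonneg"
    have "\<bar>\<Sum>i\<le>n. (y i - x i) * c i\<bar> \<le> (\<Sum>i\<le>n. \<bar>(y i - x i) * c i\<bar>)" by (rule sum_abs)
    also have "\<dots> \<le> (\<Sum>i\<le>n. e)"
    proof (intro sum_mono)
      fix i assume "i \<in> {..n}"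
      then have "\<bar>y i - x i\<bar> * \<bar>c i\<bar> \<le> e * 1" using y unit_nonneg_bound[OF c, of i] e
        by (intro mult_mono) (auto intro: less_imp_le)
      then show "\<bar>(y i - x i) * c i\<bar> \<le> e" by (simp add: abs_mult)
    qed
    also have "\<dots> = m / 2" by (simp add: e_def field_simps)
    finally have "(\<Sum>i\<le>n. (y i - x i) * c i) \<ge> - m / 2" by linarith
    moreover have "(\<Sum>i\<le>n. x i * c i) \<ge> m" using c0(2) c by (simp add: m_def)
    moreover have "(\<Sum>i\<le>n. y i * c i) = (\<Sum>i\<le>n. (y i - x i) * c i) + (\<Sum>i\<le>n. x i * c i)"
      by (simp add: sum.distrib[symmetric] algebra_simps)
    ultimately show "(\<Sum>i\<le>n. y i * c i) > 0" using m by linarith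
  qed
  then show ?thesis using e by blast
qed

text \<open>Subtracting the largest admissible multiple of \<open>v\<close> moves \<open>x\<close> to the boundary of the dual cone.\<close>

lemma extremal_multiple:
  assumes x: "\<And>p. nonnegT p \<Longrightarrow> p \<noteq> 0 \<Longrightarrow> pairing n v p = 0 \<Longrightarrow> pairing n x p > 0"
    and v: "nonnegT p1" "pairing n v p1 > 0"
  shows "\<exists>\<rho> p. nonnegT p \<and> pairing n v p > 0 \<and> dual (\<lambda>i. x i - \<rho> * v i) \<and> pairing n (\<lambda>i. x i - \<rho> * v i) p = 0"
proof -
  let ?f = "\<lambda>c. \<Sum>i\<le>n. x i * c i" and ?g = "\<lambda>c. \<Sum>i\<le>n. v i * c i"
  have cf: "continuous_on S ?f" and cg: "continuous_on S ?g" for S by (intro continuous_intros)+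
  let ?S = "unit_nonneg \<inter> {c. ?g c \<ge> 0}"
  have cS: "compact ?S" by (intro compact_Int_closed compact_unit_nonneg closed_Collect_le continuous_intros)
  have f0: "?f c > 0" if "c \<in> unit_nonneg" "?g c = 0" for c
    using x[OF unit_nonneg_poly_of[OF that(1)]] that(2) by (simp add: pairing_poly_of)
  \<comment> \<open>Admissible multiples are bounded by the quotients of the two pairings where the
    denominator is positive; the extremal one is their infimum.\<close>
  define R where "R = {?f c / ?g c | c. c \<in> ?S \<and> ?g c > 0}"
  have RD: "\<exists>c. r = ?f c / ?g c \<and> c \<in> ?S \<and> ?g c > 0" if "r \<in> R" for r
    using that unfolding R_def by (rule CollectD)
  have Rne: "R \<noteq> {}"
  proof -
    have "p1 \<noteq> 0" using v by auto
    then obtain c s where "c \<in> unit_nonneg" "s > 0" "p1 = Polynomial.smult s (poly_of n c)" using nonnegT_normalize[OF v(1)] by blast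
    then have "c \<in> ?S \<and> ?g c > 0" using v(2) by (simp add: pairing_smult_right pairing_poly_of zero_less_mult_iff)
    then show ?thesis unfolding R_def by blast
  qed
  have Rbdd: "bdd_below R"
  proof -
    \<comment> \<open>Where the numerator is not positive the denominator cannot vanish, so
      compactness keeps it away from \<open>0\<close> and the quotients from minus infinity.\<close>
    let ?Sneg = "?S \<inter> {c. ?f c \<le> 0}"
    have cS0: "compact ?Sneg" by (intro compact_Int_closed cS closed_Collect_le continuous_intros)
    show ?thesis
    proof (cases "?Sneg = {}")
      case True
      have "0 \<le> r" if "r \<in> R" for r
      proof -
        obtain c where c: "r = ?f c / ?g c" "c \<in> ?S" "?g c > 0" using RD[OF \<open>r \<in> R\<close>] by blast
        then have "\<not> ?f c \<le> 0" using True by blast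
        then show ?thesis using c by simp
      qed
      then show ?thesis by (rule bdd_belowI)
    next
      case False
      obtain c1 where c1: "c1 \<in> ?Sneg" "\<forall>c\<in>?Sneg. ?f c1 \<le> ?f c"
        using continuous_attains_inf[OF cS0 False cf] by blast
      obtain c2 where c2: "c2 \<in> ?Sneg" "\<forall>c\<in>?Sneg. ?g c2 \<le> ?g c"
        using continuous_attains_inf[OF cS0 False cg] by blast
      have g2: "?g c2 > 0" using c2(1) f0[of c2] by force
      have "?f c1 / ?g c2 \<le> r" if "r \<in> R" for r
      proof -
        obtain c where c: "r = ?f c / ?g c" "c \<in> ?S" "?g c > 0" using RD[OF \<open>r \<in> R\<close>] by blast
        show ?thesis
        proof (cases "c \<in> ?Sneg")
          case True
          have "?f c1 / ?g c2 \<le> ?f c1 / ?g c"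
            using c1(1) c2 True g2 c by (intro divide_left_mono_neg) auto
          also have "\<dots> \<le> r" using c1(2) True c by (simp add: divide_right_mono)
          finally show ?thesis .
        next
          case False
          then have "r \<ge> 0" using c by simp
          moreover have "?f c1 / ?g c2 \<le> 0" using c1(1) g2 by (simp add: divide_nonpos_pos)
          ultimately show ?thesis by linarith
        qed
      qed
      then show ?thesis by (rule bdd_belowI)
    qed
  qed
  define \<rho> where "\<rho> = Inf R"
  let ?h = "\<lambda>c. ?f c - \<rho> * ?g c"
  have h0: "?h c \<ge> 0" if c: "c \<in> ?S" for c
  proof (cases "?g c > 0")
    case True
    then have "\<rho> \<le> ?f c / ?g c" unfolding \<rho>_def using c by (intro cInf_lower Rbdd) (auto simp: R_def)
    then show ?thesis using True by (simp add: field_simps)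
  next
    case False
    then have "?g c = 0" using c by simp
    then show ?thesis using f0[of c] c by simp
  qed
  have "?S \<noteq> {}" using Rne by (auto simp: R_def)
  moreover have "continuous_on ?S ?h" by (intro continuous_intros)
  ultimately obtain c0 where c0: "c0 \<in> ?S" "\<forall>c\<in>?S. ?h c0 \<le> ?h c"
    using continuous_attains_inf[OF cS] by blast
  obtain c3 where c3: "c3 \<in> ?S" "\<forall>c\<in>?S. ?g c \<le> ?g c3"
    using continuous_attains_sup[OF cS \<open>?S \<noteq> {}\<close> cg] by blast
  \<comment> \<open>If the minimum were positive, the infimum could be raised by the minimum divided
    by the largest denominator.\<close>
  have hc0: "?h c0 = 0"
  proof (rule ccontr)
    assume "?h c0 \<noteq> 0"
    then have pos: "?h c0 > 0" using h0[OF c0(1)] by linarith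
    have g3: "?g c3 > 0" using Rne c3 by (force simp: R_def)
    have "\<rho> + ?h c0 / ?g c3 \<le> r" if "r \<in> R" for r
    proof -
      obtain c where c: "r = ?f c / ?g c" "c \<in> ?S" "?g c > 0" using RD[OF \<open>r \<in> R\<close>] by blast
      have "?h c0 / ?g c3 \<le> ?h c0 / ?g c"
        using c3 c pos g3 by (intro divide_left_mono) auto
      also have "\<dots> \<le> ?h c / ?g c" using c0(2) c by (intro divide_right_mono) auto
      also have "\<dots> = r - \<rho>" using c by (simp add: diff_divide_distrib)
      finally show ?thesis by simp
    qed
    then have "\<rho> + ?h c0 / ?g c3 \<le> \<rho>" unfolding \<rho>_def[symmetric] using Rne
      by (subst (2) \<rho>_def) (rule cInf_greatest)
    then show False using pos g3 by (simp add: divide_le_0_iff)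
  qed
  have gc0: "?g c0 > 0"
  proof (rule ccontr)
    assume "\<not> ?thesis"
    then have "?g c0 = 0" using c0(1) by simp
    then show False using f0[of c0] c0(1) hc0 by simp
  qed
  let ?y = "\<lambda>i. x i - \<rho> * v i" and ?p = "poly_of n c0"
  have pair_y: "pairing n ?y q = pairing n x q - \<rho> * pairing n v q" for q
    using pairing_combination_left[of n 1 x "- \<rho>" v q] by simp
  have p1: "nonnegT ?p" using unit_nonneg_poly_of(1)[of c0] c0(1) by blast
  have p2: "pairing n v ?p > 0" unfolding pairing_poly_of by (rule gc0)
  have p3: "pairing n ?y ?p = 0" unfolding pair_y unfolding pairing_poly_of by (rule hc0)
  note p = p1 p2 p3
  have nonneg_case: "pairing n ?y q \<ge> 0" if q: "nonnegT q" "pairing n v q \<ge> 0" for q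
  proof (cases "q = 0")
    case False
    then obtain c s where c: "c \<in> unit_nonneg" "s > 0" "q = Polynomial.smult s (poly_of n c)" using nonnegT_normalize[OF q(1)] by blast
    then have "c \<in> ?S" using q(2) by (simp add: pairing_smult_right pairing_poly_of zero_le_mult_iff)
    then have "?h c \<ge> 0" by (rule h0)
    then have "pairing n ?y (poly_of n c) \<ge> 0" unfolding pair_y unfolding pairing_poly_of .
    then show ?thesis using c by (simp add: pairing_smult_right)
  qed simp
  have "dual ?y"
    unfolding dual_def
  proof (intro allI impI)
    fix q assume q: "nonnegT q"
    show "pairing n ?y q \<ge> 0"
    proof (cases "pairing n v q \<ge> 0")
      case False
      \<comment> \<open>The vector \<open>v\<close> may pair negatively with a nonnegative
        polynomial \<open>q\<close>. Adding a multiple of the annihilating polynomial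
        \<open>?p\<close> brings the pairing with \<open>v\<close> to \<open>0\<close> and leaves
        the pairing with \<open>?y\<close> unchanged.\<close>
      define t where "t = - pairing n v q / pairing n v ?p"
      have t: "t > 0" unfolding t_def using False p(2) by (intro divide_pos_pos) auto
      let ?q = "q + Polynomial.smult t ?p"
      have "nonnegT ?q" using q p(1) t
        by (auto simp: nonnegT_def intro!: degree_add_le order_trans[OF degree_smult_le] add_nonneg_nonneg mult_nonneg_nonneg)
      moreover have "pairing n v ?q = pairing n v q + t * pairing n v ?p"
        by (simp only: pairing_add_right pairing_smult_right)
      then have "pairing n v ?q = 0" using p(2) by (simp add: t_def)
      ultimately have "pairing n ?y ?q \<ge> 0" by (intro nonneg_case) auto
      then show ?thesis using p(3) by (simp add: pairing_add_right pairing_smult_right)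
    qed (rule nonneg_case[OF q])
  qed
  then show ?thesis using p by blast
qed

text \<open>Interior atoms carry positive weights, so that counting them is meaningful; endpoint
  weights may vanish, and infinite endpoints enter through \<open>psi\<close>. The order
  \<open>m\<close> is separate from \<open>n\<close> because the odd lower case works with order
  \<open>n + 1\<close>.\<close>

definition repr :: "nat \<Rightarrow> (nat \<Rightarrow> real) \<Rightarrow> real set \<Rightarrow> (real \<Rightarrow> real) \<Rightarrow> real \<Rightarrow> real \<Rightarrow> bool" where
  "repr m x I w ca cb \<longleftrightarrow> finite I \<and> I \<subseteq> interior T \<and> (\<forall>z\<in>I. w z > 0) \<and> ca \<ge> 0 \<and> cb \<ge> 0 \<and>
    (\<forall>i\<le>m. x i = ca * psi m a i + (\<Sum>z\<in>I. w z * z ^ i) + cb * psi m b i)"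

lemma psi_real: "i \<le> m \<Longrightarrow> psi m (ereal z) i = z ^ i"
  by (simp add: psi_def)

lemma psi_infinity: "i \<le> m \<Longrightarrow> psi m \<infinity> i = (if i = m then 1 else 0)"
  by (simp add: psi_def)

lemma psi_MInfty: "even m \<Longrightarrow> psi m (-\<infinity>) = psi m \<infinity>"
  by (auto simp: psi_def fun_eq_iff)

text \<open>Interior zeros count twice.\<close>

lemma zero_count:
  assumes p: "nonnegT p" "p \<noteq> 0" and I: "finite I" "I \<subseteq> interior T" "\<And>z. z \<in> I \<Longrightarrow> poly p z = 0"
    and A: "A \<Longrightarrow> \<bar>a\<bar> \<noteq> \<infinity> \<and> poly p (real_of_ereal a) = 0"
    and B: "B \<Longrightarrow> (\<bar>b\<bar> \<noteq> \<infinity> \<and> poly p (real_of_ereal b) = 0) \<or> (b = \<infinity> \<and> coeff p n = 0)"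
  shows "2 * card I + of_bool A + of_bool B \<le> n"
proof -
  define E where "E = (if A then {real_of_ereal a} else {}) \<union> (if B \<and> \<bar>b\<bar> \<noteq> \<infinity> then {real_of_ereal b} else {})"
  have disj: "I \<inter> E = {}"
  proof -
    have "z \<notin> E" if "z \<in> I" for z
    proof -
      have "a < ereal z" "ereal z < b" using I(2) that unfolding interior_T by auto
      then show ?thesis using A by (cases a; cases b) (auto simp: E_def)
    qed
    then show ?thesis by blast
  qed
  have finE: "finite E" by (simp add: E_def)
  have ab_ne: "real_of_ereal a \<noteq> real_of_ereal b" if "A" "\<bar>b\<bar> \<noteq> \<infinity>"
    using that A ab by (cases a; cases b) auto
  have cardE: "card E = of_bool A + of_bool (B \<and> \<bar>b\<bar> \<noteq> \<infinity>)"
    using ab_ne by (auto simp: E_def)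
  have "(\<Sum>z\<in>I \<union> E. if z \<in> I then 2 else 1) \<le> degree p"
  proof (rule sum_orders_le_degree)
    fix z assume "z \<in> I \<union> E"
    then consider "z \<in> I" | "z \<notin> I" "z \<in> E" by blast
    then show "(if z \<in> I then 2 else 1) \<le> order z p"
    proof cases
      case 1
      then show ?thesis using order_ge_2_of_interior_zero[OF p(2), of z T] I p(1) by (auto simp: nonnegT_def)
    next
      case 2
      then have "poly p z = 0" using A B by (auto simp: E_def split: if_splits)
      then have "order z p \<noteq> 0" using p(2) by (simp add: order_root)
      then show ?thesis using 2 by simp
    qed
  qed (use I(1) finE p(2) in auto)
  also have "(\<Sum>z\<in>I \<union> E. if z \<in> I then 2 else 1 :: nat) = (\<Sum>z\<in>I. 2) + (\<Sum>z\<in>E. 1)"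
  proof (subst sum.union_disjoint[OF I(1) finE disj], intro arg_cong2[where f="(+)"] sum.cong refl)
    show "(if z \<in> I then 2 else 1) = (1 :: nat)" if "z \<in> E" for z using that disj by auto
  qed simp
  finally have le: "2 * card I + of_bool A + of_bool (B \<and> \<bar>b\<bar> \<noteq> \<infinity>) \<le> degree p"
    by (simp add: cardE mult.commute)
  show ?thesis
  \<comment> \<open>A zero at infinity is no root but lowers the degree below \<open>n\<close>,
    which pays for counting it.\<close>
  proof (cases "B \<and> b = \<infinity>")
    case True
    then have "coeff p n = 0" using B by auto
    then have "degree p \<noteq> n" using p(2) by auto
    then have "degree p < n" using p(1) by (simp add: nonnegT_def)
    then show ?thesis using le True by simp
  next
    case False
    then have "B \<Longrightarrow> \<bar>b\<bar> \<noteq> \<infinity>" using B by auto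
    then show ?thesis using le p(1) by (cases B) (auto simp: nonnegT_def)
  qed
qed

text \<open>The zeros of \<open>p\<close> are sorted into interior points and endpoints; a mass at
  infinity becomes the weight of \<open>b\<close>, and atoms of weight zero are dropped. Since all
  atoms are zeros of \<open>p\<close>, the count follows from \<open>zero_count\<close>.\<close>

lemma repr_of_zero:
  assumes x: "dual x" and p: "nonnegT p" "p \<noteq> 0" "pairing n x p = 0"
  shows "\<exists>I w ca cb. repr n x I w ca cb \<and> (ca > 0 \<longrightarrow> \<bar>a\<bar> \<noteq> \<infinity> \<and> poly p (real_of_ereal a) = 0) \<and>
    (cb > 0 \<longrightarrow> (\<bar>b\<bar> \<noteq> \<infinity> \<and> poly p (real_of_ereal b) = 0) \<or> (b = \<infinity> \<and> coeff p n = 0)) \<and>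
    2 * card I + of_bool (ca > 0) + of_bool (cb > 0) \<le> n"
proof -
  define Z where "Z = {z \<in> T. poly p z = 0}"
  have finZ: "finite Z" using poly_roots_finite[OF p(2)] by (rule finite_subset[rotated]) (auto simp: Z_def)
  obtain w c where w: "\<And>z. w z \<ge> 0" and c: "c \<ge> 0" "c \<noteq> 0 \<longrightarrow> b = \<infinity> \<and> coeff p n = 0"
    and xi: "\<And>i. i \<le> n \<Longrightarrow> x i = (\<Sum>z\<in>Z. w z * z ^ i) + (if i = n then c else 0)"
    using dual_supported_on_zeros[OF x p] unfolding Z_def by blast
  define I where "I = {z \<in> Z. z \<in> interior T \<and> w z > 0}"
  define ca where "ca = (if \<bar>a\<bar> \<noteq> \<infinity> \<and> real_of_ereal a \<in> Z then w (real_of_ereal a) else 0)"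
  define cb where "cb = (if b = \<infinity> then c else if real_of_ereal b \<in> Z then w (real_of_ereal b) else 0)"
  define Ea where "Ea = (if \<bar>a\<bar> \<noteq> \<infinity> then {real_of_ereal a} else {})"
  define Eb where "Eb = (if \<bar>b\<bar> \<noteq> \<infinity> then {real_of_ereal b} else {})"
  have Ia: "I \<inter> Ea = {}" "I \<inter> Eb = {}" by (auto simp: I_def Ea_def Eb_def interior_T ereal_real split: if_splits)
  have Iab: "Ea \<inter> Eb = {}" using ab by (cases a; cases b) (auto simp: Ea_def Eb_def)
  have sum_eq: "(\<Sum>z\<in>Z. w z * z ^ i) = (\<Sum>z\<in>Z \<inter> Ea. w z * z ^ i) + (\<Sum>z\<in>I. w z * z ^ i) + (\<Sum>z\<in>Z \<inter> Eb. w z * z ^ i)" for i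
  proof -
    have "(\<Sum>z\<in>Z. w z * z ^ i) = (\<Sum>z\<in>I \<union> Z \<inter> Ea \<union> Z \<inter> Eb. w z * z ^ i)"
    proof (rule sum.mono_neutral_right[OF finZ])
      show "\<forall>z\<in>Z - (I \<union> Z \<inter> Ea \<union> Z \<inter> Eb). w z * z ^ i = 0"
      proof
        fix z assume z: "z \<in> Z - (I \<union> Z \<inter> Ea \<union> Z \<inter> Eb)"
        then have "a \<noteq> ereal z" "b \<noteq> ereal z" by (auto simp: Ea_def Eb_def)
        then have "z \<in> interior T" using T_cases[of z] z by (auto simp: Z_def)
        then have "w z = 0" using z w[of z] by (auto simp: I_def less_le)
        then show "w z * z ^ i = 0" by simp
      qed
    qed (auto simp: I_def)
    also have "\<dots> = (\<Sum>z\<in>I \<union> Z \<inter> Ea. w z * z ^ i) + (\<Sum>z\<in>Z \<inter> Eb. w z * z ^ i)"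
      using finZ Ia Iab by (intro sum.union_disjoint) (auto simp: I_def)
    also have "(\<Sum>z\<in>I \<union> Z \<inter> Ea. w z * z ^ i) = (\<Sum>z\<in>I. w z * z ^ i) + (\<Sum>z\<in>Z \<inter> Ea. w z * z ^ i)"
      using finZ Ia by (intro sum.union_disjoint) (auto simp: I_def)
    finally show ?thesis by simp
  qed
  have ea: "(\<Sum>z\<in>Z \<inter> Ea. w z * z ^ i) = ca * psi n a i" if "i \<le> n" for i
    using that by (cases a) (auto simp: Ea_def ca_def psi_real)
  have eb: "(\<Sum>z\<in>Z \<inter> Eb. w z * z ^ i) + (if i = n then c else 0) = cb * psi n b i" if "i \<le> n" for i
    using that c(2) ab by (cases b) (auto simp: Eb_def cb_def psi_real psi_infinity)
  have r: "repr n x I w ca cb"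
    unfolding repr_def
  proof (intro conjI allI impI)
    show "x i = ca * psi n a i + (\<Sum>z\<in>I. w z * z ^ i) + cb * psi n b i" if "i \<le> n" for i
      using xi[OF that] sum_eq[of i] ea[OF that] eb[OF that] by linarith
  qed (use finZ w c in \<open>auto simp: I_def ca_def cb_def\<close>)
  have A: "ca > 0 \<Longrightarrow> \<bar>a\<bar> \<noteq> \<infinity> \<and> poly p (real_of_ereal a) = 0"
    by (auto simp: ca_def Z_def split: if_splits)
  have B: "cb > 0 \<Longrightarrow> (\<bar>b\<bar> \<noteq> \<infinity> \<and> poly p (real_of_ereal b) = 0) \<or> (b = \<infinity> \<and> coeff p n = 0)"
    using c(2) ab by (cases b) (auto simp: cb_def Z_def split: if_splits)
  have "finite I" by (rule finite_subset[OF _ finZ]) (auto simp: I_def)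
  then have "2 * card I + of_bool (ca > 0) + of_bool (cb > 0) \<le> n"
    using A B by (intro zero_count[OF p(1,2)]) (auto simp: I_def Z_def)
  then show ?thesis using r A B
    by (intro exI[of _ I] exI[of _ w] exI[of _ ca] exI[of _ cb] conjI impI) auto
qed

text \<open>Built to be nonnegative on the interval and to vanish at the given atoms: double roots
  in the interior, simple roots at endpoints, with the sign reversed at the right one. An atom at
  infinity needs no factor, only a degree below \<open>n\<close>.\<close>

definition support_poly :: "real set \<Rightarrow> bool \<Rightarrow> bool \<Rightarrow> real poly" where
  "support_poly I A B = (\<Prod>z\<in>I. [:- z, 1:]\<^sup>2) * (if A then [:- real_of_ereal a, 1:] else 1) *
     (if B \<and> \<bar>b\<bar> \<noteq> \<infinity> then [:real_of_ereal b, -1:] else 1)"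

lemma poly_support_poly:
  "poly (support_poly I A B) t = (\<Prod>z\<in>I. (t - z)\<^sup>2) * (if A then t - real_of_ereal a else 1) *
     (if B \<and> \<bar>b\<bar> \<noteq> \<infinity> then real_of_ereal b - t else 1)"
  by (simp add: support_poly_def poly_prod power2_eq_square) (simp add: algebra_simps)

lemma support_poly_nonneg:
  assumes "t \<in> T" "A \<Longrightarrow> \<bar>a\<bar> \<noteq> \<infinity>"
  shows "poly (support_poly I A B) t \<ge> 0"
proof -
  have "A \<Longrightarrow> t - real_of_ereal a \<ge> 0" using assms by (cases a) (auto simp: real_segment_def)
  moreover have "\<bar>b\<bar> \<noteq> \<infinity> \<Longrightarrow> real_of_ereal b - t \<ge> 0" using assms(1) by (cases b) (auto simp: real_segment_def)
  ultimately show ?thesis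
    unfolding poly_support_poly by (intro mult_nonneg_nonneg prod_nonneg) auto
qed

lemma support_poly_degree:
  assumes "finite I"
  shows "support_poly I A B \<noteq> 0" "degree (support_poly I A B) = 2 * card I + of_bool A + of_bool (B \<and> \<bar>b\<bar> \<noteq> \<infinity>)"
proof -
  have nz: "(\<Prod>z\<in>I. [:- z, 1:]\<^sup>2) \<noteq> (0 :: real poly)" using assms by (simp add: prod_zero_iff)
  then show "support_poly I A B \<noteq> 0" by (auto simp: support_poly_def)
  have "degree (\<Prod>z\<in>I. [:- z, 1:]\<^sup>2 :: real poly) = 2 * card I"
    by (subst degree_prod_sum_eq) (auto simp: degree_power_eq)
  then show "degree (support_poly I A B) = 2 * card I + of_bool A + of_bool (B \<and> \<bar>b\<bar> \<noteq> \<infinity>)"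
    using nz by (auto simp: support_poly_def degree_mult_eq)
qed

lemma pairing_repr:
  assumes "repr n x I w ca cb" "degree p \<le> n"
  shows "pairing n x p = ca * pairing n (psi n a) p + (\<Sum>z\<in>I. w z * poly p z) + cb * pairing n (psi n b) p"
proof -
  have "pairing n x p = pairing n (\<lambda>i. ca * psi n a i + (\<Sum>z\<in>I. w z * z ^ i) + cb * psi n b i) p"
    using assms(1) by (intro pairing_cong) (auto simp: repr_def)
  also have "\<dots> = ca * pairing n (psi n a) p + (\<Sum>i\<le>n. \<Sum>z\<in>I. w z * (coeff p i * z ^ i)) + cb * pairing n (psi n b) p"
    unfolding pairing_def sum_distrib_left sum.distrib[symmetric]
    by (intro sum.cong refl) (simp add: algebra_simps sum_distrib_left)
  also have "(\<Sum>i\<le>n. \<Sum>z\<in>I. w z * (coeff p i * z ^ i)) = (\<Sum>z\<in>I. w z * poly p z)"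
    by (subst sum.swap) (simp add: poly_eq_sum_le[OF assms(2)] sum_distrib_left)
  finally show ?thesis .
qed

lemma pairing_support_poly:
  assumes r: "repr n x I w ca cb" and A: "ca > 0 \<Longrightarrow> A" "A \<Longrightarrow> \<bar>a\<bar> \<noteq> \<infinity>" and B: "cb > 0 \<Longrightarrow> B"
    and deg: "2 * card I + of_bool A + of_bool B \<le> n"
  shows "nonnegT (support_poly I A B)" "pairing n x (support_poly I A B) = 0"
proof -
  let ?q = "support_poly I A B"
  have I: "finite I" using r by (simp add: repr_def)
  have dq: "degree ?q \<le> n" using deg by (cases B) (auto simp: support_poly_degree[OF I])
  show "nonnegT ?q" using dq support_poly_nonneg A(2) by (simp add: nonnegT_def)
  have c0: "ca \<ge> 0" "cb \<ge> 0" using r by (auto simp: repr_def)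
  have "(\<Sum>z\<in>I. w z * poly ?q z) = 0"
    using I by (intro sum.neutral) (auto simp: poly_support_poly intro!: prod_zero)
  moreover have "ca * pairing n (psi n a) ?q = 0"
  proof (cases "ca > 0")
    case True
    then have "A" "\<bar>a\<bar> \<noteq> \<infinity>" using A by auto
    then obtain \<alpha> where \<alpha>: "a = ereal \<alpha>" by (cases a) auto
    have "pairing n (psi n a) ?q = poly ?q \<alpha>"
      using pairing_psi_real[OF dq, of \<alpha>] by (simp only: \<alpha>[symmetric])
    also have "\<dots> = 0" using \<open>A\<close> by (simp add: poly_support_poly real_of_ereal.simps(1)[of \<alpha>, folded \<alpha>])
    finally show ?thesis by simp
  qed (use c0 in simp)
  moreover have "cb * pairing n (psi n b) ?q = 0"
  proof (cases "cb > 0")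
    case True
    then have "B" by (rule B)
    show ?thesis
    proof (cases "b = \<infinity>")
      case True
      then have "degree ?q = 2 * card I + of_bool A" using support_poly_degree(2)[OF I, of A B] by simp
      with deg \<open>B\<close> have "degree ?q < n" by simp
      moreover have "pairing n (psi n b) ?q = coeff ?q n"
        using pairing_psi_infinity[of ?q] by (simp only: True[symmetric])
      ultimately show ?thesis by (simp add: coeff_eq_0)
    next
      case False
      then obtain \<beta> where \<beta>: "b = ereal \<beta>" using ab by (cases b) auto
      then have ereal_finite: "\<bar>b\<bar> \<noteq> \<infinity>" by simp
      have "pairing n (psi n b) ?q = poly ?q \<beta>"
      using pairing_psi_real[OF dq, of \<beta>] by (simp only: \<beta>[symmetric])
      also have "\<dots> = 0" using \<open>B\<close> ereal_finite by (simp add: poly_support_poly real_of_ereal.simps(1)[of \<beta>, folded \<beta>])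
      finally show ?thesis by simp
    qed
  qed (use c0 in simp)
  ultimately show "pairing n x ?q = 0" using pairing_repr[OF r dq] by linarith
qed

text \<open>An index of at most \<open>n\<close> would leave room for \<open>support_poly\<close>
  among the nonnegative polynomials, and its pairing with the vector is zero.\<close>

lemma strict_repr_count:
  assumes x: "strict x" and r: "repr n x I w ca cb" and A: "ca > 0 \<Longrightarrow> \<bar>a\<bar> \<noteq> \<infinity>"
  shows "n < 2 * card I + of_bool (ca > 0) + of_bool (cb > 0)"
proof (rule ccontr)
  assume "\<not> ?thesis"
  then have "2 * card I + of_bool (ca > 0) + of_bool (cb > 0) \<le> n" by simp
  then have q: "nonnegT (support_poly I (ca > 0) (cb > 0))" "pairing n x (support_poly I (ca > 0) (cb > 0)) = 0"
    using pairing_support_poly[OF r, of "ca > 0" "cb > 0"] A by auto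
  have "support_poly I (ca > 0) (cb > 0) \<noteq> 0" using r by (intro support_poly_degree) (simp add: repr_def)
  then have "pairing n x (support_poly I (ca > 0) (cb > 0)) > 0" using x q(1) unfolding strict_def by blast
  then show False using q(2) by simp
qed

section \<open>Upper and lower principal representations\<close>

lemma pairing_psi_b:
  assumes "degree p \<le> n"
  shows "pairing n (psi n b) p = (if b = \<infinity> then coeff p n else poly p (real_of_ereal b))"
proof (cases "b = \<infinity>")
  case True
  have "pairing n (psi n b) p = coeff p n"
    using pairing_psi_infinity[of p] by (simp only: True[symmetric])
  then show ?thesis using True by simp
next
  case False
  then obtain \<beta> where \<beta>: "b = ereal \<beta>" using ab by (cases b) auto
  then show ?thesis using pairing_psi_real[OF assms, of \<beta>] False by simp
qed

lemma pairing_psi_a: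
  assumes "degree p \<le> n" "\<bar>a\<bar> \<noteq> \<infinity>"
  shows "pairing n (psi n a) p = poly p (real_of_ereal a)"
proof -
  obtain \<alpha> where \<alpha>: "a = ereal \<alpha>" using assms(2) by (cases a) auto
  then show ?thesis using pairing_psi_real[OF assms(1), of \<alpha>] by simp
qed

lemma pairing_gpos_b: "pairing n (psi n b) gpos > 0"
proof (cases "b = \<infinity>")
  case False
  then have "real_of_ereal b \<in> T" using ab by (cases a; cases b) (auto simp: real_segment_def)
  then have "poly gpos (real_of_ereal b) \<ge> 1" by (rule gpos_ge)
  then show ?thesis using False by (simp only: pairing_psi_b[OF gpos_degree] if_False)
qed (use pairing_psi_b[OF gpos_degree] gpos_coeff in simp)

lemma pairing_gpos_a: "\<bar>a\<bar> \<noteq> \<infinity> \<Longrightarrow> pairing n (psi n a) gpos > 0"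
proof -
  assume a: "\<bar>a\<bar> \<noteq> \<infinity>"
  then have "real_of_ereal a \<in> T" using ab by (cases a; cases b) (auto simp: real_segment_def)
  then have "poly gpos (real_of_ereal a) \<ge> 1" by (rule gpos_ge)
  then show ?thesis by (simp only: pairing_psi_a[OF gpos_degree a])
qed

lemma pairing_subtract: "pairing m (\<lambda>i. x i - r * v i) q = pairing m x q - r * pairing m v q"
  using pairing_combination_left[of m 1 x "- r" v q] by simp

lemma repr_add_b:
  assumes "repr n (\<lambda>i. x i - r * psi n b i) I w ca cb" "cb + r \<ge> 0"
  shows "repr n x I w ca (cb + r)"
  using assms unfolding repr_def by (auto simp: algebra_simps)

lemma repr_add_a:
  assumes "repr n (\<lambda>i. x i - r * psi n a i) I w ca cb" "ca + r \<ge> 0"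
  shows "repr n x I w (ca + r) cb"
  using assms unfolding repr_def by (auto simp: algebra_simps)

text \<open>The extremal multiple of the vector of \<open>b\<close> is subtracted. The annihilating
  polynomial is positive at \<open>b\<close>, so the remainder has no mass there and index at most
  \<open>n\<close>; putting the mass back raises the index by one, and strictness rules out anything
  below \<open>n + 1\<close>.\<close>

lemma upper_repr:
  assumes x: "strict x"
  shows "\<exists>I w ca cb. repr n x I w ca cb \<and> cb > 0 \<and> (ca > 0 \<longrightarrow> \<bar>a\<bar> \<noteq> \<infinity>) \<and> 2 * card I + of_bool (ca > 0) = n"
proof -
  obtain r p where p: "nonnegT p" "pairing n (psi n b) p > 0" and y: "dual (\<lambda>i. x i - r * psi n b i)"
    "pairing n (\<lambda>i. x i - r * psi n b i) p = 0"
    using extremal_multiple[of "psi n b" x gpos] x gpos_nonnegT pairing_gpos_b unfolding strict_def by blast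
  have p0: "p \<noteq> 0" using p(2) by auto
  have degp: "degree p \<le> n" using p(1) by (simp add: nonnegT_def)
  obtain I w ca cb where r1: "repr n (\<lambda>i. x i - r * psi n b i) I w ca cb"
    and ca: "ca > 0 \<longrightarrow> \<bar>a\<bar> \<noteq> \<infinity> \<and> poly p (real_of_ereal a) = 0"
    and cb: "cb > 0 \<longrightarrow> (\<bar>b\<bar> \<noteq> \<infinity> \<and> poly p (real_of_ereal b) = 0) \<or> (b = \<infinity> \<and> coeff p n = 0)"
    and cnt: "2 * card I + of_bool (ca > 0) + of_bool (cb > 0) \<le> n"
    using repr_of_zero[OF y(1) p(1) p0 y(2)] by (elim exE conjE) (rule that)
  have "\<not> cb > 0" using cb p(2) unfolding pairing_psi_b[OF degp] by (auto split: if_splits)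
  then have cb0: "cb = 0" using r1 by (simp add: repr_def)
  have "pairing n x p > 0" using x p(1) p0 unfolding strict_def by blast
  then have "r * pairing n (psi n b) p > 0" using y(2) unfolding pairing_subtract by simp
  then have r0: "r > 0" using p(2) by (simp add: zero_less_mult_iff)
  have rx: "repr n x I w ca r" using repr_add_b[OF r1] r0 cb0 by simp
  have "n < 2 * card I + of_bool (ca > 0) + of_bool (r > 0)" using ca by (intro strict_repr_count[OF x rx]) auto
  then have "2 * card I + of_bool (ca > 0) = n" using cnt r0 by simp
  then show ?thesis using rx r0 ca
    by (intro exI[of _ I] exI[of _ w] exI[of _ ca] exI[of _ r] conjI impI) auto
qed

text \<open>The same construction at \<open>a\<close>; evenness of \<open>n\<close> forbids an atom
  at \<open>b\<close>. On the whole line both infinite endpoints have the same vector, so the upper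
  representation serves.\<close>

lemma lower_repr_even:
  assumes x: "strict x" and even: "even n"
  shows "\<exists>I w ca. repr n x I w ca 0 \<and> ca > 0 \<and> 2 * card I = n"
proof (cases "\<bar>a\<bar> = \<infinity>")
  case True
  then have ai: "a = -\<infinity>" "b = \<infinity>" using ab by auto
  obtain I w ca cb where r: "repr n x I w ca cb" "cb > 0" "ca > 0 \<longrightarrow> \<bar>a\<bar> \<noteq> \<infinity>" "2 * card I + of_bool (ca > 0) = n"
    using upper_repr[OF x] by (elim exE conjE) (rule that)
  have "ca = 0" using r True by (auto simp: repr_def less_le)
  moreover have "psi n a = psi n b" using psi_MInfty[OF even] ai by simp
  ultimately have "repr n x I w cb 0" using r(1) unfolding repr_def by simp
  then show ?thesis using r \<open>ca = 0\<close> by (intro exI[of _ I] exI[of _ w] exI[of _ cb]) simp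
next
  case fin: False
  obtain r p where p: "nonnegT p" "pairing n (psi n a) p > 0" and y: "dual (\<lambda>i. x i - r * psi n a i)"
    "pairing n (\<lambda>i. x i - r * psi n a i) p = 0"
    using extremal_multiple[of "psi n a" x gpos] x gpos_nonnegT pairing_gpos_a[OF fin] unfolding strict_def by blast
  have p0: "p \<noteq> 0" using p(2) by auto
  have degp: "degree p \<le> n" using p(1) by (simp add: nonnegT_def)
  obtain I w ca cb where r1: "repr n (\<lambda>i. x i - r * psi n a i) I w ca cb"
    and ca: "ca > 0 \<longrightarrow> \<bar>a\<bar> \<noteq> \<infinity> \<and> poly p (real_of_ereal a) = 0"
    and cb: "cb > 0 \<longrightarrow> (\<bar>b\<bar> \<noteq> \<infinity> \<and> poly p (real_of_ereal b) = 0) \<or> (b = \<infinity> \<and> coeff p n = 0)"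
    and cnt: "2 * card I + of_bool (ca > 0) + of_bool (cb > 0) \<le> n"
    using repr_of_zero[OF y(1) p(1) p0 y(2)] by (elim exE conjE) (rule that)
  have "\<not> ca > 0" using ca p(2) unfolding pairing_psi_a[OF degp fin] by auto
  then have ca0: "ca = 0" using r1 by (simp add: repr_def)
  have "pairing n x p > 0" using x p(1) p0 unfolding strict_def by blast
  then have "r * pairing n (psi n a) p > 0" using y(2) unfolding pairing_subtract by simp
  then have r0: "r > 0" using p(2) by (simp add: zero_less_mult_iff)
  have rx: "repr n x I w r cb" using repr_add_a[OF r1] r0 ca0 by simp
  have "n < 2 * card I + of_bool (r > 0) + of_bool (cb > 0)" using fin by (intro strict_repr_count[OF x rx]) auto
  then have eq: "2 * card I + of_bool (cb > 0) = n" using cnt r0 ca0 by simp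
  have "\<not> cb > 0"
  proof
    assume "cb > 0"
    then have "Suc (2 * card I) = n" using eq by simp
    then show False using even by presburger
  qed
  then have "cb = 0" using rx by (simp add: repr_def)
  then show ?thesis using rx r0 eq by (intro exI[of _ I] exI[of _ w] exI[of _ r]) simp
qed

lemma lead_coeff_support_poly:
  "lead_coeff (support_poly I A B) = (if B \<and> \<bar>b\<bar> \<noteq> \<infinity> then -1 else 1)"
proof -
  have "lead_coeff (\<Prod>z\<in>I. [:- z, 1:]\<^sup>2 :: real poly) = 1" by (simp add: lead_coeff_prod lead_coeff_power)
  then show ?thesis by (simp add: support_poly_def lead_coeff_mult)
qed

text \<open>For odd \<open>n\<close> the lower representation comes from the smallest admissible moment of order \<open>n + 1\<close>.\<close>

lemma lower_repr_odd:
  assumes x: "strict x" and odd: "odd n"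
  shows "\<exists>I w. repr n x I w 0 0 \<and> 2 * card I = n + 1"
proof -
  have fina: "\<bar>a\<bar> \<noteq> \<infinity>" using ab odd by auto
  interpret N: moment_interval "Suc n" a b
    using ab odd by unfold_locales auto
  \<comment> \<open>The entry of order \<open>n + 1\<close> is a placeholder; the extremal multiple
    of the unit vector \<open>v\<close> replaces it.\<close>
  define x' where "x' = x(Suc n := 0)"
  define v where "v = (\<lambda>i. if i = Suc n then 1 else 0 :: real)"
  have pv: "pairing (Suc n) v p = coeff p (Suc n)" for p
    unfolding v_def using pairing_unit[of "Suc n" 1 p] by simp
  have restr: "pairing (Suc n) y p = pairing n x p" if "coeff p (Suc n) = 0" "\<And>i. i \<le> n \<Longrightarrow> y i = x i" for y p
    using that by (simp add: pairing_def)
  have down: "nonnegT p" if "N.nonnegT p" "coeff p (Suc n) = 0" for p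
  proof -
    have "degree p \<le> n"
    proof (rule ccontr)
      assume "\<not> ?thesis"
      then have "degree p = Suc n" using that(1) by (simp add: N.nonnegT_def)
      then have "p = 0" using that(2) by (metis leading_coeff_0_iff)
      then show False using \<open>\<not> degree p \<le> n\<close> by simp
    qed
    then show ?thesis using that(1) by (simp add: nonnegT_def N.nonnegT_def)
  qed
  have prem: "pairing (Suc n) x' p > 0" if "N.nonnegT p" "p \<noteq> 0" "pairing (Suc n) v p = 0" for p
  proof -
    have c: "coeff p (Suc n) = 0" using that(3) by (simp add: pv)
    have "pairing n x p > 0" using x down[OF that(1) c] that(2) unfolding strict_def by blast
    then show ?thesis using restr[OF c, of x'] by (simp add: x'_def)
  qed
  have "\<exists>r p. N.nonnegT p \<and> pairing (Suc n) v p > 0 \<and> N.dual (\<lambda>i. x' i - r * v i) \<and>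
      pairing (Suc n) (\<lambda>i. x' i - r * v i) p = 0"
    by (rule N.extremal_multiple[of v x' N.gpos]) (use prem N.gpos_nonnegT in \<open>auto simp: pv N.gpos_coeff\<close>)
  then obtain r p where p: "N.nonnegT p" "pairing (Suc n) v p > 0" and y: "N.dual (\<lambda>i. x' i - r * v i)"
    "pairing (Suc n) (\<lambda>i. x' i - r * v i) p = 0"
    by (elim exE conjE) (rule that)
  note p = p(1) p(2)[unfolded pv]
  define y' where "y' = (\<lambda>i. x' i - r * v i)"
  have y'x: "y' i = x i" if "i \<le> n" for i using that by (simp add: y'_def x'_def v_def)
  have p0: "p \<noteq> 0" using p(2) by auto
  obtain I w ca cb where r1: "repr (Suc n) y' I w ca cb"
    and ca: "ca > 0 \<longrightarrow> \<bar>a\<bar> \<noteq> \<infinity> \<and> poly p (real_of_ereal a) = 0"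
    and cb: "cb > 0 \<longrightarrow> (\<bar>b\<bar> \<noteq> \<infinity> \<and> poly p (real_of_ereal b) = 0) \<or> (b = \<infinity> \<and> coeff p (Suc n) = 0)"
    and cnt: "2 * card I + of_bool (ca > 0) + of_bool (cb > 0) \<le> Suc n"
    using N.repr_of_zero[OF y(1)[folded y'_def] p(1) p0 y(2)[folded y'_def]] by (elim exE conjE) (rule that)
  have cbf: "cb > 0 \<longrightarrow> \<bar>b\<bar> \<noteq> \<infinity>" using cb p(2) by auto
  have nn: "ca \<ge> 0" "cb \<ge> 0" and I: "finite I" "I \<subseteq> interior T" using r1 by (auto simp: repr_def)
  have psi_eq: "psi (Suc n) t i = psi n t i" if "\<bar>t\<bar> \<noteq> \<infinity>" "i \<le> n" for t i
    using that by (cases t) (auto simp: psi_def)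
  have rx: "repr n x I w ca cb"
    unfolding repr_def
  proof (intro conjI allI impI)
    fix i assume i: "i \<le> n"
    have "x i = ca * psi (Suc n) a i + (\<Sum>z\<in>I. w z * z ^ i) + cb * psi (Suc n) b i"
      using r1 i y'x[OF i] by (simp add: repr_def)
    moreover have "ca * psi (Suc n) a i = ca * psi n a i" using psi_eq[OF fina i] by simp
    moreover have "cb * psi (Suc n) b i = cb * psi n b i"
      using psi_eq[of b i] i cbf nn by (cases "cb = 0") auto
    ultimately show "x i = ca * psi n a i + (\<Sum>z\<in>I. w z * z ^ i) + cb * psi n b i" by linarith
  qed (use r1 in \<open>auto simp: repr_def\<close>)
  have "n < 2 * card I + of_bool (ca > 0) + of_bool (cb > 0)" using fina by (intro strict_repr_count[OF x rx]) auto
  then have eq: "2 * card I + of_bool (ca > 0) + of_bool (cb > 0) = Suc n" using cnt by linarith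
  have par: "ca > 0 \<longleftrightarrow> cb > 0"
  proof (rule ccontr)
    assume "\<not> ?thesis"
    then have "2 * card I + 1 = Suc n" using eq by (cases "ca > 0"; cases "cb > 0") auto
    then show False using odd by presburger
  qed
  have "\<not> ca > 0"
  proof
    assume pos: "ca > 0"
    then have posb: "cb > 0" and finb: "\<bar>b\<bar> \<noteq> \<infinity>" using par cbf by auto
    \<comment> \<open>Suppose both endpoints carry mass. As \<open>?D\<close> has top coefficient
      \<open>-1\<close>, adding a multiple of it to \<open>p\<close> gives a nonnegative polynomial
      of degree at most \<open>n\<close> whose pairing with \<open>x\<close> is zero, so it is the
      zero polynomial by strictness. This contradicts positivity of \<open>?D\<close> at an interior
      point off the atoms.\<close>
    let ?D = "support_poly I True True"
    have cI: "2 * card I + 2 = Suc n" using eq pos posb by simp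
    have D: "N.nonnegT ?D" "pairing (Suc n) y' ?D = 0"
      using N.pairing_support_poly[OF r1, of True True] cI fina by simp_all
    have "degree ?D = Suc n" using N.support_poly_degree(2)[OF I(1), of True True] cI finb by simp
    then have cD: "coeff ?D (Suc n) = -1" using lead_coeff_support_poly[of I True True] finb by simp
    define k where "k = coeff p (Suc n)"
    have k: "k > 0" using p(2) by (simp add: k_def)
    let ?q = "p + Polynomial.smult k ?D"
    have cq: "coeff ?q (Suc n) = 0" by (simp add: cD k_def)
    have "N.nonnegT ?q" using p(1) D(1) k
      by (auto simp: N.nonnegT_def intro!: degree_add_le order_trans[OF degree_smult_le] add_nonneg_nonneg mult_nonneg_nonneg)
    then have nq: "nonnegT ?q" by (rule down[OF _ cq])
    have "pairing (Suc n) y' ?q = 0" using y(2) D(2) by (simp add: pairing_add_right pairing_smult_right y'_def)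
    then have "pairing n x ?q = 0" using restr[OF cq, of y'] y'x by simp
    then have q0: "?q = 0" using x nq unfolding strict_def by (metis order_less_irrefl)
    obtain t where t: "t \<in> interior T" "t \<notin> I" using infinite_interior_T I(1) by (meson finite_subset subsetI)
    have tT: "t \<in> T" using t(1) interior_subset by blast
    have "a < ereal t" "ereal t < b" using t(1) unfolding interior_T by auto
    then have "t - real_of_ereal a > 0" "real_of_ereal b - t > 0"
      using fina finb by (cases a; cases b; auto)+
    moreover have "(\<Prod>z\<in>I. (t - z)\<^sup>2) > 0" using t(2) by (intro prod_pos) auto
    ultimately have "poly ?D t > 0" using finb by (simp add: poly_support_poly)
    then have "k * poly ?D t > 0" using k by simp
    moreover have "poly p t \<ge> 0" using p(1) tT by (simp add: N.nonnegT_def)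
    moreover have "poly p t + k * poly ?D t = 0" using arg_cong[OF q0, of "\<lambda>q. poly q t"] by simp
    ultimately show False by linarith
  qed
  then have "ca = 0" "cb = 0" using par nn by auto
  then show ?thesis using rx eq by auto
qed

lemma boundary_repr:
  assumes "dual x" "\<not> strict x"
  shows "\<exists>I w ca cb. repr n x I w ca cb \<and> (ca > 0 \<longrightarrow> \<bar>a\<bar> \<noteq> \<infinity>) \<and> 2 * card I + of_bool (ca > 0) + of_bool (cb > 0) \<le> n"
proof -
  obtain p where p: "nonnegT p" "p \<noteq> 0" "\<not> pairing n x p > 0" using assms(2) unfolding strict_def by blast
  then have "pairing n x p = 0" using assms(1) unfolding dual_def by (meson antisym_conv2 not_less)
  from repr_of_zero[OF assms(1) p(1,2) this] obtain I w ca cb where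
    "repr n x I w ca cb" "ca > 0 \<longrightarrow> \<bar>a\<bar> \<noteq> \<infinity> \<and> poly p (real_of_ereal a) = 0"
    "2 * card I + of_bool (ca > 0) + of_bool (cb > 0) \<le> n"
    by (elim exE conjE) (rule that)
  then show ?thesis
    by (intro exI[of _ I] exI[of _ w] exI[of _ ca] exI[of _ cb] conjI impI) auto
qed

section \<open>Identification of the moment cone and its boundary\<close>

definition cone_moments :: "(nat \<Rightarrow> real) set" where
  "cone_moments = {(\<lambda>i. \<integral>t. psi n (ereal t) i \<partial>\<mu>) | \<mu>.
        sets \<mu> = sets (restrict_space borel T) \<and> (\<forall>i\<le>n. integrable \<mu> (\<lambda>t. psi n (ereal t) i))}"

abbreviation coords :: "(nat \<Rightarrow> real) set" where
  "coords \<equiv> {x. \<forall>i\<ge>n + 1. x i = 0}"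

lemma closed_coords: "closed coords"
proof -
  have "coords = (\<Inter>i\<in>{n + 1..}. {x. x i = 0})" by auto
  then show ?thesis by (auto intro!: closed_INT closed_Collect_eq continuous_intros)
qed

lemma cone_moments_coords: "cone_moments \<subseteq> coords"
  by (auto simp: cone_moments_def psi_def)

lemma Euclidean_space_eq: "Euclidean_space (n + 1) = top_of_set coords"
  by (simp add: Euclidean_space_def euclidean_product_topology)

lemma moment_cone_eq_closure: "moment_cone n T = closure cone_moments"
proof -
  have "moment_cone n T = Euclidean_space (n + 1) closure_of cone_moments"
    by (simp add: moment_cone_def cone_moments_def)
  also have "\<dots> = coords \<inter> closure cone_moments"
    unfolding Euclidean_space_eq using cone_moments_coords
    by (simp add: closure_of_subtopology Int_absorb1 euclidean_closure_of)
  also have "\<dots> = closure cone_moments"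
    using closure_minimal[OF cone_moments_coords closed_coords] by blast
  finally show ?thesis .
qed

lemma cone_moments_dual: "x \<in> cone_moments \<Longrightarrow> dual x"
proof -
  assume "x \<in> cone_moments"
  then obtain \<mu> where \<mu>: "sets \<mu> = sets (restrict_space borel T)" "\<And>i. i \<le> n \<Longrightarrow> integrable \<mu> (\<lambda>t. psi n (ereal t) i)"
    and x: "x = (\<lambda>i. \<integral>t. psi n (ereal t) i \<partial>\<mu>)" by (auto simp: cone_moments_def)
  have sp: "space \<mu> = T" using sets_eq_imp_space_eq[OF \<mu>(1)] by (simp add: space_restrict_space)
  show ?thesis
    unfolding dual_def
  proof (intro allI impI)
    fix p assume p: "nonnegT p"
    have "pairing n x p = (\<integral>t. (\<Sum>i\<le>n. psi n (ereal t) i * coeff p i) \<partial>\<mu>)"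
      unfolding pairing_def x using \<mu>(2) by (subst Bochner_Integration.integral_sum) auto
    also have "\<dots> = (\<integral>t. poly p t \<partial>\<mu>)"
    proof -
      have "(\<Sum>i\<le>n. psi n (ereal t) i * coeff p i) = poly p t" for t
        using pairing_psi_real[of p t] p by (simp add: pairing_def nonnegT_def)
      then show ?thesis by simp
    qed
    also have "\<dots> \<ge> 0" using p sp by (intro Bochner_Integration.integral_nonneg_AE AE_I2) (auto simp: nonnegT_def)
    finally show "pairing n x p \<ge> 0" .
  qed
qed

lemma moment_cone_dual: "x \<in> moment_cone n T \<Longrightarrow> dual x \<and> x \<in> coords"
proof -
  have "closed {x. dual x}"
  proof -
    have "{x. dual x} = (\<Inter>p\<in>{p. nonnegT p}. {x. pairing n x p \<ge> 0})" by (auto simp: dual_def)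
    then show ?thesis unfolding pairing_def by (auto intro!: closed_INT closed_Collect_le continuous_intros)
  qed
  then have "closure cone_moments \<subseteq> {x. dual x}" using cone_moments_dual by (intro closure_minimal) auto
  moreover have "closure cone_moments \<subseteq> coords" by (rule closure_minimal[OF cone_moments_coords closed_coords])
  ultimately show "x \<in> moment_cone n T \<Longrightarrow> dual x \<and> x \<in> coords" by (auto simp: moment_cone_eq_closure)
qed

lemma finite_combination_in_cone_moments:
  assumes J: "finite J" "J \<subseteq> T" "\<And>z. z \<in> J \<Longrightarrow> w z \<ge> 0"
  shows "(\<lambda>i. if i \<le> n then \<Sum>z\<in>J. w z * z ^ i else 0) \<in> cone_moments"
proof -
  \<comment> \<open>Transports the point measure from the discrete sigma-algebra to the Borel sets
    of the interval.\<close>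
  define \<mu> where "\<mu> = distr (point_measure J (\<lambda>z. ennreal (w z))) (restrict_space borel T) (\<lambda>z. z)"
  have meas: "(\<lambda>z. z) \<in> measurable (point_measure J (\<lambda>z. ennreal (w z))) (restrict_space borel T)"
    using J(2) by (auto simp: measurable_def space_point_measure space_restrict_space sets_point_measure)
  have psi_meas: "(\<lambda>t. psi n (ereal t) i) \<in> borel_measurable (restrict_space borel T)" for i
  proof -
    have "psi n (ereal t) i = (if i > n then 0 else t ^ i)" for t by (simp add: psi_def)
    then show ?thesis by (intro measurable_restrict_space1) simp
  qed
  have int: "integrable \<mu> (\<lambda>t. psi n (ereal t) i)" for i
    unfolding \<mu>_def using J(1) by (subst integrable_distr_eq[OF meas psi_meas]) (auto intro!: integrable_point_measure_finite)
  have eq: "(\<integral>t. psi n (ereal t) i \<partial>\<mu>) = (if i \<le> n then \<Sum>z\<in>J. w z * z ^ i else 0)" for i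
    unfolding \<mu>_def integral_distr[OF meas psi_meas] using J
    by (subst lebesgue_integral_point_measure_finite) (auto simp: psi_def)
  show ?thesis
    unfolding cone_moments_def
  proof (intro CollectI exI[of _ \<mu>] conjI allI impI)
    show "(\<lambda>i. if i \<le> n then \<Sum>z\<in>J. w z * z ^ i else 0) = (\<lambda>i. \<integral>t. psi n (ereal t) i \<partial>\<mu>)"
      by (simp only: eq)
    show "sets \<mu> = sets (restrict_space borel T)" by (simp add: \<mu>_def)
  qed (rule int)
qed

text \<open>A mass at infinity is a limit of masses \<open>c / t ^ n\<close> at points
  \<open>t\<close> going to infinity, which is where the closure in the definition of the cone is
  used.\<close>

lemma combination_in_moment_cone:
  assumes J: "finite J" "J \<subseteq> T" "\<And>z. z \<in> J \<Longrightarrow> w z \<ge> 0" and c: "c \<ge> 0" "c \<noteq> 0 \<Longrightarrow> b = \<infinity>"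
  shows "(\<lambda>i. if i \<le> n then (\<Sum>z\<in>J. w z * z ^ i) + (if i = n then c else 0) else 0) \<in> moment_cone n T"
proof (cases "c = 0")
  case True
  have "(\<lambda>i. if i \<le> n then \<Sum>z\<in>J. w z * z ^ i else 0) \<in> closure cone_moments"
    using finite_combination_in_cone_moments[of J w] J closure_subset[of cone_moments] by blast
  then show ?thesis unfolding moment_cone_eq_closure by (simp add: True cong: if_cong)
next
  case False
  then have b: "b = \<infinity>" by (rule c)
  define M where "M = \<bar>real_of_ereal a\<bar> + (\<Sum>z\<in>J. \<bar>z\<bar>) + 1"
  have sJ: "(\<Sum>z\<in>J. \<bar>z\<bar>) \<ge> 0" by (rule sum_nonneg) simp
  have M: "M > 0"
    using sJ abs_ge_zero[of "real_of_ereal a"] unfolding M_def by linarith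
  \<comment> \<open>Written in terms of \<open>s = 1 / t\<close>, so that the limit is the value at
    \<open>s = 0\<close>, where \<open>0 ^ 0 = 1\<close> leaves \<open>c\<close> in order
    \<open>n\<close> only.\<close>
  define y where "y = (\<lambda>s::real. \<lambda>i. if i \<le> n then (\<Sum>z\<in>J. w z * z ^ i) + c * s ^ (n - i) else 0)"
  have in_M: "y s \<in> cone_moments" if s: "s \<in> {0<..<1 / M}" for s
  proof -
    define t where "t = 1 / s"
    have t: "t > M" using s M by (simp add: t_def field_simps)
    have "t \<ge> real_of_ereal a" using t sJ abs_ge_self[of "real_of_ereal a"] unfolding M_def by linarith
    then have tT: "t \<in> T" using b ab by (cases a) (auto simp: real_segment_def)
    have "\<bar>z\<bar> < t" if "z \<in> J" for z
    proof -
      have "\<bar>z\<bar> \<le> (\<Sum>z\<in>J. \<bar>z\<bar>)" using that J(1) by (intro member_le_sum) auto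
      then show ?thesis using t abs_ge_zero[of "real_of_ereal a"] unfolding M_def by linarith
    qed
    then have tJ: "t \<notin> J" by force
    define w' where "w' = w(t := c / t ^ n)"
    have t0: "t > 0" using t M by simp
    have "(\<lambda>i. if i \<le> n then \<Sum>z\<in>insert t J. w' z * z ^ i else 0) \<in> cone_moments"
      using J tT c t0 by (intro finite_combination_in_cone_moments) (auto simp: w'_def)
    moreover have "(\<Sum>z\<in>insert t J. w' z * z ^ i) = (\<Sum>z\<in>J. w z * z ^ i) + c * s ^ (n - i)" if "i \<le> n" for i
    proof -
      have "(\<Sum>z\<in>J. w' z * z ^ i) = (\<Sum>z\<in>J. w z * z ^ i)" using tJ by (intro sum.cong) (auto simp: w'_def)
      moreover have "c / t ^ n * t ^ i = c * s ^ (n - i)"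
      proof -
        have "t ^ n = t ^ i * t ^ (n - i)" using that by (simp add: power_add[symmetric])
        then show ?thesis using t0 s by (simp add: t_def power_divide)
      qed
      ultimately show ?thesis using J(1) tJ by (simp add: w'_def)
    qed
    ultimately show ?thesis by (simp add: y_def cong: if_cong)
  qed
  have "continuous_on {0..1 / M} y"
    unfolding y_def
  proof (rule continuous_on_coordinatewise_then_product)
    fix i
    show "continuous_on {0..1 / M} (\<lambda>s. if i \<le> n then (\<Sum>z\<in>J. w z * z ^ i) + c * s ^ (n - i) else 0)"
      by (cases "i \<le> n") (auto intro!: continuous_intros)
  qed
  moreover have cl: "closure {0<..<1 / M} = {0..1 / M}" using M by (intro closure_greaterThanLessThan) simp
  ultimately have cont: "continuous_on (closure {0<..<1 / M}) y" by simp
  have "y ` {0<..<1 / M} \<subseteq> closure cone_moments" using in_M closure_subset[of cone_moments] by blast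
  then have "y ` closure {0<..<1 / M} \<subseteq> closure cone_moments"
    by (rule image_closure_subset[OF cont closed_closure])
  then have "y 0 \<in> moment_cone n T" using M unfolding cl moment_cone_eq_closure by auto
  moreover have "y 0 = (\<lambda>i. if i \<le> n then (\<Sum>z\<in>J. w z * z ^ i) + (if i = n then c else 0) else 0)"
    by (auto simp: y_def fun_eq_iff power_0_left)
  ultimately show ?thesis by simp
qed

lemma repr_in_moment_cone:
  assumes r: "repr n x I w ca cb" and x: "x \<in> coords"
  shows "x \<in> moment_cone n T"
proof -
  have I: "finite I" "I \<subseteq> interior T" "\<And>z. z \<in> I \<Longrightarrow> w z > 0" and c0: "ca \<ge> 0" "cb \<ge> 0"
    and xi: "\<And>i. i \<le> n \<Longrightarrow> x i = ca * psi n a i + (\<Sum>z\<in>I. w z * z ^ i) + cb * psi n b i"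
    using r by (auto simp: repr_def)
  define ra rb where "ra = real_of_ereal a" and "rb = real_of_ereal b"
  define Ea where "Ea = (if \<bar>a\<bar> \<noteq> \<infinity> then {ra} else {})"
  define Eb where "Eb = (if \<bar>b\<bar> \<noteq> \<infinity> then {rb} else {})"
  \<comment> \<open>The total mass at infinity; on the line both endpoints contribute to it, having
    the same moment vector.\<close>
  define c where "c = (if \<bar>a\<bar> = \<infinity> then ca else 0) + (if \<bar>b\<bar> = \<infinity> then cb else 0)"
  define W where "W = (\<lambda>z. if z \<in> I then w z else if z \<in> Ea then ca else cb)"
  have disj: "I \<inter> Ea = {}" "I \<inter> Eb = {}" "Ea \<inter> Eb = {}"
  proof -
    have "z \<notin> Ea \<and> z \<notin> Eb" if "z \<in> I" for z
    proof -
      have "a < ereal z" "ereal z < b" using I(2) that unfolding interior_T by auto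
      then show ?thesis by (cases a; cases b) (auto simp: Ea_def Eb_def ra_def rb_def)
    qed
    then show "I \<inter> Ea = {}" "I \<inter> Eb = {}" by blast+
    show "Ea \<inter> Eb = {}" using ab by (cases a; cases b) (auto simp: Ea_def Eb_def ra_def rb_def)
  qed
  have fE: "finite Ea" "finite Eb" by (auto simp: Ea_def Eb_def)
  have comb: "(\<lambda>i. if i \<le> n then (\<Sum>z\<in>I \<union> Ea \<union> Eb. W z * z ^ i) + (if i = n then c else 0) else 0) \<in> moment_cone n T"
  proof (rule combination_in_moment_cone)
    have "Ea \<subseteq> T" "Eb \<subseteq> T" using ab by (cases a; cases b; auto simp: Ea_def Eb_def ra_def rb_def real_segment_def)+
    then show "I \<union> Ea \<union> Eb \<subseteq> T" using I(2) interior_subset[of T] by blast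
    show "W z \<ge> 0" for z using I(3)[of z] c0 by (auto simp: W_def)
    show "c \<ge> 0" using c0 by (simp add: c_def)
    show "b = \<infinity>" if "c \<noteq> 0" using that ab by (auto simp: c_def split: if_splits)
  qed (use I fE in auto)
  have moments: "(\<Sum>z\<in>I \<union> Ea \<union> Eb. W z * z ^ i) + (if i = n then c else 0) = x i" if i: "i \<le> n" for i
  proof -
    have "(\<Sum>z\<in>I \<union> Ea \<union> Eb. W z * z ^ i) = (\<Sum>z\<in>I. W z * z ^ i) + (\<Sum>z\<in>Ea. W z * z ^ i) + (\<Sum>z\<in>Eb. W z * z ^ i)"
      using I(1) fE disj by (simp add: sum.union_disjoint Int_Un_distrib2)
    moreover have "(\<Sum>z\<in>I. W z * z ^ i) = (\<Sum>z\<in>I. w z * z ^ i)" by (intro sum.cong) (auto simp: W_def)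
    moreover have "(\<Sum>z\<in>Ea. W z * z ^ i) = (\<Sum>z\<in>Ea. ca * z ^ i)" using disj by (intro sum.cong) (auto simp: W_def)
    moreover have "(\<Sum>z\<in>Eb. W z * z ^ i) = (\<Sum>z\<in>Eb. cb * z ^ i)" using disj by (intro sum.cong) (auto simp: W_def)
    moreover have "(\<Sum>z\<in>Ea. ca * z ^ i) + (if i = n then (if \<bar>a\<bar> = \<infinity> then ca else 0) else 0) = ca * psi n a i"
    proof (cases "\<bar>a\<bar> = \<infinity>")
      case True
      then have "a = -\<infinity>" "even n" using ab by auto
      then have "psi n a = psi n \<infinity>" using psi_MInfty by simp
      then show ?thesis using True i by (simp add: Ea_def psi_infinity)
    next
      case False
      then obtain \<alpha> where "a = ereal \<alpha>" by (cases a) auto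
      then show ?thesis using i by (simp add: Ea_def ra_def psi_real)
    qed
    moreover have "(\<Sum>z\<in>Eb. cb * z ^ i) + (if i = n then (if \<bar>b\<bar> = \<infinity> then cb else 0) else 0) = cb * psi n b i"
    proof (cases "b = \<infinity>")
      case True
      then show ?thesis using i by (simp add: Eb_def psi_infinity)
    next
      case False
      then obtain \<beta> where "b = ereal \<beta>" using ab by (cases b) auto
      then show ?thesis using i by (simp add: Eb_def rb_def psi_real)
    qed
    ultimately show ?thesis using xi[OF i] by (simp add: c_def split: if_splits)
  qed
  have zeros: "x i = 0" if "\<not> i \<le> n" for i using x that by simp
  show ?thesis
  proof -
    have "x = (\<lambda>i. if i \<le> n then (\<Sum>z\<in>I \<union> Ea \<union> Eb. W z * z ^ i) + (if i = n then c else 0) else 0)"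
      using moments zeros by (intro ext) simp
    then show ?thesis using comb by simp
  qed
qed

text \<open>The bipolar theorem for this cone, obtained from explicit representations instead of
  separation.\<close>

lemma moment_cone_iff: "x \<in> moment_cone n T \<longleftrightarrow> x \<in> coords \<and> dual x"
proof
  assume x: "x \<in> coords \<and> dual x"
  show "x \<in> moment_cone n T"
  proof (cases "strict x")
    case True
    then show ?thesis using upper_repr[OF True] repr_in_moment_cone x by blast
  next
    case False
    then show ?thesis using boundary_repr[of x] repr_in_moment_cone x by blast
  qed
qed (use moment_cone_dual in blast)

lemma strict_imp_dual: "strict x \<Longrightarrow> dual x"
  unfolding strict_def dual_def by (metis less_imp_le pairing_zero_right order_refl)

lemma moment_cone_boundary_iff: "x \<in> moment_cone_boundary n T \<longleftrightarrow> x \<in> moment_cone n T \<and> \<not> strict x"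
proof -
  let ?E = "Euclidean_space (n + 1)" and ?K = "moment_cone n T"
  have cl: "?E closure_of ?K = ?K" by (simp add: moment_cone_def)
  have "x \<in> ?E interior_of ?K \<longleftrightarrow> strict x" if x: "x \<in> ?K"
  proof
    assume s: "strict x"
    obtain e where e: "e > 0" "\<And>y. (\<forall>i\<le>n. \<bar>y i - x i\<bar> < e) \<Longrightarrow> strict y" using strict_stable[OF s] by blast
    let ?U = "coords \<inter> {y. \<forall>i\<le>n. \<bar>y i - x i\<bar> < e}"
    have "open {y. \<forall>i\<le>n. \<bar>y i - x i\<bar> < e}"
    proof -
      have "{y. \<forall>i\<le>n. \<bar>y i - x i\<bar> < e} = (\<Inter>i\<in>{..n}. {y. \<bar>y i - x i\<bar> < e})" by auto
      also have "open \<dots>" by (intro open_INT ballI open_Collect_less continuous_intros) auto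
      finally show ?thesis .
    qed
    then have "openin ?E ?U" unfolding Euclidean_space_eq by (rule openin_open_Int)
    moreover have "?U \<subseteq> ?K" using e(2) strict_imp_dual by (auto simp: moment_cone_iff)
    moreover have "x \<in> ?U" using x e(1) by (auto simp: moment_cone_iff)
    ultimately show "x \<in> ?E interior_of ?K" unfolding interior_of_def by blast
  next
    assume "x \<in> ?E interior_of ?K"
    then obtain U where U: "openin ?E U" "x \<in> U" "U \<subseteq> ?K" unfolding interior_of_def by blast
    then obtain O' where O': "open O'" "U = coords \<inter> O'" unfolding Euclidean_space_eq by (auto simp: openin_open)
    show "strict x"
    proof (rule ccontr)
      assume "\<not> strict x"
      then obtain p where p: "nonnegT p" "p \<noteq> 0" "\<not> pairing n x p > 0" unfolding strict_def by blast
      have degp: "degree p \<le> n" using p(1) by (simp add: nonnegT_def)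
      \<comment> \<open>Moving against the coefficients of \<open>p\<close> lowers the pairing with
        \<open>p\<close> by \<open>s\<close> times their sum of squares and so leaves the dual cone
        at once.\<close>
      let ?y = "\<lambda>s::real. \<lambda>i. x i - s * coeff p i"
      have "continuous_on UNIV ?y"
        by (intro continuous_on_coordinatewise_then_product continuous_intros)
      then have "open (?y -` O')" using O'(1) by (intro open_vimage)
      moreover have "0 \<in> ?y -` O'" using U(2) O'(2) by simp
      ultimately obtain d where d: "d > 0" "ball 0 d \<subseteq> ?y -` O'" by (meson open_contains_ball)
      let ?s = "d / 2"
      have "?s \<in> ball 0 d" using d(1) by (simp add: dist_real_def)
      then have "?s \<in> ?y -` O'" using d(2) by blast
      then have "?y ?s \<in> O'" by simp
      moreover have "?y ?s \<in> coords" using U(2) O'(2) degp by (auto simp: coeff_eq_0)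
      ultimately have "?y ?s \<in> U" unfolding O'(2) by (intro IntI)
      then have "?y ?s \<in> ?K" using U(3) by (rule subsetD[rotated])
      then have "dual (?y ?s)" by (rule moment_cone_dual[THEN conjunct1])
      then have "0 \<le> pairing n (?y ?s) p" using p(1) unfolding dual_def by blast
      also have "\<dots> = pairing n x p - ?s * (\<Sum>i\<le>n. (coeff p i)\<^sup>2)"
        using pairing_subtract[of n x ?s "coeff p" p] by (simp add: pairing_def power2_eq_square)
      finally have le: "?s * (\<Sum>i\<le>n. (coeff p i)\<^sup>2) \<le> pairing n x p" by simp
      have "0 < (lead_coeff p)\<^sup>2" using p(2) by simp
      also have "\<dots> \<le> (\<Sum>i\<le>n. (coeff p i)\<^sup>2)" using degp by (intro member_le_sum) auto
      finally have "0 < ?s * (\<Sum>i\<le>n. (coeff p i)\<^sup>2)" using d(1) by simp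
      then show False using le p(3) by linarith
    qed
  qed
  then show ?thesis
    unfolding moment_cone_boundary_def frontier_of_def cl by blast
qed

end


section \<open>Pairs of parameter vectors\<close>

text \<open>A pair of parameter vectors is identified with one vector of length
  \<open>p + q\<close>, the form in which the area formula is stated.\<close>

definition par_fst :: "nat \<Rightarrow> (nat \<Rightarrow> real) \<Rightarrow> (nat \<Rightarrow> real)" where
  "par_fst p x = restrict x {..<p}"

definition par_snd :: "nat \<Rightarrow> nat \<Rightarrow> (nat \<Rightarrow> real) \<Rightarrow> (nat \<Rightarrow> real)" where
  "par_snd p q x = (\<lambda>i\<in>{..<q}. x (p + i))"

definition par_join :: "nat \<Rightarrow> nat \<Rightarrow> (nat \<Rightarrow> real) \<times> (nat \<Rightarrow> real) \<Rightarrow> (nat \<Rightarrow> real)" where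
  "par_join p q = (\<lambda>(\<theta>, \<tau>). \<lambda>i\<in>{..<p + q}. if i < p then \<theta> i else \<tau> (i - p))"

lemma par_fst_join: "\<theta> \<in> ext_space p \<Longrightarrow> par_fst p (par_join p q (\<theta>, \<tau>)) = \<theta>"
  by (auto simp: par_fst_def par_join_def fun_eq_iff PiE_def extensional_def)

lemma par_snd_join: "\<tau> \<in> ext_space q \<Longrightarrow> par_snd p q (par_join p q (\<theta>, \<tau>)) = \<tau>"
  by (auto simp: par_snd_def par_join_def fun_eq_iff PiE_def extensional_def)

lemma par_join_split: "x \<in> ext_space (p + q) \<Longrightarrow> par_join p q (par_fst p x, par_snd p q x) = x"
  by (auto simp: par_snd_def par_fst_def par_join_def fun_eq_iff PiE_def extensional_def)

lemma par_join_ext: "par_join p q z \<in> ext_space (p + q)"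
  by (auto simp: par_join_def split: prod.splits)

lemma par_fst_ext: "par_fst p x \<in> ext_space p"
  by (simp add: par_fst_def)

lemma par_snd_ext: "par_snd p q x \<in> ext_space q"
  by (simp add: par_snd_def)

lemma par_fst_upd_less: "j < p \<Longrightarrow> par_fst p (x(j := s)) = (par_fst p x)(j := s)"
  by (auto simp: par_fst_def fun_eq_iff)

lemma par_fst_upd_ge: "p \<le> j \<Longrightarrow> par_fst p (x(j := s)) = par_fst p x"
  by (auto simp: par_fst_def fun_eq_iff)

lemma par_snd_upd_less: "j < p \<Longrightarrow> par_snd p q (x(j := s)) = par_snd p q x"
  by (auto simp: par_snd_def fun_eq_iff)

lemma par_snd_upd_ge: "p \<le> j \<Longrightarrow> j < p + q \<Longrightarrow> par_snd p q (x(j := s)) = (par_snd p q x)(j - p := s)"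
  by (auto simp: par_snd_def fun_eq_iff)

lemma measurable_par_join [measurable]:
  "par_join p q \<in> measurable (lebesgue_fun p \<Otimes>\<^sub>M lebesgue_fun q) (lebesgue_fun (p + q))"
  unfolding par_join_def split_def
proof (rule measurable_restrict)
  fix i assume "i \<in> {..<p + q}"
  then show "(\<lambda>x. if i < p then fst x i else snd x (i - p)) \<in> lebesgue_fun p \<Otimes>\<^sub>M lebesgue_fun q \<rightarrow>\<^sub>M lborel"
  proof (cases "i < p")
    case True
    have "(\<lambda>x. fst x i) \<in> lebesgue_fun p \<Otimes>\<^sub>M lebesgue_fun q \<rightarrow>\<^sub>M lborel"
      by (rule measurable_compose[OF measurable_fst measurable_component_singleton]) (use True in simp)
    then show ?thesis using True by simp
  next
    case False
    have "(\<lambda>x. snd x (i - p)) \<in> lebesgue_fun p \<Otimes>\<^sub>M lebesgue_fun q \<rightarrow>\<^sub>M lborel"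
      by (rule measurable_compose[OF measurable_snd measurable_component_singleton])
        (use False \<open>i \<in> {..<p + q}\<close> in auto)
    then show ?thesis using False by simp
  qed
qed

lemma measurable_par_fst [measurable]: "par_fst p \<in> measurable (lebesgue_fun (p + q)) (lebesgue_fun p)"
  unfolding par_fst_def by (rule measurable_restrict) measurable

lemma measurable_par_snd [measurable]: "par_snd p q \<in> measurable (lebesgue_fun (p + q)) (lebesgue_fun q)"
  unfolding par_snd_def by (rule measurable_restrict) measurable

text \<open>Induction on \<open>q\<close>, peeling off the last coordinate of the second factor,
  which is also the last coordinate of the joined vector.\<close>

lemma nn_integral_param_lebesgue:
  assumes "f \<in> borel_measurable (lebesgue_fun p \<Otimes>\<^sub>M lebesgue_fun q)"
  shows "(\<integral>\<^sup>+z. f z \<partial>param_lebesgue p q) = (\<integral>\<^sup>+x. f (par_fst p x, par_snd p q x) \<partial>lebesgue_fun (p + q))"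
  using assms unfolding param_lebesgue_def
proof (induction q arbitrary: f)
  case (0 f)
  note [measurable] = 0
  interpret L0: sigma_finite_measure "lebesgue_fun 0" by (intro lborel_fun.sigma_finite) auto
  have "(\<integral>\<^sup>+z. f z \<partial>(lebesgue_fun p \<Otimes>\<^sub>M lebesgue_fun 0)) = (\<integral>\<^sup>+x. \<integral>\<^sup>+y. f (x, y) \<partial>lebesgue_fun 0 \<partial>lebesgue_fun p)"
    by (rule L0.nn_integral_fst[symmetric]) measurable
  also have "\<dots> = (\<integral>\<^sup>+x. f (par_fst p x, par_snd p 0 x) \<partial>lebesgue_fun p)"
  proof (intro nn_integral_cong)
    fix x assume x: "x \<in> space (lebesgue_fun p)"
    have "par_fst p x = x" using x by (auto simp: par_fst_def space_PiM PiE_def extensional_def fun_eq_iff)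
    moreover have "par_snd p 0 x = (\<lambda>_. undefined)" by (auto simp: par_snd_def)
    ultimately show "(\<integral>\<^sup>+y. f (x, y) \<partial>lebesgue_fun 0) = f (par_fst p x, par_snd p 0 x)"
      by (simp add: lborel_fun.nn_integral_empty)
  qed
  finally show ?case by simp
next
  case (Suc q f)
  note [measurable] = Suc.prems
  interpret L1: sigma_finite_measure "lebesgue_fun (Suc q)" by (intro lborel_fun.sigma_finite) auto
  interpret L: sigma_finite_measure "lebesgue_fun q" by (intro lborel_fun.sigma_finite) auto
  let ?g = "\<lambda>z. \<integral>\<^sup>+s. f (fst z, (snd z)(q := s)) \<partial>lborel"
  have m: "(\<lambda>(z, s). f (fst z, (snd z)(q := s))) \<in> borel_measurable ((lebesgue_fun p \<Otimes>\<^sub>M lebesgue_fun q) \<Otimes>\<^sub>M lborel)"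
  proof -
    have "(\<lambda>w. (fst (fst w), (\<lambda>(x, s). x(q := s)) (snd (fst w), snd w)))
        \<in> measurable ((lebesgue_fun p \<Otimes>\<^sub>M lebesgue_fun q) \<Otimes>\<^sub>M lborel) (lebesgue_fun p \<Otimes>\<^sub>M lebesgue_fun (Suc q))"
      by (intro measurable_Pair measurable_compose[OF _ measurable_lebesgue_fun_upd]) measurable
    from measurable_compose[OF this Suc.prems] show ?thesis by (simp add: split_def)
  qed
  have g: "?g \<in> borel_measurable (lebesgue_fun p \<Otimes>\<^sub>M lebesgue_fun q)"
    by (intro lborel.borel_measurable_nn_integral m)
  have "(\<integral>\<^sup>+z. f z \<partial>(lebesgue_fun p \<Otimes>\<^sub>M lebesgue_fun (Suc q)))
      = (\<integral>\<^sup>+x. \<integral>\<^sup>+y. f (x, y) \<partial>lebesgue_fun (Suc q) \<partial>lebesgue_fun p)"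
    by (rule L1.nn_integral_fst[symmetric]) measurable
  also have "\<dots> = (\<integral>\<^sup>+x. \<integral>\<^sup>+y. ?g (x, y) \<partial>lebesgue_fun q \<partial>lebesgue_fun p)"
    by (intro nn_integral_cong) (subst nn_integral_lebesgue_fun_Suc, auto)
  also have "\<dots> = (\<integral>\<^sup>+z. ?g z \<partial>(lebesgue_fun p \<Otimes>\<^sub>M lebesgue_fun q))"
    by (rule L.nn_integral_fst[OF g])
  also have "\<dots> = (\<integral>\<^sup>+x. ?g (par_fst p x, par_snd p q x) \<partial>lebesgue_fun (p + q))"
    by (rule Suc.IH[OF g])
  also have "\<dots> = (\<integral>\<^sup>+x. \<integral>\<^sup>+s. f (par_fst p (x(p + q := s)), par_snd p (Suc q) (x(p + q := s))) \<partial>lborel \<partial>lebesgue_fun (p + q))"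
  proof (intro nn_integral_cong)
    fix x s
    have "par_fst p (x(p + q := s)) = par_fst p x" by (rule par_fst_upd_ge) simp
    moreover have "par_snd p (Suc q) (x(p + q := s)) = (par_snd p q x)(q := s)"
      by (auto simp: par_snd_def fun_eq_iff less_Suc_eq)
    ultimately show "f (fst (par_fst p x, par_snd p q x), (snd (par_fst p x, par_snd p q x))(q := s)) =
        f (par_fst p (x(p + q := s)), par_snd p (Suc q) (x(p + q := s)))" by simp
  qed
  also have "\<dots> = (\<integral>\<^sup>+x. f (par_fst p x, par_snd p (Suc q) x) \<partial>lebesgue_fun (Suc (p + q)))"
  proof (subst nn_integral_lebesgue_fun_Suc)
    have "par_fst p \<in> measurable (lebesgue_fun (Suc (p + q))) (lebesgue_fun p)"
      using measurable_par_fst[of p "Suc q"] by simp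
    moreover have "par_snd p (Suc q) \<in> measurable (lebesgue_fun (Suc (p + q))) (lebesgue_fun (Suc q))"
      using measurable_par_snd[of p "Suc q"] by simp
    ultimately show "(\<lambda>x. f (par_fst p x, par_snd p (Suc q) x)) \<in> borel_measurable (lebesgue_fun (Suc (p + q)))"
      by measurable
  qed simp
  finally show ?case by simp
qed

section \<open>Topologies of parameter spaces and coordinate systems\<close>

lemma continuous_map_restrict_powertop:
  "continuous_map (euclidean :: (nat \<Rightarrow> real) topology) (powertop_real {..<m}) (\<lambda>x. restrict x {..<m})"
  unfolding continuous_map_componentwise
proof (intro conjI ballI)
  fix k assume k: "k \<in> {..<m}"
  have "continuous_map euclidean euclidean (\<lambda>x :: nat \<Rightarrow> real. x k)"
    unfolding continuous_map_iff_continuous2 by (rule continuous_on_product_coordinates)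
  then show "continuous_map euclidean euclideanreal (\<lambda>x. restrict x {..<m} k)" using k by simp
qed auto

lemma openin_powertop_ext_open:
  assumes "openin (powertop_real {..<m}) \<Theta>"
  shows "ext_open m \<Theta>"
proof -
  have sub: "\<Theta> \<subseteq> ext_space m" using openin_subset[OF assms] by simp
  have "openin euclidean {x \<in> topspace (euclidean :: (nat \<Rightarrow> real) topology). restrict x {..<m} \<in> \<Theta>}"
    by (rule openin_continuous_map_preimage[OF continuous_map_restrict_powertop assms])
  then have "open {x. restrict x {..<m} \<in> \<Theta>}" by simp
  moreover have "\<Theta> = ext_space m \<inter> {x. restrict x {..<m} \<in> \<Theta>}"
  proof -
    have "restrict x {..<m} = x" if "x \<in> ext_space m" for x :: "nat \<Rightarrow> real"
      using that by (auto simp: PiE_def extensional_def fun_eq_iff)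
    then show ?thesis using sub by force
  qed
  ultimately show ?thesis unfolding openin_open by blast
qed

lemma continuous_map_powertop_imp:
  assumes "continuous_map (subtopology (powertop_real {..<m}) \<Theta>) euclideanreal g" "\<Theta> \<subseteq> ext_space m"
  shows "continuous_on \<Theta> g"
proof -
  have r: "restrict x {..<m} = x" if "x \<in> \<Theta>" for x
    using that assms(2) by (force simp: PiE_def extensional_def fun_eq_iff)
  have "continuous_map (top_of_set \<Theta>) (subtopology (powertop_real {..<m}) \<Theta>) (\<lambda>x. restrict x {..<m})"
    using r by (intro continuous_map_into_subtopology continuous_map_from_subtopology continuous_map_restrict_powertop)
      (auto simp: Pi_iff image_subset_iff)
  from continuous_map_compose[OF this assms(1)]
  have "continuous_on \<Theta> (g \<circ> (\<lambda>x. restrict x {..<m}))" by (simp add: continuous_map_iff_continuous)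
  then show ?thesis using r by (simp cong: continuous_on_cong)
qed

lemma sphere_coordinates_ext_open: "sphere_coordinates m \<Theta> \<rho> \<Longrightarrow> ext_open m \<Theta>"
  by (intro openin_powertop_ext_open) (simp add: sphere_coordinates_def)

lemma sphere_coordinates_C1:
  assumes "sphere_coordinates m \<Theta> \<rho>" "i \<le> m"
  shows "C1 m \<Theta> (\<lambda>\<theta>. \<rho> \<theta> i)"
proof -
  have sub: "\<Theta> \<subseteq> ext_space m"
    using sphere_coordinates_ext_open[OF assms(1)] by (auto dest: openin_imp_subset)
  have "C1_with m \<Theta> (\<lambda>\<theta>. \<rho> \<theta> i) (partial_deriv (\<lambda>\<theta>. \<rho> \<theta> i))"
    unfolding C1_with_def
  proof (intro allI impI conjI ballI)
    fix j assume j: "j < m"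
    show "continuous_on \<Theta> (partial_deriv (\<lambda>\<theta>. \<rho> \<theta> i) j)"
      using assms j by (intro continuous_map_powertop_imp[OF _ sub]) (simp add: sphere_coordinates_def)
    fix x assume "x \<in> \<Theta>"
    then have "(\<lambda>s. \<rho> (x(j := s)) i) differentiable (at (x j))"
      using assms j by (simp add: sphere_coordinates_def)
    then show "((\<lambda>s. \<rho> (x(j := s)) i) has_real_derivative partial_deriv (\<lambda>\<theta>. \<rho> \<theta> i) j x) (at (x j))"
      unfolding partial_deriv_def by (simp add: DERIV_deriv_iff_real_differentiable)
  qed
  then show ?thesis unfolding C1_def by blast
qed

lemma continuous_on_par_fst: "continuous_on S (par_fst p)"
proof (rule continuous_on_coordinatewise_then_product)
  fix i show "continuous_on S (\<lambda>x. par_fst p x i)"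
    by (cases "i < p") (auto simp: par_fst_def intro: continuous_on_subset[OF continuous_on_product_coordinates])
qed

lemma continuous_on_par_snd: "continuous_on S (par_snd p q)"
proof (rule continuous_on_coordinatewise_then_product)
  fix i show "continuous_on S (\<lambda>x. par_snd p q x i)"
    by (cases "i < q") (auto simp: par_snd_def intro: continuous_on_subset[OF continuous_on_product_coordinates])
qed

lemma ext_open_par:
  assumes "ext_open p A" "ext_open q B"
  shows "ext_open (p + q) {x \<in> ext_space (p + q). par_fst p x \<in> A \<and> par_snd p q x \<in> B}"
proof -
  obtain A' B' where AB: "open A'" "A = ext_space p \<inter> A'" "open B'" "B = ext_space q \<inter> B'"
    using assms by (auto simp: openin_open)
  have "open (par_fst p -` A' \<inter> par_snd p q -` B')"
    using AB by (intro open_Int open_vimage continuous_on_par_fst continuous_on_par_snd)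
  moreover have "{x \<in> ext_space (p + q). par_fst p x \<in> A \<and> par_snd p q x \<in> B} =
      ext_space (p + q) \<inter> (par_fst p -` A' \<inter> par_snd p q -` B')"
    using AB par_fst_ext par_snd_ext by auto
  ultimately show ?thesis unfolding openin_open by blast
qed

lemma ext_open_ext_space: "ext_open d (ext_space d)"
  by simp

lemma C1_par_fst:
  assumes f: "C1 p A f" and sub: "\<And>x. x \<in> \<Omega> \<Longrightarrow> par_fst p x \<in> A"
  shows "C1 (p + q) \<Omega> (\<lambda>x. f (par_fst p x))"
proof -
  obtain f' where f': "C1_with p A f f'" using f by (auto simp: C1_def)
  have "C1_with (p + q) \<Omega> (\<lambda>x. f (par_fst p x)) (\<lambda>j x. if j < p then f' j (par_fst p x) else 0)"
    unfolding C1_with_def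
  proof (intro allI impI conjI ballI)
    fix j assume "j < p + q"
    show "continuous_on \<Omega> (\<lambda>x. if j < p then f' j (par_fst p x) else 0)"
    proof (cases "j < p")
      case True
      then have "continuous_on A (f' j)" using f' by (simp add: C1_with_def)
      then have "continuous_on \<Omega> (\<lambda>x. f' j (par_fst p x))"
        by (rule continuous_on_compose2[OF _ continuous_on_par_fst]) (use sub in auto)
      then show ?thesis using True by simp
    qed simp
    fix x assume x: "x \<in> \<Omega>"
    show "((\<lambda>s. f (par_fst p (x(j := s)))) has_real_derivative (if j < p then f' j (par_fst p x) else 0)) (at (x j))"
    proof (cases "j < p")
      case True
      have "((\<lambda>s. f ((par_fst p x)(j := s))) has_real_derivative f' j (par_fst p x)) (at ((par_fst p x) j))"
        using f' sub[OF x] True unfolding C1_with_def by blast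
      then show ?thesis using True by (simp add: par_fst_upd_less) (simp add: par_fst_def)
    qed (simp add: par_fst_upd_ge)
  qed
  then show ?thesis by (auto simp: C1_def)
qed

lemma C1_par_snd_coord:
  assumes "j < q"
  shows "C1 (p + q) \<Omega> (\<lambda>x. par_snd p q x j)"
  using C1_coord[of "p + q" \<Omega> "p + j"] assms by (simp add: par_snd_def)

lemma C1_mat_normalize:
  assumes \<Omega>: "ext_open d \<Omega>" and A: "A \<in> carrier_mat D D"
    and N: "\<And>i. i < D \<Longrightarrow> C1 d \<Omega> (\<lambda>x. N x i)"
    and pos: "\<And>x. x \<in> \<Omega> \<Longrightarrow> mat_inner A (N x) (N x) > 0" and i: "i < D"
  shows "C1 d \<Omega> (\<lambda>x. mat_normalize A (N x) i)"
proof -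
  let ?q = "\<lambda>x. mat_inner A (N x) (N x)"
  have q: "C1 d \<Omega> ?q"
    unfolding mat_inner_eq_sum[OF A] by (intro C1_sum C1_mult \<Omega> C1_const N) auto
  have "C1 d \<Omega> (\<lambda>x. (\<lambda>t. inverse (sqrt t)) (?q x))"
  proof (rule C1_compose[OF \<Omega> q, where g="\<lambda>t. inverse (sqrt t)" and g'="\<lambda>t. - (inverse (sqrt t) * (inverse (sqrt t) / 2) * inverse (sqrt t))"])
    fix x assume x: "x \<in> \<Omega>"
    show "((\<lambda>t. inverse (sqrt t)) has_real_derivative
       - (inverse (sqrt (?q x)) * (inverse (sqrt (?q x)) / 2) * inverse (sqrt (?q x)))) (at (?q x))"
      using pos[OF x] by (auto intro!: derivative_eq_intros)
  next
    show "continuous_on (?q ` \<Omega>) (\<lambda>t. - (inverse (sqrt t) * (inverse (sqrt t) / 2) * inverse (sqrt t)))"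
      using pos by (intro continuous_intros) (auto simp: less_imp_neq[symmetric])
  qed
  from C1_mult[OF \<Omega> N[OF i] this] show ?thesis
    by (simp add: mat_normalize_def mat_norm_def divide_inverse)
qed

text \<open>Additional parameters on which the map does not depend make the Jacobian degenerate.\<close>

lemma Vol_image_fewer_parameters:
  assumes d: "d' < d" and \<Omega>: "ext_open d' \<Omega>" and F: "\<And>i. i < D \<Longrightarrow> C1 d' \<Omega> (\<lambda>x. F x i)" and A: "pos_def_mat D A"
  shows "Vol A d (F ` \<Omega>) = 0"
proof -
  define q where "q = d - d'"
  have dq: "d = d' + q" "q > 0" using d by (auto simp: q_def)
  let ?\<Omega> = "{x \<in> ext_space (d' + q). par_fst d' x \<in> \<Omega> \<and> par_snd d' q x \<in> ext_space q}"
  let ?F = "\<lambda>x. F (par_fst d' x)"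
  interpret C1_param d D ?\<Omega> ?F A
  proof
    show "ext_open d ?\<Omega>" unfolding dq(1) by (rule ext_open_par[OF \<Omega> ext_open_ext_space])
    show "C1 d ?\<Omega> (\<lambda>x. ?F x i)" if "i < D" for i
      unfolding dq(1) by (rule C1_par_fst[OF F[OF that]]) simp
  qed (use d A in auto)
  have dens0: "dens x = 0" for x
  proof (rule ccontr)
    assume "dens x \<noteq> 0"
    then have "dens x > 0" using dens_nonneg[of x] by simp
    let ?e = "\<lambda>j. if j = d' then 1 else 0 :: real"
    have "partial_deriv (\<lambda>y. ?F y i) d' x = 0" for i
      unfolding partial_deriv_def by (simp add: par_fst_upd_ge)
    then have "dF x ?e i = 0" for i
      unfolding dF_def by (intro sum.neutral) auto
    then have "mat_inner (G x) ?e ?e = 0" by (simp add: G_inner mat_inner_eq_sum[OF A_carrier])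
    moreover have "mat_inner (G x) ?e ?e > 0"
      using assms(1) by (intro pos_def_mat_inner_pos[OF G_pos_def[OF \<open>dens x > 0\<close>], of d']) auto
    ultimately show False by simp
  qed
  have "F ` \<Omega> \<subseteq> ?F ` ?\<Omega>"
  proof
    fix y assume "y \<in> F ` \<Omega>"
    then obtain x where x: "x \<in> \<Omega>" "y = F x" by blast
    have xe: "x \<in> ext_space d'" using x(1) openin_imp_subset[OF assms(2)] by blast
    let ?x = "par_join d' q (x, \<lambda>i\<in>{..<q}. 0)"
    have "par_fst d' ?x = x" by (rule par_fst_join[OF xe])
    then have "?x \<in> ?\<Omega>" using x par_join_ext par_snd_ext by simp
    then show "y \<in> ?F ` ?\<Omega>" using x(2) \<open>par_fst d' ?x = x\<close> by (intro image_eqI[of _ _ ?x]) auto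
  qed
  then have "Vol A d (F ` \<Omega>) \<le> Vol A d (?F ` ?\<Omega>)"
    unfolding Vol_def using assms(1) by (intro hausdorff_measure_mono) auto
  also have "\<dots> \<le> emeasure (gmeas 0) ?\<Omega>" by (rule Vol_image_le)
  also have "\<dots> = 0" using ext_open_sets[OF local.\<Omega>] by (simp add: emeasure_gmeas dens0)
  finally show ?thesis by simp
qed


section \<open>Strata of the moment cone\<close>

lemma strict_mono_on_image_unique:
  fixes f g :: "nat \<Rightarrow> real"
  assumes "strict_mono_on {..<k} f" "strict_mono_on {..<l} g" "f ` {..<k} = g ` {..<l}"
  shows "k = l \<and> (\<forall>i<k. f i = g i)"
proof -
  have inj: "inj_on f {..<k}" "inj_on g {..<l}" using assms(1,2) by (simp_all add: strict_mono_on_imp_inj_on)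
  then have kl: "k = l" using assms(3) by (metis card_image card_lessThan)
  have sorted: "sorted (map h [0..<m]) \<and> distinct (map h [0..<m])" if "strict_mono_on {..<m} h" for h :: "nat \<Rightarrow> real" and m
  proof
    show "sorted (map h [0..<m])"
      using that by (auto simp: sorted_iff_nth_mono strict_mono_on_leD)
    show "distinct (map h [0..<m])"
      using strict_mono_on_imp_inj_on[OF that] by (simp add: distinct_map atLeast0LessThan)
  qed
  have "map f [0..<k] = map g [0..<l]"
    using sorted[OF assms(1)] sorted[OF assms(2)] assms(3)
    by (intro sorted_distinct_set_unique) (auto simp: atLeast0LessThan)
  then show ?thesis using kl by (auto simp: list_eq_iff_nth_eq)
qed

lemma finite_set_enumeration:
  fixes I :: "real set"
  assumes "finite I"
  obtains t where "t \<in> ext_space (card I)" "strict_mono_on {..<card I} t" "t ` {..<card I} = I"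
proof -
  let ?L = "sorted_list_of_set I"
  define t where "t = (\<lambda>i\<in>{..<card I}. ?L ! i)"
  have len: "length ?L = card I" by simp
  have "strict_mono_on {..<card I} t"
  proof (rule strict_mono_onI)
    fix i j assume "i \<in> {..<card I}" "j \<in> {..<card I}" "i < j"
    then show "t i < t j"
      using strict_sorted_list_of_set[of I] by (simp add: t_def sorted_wrt_iff_nth_less)
  qed
  moreover have "t ` {..<card I} = set ?L"
    unfolding set_conv_nth len by (auto simp: t_def image_iff Bex_def)
  ultimately show thesis using assms that[of t] by (simp add: t_def)
qed

context moment_interval
begin

text \<open>The endpoint flags \<open>A\<close>, \<open>B\<close> and the number \<open>k\<close> of interior points cover
  \<open>phiU\<close> and \<open>phiL\<close> as well as all lower-dimensional strata.\<close>

definition gphi :: "bool \<Rightarrow> bool \<Rightarrow> nat \<Rightarrow> (nat \<Rightarrow> real) \<Rightarrow> (nat \<Rightarrow> real) \<Rightarrow> (nat \<Rightarrow> real)" where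
  "gphi A B k \<rho> \<tau> = (\<lambda>i. (if A then \<rho> 0 else 0) * psi n a i +
     (\<Sum>j<k. \<rho> (j + of_bool A) * psi n (ereal (\<tau> j)) i) + (if B then \<rho> (k + of_bool A) else 0) * psi n b i)"

lemma phiU_eq_gphi: "phiU n l a b \<rho> \<tau> = gphi (odd l) True (l div 2) \<rho> \<tau>"
  by (auto simp: phiU_def gphi_def Let_def fun_eq_iff)

text \<open>For \<open>l = 2 * m + 1\<close> the lower form has \<open>m + 1\<close> interior
  points; \<open>(l + 1) div 2\<close> is their number in both parities.\<close>

lemma phiL_eq_gphi: "phiL n l a b \<rho> \<tau> = gphi (even l) False ((l + 1) div 2) \<rho> \<tau>"
  by (auto simp: phiL_def gphi_def Let_def fun_eq_iff)

lemma gphi_coords: "gphi A B k \<rho> \<tau> \<in> coords"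
  by (auto simp: gphi_def psi_def)

lemma gphi_repr:
  assumes \<rho>: "\<And>i. i < k + of_bool A + of_bool B \<Longrightarrow> \<rho> i > 0" and \<tau>: "\<tau> \<in> Delta T k"
  shows "repr n (gphi A B k \<rho> \<tau>) (\<tau> ` {..<k}) (\<lambda>z. \<rho> (the_inv_into {..<k} \<tau> z + of_bool A))
    (if A then \<rho> 0 else 0) (if B then \<rho> (k + of_bool A) else 0)"
proof -
  have mono: "strict_mono_on {..<k} \<tau>" and int: "\<And>j. j < k \<Longrightarrow> \<tau> j \<in> interior T"
    using \<tau> by (auto simp: Delta_def)
  have inj: "inj_on \<tau> {..<k}" by (rule strict_mono_on_imp_inj_on[OF mono])
  have inv: "the_inv_into {..<k} \<tau> (\<tau> j) = j" if "j < k" for j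
    using the_inv_into_f_f[OF inj] that by simp
  show ?thesis
    unfolding repr_def
  proof (intro conjI ballI allI impI)
    show "\<tau> ` {..<k} \<subseteq> interior T" using int by auto
    show "\<rho> (the_inv_into {..<k} \<tau> z + of_bool A) > 0" if "z \<in> \<tau> ` {..<k}" for z
      using that inv \<rho> by auto
    show "0 \<le> (if A then \<rho> 0 else 0)" using \<rho>[of 0] by auto
    show "0 \<le> (if B then \<rho> (k + of_bool A) else 0)" using \<rho>[of "k + of_bool A"] by auto
    fix i assume i: "i \<le> n"
    have "(\<Sum>z\<in>\<tau> ` {..<k}. \<rho> (the_inv_into {..<k} \<tau> z + of_bool A) * z ^ i) = (\<Sum>j<k. \<rho> (j + of_bool A) * \<tau> j ^ i)"
      using inv by (subst sum.reindex[OF inj]) (auto intro!: sum.cong)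
    then show "gphi A B k \<rho> \<tau> i = (if A then \<rho> 0 else 0) * psi n a i +
      (\<Sum>z\<in>\<tau> ` {..<k}. \<rho> (the_inv_into {..<k} \<tau> z + of_bool A) * z ^ i) + (if B then \<rho> (k + of_bool A) else 0) * psi n b i"
      using i by (simp add: gphi_def psi_real)
  qed simp
qed

lemma repr_scale:
  assumes "repr n x I w ca cb" "s > 0"
  shows "repr n (\<lambda>i. s * x i) I (\<lambda>z. s * w z) (s * ca) (s * cb)"
  using assms by (auto simp: repr_def algebra_simps sum_distrib_left)

text \<open>The difference of the two representations is a vanishing combination of at most
  \<open>n + 1\<close> moment vectors, so \<open>moments_independent\<close> applies. Two infinite
  endpoints share one vector, hence at most one of them may carry mass.\<close>

lemma repr_unique:
  assumes r: "repr n x I w ca cb" and r': "repr n x I' w' ca' cb'"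
    and a: "\<bar>a\<bar> = \<infinity> \<Longrightarrow> (ca = 0 \<and> ca' = 0) \<or> (cb = 0 \<and> cb' = 0)"
    and cnt: "card (I \<union> I') + of_bool (ca > 0 \<or> ca' > 0) + of_bool (cb > 0 \<or> cb' > 0) \<le> n + 1"
  shows "I = I' \<and> (\<forall>z\<in>I. w z = w' z) \<and> ca = ca' \<and> cb = cb'"
proof -
  have I: "finite I" "I \<subseteq> interior T" "\<And>z. z \<in> I \<Longrightarrow> w z > 0" "ca \<ge> 0" "cb \<ge> 0"
    and I': "finite I'" "I' \<subseteq> interior T" "\<And>z. z \<in> I' \<Longrightarrow> w' z > 0" "ca' \<ge> 0" "cb' \<ge> 0"
    using r r' by (auto simp: repr_def)
  define ra rb where "ra = real_of_ereal a" and "rb = real_of_ereal b"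
  define Ea where "Ea = (if \<bar>a\<bar> \<noteq> \<infinity> \<and> (ca > 0 \<or> ca' > 0) then {ra} else {})"
  define Eb where "Eb = (if \<bar>b\<bar> \<noteq> \<infinity> \<and> (cb > 0 \<or> cb' > 0) then {rb} else {})"
  define c where "c = (if \<bar>a\<bar> = \<infinity> then ca - ca' else 0) + (if \<bar>b\<bar> = \<infinity> then cb - cb' else 0)"
  define u where "u = (\<lambda>z. (if z \<in> I then w z else 0) - (if z \<in> I' then w' z else 0))"
  define W where "W = (\<lambda>z. if z \<in> I \<union> I' then u z else if z \<in> Ea then ca - ca' else cb - cb')"
  have disj: "(I \<union> I') \<inter> Ea = {}" "(I \<union> I') \<inter> Eb = {}" "Ea \<inter> Eb = {}"
  proof -
    have "z \<notin> Ea \<and> z \<notin> Eb" if "z \<in> I \<union> I'" for z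
    proof -
      have "a < ereal z" "ereal z < b" using I(2) I'(2) that unfolding interior_T by auto
      then show ?thesis by (cases a; cases b) (auto simp: Ea_def Eb_def ra_def rb_def)
    qed
    then show "(I \<union> I') \<inter> Ea = {}" "(I \<union> I') \<inter> Eb = {}" by blast+
    show "Ea \<inter> Eb = {}" using ab by (cases a; cases b) (auto simp: Ea_def Eb_def ra_def rb_def)
  qed
  have fE: "finite Ea" "finite Eb" by (auto simp: Ea_def Eb_def)
  let ?Z = "I \<union> I' \<union> Ea \<union> Eb"
  have cardE: "card Ea = of_bool (\<bar>a\<bar> \<noteq> \<infinity> \<and> (ca > 0 \<or> ca' > 0))" "card Eb = of_bool (\<bar>b\<bar> \<noteq> \<infinity> \<and> (cb > 0 \<or> cb' > 0))"
    by (auto simp: Ea_def Eb_def)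
  have cardZ: "card ?Z = card (I \<union> I') + card Ea + card Eb"
    using I(1) I'(1) fE disj by (simp add: card_Un_disjoint Int_Un_distrib2)
  have "(\<forall>z\<in>?Z. W z = 0) \<and> c = 0"
  proof (rule moments_independent[where n=n])
    show "card ?Z \<le> n + 1" using cnt unfolding cardZ cardE by (auto split: if_splits)
    show "card ?Z \<le> n" if "c \<noteq> 0"
    proof -
      have "(\<bar>a\<bar> = \<infinity> \<and> (ca > 0 \<or> ca' > 0)) \<or> (\<bar>b\<bar> = \<infinity> \<and> (cb > 0 \<or> cb' > 0))"
      proof (rule ccontr)
        assume "\<not> ?thesis"
        then have "c = 0" using I(4,5) I'(4,5) by (auto simp: c_def not_less)
        then show False using that by simp
      qed
      then show ?thesis using cnt unfolding cardZ cardE by (auto split: if_splits)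
    qed
    fix i assume i: "i \<le> n"
    have e1: "(\<Sum>z\<in>?Z. W z * z ^ i) = (\<Sum>z\<in>I \<union> I'. u z * z ^ i) + (\<Sum>z\<in>Ea. (ca - ca') * z ^ i) + (\<Sum>z\<in>Eb. (cb - cb') * z ^ i)"
    proof -
      have "(\<Sum>z\<in>?Z. W z * z ^ i) = (\<Sum>z\<in>I \<union> I'. W z * z ^ i) + (\<Sum>z\<in>Ea. W z * z ^ i) + (\<Sum>z\<in>Eb. W z * z ^ i)"
        using I(1) I'(1) fE disj by (simp add: sum.union_disjoint[of "I \<union> I'" Ea] sum.union_disjoint[of "I \<union> I' \<union> Ea" Eb] Int_Un_distrib2)
      moreover have "(\<Sum>z\<in>I \<union> I'. W z * z ^ i) = (\<Sum>z\<in>I \<union> I'. u z * z ^ i)" by (intro sum.cong) (auto simp: W_def)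
      moreover have "(\<Sum>z\<in>Ea. W z * z ^ i) = (\<Sum>z\<in>Ea. (ca - ca') * z ^ i)" using disj by (intro sum.cong) (auto simp: W_def)
      moreover have "(\<Sum>z\<in>Eb. W z * z ^ i) = (\<Sum>z\<in>Eb. (cb - cb') * z ^ i)" using disj by (intro sum.cong) (auto simp: W_def)
      ultimately show ?thesis by simp
    qed
    have e2: "(\<Sum>z\<in>I \<union> I'. u z * z ^ i) = (\<Sum>z\<in>I. w z * z ^ i) - (\<Sum>z\<in>I'. w' z * z ^ i)"
    proof -
      have "(\<Sum>z\<in>I \<union> I'. u z * z ^ i) = (\<Sum>z\<in>I \<union> I'. (if z \<in> I then w z * z ^ i else 0) - (if z \<in> I' then w' z * z ^ i else 0))"
        by (intro sum.cong refl) (auto simp: u_def left_diff_distrib)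
      also have "\<dots> = (\<Sum>z\<in>I \<union> I'. if z \<in> I then w z * z ^ i else 0) - (\<Sum>z\<in>I \<union> I'. if z \<in> I' then w' z * z ^ i else 0)"
        by (rule sum_subtractf)
      also have "(\<Sum>z\<in>I \<union> I'. if z \<in> I then w z * z ^ i else 0) = (\<Sum>z\<in>I. w z * z ^ i)"
        using I(1) I'(1) by (intro sum.mono_neutral_cong_right) auto
      also have "(\<Sum>z\<in>I \<union> I'. if z \<in> I' then w' z * z ^ i else 0) = (\<Sum>z\<in>I'. w' z * z ^ i)"
        using I(1) I'(1) by (intro sum.mono_neutral_cong_right) auto
      finally show ?thesis .
    qed
    have e3: "(\<Sum>z\<in>Ea. (ca - ca') * z ^ i) + (if i = n then (if \<bar>a\<bar> = \<infinity> then ca - ca' else 0) else 0) = (ca - ca') * psi n a i"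
    proof (cases "\<bar>a\<bar> = \<infinity>")
      case True
      then have "a = -\<infinity>" "even n" using ab by auto
      then have "psi n a = psi n \<infinity>" using psi_MInfty by simp
      then show ?thesis using True i by (simp add: Ea_def psi_infinity)
    next
      case False
      then obtain \<alpha> where "a = ereal \<alpha>" by (cases a) auto
      then show ?thesis using i I(4) I'(4) by (auto simp: Ea_def ra_def psi_real)
    qed
    have e4: "(\<Sum>z\<in>Eb. (cb - cb') * z ^ i) + (if i = n then (if \<bar>b\<bar> = \<infinity> then cb - cb' else 0) else 0) = (cb - cb') * psi n b i"
    proof (cases "b = \<infinity>")
      case True
      then show ?thesis using i by (simp add: Eb_def psi_infinity)
    next
      case False
      then obtain \<beta> where "b = ereal \<beta>" using ab by (cases b) auto
      then show ?thesis using i I(5) I'(5) by (auto simp: Eb_def rb_def psi_real)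
    qed
    have "x i = ca * psi n a i + (\<Sum>z\<in>I. w z * z ^ i) + cb * psi n b i" using r i by (simp add: repr_def)
    moreover have "x i = ca' * psi n a i + (\<Sum>z\<in>I'. w' z * z ^ i) + cb' * psi n b i" using r' i by (simp add: repr_def)
    ultimately have "(\<Sum>z\<in>I. w z * z ^ i) - (\<Sum>z\<in>I'. w' z * z ^ i) + (ca - ca') * psi n a i + (cb - cb') * psi n b i = 0"
      by (simp add: algebra_simps)
    then show "(\<Sum>z\<in>?Z. W z * z ^ i) + (if i = n then c else 0) = 0"
      unfolding e1 e2 using e3 e4 by (simp add: c_def split: if_splits)
  qed (use I(1) I'(1) fE in simp)
  then have W0: "\<And>z. z \<in> ?Z \<Longrightarrow> W z = 0" and c0: "c = 0" by blast+
  have u0: "u z = 0" if "z \<in> I \<union> I'" for z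
  proof -
    have "W z = 0" by (rule W0) (use that in blast)
    moreover have "W z = u z" using that by (auto simp: W_def)
    ultimately show ?thesis by simp
  qed
  have II: "I = I'"
  proof (intro equalityI subsetI)
    fix z assume "z \<in> I"
    then show "z \<in> I'" using u0[of z] I(3)[of z] by (auto simp: u_def split: if_splits)
  next
    fix z assume "z \<in> I'"
    then show "z \<in> I" using u0[of z] I'(3)[of z] by (auto simp: u_def split: if_splits)
  qed
  have ww: "w z = w' z" if "z \<in> I" for z using u0[of z] that II by (simp add: u_def)
  have fa: "ca = ca'" if "\<bar>a\<bar> \<noteq> \<infinity>"
  proof (cases "ca > 0 \<or> ca' > 0")
    case True
    then have "ra \<in> Ea" using that by (simp add: Ea_def)
    moreover from this have "ra \<notin> I \<union> I'" using disj(1) by blast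
    ultimately show ?thesis using W0[of ra] unfolding W_def by simp
  qed (use I(4) I'(4) in auto)
  have fb: "cb = cb'" if "\<bar>b\<bar> \<noteq> \<infinity>"
  proof (cases "cb > 0 \<or> cb' > 0")
    case True
    then have "rb \<in> Eb" using that by (simp add: Eb_def)
    moreover from this have "rb \<notin> I \<union> I'" "rb \<notin> Ea" using disj(2,3) by blast+
    ultimately show ?thesis using W0[of rb] unfolding W_def by simp
  qed (use I(5) I'(5) in auto)
  have "ca = ca' \<and> cb = cb'"
  proof (cases "\<bar>a\<bar> = \<infinity>")
    case True
    then have "\<bar>b\<bar> = \<infinity>" using ab by auto
    then have "ca - ca' + (cb - cb') = 0" using c0 True by (simp add: c_def)
    then show ?thesis using a[OF True] by auto
  next
    case False
    show ?thesis
    proof (cases "\<bar>b\<bar> = \<infinity>")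
      case True
      then show ?thesis using c0 fa[OF False] False by (simp add: c_def)
    qed (use fa[OF False] fb in simp)
  qed
  then show ?thesis using II ww by blast
qed

lemma repr_zero: "repr n (\<lambda>_. 0) {} w 0 0"
  by (simp add: repr_def)

end

section \<open>Parametrized strata on the sphere\<close>

locale moment_volume = moment_interval n a b for n :: nat and a b :: ereal +
  fixes S :: "real mat" and \<Theta> :: "nat \<Rightarrow> (nat \<Rightarrow> real) set" and \<rho> :: "nat \<Rightarrow> (nat \<Rightarrow> real) \<Rightarrow> (nat \<Rightarrow> real)"
  assumes S: "pos_def_mat (n + 1) S" and coords: "\<And>m. sphere_coordinates m (\<Theta> m) (\<rho> m)"
begin

definition F :: "bool \<Rightarrow> bool \<Rightarrow> nat \<Rightarrow> nat \<Rightarrow> (nat \<Rightarrow> real) \<Rightarrow> (nat \<Rightarrow> real)" where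
  "F A B k p x = mat_normalize S (gphi A B k (\<rho> p (par_fst p x)) (par_snd p k x))"

definition Om :: "nat \<Rightarrow> nat \<Rightarrow> (nat \<Rightarrow> real) set" where
  "Om k p = {x \<in> ext_space (p + k). par_fst p x \<in> \<Theta> p \<and> par_snd p k x \<in> Delta T k}"

text \<open>\<open>p + 1\<close> is the number of atoms, each with one coordinate of the weight
  sphere. At most \<open>n + 1\<close> atoms keep their moment vectors independent, and two infinite
  endpoints would be the same atom.\<close>

definition valid :: "bool \<Rightarrow> bool \<Rightarrow> nat \<Rightarrow> nat \<Rightarrow> bool" where
  "valid A B k p \<longleftrightarrow> k + of_bool A + of_bool B = p + 1 \<and> p + 1 \<le> n + 1 \<and> (\<bar>a\<bar> = \<infinity> \<longrightarrow> \<not> (A \<and> B))"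

lemma S_carrier: "S \<in> carrier_mat (n + 1) (n + 1)"
  by (rule pos_def_mat_carrier[OF S])

lemma S_dim [simp]: "dim_row S = Suc n" "dim_col S = Suc n"
  using S_carrier by auto

lemma \<rho>_sphere: "\<theta> \<in> \<Theta> p \<Longrightarrow> \<rho> p \<theta> \<in> pos_sphere p"
  using coords[of p] by (auto simp: sphere_coordinates_def bij_betw_def)

lemma \<rho>_pos: "\<theta> \<in> \<Theta> p \<Longrightarrow> i \<le> p \<Longrightarrow> \<rho> p \<theta> i > 0"
  using \<rho>_sphere[of \<theta> p] by (simp add: pos_sphere_def)

lemma Delta_ext_open: "ext_open k (Delta T k)"
proof -
  let ?O = "(\<Inter>i\<in>{..<k}. {\<tau>. \<tau> i \<in> interior T}) \<inter> (\<Inter>i\<in>{..<k}. \<Inter>j\<in>{i<..<k}. {\<tau> :: nat \<Rightarrow> real. \<tau> i < \<tau> j})"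
  have "open {\<tau> :: nat \<Rightarrow> real. \<tau> i \<in> interior T}" for i
    using open_vimage[OF open_interior, of "\<lambda>\<tau> :: nat \<Rightarrow> real. \<tau> i" T] continuous_on_product_coordinates
    by (simp add: vimage_def)
  then have "open ?O"
    by (intro open_Int open_INT ballI open_Collect_less continuous_on_product_coordinates) auto
  moreover have "Delta T k = ext_space k \<inter> ?O"
    by (auto simp: Delta_def strict_mono_on_def PiE_def Pi_def)
  ultimately show ?thesis unfolding openin_open by blast
qed

lemma Om_ext_open: "ext_open (p + k) (Om k p)"
  unfolding Om_def by (intro ext_open_par sphere_coordinates_ext_open[OF coords] Delta_ext_open)

lemma F_repr:
  assumes v: "valid A B k p" and x: "x \<in> Om k p"
  shows "repr n (gphi A B k (\<rho> p (par_fst p x)) (par_snd p k x)) (par_snd p k x ` {..<k})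
      (\<lambda>z. \<rho> p (par_fst p x) (the_inv_into {..<k} (par_snd p k x) z + of_bool A))
      (if A then \<rho> p (par_fst p x) 0 else 0) (if B then \<rho> p (par_fst p x) (k + of_bool A) else 0)"
  using v x by (intro gphi_repr \<rho>_pos) (auto simp: Om_def valid_def)

lemma card_tau:
  assumes "\<tau> \<in> Delta T k"
  shows "card (\<tau> ` {..<k}) = k"
  using assms by (simp add: Delta_def card_image strict_mono_on_imp_inj_on)

text \<open>The vector is nonzero because its representation would otherwise coincide, by
  uniqueness, with the empty representation of zero.\<close>

lemma gphi_norm_pos:
  assumes v: "valid A B k p" and x: "x \<in> Om k p"
  shows "mat_inner S (gphi A B k (\<rho> p (par_fst p x)) (par_snd p k x)) (gphi A B k (\<rho> p (par_fst p x)) (par_snd p k x)) > 0"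
proof -
  let ?N = "gphi A B k (\<rho> p (par_fst p x)) (par_snd p k x)" and ?\<rho> = "\<rho> p (par_fst p x)"
  have \<tau>: "par_snd p k x \<in> Delta T k" and \<theta>: "par_fst p x \<in> \<Theta> p" using x by (auto simp: Om_def)
  have "\<exists>i<n + 1. ?N i \<noteq> 0"
  proof (rule ccontr)
    assume "\<not> ?thesis"
    then have z: "?N = (\<lambda>_. 0)" using gphi_coords[of A B k ?\<rho> "par_snd p k x"] by (auto simp: fun_eq_iff not_less)
    have "k + of_bool A + of_bool B = p + 1" "p + 1 \<le> n + 1" using v by (auto simp: valid_def)
    moreover have "par_snd p k x ` {..<k} = {} \<and> (\<forall>z\<in>par_snd p k x ` {..<k}.
        \<rho> p (par_fst p x) (the_inv_into {..<k} (par_snd p k x) z + of_bool A) = 0) \<and>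
      (if A then ?\<rho> 0 else 0) = 0 \<and> (if B then ?\<rho> (k + of_bool A) else 0) = 0"
    proof (rule repr_unique[OF F_repr[OF v x, unfolded z] repr_zero])
      show "card (par_snd p k x ` {..<k} \<union> {}) + of_bool ((if A then ?\<rho> 0 else 0) > 0 \<or> (0 :: real) > 0) +
          of_bool ((if B then ?\<rho> (k + of_bool A) else 0) > 0 \<or> (0 :: real) > 0) \<le> n + 1"
        using v card_tau[OF \<tau>] by (auto simp: valid_def split: if_splits)
      show "\<bar>a\<bar> = \<infinity> \<Longrightarrow> (if A then ?\<rho> 0 else 0) = 0 \<and> (0 :: real) = 0 \<or> (if B then ?\<rho> (k + of_bool A) else 0) = 0 \<and> (0 :: real) = 0"
        using v by (auto simp: valid_def)
    qed
    moreover have "A \<Longrightarrow> ?\<rho> 0 > 0" "B \<Longrightarrow> ?\<rho> (k + of_bool A) > 0"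
      using v by (auto intro!: \<rho>_pos[OF \<theta>] simp: valid_def)
    ultimately show False by (cases A; cases B) auto
  qed
  then show ?thesis using pos_def_mat_inner_pos[OF S] by blast
qed

lemma C1_gphi:
  assumes "valid A B k p"
  shows "C1 (p + k) (Om k p) (\<lambda>x. gphi A B k (\<rho> p (par_fst p x)) (par_snd p k x) i)"
proof -
  note \<Omega> = Om_ext_open[of p k]
  have r: "C1 (p + k) (Om k p) (\<lambda>x. \<rho> p (par_fst p x) w)" if "w \<le> p" for w
    using C1_par_fst[OF sphere_coordinates_C1[OF coords that], of "Om k p" k] by (simp add: Om_def)
  have pw: "C1 (p + k) (Om k p) (\<lambda>x. psi n (ereal (par_snd p k x j)) i)" if "j < k" for j
  proof (cases "i \<le> n")
    case True
    then show ?thesis using C1_power[OF \<Omega> C1_par_snd_coord[OF that], of i] by (simp add: psi_real)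
  next
    case False
    then show ?thesis using C1_const[of "p + k" "Om k p" 0] by (simp add: psi_def)
  qed
  have A: "C1 (p + k) (Om k p) (\<lambda>x. if A then \<rho> p (par_fst p x) 0 else 0)"
    using r[of 0] C1_const[of "p + k" "Om k p" 0] by (cases A) auto
  have B: "C1 (p + k) (Om k p) (\<lambda>x. if B then \<rho> p (par_fst p x) (k + of_bool A) else 0)"
    using r[of "k + of_bool A"] C1_const[of "p + k" "Om k p" 0] assms by (cases B) (auto simp: valid_def)
  have "j + of_bool A \<le> p" if "j < k" for j using assms that by (auto simp: valid_def)
  then show ?thesis
    unfolding gphi_def using A B
    by (intro C1_add C1_mult[OF \<Omega>] C1_sum C1_const r pw) auto
qed

lemma F_C1: "valid A B k p \<Longrightarrow> i < n + 1 \<Longrightarrow> C1 (p + k) (Om k p) (\<lambda>x. F A B k p x i)"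
  unfolding F_def
  by (rule C1_mat_normalize[OF Om_ext_open S_carrier C1_gphi gphi_norm_pos]) auto

lemma F_C1_param: "valid A B k p \<Longrightarrow> p + k > 0 \<Longrightarrow> C1_param (p + k) (n + 1) (Om k p) (F A B k p) S"
  by unfold_locales (use S in \<open>auto intro: F_C1 Om_ext_open\<close>)

lemma F_repr_normalized:
  assumes v: "valid A B k p" and x: "x \<in> Om k p"
  defines "s \<equiv> 1 / mat_norm S (gphi A B k (\<rho> p (par_fst p x)) (par_snd p k x))"
  shows "s > 0" "repr n (F A B k p x) (par_snd p k x ` {..<k})
      (\<lambda>z. s * \<rho> p (par_fst p x) (the_inv_into {..<k} (par_snd p k x) z + of_bool A))
      (s * (if A then \<rho> p (par_fst p x) 0 else 0)) (s * (if B then \<rho> p (par_fst p x) (k + of_bool A) else 0))"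
proof -
  show s: "s > 0" using gphi_norm_pos[OF v x] by (simp add: s_def mat_norm_def)
  have "F A B k p x = (\<lambda>i. s * gphi A B k (\<rho> p (par_fst p x)) (par_snd p k x) i)"
    by (simp add: F_def mat_normalize_def s_def fun_eq_iff)
  then show "repr n (F A B k p x) (par_snd p k x ` {..<k})
      (\<lambda>z. s * \<rho> p (par_fst p x) (the_inv_into {..<k} (par_snd p k x) z + of_bool A))
      (s * (if A then \<rho> p (par_fst p x) 0 else 0)) (s * (if B then \<rho> p (par_fst p x) (k + of_bool A) else 0))"
    using repr_scale[OF F_repr[OF v x] s] by simp
qed

lemma F_coords: "F A B k p x \<in> coords"
  using gphi_coords by (auto simp: F_def mat_normalize_def)

lemma mat_sphere_eq: "mat_sphere S = {x \<in> coords. mat_inner S x x = 1}"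
  by (auto simp: mat_sphere_def topspace_Euclidean_space)

lemma F_in:
  assumes v: "valid A B k p" and x: "x \<in> Om k p"
  shows "F A B k p x \<in> moment_cone n T \<inter> mat_sphere S"
proof
  show "F A B k p x \<in> moment_cone n T"
    by (rule repr_in_moment_cone[OF F_repr_normalized(2)[OF v x] F_coords])
  let ?N = "gphi A B k (\<rho> p (par_fst p x)) (par_snd p k x)"
  have "mat_inner S (F A B k p x) (F A B k p x) = (1 / mat_norm S ?N)\<^sup>2 * mat_inner S ?N ?N"
    unfolding mat_inner_scale[OF S_carrier, symmetric] by (simp add: F_def mat_normalize_def)
  also have "\<dots> = 1" using gphi_norm_pos[OF v x] by (simp add: mat_norm_def power_divide)
  finally show "F A B k p x \<in> mat_sphere S" using F_coords by (simp add: mat_sphere_eq)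
qed

text \<open>By uniqueness of representations the atoms agree, and the weights agree up to the two
  normalizing factors; as both weight vectors lie on the unit sphere, these factors agree
  too.\<close>

lemma F_eq_imp:
  assumes v: "valid A B k p" and v': "valid A' B' k' p'" and x: "x \<in> Om k p" and x': "x' \<in> Om k' p'"
    and eq: "\<And>i. i < n + 1 \<Longrightarrow> F A B k p x i = F A' B' k' p' x' i"
    and a: "\<bar>a\<bar> = \<infinity> \<Longrightarrow> (\<not> A \<and> \<not> A') \<or> (\<not> B \<and> \<not> B')"
    and cnt: "k + k' + of_bool (A \<or> A') + of_bool (B \<or> B') \<le> n + 1"
  shows "A = A' \<and> B = B' \<and> k = k' \<and> x = x'"
proof -
  let ?\<rho> = "\<rho> p (par_fst p x)" and ?\<tau> = "par_snd p k x" and ?\<rho>' = "\<rho> p' (par_fst p' x')" and ?\<tau>' = "par_snd p' k' x'"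
  have \<tau>: "?\<tau> \<in> Delta T k" and \<theta>: "par_fst p x \<in> \<Theta> p" using x by (auto simp: Om_def)
  have \<tau>': "?\<tau>' \<in> Delta T k'" and \<theta>': "par_fst p' x' \<in> \<Theta> p'" using x' by (auto simp: Om_def)
  define s where "s = 1 / mat_norm S (gphi A B k ?\<rho> ?\<tau>)"
  define s' where "s' = 1 / mat_norm S (gphi A' B' k' ?\<rho>' ?\<tau>')"
  note R = F_repr_normalized[OF v x, folded s_def] and R' = F_repr_normalized[OF v' x', folded s'_def]
  have same: "F A B k p x = F A' B' k' p' x'"
  proof
    fix i show "F A B k p x i = F A' B' k' p' x' i"
      using eq[of i] F_coords[of A B k p x] F_coords[of A' B' k' p' x'] by (cases "i < n + 1") auto
  qed
  have pos: "A \<Longrightarrow> ?\<rho> 0 > 0" "B \<Longrightarrow> ?\<rho> (k + of_bool A) > 0"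
    using v by (auto intro!: \<rho>_pos[OF \<theta>] simp: valid_def)
  have pos': "A' \<Longrightarrow> ?\<rho>' 0 > 0" "B' \<Longrightarrow> ?\<rho>' (k' + of_bool A') > 0"
    using v' by (auto intro!: \<rho>_pos[OF \<theta>'] simp: valid_def)
  have U: "?\<tau> ` {..<k} = ?\<tau>' ` {..<k'} \<and>
    (\<forall>z\<in>?\<tau> ` {..<k}. s * ?\<rho> (the_inv_into {..<k} ?\<tau> z + of_bool A) = s' * ?\<rho>' (the_inv_into {..<k'} ?\<tau>' z + of_bool A')) \<and>
    s * (if A then ?\<rho> 0 else 0) = s' * (if A' then ?\<rho>' 0 else 0) \<and>
    s * (if B then ?\<rho> (k + of_bool A) else 0) = s' * (if B' then ?\<rho>' (k' + of_bool A') else 0)"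
  proof (rule repr_unique[OF R(2) R'(2)[folded same]])
    have iA: "s * (if A then ?\<rho> 0 else 0) > 0 \<longleftrightarrow> A" "s' * (if A' then ?\<rho>' 0 else 0) > 0 \<longleftrightarrow> A'"
      using pos pos' R(1) R'(1) by auto
    have iB: "s * (if B then ?\<rho> (k + of_bool A) else 0) > 0 \<longleftrightarrow> B" "s' * (if B' then ?\<rho>' (k' + of_bool A') else 0) > 0 \<longleftrightarrow> B'"
      using pos pos' R(1) R'(1) by auto
    have "card (?\<tau> ` {..<k} \<union> ?\<tau>' ` {..<k'}) \<le> k + k'"
      using card_Un_le[of "?\<tau> ` {..<k}" "?\<tau>' ` {..<k'}"] card_tau[OF \<tau>] card_tau[OF \<tau>'] by simp
    then show "card (?\<tau> ` {..<k} \<union> ?\<tau>' ` {..<k'}) +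
        of_bool (s * (if A then ?\<rho> 0 else 0) > 0 \<or> s' * (if A' then ?\<rho>' 0 else 0) > 0) +
        of_bool (s * (if B then ?\<rho> (k + of_bool A) else 0) > 0 \<or> s' * (if B' then ?\<rho>' (k' + of_bool A') else 0) > 0) \<le> n + 1"
      using cnt unfolding iA iB by linarith
    show "\<bar>a\<bar> = \<infinity> \<Longrightarrow> s * (if A then ?\<rho> 0 else 0) = 0 \<and> s' * (if A' then ?\<rho>' 0 else 0) = 0 \<or>
      s * (if B then ?\<rho> (k + of_bool A) else 0) = 0 \<and> s' * (if B' then ?\<rho>' (k' + of_bool A') else 0) = 0"
      using a by auto
  qed
  have AA: "A = A'" using U pos(1) pos'(1) R(1) R'(1) by (cases A; cases A') auto
  have BB: "B = B'" using U pos(2) pos'(2) R(1) R'(1) by (cases B; cases B') auto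
  have mono: "strict_mono_on {..<k} ?\<tau>" "strict_mono_on {..<k'} ?\<tau>'" using \<tau> \<tau>' by (auto simp: Delta_def)
  have kk: "k = k'" and tt: "\<And>j. j < k \<Longrightarrow> ?\<tau> j = ?\<tau>' j"
    using strict_mono_on_image_unique[OF mono] U by auto
  have pp: "p = p'" using v v' AA BB kk by (auto simp: valid_def)
  have \<tau>eq: "?\<tau> = ?\<tau>'" using tt kk by (auto simp: par_snd_def fun_eq_iff)
  have inv: "the_inv_into {..<k} ?\<tau> (?\<tau> j) = j" if "j < k" for j
    using the_inv_into_f_f[OF strict_mono_on_imp_inj_on[OF mono(1)]] that by simp
  have weights: "s * ?\<rho> i = s' * ?\<rho>' i" if i: "i \<le> p" for i
  proof -
    have kp: "k + of_bool A + of_bool B = p + 1" using v by (simp add: valid_def)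
    consider "A" "i = 0" | j where "j < k" "i = j + of_bool A" | "B" "i = k + of_bool A"
    proof (cases "A \<and> i = 0")
      case False
      show thesis
      proof (cases "i < k + of_bool A")
        case True
        then show thesis using that(2)[of "i - of_bool A"] False by (cases A) auto
      next
        case F2: False
        then have "B" "i = k + of_bool A" using i kp by (cases B; auto)+
        then show thesis by (rule that(3))
      qed
    qed (use that(1) in simp)
    then show ?thesis
    proof cases
      case 1
      then show ?thesis using U AA by simp
    next
      case (2 j)
      then have "s * ?\<rho> (the_inv_into {..<k} ?\<tau> (?\<tau> j) + of_bool A) = s' * ?\<rho>' (the_inv_into {..<k'} ?\<tau>' (?\<tau> j) + of_bool A')"
        using U by auto
      then show ?thesis using 2 inv kk AA unfolding \<tau>eq[symmetric] by simp
    next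
      case 3
      then show ?thesis using U AA BB kk by simp
    qed
  qed
  have sq: "(\<Sum>i\<le>p. (?\<rho> i)\<^sup>2) = 1" "(\<Sum>i\<le>p. (?\<rho>' i)\<^sup>2) = 1"
    using \<rho>_sphere[OF \<theta>] \<rho>_sphere[OF \<theta>'] pp by (auto simp: pos_sphere_def)
  have "s\<^sup>2 * (\<Sum>i\<le>p. (?\<rho> i)\<^sup>2) = s'\<^sup>2 * (\<Sum>i\<le>p. (?\<rho>' i)\<^sup>2)"
    unfolding sum_distrib_left power_mult_distrib[symmetric] using weights by (intro sum.cong) auto
  then have ss: "s = s'" using R(1) R'(1) unfolding sq by (simp add: power2_eq_iff_nonneg)
  have "?\<rho> i = ?\<rho>' i" for i
  proof (cases "i \<le> p")
    case True
    then show ?thesis using weights[OF True] ss R(1) by simp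
  next
    case False
    then show ?thesis using \<rho>_sphere[OF \<theta>] \<rho>_sphere[OF \<theta>'] pp by (simp add: pos_sphere_def topspace_Euclidean_space)
  qed
  then have \<rho>eq: "\<rho> p (par_fst p x) = \<rho> p (par_fst p x')" using pp by auto
  have "par_fst p x = par_fst p x'"
  proof (rule inj_onD)
    show "inj_on (\<rho> p) (\<Theta> p)" using coords[of p] unfolding sphere_coordinates_def bij_betw_def by blast
    show "\<rho> p (par_fst p x) = \<rho> p (par_fst p x')" by (rule \<rho>eq)
    show "par_fst p x \<in> \<Theta> p" by (rule \<theta>)
    show "par_fst p x' \<in> \<Theta> p" using \<theta>' unfolding pp .
  qed
  moreover have "par_snd p k x = par_snd p k x'" using \<tau>eq unfolding pp kk .
  moreover have "x \<in> ext_space (p + k)" using x by (simp add: Om_def)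
  moreover have "x' \<in> ext_space (p + k)" using x' unfolding pp kk by (simp add: Om_def)
  ultimately have "x = x'" by (metis par_join_split)
  then show ?thesis using AA BB kk by blast
qed

text \<open>The weights, in the order of the sorted atoms, are rescaled to the unit sphere;
  \<open>mat_normalize\<close> undoes the scaling, as \<open>x\<close> has norm one.\<close>

lemma F_surj:
  assumes r: "repr n x I w ca cb" and x: "x \<in> mat_sphere S" and fin: "\<bar>a\<bar> = \<infinity> \<Longrightarrow> \<not> (ca > 0 \<and> cb > 0)"
    and cnt: "card I + of_bool (ca > 0) + of_bool (cb > 0) \<le> n + 1"
  shows "\<exists>p. valid (ca > 0) (cb > 0) (card I) p \<and> x \<in> F (ca > 0) (cb > 0) (card I) p ` Om (card I) p"
proof -
  define A B k where "A \<longleftrightarrow> ca > 0" and "B \<longleftrightarrow> cb > 0" and "k = card I"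
  have I: "finite I" "I \<subseteq> interior T" "\<And>z. z \<in> I \<Longrightarrow> w z > 0" "ca \<ge> 0" "cb \<ge> 0"
    and xi: "\<And>i. i \<le> n \<Longrightarrow> x i = ca * psi n a i + (\<Sum>z\<in>I. w z * z ^ i) + cb * psi n b i"
    using r by (auto simp: repr_def)
  have xc: "x \<in> coords" and x1: "mat_inner S x x = 1" using x by (auto simp: mat_sphere_eq)
  have ca: "ca = (if A then ca else 0)" and cb: "cb = (if B then cb else 0)" using I(4,5) by (auto simp: A_def B_def)
  have "k + of_bool A + of_bool B > 0"
  proof (rule ccontr)
    assume "\<not> ?thesis"
    then have "I = {}" "ca = 0" "cb = 0" using I by (auto simp: A_def B_def k_def)
    then have "x i = 0" if "i \<le> n" for i using xi[OF that] by simp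
    then have "mat_inner S x x = 0" by (simp add: mat_inner_eq_sum[OF S_carrier])
    then show False using x1 by simp
  qed
  then obtain p where p: "k + of_bool A + of_bool B = p + 1" by (metis Suc_eq_plus1 gr0_implies_Suc)
  have v: "valid A B k p" using p cnt fin by (auto simp: valid_def A_def B_def k_def)
  obtain t where t: "t \<in> ext_space k" "strict_mono_on {..<k} t" "t ` {..<k} = I"
    using finite_set_enumeration[OF I(1)] unfolding k_def by blast
  have inj: "inj_on t {..<k}" by (rule strict_mono_on_imp_inj_on[OF t(2)])
  have tD: "t \<in> Delta T k" using t I(2) by (auto simp: Delta_def PiE_def)
  define u where "u = (\<lambda>i. if A \<and> i = 0 then ca else if i < k + of_bool A then w (t (i - of_bool A)) else if i \<le> p then cb else 0)"
  have upos: "u i > 0" if i: "i \<le> p" for i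
  proof (cases "A \<and> i = 0")
    case False
    show ?thesis
    proof (cases "i < k + of_bool A")
      case True
      then have "i - of_bool A < k" using False by (cases A) auto
      then have "w (t (i - of_bool A)) > 0" using I(3) t(3) by blast
      then show ?thesis using False True by (auto simp: u_def)
    next
      case F2: False
      then have "B" using i p by (cases B) auto
      then show ?thesis using False F2 i by (auto simp: u_def B_def)
    qed
  qed (simp add: u_def A_def)
  define s where "s = sqrt (\<Sum>i\<le>p. (u i)\<^sup>2)"
  have "0 < (u 0)\<^sup>2" using upos[of 0] by simp
  also have "\<dots> \<le> (\<Sum>i\<le>p. (u i)\<^sup>2)" by (intro member_le_sum) auto
  finally have s2: "(\<Sum>i\<le>p. (u i)\<^sup>2) > 0" .
  then have s: "s > 0" by (simp add: s_def)
  have "(\<lambda>i. u i / s) \<in> pos_sphere p"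
    unfolding pos_sphere_def topspace_Euclidean_space
  proof (intro CollectI conjI allI impI)
    show "u i / s = 0" if "i \<ge> p + 1" for i using that p by (auto simp: u_def)
    have "(\<Sum>i\<le>p. (u i / s)\<^sup>2) = (\<Sum>i\<le>p. (u i)\<^sup>2) / s\<^sup>2" by (simp add: power_divide sum_divide_distrib)
    then show "(\<Sum>i\<le>p. (u i / s)\<^sup>2) = 1" using s2 by (simp add: s_def)
  qed (use upos s in auto)
  then obtain \<theta> where \<theta>: "\<theta> \<in> \<Theta> p" "\<rho> p \<theta> = (\<lambda>i. u i / s)"
    using coords[of p] unfolding sphere_coordinates_def bij_betw_def by (metis (no_types, lifting) imageE)
  have \<theta>e: "\<theta> \<in> ext_space p"
    using \<theta>(1) openin_imp_subset[OF sphere_coordinates_ext_open[OF coords[of p]]] by blast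
  define y where "y = par_join p k (\<theta>, t)"
  have y1: "par_fst p y = \<theta>" "par_snd p k y = t"
    using par_fst_join[OF \<theta>e] par_snd_join[OF t(1)] by (simp_all add: y_def)
  have yO: "y \<in> Om k p" using y1 \<theta>(1) tD par_join_ext by (simp add: Om_def y_def)
  have g: "gphi A B k (\<rho> p \<theta>) t = (\<lambda>i. (1 / s) * x i)"
  proof
    fix i
    show "gphi A B k (\<rho> p \<theta>) t i = (1 / s) * x i"
    proof (cases "i \<le> n")
      case True
      have "(\<Sum>j<k. u (j + of_bool A) / s * psi n (ereal (t j)) i) = (1 / s) * (\<Sum>j<k. w (t j) * t j ^ i)"
        unfolding sum_distrib_left using True by (intro sum.cong) (auto simp: u_def psi_real)
      also have "(\<Sum>j<k. w (t j) * t j ^ i) = (\<Sum>z\<in>I. w z * z ^ i)"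
        unfolding t(3)[symmetric] by (subst sum.reindex[OF inj]) simp
      finally have mid: "(\<Sum>j<k. u (j + of_bool A) / s * psi n (ereal (t j)) i) = (1 / s) * (\<Sum>z\<in>I. w z * z ^ i)" .
      have ea: "(if A then u 0 / s else 0) = (1 / s) * ca" using ca by (auto simp: u_def)
      have eb: "(if B then u (k + of_bool A) / s else 0) = (1 / s) * cb" using cb p by (auto simp: u_def)
      show ?thesis unfolding gphi_def \<theta>(2) mid ea eb xi[OF True] by (simp add: algebra_simps)
    next
      case False
      then show ?thesis using gphi_coords[of A B k "\<rho> p \<theta>" t] xc by auto
    qed
  qed
  have "mat_inner S (\<lambda>i. (1 / s) * x i) (\<lambda>i. (1 / s) * x i) = (1 / s)\<^sup>2"
    unfolding mat_inner_scale[OF S_carrier] x1 by simp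
  then have "mat_norm S (gphi A B k (\<rho> p \<theta>) t) = 1 / s" unfolding g mat_norm_def using s by simp
  then have "F A B k p y = x" using s unfolding F_def y1 mat_normalize_def g by (auto simp: fun_eq_iff)
  then have "x \<in> F A B k p ` Om k p" using yO by blast
  then show ?thesis using v unfolding A_def B_def k_def by blast
qed

section \<open>Volumes of strata and the integral formulas\<close>

definition mass :: "bool \<Rightarrow> bool \<Rightarrow> nat \<Rightarrow> nat \<Rightarrow> ennreal" where
  "mass A B k p = emeasure (C1_param.gmeas (p + k) (n + 1) (Om k p) (F A B k p) S 0) (Om k p)"

lemma gram_density_eq:
  assumes v: "valid A B k p" and pos: "p + k > 0"
  shows "gram_density S p k (\<lambda>(\<theta>, \<tau>). mat_normalize S (gphi A B k (\<rho> p \<theta>) \<tau>)) (par_fst p x, par_snd p k x)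
    = C1_param.dens (p + k) (n + 1) (F A B k p) S x"
proof -
  interpret C: C1_param "p + k" "n + 1" "Om k p" "F A B k p" S by (rule F_C1_param[OF v pos])
  let ?H = "\<lambda>(\<theta>, \<tau>). mat_normalize S (gphi A B k (\<rho> p \<theta>) \<tau>)"
  have dimS: "dim_row S = n + 1" by simp
  have Jeq: "jacobian (n + 1) p k ?H (par_fst p x, par_snd p k x) = C.J x"
  proof (rule eq_matI)
    fix i j assume "i < dim_row (C.J x)" "j < dim_col (C.J x)"
    then have ij: "i < n + 1" "j < p + k" by (simp_all only: C.J_dim)
    show "jacobian (n + 1) p k ?H (par_fst p x, par_snd p k x) $$ (i, j) = C.J x $$ (i, j)"
    proof (cases "j < p")
      case True
      have e: "par_fst p x j = x j" using True by (simp add: par_fst_def)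
      show ?thesis
        using True ij unfolding jacobian_def C.J_def partial_deriv_def F_def
        by (simp add: par_fst_upd_less par_snd_upd_less e)
    next
      case False
      have jp: "j - p < k" "p + (j - p) = j" using False ij by linarith+
      then have e: "par_snd p k x (j - p) = x j" by (simp add: par_snd_def)
      show ?thesis
        using False ij unfolding jacobian_def C.J_def partial_deriv_def F_def
        by (simp add: par_fst_upd_ge par_snd_upd_ge e)
    qed
  qed (simp_all only: C.J_dim, simp_all add: jacobian_def)
  show ?thesis unfolding gram_density_def Let_def dimS Jeq C.dens_def C.G_def ..
qed

lemma integral_gram_density:
  assumes v: "valid A B k p" and pos: "p + k > 0"
  shows "(\<integral>\<^sup>+\<xi>\<in>\<Theta> p \<times> Delta T k.
      ennreal (gram_density S p k (\<lambda>(\<theta>, \<tau>). mat_normalize S (gphi A B k (\<rho> p \<theta>) \<tau>)) \<xi>) \<partial>param_lebesgue p k)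
    = mass A B k p"
proof -
  interpret C: C1_param "p + k" "n + 1" "Om k p" "F A B k p" S by (rule F_C1_param[OF v pos])
  let ?g = "gram_density S p k (\<lambda>(\<theta>, \<tau>). mat_normalize S (gphi A B k (\<rho> p \<theta>) \<tau>))"
  let ?h = "\<lambda>x. ennreal (C.dens x + 0) * indicator (Om k p) x"
  have "(\<integral>\<^sup>+\<xi>\<in>\<Theta> p \<times> Delta T k. ennreal (?g \<xi>) \<partial>param_lebesgue p k) = (\<integral>\<^sup>+\<xi>. ?h (par_join p k \<xi>) \<partial>param_lebesgue p k)"
  proof (rule nn_integral_cong)
    fix \<xi> assume \<xi>: "\<xi> \<in> space (param_lebesgue p k)"
    obtain \<theta> \<tau> where x: "\<xi> = (\<theta>, \<tau>)" by (cases \<xi>)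
    have e: "\<theta> \<in> ext_space p" "\<tau> \<in> ext_space k"
      using \<xi> by (auto simp: x param_lebesgue_def space_pair_measure space_PiM)
    note j = par_fst_join[OF e(1), of k \<tau>] par_snd_join[OF e(2), of p \<theta>]
    have g: "?g \<xi> = C.dens (par_join p k \<xi>)"
      using gram_density_eq[OF v pos, of "par_join p k \<xi>"] by (simp add: x j)
    have "indicator (\<Theta> p \<times> Delta T k) \<xi> = (indicator (Om k p) (par_join p k \<xi>) :: ennreal)"
      unfolding x Om_def indicator_def using par_join_ext[of p k "(\<theta>, \<tau>)"] by (simp add: j)
    then show "ennreal (?g \<xi>) * indicator (\<Theta> p \<times> Delta T k) \<xi> = ?h (par_join p k \<xi>)" by (simp add: g)
  qed
  also have "\<dots> = (\<integral>\<^sup>+x. ?h (par_join p k (par_fst p x, par_snd p k x)) \<partial>lebesgue_fun (p + k))"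
    by (intro nn_integral_param_lebesgue measurable_compose[OF measurable_par_join C.gmeas_measurable])
  also have "\<dots> = (\<integral>\<^sup>+x. ?h x \<partial>lebesgue_fun (p + k))"
    by (intro nn_integral_cong) (simp only: space_PiM space_lborel space_borel par_join_split)
  also have "\<dots> = mass A B k p"
    unfolding mass_def by (intro C.emeasure_gmeas[symmetric] ext_open_sets Om_ext_open order_refl)
  finally show ?thesis .
qed

lemma integralU_eq_mass:
  "valid (odd l) True (l div 2) p \<Longrightarrow> p + l div 2 > 0 \<Longrightarrow>
    integralU n l a b S \<Theta> \<rho> p (l div 2) = mass (odd l) True (l div 2) p"
  unfolding integralU_def phiU_eq_gphi by (rule integral_gram_density)

lemma integralL_eq_mass:
  "valid (even l) False ((l + 1) div 2) p \<Longrightarrow> p + (l + 1) div 2 > 0 \<Longrightarrow>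
    integralL n l a b S \<Theta> \<rho> p ((l + 1) div 2) = mass (even l) False ((l + 1) div 2) p"
  unfolding integralL_def phiL_eq_gphi by (rule integral_gram_density)

lemma F_inj:
  assumes v: "valid A B k p" and cnt: "2 * k + of_bool A + of_bool B \<le> n + 1"
    and x: "x \<in> Om k p" and y: "y \<in> Om k p" and eq: "\<And>i. i < n + 1 \<Longrightarrow> F A B k p x i = F A B k p y i"
  shows "x = y"
proof -
  have "A = A \<and> B = B \<and> k = k \<and> x = y"
    by (rule F_eq_imp[OF v v x y eq]) (use v cnt in \<open>auto simp: valid_def\<close>)
  then show ?thesis by simp
qed

lemma Vol_stratum:
  assumes v: "valid A B k p" and pos: "p + k > 0" and cnt: "2 * k + of_bool A + of_bool B \<le> n + 1"
  shows "Vol S (p + k) (F A B k p ` Om k p) = mass A B k p"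
proof -
  interpret C: C1_param "p + k" "n + 1" "Om k p" "F A B k p" S by (rule F_C1_param[OF v pos])
  show ?thesis unfolding mass_def
  proof (rule antisym)
    show "Vol S (p + k) (F A B k p ` Om k p) \<le> emeasure (C.gmeas 0) (Om k p)" by (rule C.Vol_image_le)
    show "emeasure (C.gmeas 0) (Om k p) \<le> Vol S (p + k) (F A B k p ` Om k p)"
      by (rule C.Vol_image_ge) (rule F_inj[OF v cnt])
  qed
qed

text \<open>A stratum has \<open>p + k\<close> parameters, one less than its index, so every index
  at most \<open>d\<close> means fewer than \<open>d\<close> parameters. The strata collected here
  form a countable union.\<close>

definition null_strata :: "nat \<Rightarrow> (nat \<Rightarrow> real) set" where
  "null_strata d = (\<Union>(A, B, k, p)\<in>{(A, B, k, p). valid A B k p \<and> p + k < d}. F A B k p ` Om k p)"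

lemma Vol_null_strata:
  assumes "d > 0"
  shows "Vol S d (null_strata d) = 0"
  unfolding null_strata_def Vol_def
proof (rule hausdorff_measure_UN_null[OF assms countableI_type])
  fix z :: "bool \<times> bool \<times> nat \<times> nat" assume z: "z \<in> {(A, B, k, p). valid A B k p \<and> p + k < d}"
  obtain A B k p where ABkp: "z = (A, B, k, p)" by (cases z)
  have "Vol S d (F A B k p ` Om k p) = 0"
    by (rule Vol_image_fewer_parameters[OF _ Om_ext_open F_C1 S]) (use z ABkp in auto)
  then show "hausdorff_measure (mat_dist S) d (case z of (A, B, k, p) \<Rightarrow> F A B k p ` Om k p) = 0"
    by (simp add: ABkp Vol_def)
qed

lemma in_null_strata:
  assumes r: "repr n x I w ca cb" and x: "x \<in> mat_sphere S" and ca: "ca > 0 \<longrightarrow> \<bar>a\<bar> \<noteq> \<infinity>"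
    and cnt: "2 * card I + of_bool (ca > 0) + of_bool (cb > 0) \<le> d" and d: "d \<le> n"
  shows "x \<in> null_strata d"
proof -
  have "\<exists>p. valid (ca > 0) (cb > 0) (card I) p \<and> x \<in> F (ca > 0) (cb > 0) (card I) p ` Om (card I) p"
    by (rule F_surj[OF r x]) (use ca cnt d in auto)
  then obtain p where p: "valid (ca > 0) (cb > 0) (card I) p" "x \<in> F (ca > 0) (cb > 0) (card I) p ` Om (card I) p"
    by (elim exE conjE)
  have "p + card I < d" using p(1) cnt by (simp add: valid_def)
  then have "(ca > 0, cb > 0, card I, p) \<in> {(A, B, k, p). valid A B k p \<and> p + k < d}" using p(1) by simp
  from UN_I[OF this, where B="\<lambda>(A, B, k, p). F A B k p ` Om k p"] show ?thesis
    using p(2) unfolding null_strata_def by simp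
qed

lemma in_stratum:
  assumes r: "repr n x I w ca cb" and x: "x \<in> mat_sphere S" and v: "valid A B k p"
    and eq: "ca > 0 \<longleftrightarrow> A" "cb > 0 \<longleftrightarrow> B" "card I = k"
  shows "x \<in> F A B k p ` Om k p"
proof -
  have "\<exists>p. valid (ca > 0) (cb > 0) (card I) p \<and> x \<in> F (ca > 0) (cb > 0) (card I) p ` Om (card I) p"
    by (rule F_surj[OF r x]) (use v eq in \<open>auto simp: valid_def\<close>)
  then obtain p' where p': "valid A B k p'" "x \<in> F A B k p' ` Om k p'"
    unfolding eq by (elim exE conjE)
  have "p' = p" using p'(1) v by (simp add: valid_def)
  then show ?thesis using p'(2) by simp
qed

lemma Vol_eq_modulo_null:
  assumes d: "d > 0" and X: "X \<subseteq> Y" "Y \<subseteq> X \<union> null_strata d"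
  shows "Vol S d Y = Vol S d X"
proof (rule antisym)
  have "Vol S d Y \<le> Vol S d (X \<union> null_strata d)"
    unfolding Vol_def by (rule hausdorff_measure_mono[OF d X(2)])
  also have "\<dots> \<le> Vol S d X + Vol S d (null_strata d)"
    unfolding Vol_def by (rule hausdorff_measure_Un_le[OF d])
  finally show "Vol S d Y \<le> Vol S d X" by (simp add: Vol_null_strata[OF d])
  show "Vol S d X \<le> Vol S d Y"
    unfolding Vol_def by (rule hausdorff_measure_mono[OF d X(1)])
qed

text \<open>Index \<open>n + 1\<close> means \<open>p + k = n\<close> parameters. Strict vectors lie
  in the chosen stratum; the other vectors of the cone have index at most \<open>n\<close> and fall
  into \<open>null_strata n\<close>.\<close>

lemma Vol_cone:
  assumes v: "valid A B k p" and cnt: "2 * k + of_bool A + of_bool B = n + 1"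
    and main: "\<And>x. strict x \<Longrightarrow> \<exists>I w ca cb. repr n x I w ca cb \<and> (ca > 0 \<longleftrightarrow> A) \<and> (cb > 0 \<longleftrightarrow> B) \<and> card I = k"
  shows "Vol S n (moment_cone n T \<inter> mat_sphere S) = mass A B k p"
proof -
  have pk: "p + k = n" using v cnt by (simp add: valid_def)
  have "Vol S n (moment_cone n T \<inter> mat_sphere S) = Vol S n (F A B k p ` Om k p)"
  proof (rule Vol_eq_modulo_null)
    show "F A B k p ` Om k p \<subseteq> moment_cone n T \<inter> mat_sphere S" using F_in[OF v] by blast
    show "moment_cone n T \<inter> mat_sphere S \<subseteq> F A B k p ` Om k p \<union> null_strata n"
    proof
      fix x assume "x \<in> moment_cone n T \<inter> mat_sphere S"
      then have dual: "dual x" and x: "x \<in> mat_sphere S" by (auto dest: moment_cone_dual)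
      show "x \<in> F A B k p ` Om k p \<union> null_strata n"
      proof (cases "strict x")
        case True
        from main[OF this] show ?thesis using in_stratum[OF _ x v] by (elim exE conjE) simp
      next
        case False
        from boundary_repr[OF dual this] show ?thesis
          using in_null_strata[OF _ x _ _ order_refl] by (elim exE conjE) simp
      qed
    qed
  qed (use n in simp)
  also have "\<dots> = mass A B k p" using Vol_stratum[OF v] cnt n unfolding pk by simp
  finally show ?thesis .
qed

lemma valid_strata:
  "valid (odd n) True (n div 2) ((n + 1) div 2)"
  "valid (even n) False ((n + 1) div 2) (n div 2)"
  "n \<ge> 2 \<Longrightarrow> valid (even (n - 1)) False (n div 2) ((n - 1) div 2)"
  "n \<ge> 2 \<Longrightarrow> \<bar>a\<bar> \<noteq> \<infinity> \<Longrightarrow> valid (odd (n - 1)) True ((n - 1) div 2) (n div 2)"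
  using n ab by (cases "even n"; auto simp: valid_def elim!: evenE oddE)+

lemma Vol_cone_U: "Vol S n (moment_cone n T \<inter> mat_sphere S) = mass (odd n) True (n div 2) ((n + 1) div 2)"
proof (rule Vol_cone[OF valid_strata(1)])
  fix x assume "strict x"
  from upper_repr[OF this] obtain I w ca cb where r: "repr n x I w ca cb" "cb > 0" "2 * card I + of_bool (ca > 0) = n"
    by (elim exE conjE) (rule that)
  have "ca > 0 \<longleftrightarrow> odd n" "card I = n div 2" using r(3) by (cases "ca > 0"; auto)+
  then show "\<exists>I w ca cb. repr n x I w ca cb \<and> (ca > 0 \<longleftrightarrow> odd n) \<and> (cb > 0 \<longleftrightarrow> True) \<and> card I = n div 2"
    using r by (intro exI[of _ I] exI[of _ w] exI[of _ ca] exI[of _ cb]) simp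
qed (cases "even n"; auto elim!: evenE oddE)

lemma Vol_cone_L: "Vol S n (moment_cone n T \<inter> mat_sphere S) = mass (even n) False ((n + 1) div 2) (n div 2)"
proof (rule Vol_cone[OF valid_strata(2)])
  fix x assume x: "strict x"
  show "\<exists>I w ca cb. repr n x I w ca cb \<and> (ca > 0 \<longleftrightarrow> even n) \<and> (cb > 0 \<longleftrightarrow> False) \<and> card I = (n + 1) div 2"
  proof (cases "even n")
    case True
    from lower_repr_even[OF x this] obtain I w ca where r: "repr n x I w ca 0" "ca > 0" "2 * card I = n"
      by (elim exE conjE) (rule that)
    then show ?thesis using True
      by (intro exI[of _ I] exI[of _ w] exI[of _ ca] exI[of _ 0]) auto
  next
    case False
    from lower_repr_odd[OF x this] obtain I w where r: "repr n x I w 0 0" "2 * card I = n + 1"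
      by (elim exE conjE) (rule that)
    then show ?thesis using False
      by (intro exI[of _ I] exI[of _ w] exI[of _ 0]) auto
  qed
qed (cases "even n"; auto elim!: evenE oddE)

text \<open>For index at most \<open>n\<close> the polynomial \<open>support_poly\<close> of the
  atoms is admissible, and its pairing with the vector is zero.\<close>

lemma F_in_boundary:
  assumes v: "valid A B k p" and A: "A \<Longrightarrow> \<bar>a\<bar> \<noteq> \<infinity>" and cnt: "2 * k + of_bool A + of_bool B \<le> n"
  shows "F A B k p ` Om k p \<subseteq> moment_cone_boundary n T \<inter> mat_sphere S"
proof (rule image_subsetI)
  fix x assume x: "x \<in> Om k p"
  let ?I = "par_snd p k x ` {..<k}"
  have card: "card ?I = k" using x by (intro card_tau) (simp add: Om_def)
  have q: "nonnegT (support_poly ?I A B)" "pairing n (F A B k p x) (support_poly ?I A B) = 0"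
    by (rule pairing_support_poly[OF F_repr_normalized(2)[OF v x]];
        use A cnt in \<open>simp add: card split: if_splits\<close>)+
  have "support_poly ?I A B \<noteq> 0" by (intro support_poly_degree) simp
  then have "\<not> strict (F A B k p x)" using q unfolding strict_def by force
  then show "F A B k p x \<in> moment_cone_boundary n T \<inter> mat_sphere S"
    using F_in[OF v x] by (simp add: moment_cone_boundary_iff)
qed

lemma boundary_point_cases:
  assumes n2: "n \<ge> 2" and x: "x \<in> moment_cone_boundary n T \<inter> mat_sphere S"
  shows "x \<in> null_strata (n - 1) \<or> x \<in> F (even (n - 1)) False (n div 2) ((n - 1) div 2) ` Om (n div 2) ((n - 1) div 2) \<or>
    \<bar>a\<bar> \<noteq> \<infinity> \<and> x \<in> F (odd (n - 1)) True ((n - 1) div 2) (n div 2) ` Om ((n - 1) div 2) (n div 2)"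
proof -
  have dual: "dual x" and ns: "\<not> strict x" and xs: "x \<in> mat_sphere S"
    using x moment_cone_dual by (auto simp: moment_cone_boundary_iff)
  from boundary_repr[OF dual ns] obtain I w ca cb where r: "repr n x I w ca cb" "ca > 0 \<longrightarrow> \<bar>a\<bar> \<noteq> \<infinity>"
    "2 * card I + of_bool (ca > 0) + of_bool (cb > 0) \<le> n"
    by (elim exE conjE) (rule that)
  show ?thesis
  proof (cases "2 * card I + of_bool (ca > 0) + of_bool (cb > 0) = n")
    case False
    then have "2 * card I + of_bool (ca > 0) + of_bool (cb > 0) \<le> n - 1" using r(3) by linarith
    from in_null_strata[OF r(1) xs r(2) this] show ?thesis by simp
  next
    case eq: True
    show ?thesis
    proof (cases "cb > 0")
      case True
      \<comment> \<open>On the line an atom at infinity makes the index odd, whereas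
        \<open>n\<close> is even.\<close>
      have a: "\<bar>a\<bar> \<noteq> \<infinity>"
      proof
        assume inf: "\<bar>a\<bar> = \<infinity>"
        then have "2 * card I + 1 = n" using eq True r(2) by simp
        moreover have "even n" using ab inf by auto
        ultimately show False by presburger
      qed
      have "ca > 0 \<longleftrightarrow> odd (n - 1)" "card I = (n - 1) div 2"
        using eq True by (cases "ca > 0"; auto)+
      then have "x \<in> F (odd (n - 1)) True ((n - 1) div 2) (n div 2) ` Om ((n - 1) div 2) (n div 2)"
        using True by (intro in_stratum[OF r(1) xs valid_strata(4)[OF n2 a]]) auto
      then show ?thesis using a by blast
    next
      case False
      have "ca > 0 \<longleftrightarrow> even (n - 1)" "card I = n div 2"
        using eq False n2 by (cases "ca > 0"; auto)+
      then have "x \<in> F (even (n - 1)) False (n div 2) ((n - 1) div 2) ` Om (n div 2) ((n - 1) div 2)"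
        using False by (intro in_stratum[OF r(1) xs valid_strata(3)[OF n2]]) auto
      then show ?thesis by blast
    qed
  qed
qed

text \<open>The vectors of index \<open>n\<close> form two strata, without and with an atom at
  \<open>b\<close>. They are disjoint but can approach each other as a node tends to an endpoint,
  hence \<open>Vol_disjoint_images_ge\<close>.\<close>

lemma Vol_boundary:
  assumes n2: "n \<ge> 2"
  defines "L \<equiv> mass (even (n - 1)) False (n div 2) ((n - 1) div 2)"
    and "U \<equiv> mass (odd (n - 1)) True ((n - 1) div 2) (n div 2)"
  shows "Vol S (n - 1) (moment_cone_boundary n T \<inter> mat_sphere S) = (if \<bar>a\<bar> = \<infinity> then L else L + U)"
proof -
  let ?Y = "moment_cone_boundary n T \<inter> mat_sphere S"
  let ?OL = "Om (n div 2) ((n - 1) div 2)" and ?FL = "F (even (n - 1)) False (n div 2) ((n - 1) div 2)"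
  let ?OU = "Om ((n - 1) div 2) (n div 2)" and ?FU = "F (odd (n - 1)) True ((n - 1) div 2) (n div 2)"
  have d: "n - 1 > 0" using n2 by simp
  have dL: "(n - 1) div 2 + n div 2 = n - 1" and dU: "n div 2 + (n - 1) div 2 = n - 1"
    using n2 by (cases "even n"; auto elim!: evenE oddE)+
  have cntL: "2 * (n div 2) + of_bool (even (n - 1)) + of_bool False = n"
    using n2 by (cases "even n"; auto elim!: evenE oddE)
  have cntU: "2 * ((n - 1) div 2) + of_bool (odd (n - 1)) + of_bool True = n"
    using n2 by (cases "even n"; auto elim!: evenE oddE)
  note vL = valid_strata(3)[OF n2]
  \<comment> \<open>An atom at \<open>a\<close> occurs in the lower stratum only for odd
    \<open>n\<close>, which excludes the whole line.\<close>
  have odd_fin: "\<bar>a\<bar> \<noteq> \<infinity>" if "even (n - 1)" using that n2 ab by auto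
  have L: "?FL ` ?OL \<subseteq> ?Y" by (rule F_in_boundary[OF vL odd_fin]) (use cntL in auto)
  have VL: "Vol S (n - 1) (?FL ` ?OL) = L"
    by (rule Vol_stratum[OF vL, unfolded dL, folded L_def, OF d]) (simp only: cntL)
  show ?thesis
  proof (cases "\<bar>a\<bar> = \<infinity>")
    case True
    have "Vol S (n - 1) ?Y = Vol S (n - 1) (?FL ` ?OL)"
    proof (rule Vol_eq_modulo_null[OF d L], rule subsetI)
      fix x assume "x \<in> ?Y"
      from boundary_point_cases[OF n2 this] show "x \<in> ?FL ` ?OL \<union> null_strata (n - 1)"
        unfolding Un_iff using True by (elim disjE conjE) (assumption | erule disjI1 | erule disjI2 | erule notE)+
    qed
    then show ?thesis using True VL by simp
  next
    case False
    note vU = valid_strata(4)[OF n2 False]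
    have U: "?FU ` ?OU \<subseteq> ?Y" by (rule F_in_boundary[OF vU False]) (simp only: cntU)
    have VU: "Vol S (n - 1) (?FU ` ?OU) = U"
      by (rule Vol_stratum[OF vU, unfolded dU, folded U_def, OF d]) (simp only: cntU)
    have "Vol S (n - 1) ?Y = Vol S (n - 1) (?FL ` ?OL \<union> ?FU ` ?OU)"
    proof (rule Vol_eq_modulo_null[OF d])
      show "?FL ` ?OL \<union> ?FU ` ?OU \<subseteq> ?Y" using L U by blast
      show "?Y \<subseteq> ?FL ` ?OL \<union> ?FU ` ?OU \<union> null_strata (n - 1)" 
      proof
        fix x assume "x \<in> ?Y"
        from boundary_point_cases[OF n2 this] show "x \<in> ?FL ` ?OL \<union> ?FU ` ?OU \<union> null_strata (n - 1)"
          unfolding Un_iff by (elim disjE conjE) simp_all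
      qed
    qed
    also have "\<dots> = L + U"
    proof (rule antisym)
      show "Vol S (n - 1) (?FL ` ?OL \<union> ?FU ` ?OU) \<le> L + U"
        unfolding VL[symmetric] VU[symmetric] unfolding Vol_def by (rule hausdorff_measure_Un_le[OF d])
      have "C1_param (n - 1) (n + 1) ?OL ?FL S" "C1_param (n - 1) (n + 1) ?OU ?FU S"
        using F_C1_param[OF vL] F_C1_param[OF vU] d unfolding dL dU by auto
      then have "emeasure (C1_param.gmeas (n - 1) (n + 1) ?OL ?FL S 0) ?OL + emeasure (C1_param.gmeas (n - 1) (n + 1) ?OU ?FU S 0) ?OU
          \<le> Vol S (n - 1) (?FL ` ?OL \<union> ?FU ` ?OU)"
      proof (rule Vol_disjoint_images_ge)
        show "x = y" if "x \<in> ?OL" "y \<in> ?OL" "\<And>i. i < n + 1 \<Longrightarrow> ?FL x i = ?FL y i" for x y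
          by (rule F_inj[OF vL _ that]) (use cntL in auto)
        show "x = y" if "x \<in> ?OU" "y \<in> ?OU" "\<And>i. i < n + 1 \<Longrightarrow> ?FU x i = ?FU y i" for x y
          by (rule F_inj[OF vU _ that]) (use cntU in auto)
        show "\<exists>i<n + 1. ?FL x i \<noteq> ?FU y i" if x: "x \<in> ?OL" and y: "y \<in> ?OU" for x y
        proof (rule ccontr)
          assume "\<not> ?thesis"
          then have eq: "?FL x i = ?FU y i" if "i < n + 1" for i using that by blast
          have "even (n - 1) = odd (n - 1) \<and> False = True \<and> n div 2 = (n - 1) div 2 \<and> x = y"
          proof (rule F_eq_imp[OF vL vU x y eq])
            \<comment> \<open>Together the two representations use \<open>n - 1\<close> interior
              points and both endpoints, at most \<open>n + 1\<close> atoms in all, so uniqueness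
              applies.\<close>
            have "n div 2 + (n - 1) div 2 + 2 \<le> n + 1" using dU n2 by linarith
            then show "n div 2 + (n - 1) div 2 + of_bool (even (n - 1) \<or> odd (n - 1)) + of_bool (False \<or> True) \<le> n + 1"
              by simp
          qed (use False in auto)
          then show False by simp
        qed
      qed
      then show "L + U \<le> Vol S (n - 1) (?FL ` ?OL \<union> ?FU ` ?OU)"
        unfolding L_def U_def mass_def dL dU .
    qed
    finally show ?thesis using False by simp
  qed
qed

end

theorem proposition3p5:
  fixes n :: nat and a b :: ereal and \<Sigma> :: "real mat"
    and \<Theta> :: "nat \<Rightarrow> (nat \<Rightarrow> real) set"
    and \<rho> :: "nat \<Rightarrow> (nat \<Rightarrow> real) \<Rightarrow> (nat \<Rightarrow> real)"
  assumes "n \<ge> 1"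
    and "(\<bar>a\<bar> \<noteq> \<infinity> \<and> \<bar>b\<bar> \<noteq> \<infinity> \<and> a < b) \<or> (\<bar>a\<bar> \<noteq> \<infinity> \<and> b = \<infinity>) \<or> (a = -\<infinity> \<and> b = \<infinity> \<and> even n)"
    and "pos_def_mat (n + 1) \<Sigma>"
    and "\<And>m. sphere_coordinates m (\<Theta> m) (\<rho> m)"
  shows "Vol \<Sigma> n (moment_cone n (real_segment a b) \<inter> mat_sphere \<Sigma>)
           = integralU n n a b \<Sigma> \<Theta> \<rho> ((n + 1) div 2) (n div 2) \<and>
         Vol \<Sigma> n (moment_cone n (real_segment a b) \<inter> mat_sphere \<Sigma>)
           = integralL n n a b \<Sigma> \<Theta> \<rho> (n div 2) ((n + 1) div 2) \<and>
         (n \<ge> 2 \<and> \<bar>a\<bar> \<noteq> \<infinity> \<longrightarrow>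
           Vol \<Sigma> (n - 1) (moment_cone_boundary n (real_segment a b) \<inter> mat_sphere \<Sigma>)
             = integralL n (n - 1) a b \<Sigma> \<Theta> \<rho> ((n - 1) div 2) (n div 2)
               + integralU n (n - 1) a b \<Sigma> \<Theta> \<rho> (n div 2) ((n - 1) div 2)) \<and>
         (n \<ge> 2 \<and> a = -\<infinity> \<longrightarrow>
           Vol \<Sigma> (n - 1) (moment_cone_boundary n (real_segment a b) \<inter> mat_sphere \<Sigma>)
             = integralL n (n - 1) a b \<Sigma> \<Theta> \<rho> ((n - 1) div 2) (n div 2))"
proof -
  interpret moment_volume n a b \<Sigma> \<Theta> \<rho>
    by unfold_locales (rule assms)+
  have U: "integralU n n a b \<Sigma> \<Theta> \<rho> ((n + 1) div 2) (n div 2) = mass (odd n) True (n div 2) ((n + 1) div 2)"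
    using assms(1) by (intro integralU_eq_mass valid_strata) simp
  have L: "integralL n n a b \<Sigma> \<Theta> \<rho> (n div 2) ((n + 1) div 2) = mass (even n) False ((n + 1) div 2) (n div 2)"
    using assms(1) by (intro integralL_eq_mass valid_strata) simp
  have bL: "integralL n (n - 1) a b \<Sigma> \<Theta> \<rho> ((n - 1) div 2) (n div 2) = mass (even (n - 1)) False (n div 2) ((n - 1) div 2)"
    if "n \<ge> 2"
  proof -
    have "n - 1 + 1 = n" using that by simp
    from integralL_eq_mass[of "n - 1" "(n - 1) div 2", unfolded this, OF valid_strata(3)] show ?thesis using that by simp
  qed
  have bU: "integralU n (n - 1) a b \<Sigma> \<Theta> \<rho> (n div 2) ((n - 1) div 2) = mass (odd (n - 1)) True ((n - 1) div 2) (n div 2)"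
    if "n \<ge> 2" "\<bar>a\<bar> \<noteq> \<infinity>"
    using that by (intro integralU_eq_mass valid_strata) simp_all
  show ?thesis
  proof (intro conjI impI; (elim conjE)?)
    show "Vol \<Sigma> n (moment_cone n T \<inter> mat_sphere \<Sigma>) = integralU n n a b \<Sigma> \<Theta> \<rho> ((n + 1) div 2) (n div 2)"
      unfolding U by (rule Vol_cone_U)
    show "Vol \<Sigma> n (moment_cone n T \<inter> mat_sphere \<Sigma>) = integralL n n a b \<Sigma> \<Theta> \<rho> (n div 2) ((n + 1) div 2)"
      unfolding L by (rule Vol_cone_L)
    show "Vol \<Sigma> (n - 1) (moment_cone_boundary n T \<inter> mat_sphere \<Sigma>)
      = integralL n (n - 1) a b \<Sigma> \<Theta> \<rho> ((n - 1) div 2) (n div 2)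
        + integralU n (n - 1) a b \<Sigma> \<Theta> \<rho> (n div 2) ((n - 1) div 2)" if "n \<ge> 2" "\<bar>a\<bar> \<noteq> \<infinity>"
      unfolding bL[OF that(1)] bU[OF that] Vol_boundary[OF that(1)] using that(2) by (simp only: if_False)
    show "Vol \<Sigma> (n - 1) (moment_cone_boundary n T \<inter> mat_sphere \<Sigma>)
      = integralL n (n - 1) a b \<Sigma> \<Theta> \<rho> ((n - 1) div 2) (n div 2)" if "n \<ge> 2" "a = -\<infinity>"
    proof -
      have "\<bar>a\<bar> = \<infinity>" using that(2) by simp
      then show ?thesis unfolding bL[OF that(1)] Vol_boundary[OF that(1)] by (simp only: if_True simp_thms)
    qed
  qed
qed

end
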